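(* Let $h_n$ be the number of labelled outerplanar graphs on $n$ vertices. Then, as $n\to\infty$, $$ h_n \sim h\cdot n^{-5/2}\cdot \rho^{-n}\, n!,$$ where $\rho\approx 0.13659$ and $h \approx 0.017657$.
   Context: All graphs are simple and labelled. A graph is outerplanar if it can be embedded in the plane so that all vertices are in the outer face (equivalently, it contains neither $K_4$ nor $K_{2,3}$ as a minor). The constant $\rho$ is $\rho=\Psi(\tau)$, where $\Psi(u)=u\,e^{-B'(u)}$ with $B'(u)=\frac{1+5u-\sqrt{1-6u+u^2}}{8}$, and $\tau\approx 0.17076$ is the smallest positive root of $3u^4-28u^3+70u^2-58u+8=0$.
   Formalization: The printed value h ≈ 0.017657 is incorrect: the constant h is uniquely determined by the asymptotics and equals about 0.008096, so the formal statement asserts h ≈ 0.008096 instead; everything else is as stated. *)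

theory Defs
  imports "HOL-Analysis.Analysis" "HOL-Library.Ramsey" "HOL-Library.Landau_Symbols"
begin

text \<open>A simple graph is given by a vertex set \<open>V\<close> and an edge set \<open>E \<subseteq> nsets V 2\<close>, where
  \<open>nsets V 2\<close> is the set of all two-element subsets of \<open>V\<close>. The plane is \<open>complex\<close>.\<close>

definition plane_embedding ::
  "'a set \<Rightarrow> 'a set set \<Rightarrow> ('a \<Rightarrow> complex) \<Rightarrow> ('a set \<Rightarrow> real \<Rightarrow> complex) \<Rightarrow> bool" where
  "plane_embedding V E pos \<gamma> \<longleftrightarrow>
     inj_on pos V \<and>
     (\<forall>e\<in>E. arc (\<gamma> e) \<and> {pathstart (\<gamma> e), pathfinish (\<gamma> e)} = pos ` e) \<and>
     (\<forall>e\<in>E. path_image (\<gamma> e) \<inter> pos ` V = pos ` e) \<and>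
     (\<forall>e\<in>E. \<forall>f\<in>E. e \<noteq> f \<longrightarrow> path_image (\<gamma> e) \<inter> path_image (\<gamma> f) \<subseteq> pos ` (e \<inter> f))"

definition drawing ::
  "'a set \<Rightarrow> 'a set set \<Rightarrow> ('a \<Rightarrow> complex) \<Rightarrow> ('a set \<Rightarrow> real \<Rightarrow> complex) \<Rightarrow> complex set" where
  "drawing V E pos \<gamma> = pos ` V \<union> (\<Union>e\<in>E. path_image (\<gamma> e))"

text \<open>For a bounded subset \<open>D\<close> of the plane, \<open>outside D\<close> is the unique unbounded component of its
  complement, so for a drawing it is the outer face. Faces are open, hence a vertex being in the
  outer face means that it lies on the boundary of that face.\<close>

definition outerplanar :: "'a set \<Rightarrow> 'a set set \<Rightarrow> bool" where
  "outerplanar V E \<longleftrightarrow>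
     (\<exists>pos \<gamma>. plane_embedding V E pos \<gamma> \<and>
             pos ` V \<subseteq> frontier (outside (drawing V E pos \<gamma>)))"

definition num_outerplanar :: "nat \<Rightarrow> nat" where
  "num_outerplanar n = card {E. E \<subseteq> nsets {1..n} 2 \<and> outerplanar {1..n} E}"

text \<open>\<open>B'\<close> is the derivative of the exponential generating function of labelled 2-connected
  outerplanar graphs (a single edge included).\<close>

definition B' :: "real \<Rightarrow> real" where
  "B' u = (1 + 5 * u - sqrt (1 - 6 * u + u ^ 2)) / 8"

definition Psi :: "real \<Rightarrow> real" where
  "Psi u = u * exp (- B' u)"

definition tau :: real where
  "tau = Min {u. 0 < u \<and> 3 * u ^ 4 - 28 * u ^ 3 + 70 * u ^ 2 - 58 * u + 8 = 0}"

definition rho :: real where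
  "rho = Psi tau"

end

theory Submission
  imports Defs "HOL-Library.Sublist" "HOL-Combinatorics.Multiset_Permutations"
    "HOL-Probability.Characteristic_Functions" "HOL-Complex_Analysis.Complex_Analysis"
begin

text \<open>
  On finitely many vertices, outerplanar means that the vertices can be arranged on a circle in such
  a way that no two edges interleave. One direction is a drawing with straight edges between points
  of a parabola (\<open>onepage_imp_outerplanar\<close>). For the other one (\<open>outerplanar_imp_onepage\<close>) the
  topology of the plane enters through theta curves: one of the three arcs runs inside the loop formed
  by the other two (\<open>theta_enclosed\<close>) and cuts this inside into two discs (\<open>theta_split\<close>). Hence three internally
  disjoint paths between two vertices of an outerplanar drawing cannot all have inner vertices, so
  a longest cycle of a 2-connected outerplanar graph is a Hamilton cycle, and its chords do not cross.

  The combinatorial description makes the graphs countable. A block with at least three vertices is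
  a polygon with a dissection by chords, and it determines this polygon, so there are
  \<open>n! d\<^sub>n / 2\<close> blocks on \<open>n + 1 \<ge> 3\<close> vertices (\<open>card_bgraphs\<close>), where the numbers \<open>d\<^sub>n\<close> of dissections obey
  a quadratic recursion. Therefore the derivative of the exponential generating function \<open>B\<close> of the
  blocks is algebraic, with the closed form \<open>B'\<close>. Cutting a connected graph at a root vertex into
  the blocks through the root and the connected graphs that hang at their other vertices gives
  \<open>C' = exp (B'(z C'))\<close> for the exponential generating function \<open>C\<close> of connected graphs
  (\<open>deriv_Cf_eq\<close>), and the series of all graphs is \<open>exp C\<close>.

  By Lagrange inversion, \<open>n\<^sup>2 [z\<^sup>n] C = [u\<^sup>n\<^sup>-\<^sup>1] exp (n B'(u))\<close> (\<open>Cf_nth\<close>). On the circle of radius \<open>tau\<close>,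
  where \<open>tau B''(tau) = 1\<close>, the exponent \<open>n (B'(u) - ln u)\<close> is stationary at \<open>u = tau\<close>, and since \<open>B'\<close> has
  nonnegative coefficients its real part is maximal there. The Cauchy integral is then asymptotically a
  Gaussian integral, whence \<open>[z\<^sup>n] C\<close> is asymptotic to \<open>c n powr (-5/2) / rho\<^sup>n\<close> with
  \<open>c = tau / sqrt (2 pi (1 + tau\<^sup>2 B'''(tau)))\<close> (\<open>Cf_asymptotics\<close>).

  Sequences of this shape are subexponential: in a product, one factor carries almost all of the
  index. So the coefficients of \<open>exp C\<close> have the same growth, and only the constant is multiplied, by
  \<open>exp (C(rho))\<close> (\<open>exp_subexponential\<close>). The value \<open>C(rho)\<close> comes from the identity of formal power
  series \<open>C = R - R B'(R) + B(R)\<close> with \<open>R = z C'\<close> (\<open>Cf_dissymmetry\<close>) together with \<open>R(rho) = tau\<close>.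
  The numerical values follow from rational bounds for \<open>tau\<close>.
\<close>

section \<open>Paths in plane drawings\<close>

lemma arc_pair_loop:
  fixes c1 c2 :: "real \<Rightarrow> complex"
  assumes "arc c1" "pathstart c1 = a" "pathfinish c1 = b"
      and "arc c2" "pathstart c2 = a" "pathfinish c2 = b"
      and "path_image c1 \<inter> path_image c2 = {a,b}"
  shows "simple_path (c1 +++ reversepath c2)"
    and "pathfinish (c1 +++ reversepath c2) = pathstart (c1 +++ reversepath c2)"
    and "path_image (c1 +++ reversepath c2) = path_image c1 \<union> path_image c2"
  using assms by (auto simp: simple_path_join_loop_eq arc_reversepath path_image_join)

text \<open>A connected set that avoids \<open>B\<close> lies in a single component of the complement of \<open>B\<close>.\<close>

lemma inside_subset_inside:
  assumes con: "connected (inside A)" and avoid: "inside A \<inter> B = {}" and meet: "inside A \<inter> inside B \<noteq> {}"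
  shows "inside A \<subseteq> inside B"
proof -
  obtain x where x: "x \<in> inside A" "x \<in> inside B" using meet by auto
  have "inside A \<subseteq> connected_component_set (- B) x"
    using connected_component_maximal[OF x(1) con] avoid by blast
  then show ?thesis
    using x(2) inside_same_component by blast
qed

text \<open>Otherwise the insides of the three loops would be pairwise disjoint, so a point inside the first loop could be
  joined to infinity both off the second loop and off the third one. These two loops meet in the
  connected set \<open>path_image c3\<close>, so by the theorem of Janiszewski the point could be joined to infinity off
  the whole theta curve, and in particular off the first loop.\<close>

lemma theta_enclosed:
  fixes c1 c2 c3 :: "real \<Rightarrow> complex"
  assumes c1: "arc c1" "pathstart c1 = a" "pathfinish c1 = b"
      and c2: "arc c2" "pathstart c2 = a" "pathfinish c2 = b"
      and c3: "arc c3" "pathstart c3 = a" "pathfinish c3 = b"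
      and i12: "path_image c1 \<inter> path_image c2 = {a,b}"
      and i13: "path_image c1 \<inter> path_image c3 = {a,b}"
      and i23: "path_image c2 \<inter> path_image c3 = {a,b}"
  shows "path_image c1 \<inter> inside (path_image c2 \<union> path_image c3) \<noteq> {} \<or>
         path_image c2 \<inter> inside (path_image c1 \<union> path_image c3) \<noteq> {} \<or>
         path_image c3 \<inter> inside (path_image c1 \<union> path_image c2) \<noteq> {}"
proof (rule ccontr)
  let ?A = "path_image c1" let ?B = "path_image c2" let ?C = "path_image c3"
  assume "\<not> ?thesis"
  then have e1: "?A \<inter> inside (?B \<union> ?C) = {}" and e2: "?B \<inter> inside (?A \<union> ?C) = {}"
    and e3: "?C \<inter> inside (?A \<union> ?B) = {}" by auto
  note J12 = Jordan_inside_outside[OF arc_pair_loop(1,2)[OF c1 c2 i12], unfolded arc_pair_loop(3)[OF c1 c2 i12]]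
  note J13 = Jordan_inside_outside[OF arc_pair_loop(1,2)[OF c1 c3 i13], unfolded arc_pair_loop(3)[OF c1 c3 i13]]
  note J23 = Jordan_inside_outside[OF arc_pair_loop(1,2)[OF c2 c3 i23], unfolded arc_pair_loop(3)[OF c2 c3 i23]]
  have ne: "?A - {a,b} \<noteq> {}" "?B - {a,b} \<noteq> {}"
    using nonempty_simple_path_endless[OF arc_imp_simple_path[OF c1(1)]] c1
          nonempty_simple_path_endless[OF arc_imp_simple_path[OF c2(1)]] c2 by auto
  obtain x where x: "x \<in> inside (?A \<union> ?B)" using J12 by auto
  have num_dissections: "inside X \<inter> X = {}" for X :: "complex set" by (auto simp: inside_def)
  \<comment> \<open>If \<open>x\<close> were inside a second loop, the insides of the two loops would contain each other, and the loops would be equal.\<close>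
  have n13: "x \<notin> inside (?A \<union> ?C)"
  proof
    assume "x \<in> inside (?A \<union> ?C)"
    then have m: "inside (?A \<union> ?B) \<inter> inside (?A \<union> ?C) \<noteq> {}" "inside (?A \<union> ?C) \<inter> inside (?A \<union> ?B) \<noteq> {}" using x by auto
    have "inside (?A \<union> ?B) \<subseteq> inside (?A \<union> ?C)"
      by (rule inside_subset_inside[OF _ _ m(1)]) (use J12 in blast, use e3 num_dissections[of "?A \<union> ?B"] in blast)
    moreover have "inside (?A \<union> ?C) \<subseteq> inside (?A \<union> ?B)"
      by (rule inside_subset_inside[OF _ _ m(2)]) (use J13 in blast, use e2 num_dissections[of "?A \<union> ?C"] in blast)
    ultimately have "?A \<union> ?B = ?A \<union> ?C" using J12 J13 by (metis subset_antisym)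
    then show False using ne i12 i23 by blast
  qed
  have n23: "x \<notin> inside (?B \<union> ?C)"
  proof
    assume "x \<in> inside (?B \<union> ?C)"
    then have m: "inside (?A \<union> ?B) \<inter> inside (?B \<union> ?C) \<noteq> {}" "inside (?B \<union> ?C) \<inter> inside (?A \<union> ?B) \<noteq> {}" using x by auto
    have "inside (?A \<union> ?B) \<subseteq> inside (?B \<union> ?C)"
      by (rule inside_subset_inside[OF _ _ m(1)]) (use J12 in blast, use e3 num_dissections[of "?A \<union> ?B"] in blast)
    moreover have "inside (?B \<union> ?C) \<subseteq> inside (?A \<union> ?B)"
      by (rule inside_subset_inside[OF _ _ m(2)]) (use J23 in blast, use e1 num_dissections[of "?B \<union> ?C"] in blast)
    ultimately have "?A \<union> ?B = ?B \<union> ?C" using J12 J23 by (metis subset_antisym)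
    then show False using ne i12 i13 by blast
  qed
  have xA: "x \<notin> ?A \<union> ?B \<union> ?C" using x e3 num_dissections[of "?A \<union> ?B"] by blast
  have o: "x \<in> outside (?A \<union> ?C)" "x \<in> outside (?B \<union> ?C)"
    using n13 n23 xA inside_Un_outside[of "?A \<union> ?C"] inside_Un_outside[of "?B \<union> ?C"] by blast+
  have cpt: "compact ?A" "compact ?B" "compact ?C"
    using c1 c2 c3 by (simp_all add: compact_arc_image)
  have "outside (?A \<union> ?B \<union> ?C) \<noteq> {}"
    using cpt by (intro outside_bounded_nonempty) (auto intro: compact_imp_bounded)
  then obtain y where y: "y \<in> outside (?A \<union> ?B \<union> ?C)" by auto
  have oy: "y \<in> outside (?A \<union> ?C)" "y \<in> outside (?B \<union> ?C)"
    using y outside_mono[of "?A \<union> ?C" "?A \<union> ?B \<union> ?C"] outside_mono[of "?B \<union> ?C" "?A \<union> ?B \<union> ?C"] by auto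
  have sub: "outside X \<subseteq> - X" for X :: "complex set" by (auto simp: outside_def)
  have "connected_component (- ((?A \<union> ?C) \<union> (?B \<union> ?C))) x y"
  proof (rule Janiszewski)
    show "compact (?A \<union> ?C)" "closed (?B \<union> ?C)" using cpt by (auto intro: compact_imp_closed)
    have "(?A \<union> ?C) \<inter> (?B \<union> ?C) = ?C" using i12 i13 by auto
    then show "connected ((?A \<union> ?C) \<inter> (?B \<union> ?C))" using c3 by (simp add: connected_arc_image)
    show "connected_component (- (?A \<union> ?C)) x y"
      unfolding connected_component_def
      by (rule exI[of _ "outside (?A \<union> ?C)"]) (intro conjI o oy sub, use J13 in blast)
    show "connected_component (- (?B \<union> ?C)) x y"
      unfolding connected_component_def
      by (rule exI[of _ "outside (?B \<union> ?C)"]) (intro conjI o oy sub, use J23 in blast)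
  qed
  moreover have "(?A \<union> ?C) \<union> (?B \<union> ?C) = ?A \<union> ?B \<union> ?C" by auto
  ultimately have cc: "connected_component (- (?A \<union> ?B \<union> ?C)) x y" by simp
  then have "connected_component_set (- (?A \<union> ?B \<union> ?C)) x = connected_component_set (- (?A \<union> ?B \<union> ?C)) y"
    by (metis connected_component_eq mem_Collect_eq)
  then have "\<not> bounded (connected_component_set (- (?A \<union> ?B \<union> ?C)) x)"
    using y by (simp add: outside_def)
  moreover have "connected_component_set (- (?A \<union> ?B \<union> ?C)) x \<subseteq> connected_component_set (- (?A \<union> ?B)) x"
    by (rule connected_component_mono) auto
  moreover have "bounded (connected_component_set (- (?A \<union> ?B)) x)" using x by (simp add: inside_def)
  ultimately show False using bounded_subset by blast
qed

lemma theta_split: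
  fixes c1 c2 c3 :: "real \<Rightarrow> complex"
  assumes c1: "arc c1" "pathstart c1 = a" "pathfinish c1 = b"
      and c2: "arc c2" "pathstart c2 = a" "pathfinish c2 = b"
      and c3: "arc c3" "pathstart c3 = a" "pathfinish c3 = b"
      and i12: "path_image c1 \<inter> path_image c2 = {a,b}"
      and i13: "path_image c1 \<inter> path_image c3 = {a,b}"
      and i23: "path_image c2 \<inter> path_image c3 = {a,b}"
      and ne: "path_image c3 \<inter> inside (path_image c1 \<union> path_image c2) \<noteq> {}"
  shows "inside (path_image c1 \<union> path_image c3) \<inter> inside (path_image c2 \<union> path_image c3) = {}"
    and "inside (path_image c1 \<union> path_image c3) \<union> inside (path_image c2 \<union> path_image c3) \<union>
           (path_image c3 - {a,b}) = inside (path_image c1 \<union> path_image c2)"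
proof -
  have ab: "a \<noteq> b" using arc_distinct_ends[OF c1(1)] c1 by simp
  note split = split_inside_simple_closed_curve[OF arc_imp_simple_path[OF c1(1)] c1(2,3)
     arc_imp_simple_path[OF c2(1)] c2(2,3) arc_imp_simple_path[OF c3(1)] c3(2,3) ab i12 i13 i23 ne]
  show "inside (path_image c1 \<union> path_image c3) \<inter> inside (path_image c2 \<union> path_image c3) = {}"
    by (rule split)
  show "inside (path_image c1 \<union> path_image c3) \<union> inside (path_image c2 \<union> path_image c3) \<union>
           (path_image c3 - {a,b}) = inside (path_image c1 \<union> path_image c2)"
    by (rule split)
qed

fun path_edges :: "'a list \<Rightarrow> 'a set set" where
  "path_edges [] = {}"
| "path_edges [x] = {}"
| "path_edges (x # y # zs) = insert {x,y} (path_edges (y # zs))"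

lemma path_edges_append:
  "path_edges (xs @ y # ys) = path_edges (xs @ [y]) \<union> path_edges (y # ys)"
  by (induction xs rule: path_edges.induct) auto

lemma path_edges_rev: "path_edges (rev xs) = path_edges xs"
proof (induction xs rule: path_edges.induct)
  case (3 x y zs)
  have "path_edges (rev zs @ y # [x]) = path_edges (rev zs @ [y]) \<union> path_edges [y,x]"
    by (rule path_edges_append)
  then show ?case using 3 by (auto simp: insert_commute)
qed auto

lemma path_edges_subset: "e \<in> path_edges xs \<Longrightarrow> e \<subseteq> set xs"
  by (induction xs rule: path_edges.induct) auto

lemma path_edges_doubleton: "distinct xs \<Longrightarrow> e \<in> path_edges xs \<Longrightarrow> \<exists>x y. x \<noteq> y \<and> e = {x,y}"
  by (induction xs rule: path_edges.induct) auto

lemma Union_path_edges: "length xs \<ge> 2 \<Longrightarrow> \<Union> (path_edges xs) = set xs"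
proof (induction xs rule: path_edges.induct)
  case (3 x y zs)
  then show ?case by (cases zs) auto
qed auto

lemma path_edges_ends:
  assumes "distinct (a # p @ [b])" "p \<noteq> []"
  shows "{a,b} \<notin> path_edges (a # p @ [b])"
proof -
  obtain y q where p: "p = y # q" using assms by (cases p) auto
  have "a \<notin> \<Union> (path_edges (y # q @ [b]))"
    using path_edges_subset assms p by fastforce
  then show ?thesis using assms p by (auto simp: doubleton_eq_iff)
qed

context
  fixes V :: "'a set" and E :: "'a set set" and pos :: "'a \<Rightarrow> complex" and \<gamma> :: "'a set \<Rightarrow> real \<Rightarrow> complex"
  assumes emb: "plane_embedding V E pos \<gamma>"
begin

definition path_trace :: "'a list \<Rightarrow> complex set" where
  "path_trace xs = (\<Union>e\<in>path_edges xs. path_image (\<gamma> e))"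

lemma inj_pos: "inj_on pos V"
  using emb by (simp add: plane_embedding_def)

lemma arc_edge: "e \<in> E \<Longrightarrow> arc (\<gamma> e)"
  using emb by (simp add: plane_embedding_def)

lemma ends_edge: "e \<in> E \<Longrightarrow> {pathstart (\<gamma> e), pathfinish (\<gamma> e)} = pos ` e"
  using emb by (simp add: plane_embedding_def)

lemma vertices_on_edge: "e \<in> E \<Longrightarrow> path_image (\<gamma> e) \<inter> pos ` V = pos ` e"
  using emb by (simp add: plane_embedding_def)

lemma edge_arc:
  assumes "{x,y} \<in> E"
  shows "\<exists>g. arc g \<and> pathstart g = pos x \<and> pathfinish g = pos y \<and> path_image g = path_image (\<gamma> {x,y})"
proof -
  have a: "arc (\<gamma> {x,y})" and e: "{pathstart (\<gamma> {x,y}), pathfinish (\<gamma> {x,y})} = {pos x, pos y}"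
    using arc_edge[OF assms] ends_edge[OF assms] by simp_all
  then consider "pathstart (\<gamma> {x,y}) = pos x" "pathfinish (\<gamma> {x,y}) = pos y" |
    "pathstart (\<gamma> {x,y}) = pos y" "pathfinish (\<gamma> {x,y}) = pos x" by (auto simp: doubleton_eq_iff)
  then show ?thesis
  proof cases
    case 1 then show ?thesis using a by blast
  next
    case 2 then show ?thesis using a
      by (intro exI[of _ "reversepath (\<gamma> {x,y})"]) (auto simp: arc_reversepath)
  qed
qed

lemma edge_inter:
  assumes "e \<in> E" "f \<in> E" "e \<noteq> f"
  shows "path_image (\<gamma> e) \<inter> path_image (\<gamma> f) \<subseteq> pos ` (e \<inter> f)"
  using emb assms by (simp add: plane_embedding_def)

text \<open>The edge curves along a path meet only in the vertices they share, so they can be joined to one arc.\<close>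

lemma arc_of_path:
  assumes "distinct xs" "path_edges xs \<subseteq> E" "length xs \<ge> 2"
  shows "\<exists>g. arc g \<and> pathstart g = pos (hd xs) \<and> pathfinish g = pos (last xs) \<and> path_image g = path_trace xs"
  using assms
proof (induction xs rule: path_edges.induct)
  case (3 x y zs)
  obtain g1 where g1: "arc g1" "pathstart g1 = pos x" "pathfinish g1 = pos y" "path_image g1 = path_image (\<gamma> {x,y})"
    using edge_arc[of x y] 3 by auto
  show ?case
  proof (cases zs)
    case Nil
    then show ?thesis using g1 by (auto simp: path_trace_def)
  next
    case (Cons z zs')
    then obtain g where g: "arc g" "pathstart g = pos y" "pathfinish g = pos (last (y # zs))" "path_image g = path_trace (y # zs)"
      using 3 by auto
    have "path_image g1 \<inter> path_image g \<subseteq> {pathstart g}"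
    proof
      fix p assume "p \<in> path_image g1 \<inter> path_image g"
      then obtain e where e: "e \<in> path_edges (y # zs)" "p \<in> path_image (\<gamma> e)" "p \<in> path_image (\<gamma> {x,y})"
        using g g1 by (auto simp: path_trace_def)
      have "x \<notin> e" using path_edges_subset[OF e(1)] 3(2) by auto
      then have "e \<noteq> {x,y}" "e \<in> E" "{x,y} \<in> E" using e 3 by auto
      then have "p \<in> pos ` (e \<inter> {x,y})" using edge_inter e by blast
      then show "p \<in> {pathstart g}" using \<open>x \<notin> e\<close> g by auto
    qed
    then have "arc (g1 +++ g)" using g g1 by (intro arc_join) auto
    moreover have "path_image (g1 +++ g) = path_trace (x # y # zs)"
      using g g1 by (simp add: path_image_join path_trace_def)
    ultimately show ?thesis using g g1 by (intro exI[of _ "g1 +++ g"]) simp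
  qed
qed auto

lemma path_trace_inter:
  assumes "path_edges xs \<subseteq> E" "path_edges ys \<subseteq> E" "path_edges xs \<inter> path_edges ys = {}"
  shows "path_trace xs \<inter> path_trace ys \<subseteq> pos ` (set xs \<inter> set ys)"
proof
  fix p assume "p \<in> path_trace xs \<inter> path_trace ys"
  then obtain e f where ef: "e \<in> path_edges xs" "f \<in> path_edges ys" "p \<in> path_image (\<gamma> e)" "p \<in> path_image (\<gamma> f)"
    by (auto simp: path_trace_def)
  then have "p \<in> pos ` (e \<inter> f)" using edge_inter[of e f] assms by blast
  then show "p \<in> pos ` (set xs \<inter> set ys)" using path_edges_subset ef(1,2) by fastforce
qed

lemma path_trace_vertex:
  assumes "path_edges xs \<subseteq> E" "v \<in> V" "E \<subseteq> Pow V" "pos v \<in> path_trace xs"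
  shows "v \<in> set xs"
proof -
  obtain e where e: "e \<in> path_edges xs" "pos v \<in> path_image (\<gamma> e)" using assms by (auto simp: path_trace_def)
  then have eE: "e \<in> E" using assms(1) by blast
  then have "pos v \<in> pos ` e" using vertices_on_edge[OF eE] assms(2) e(2) by blast
  then have "v \<in> e" using inj_on_image_mem_iff[OF inj_pos assms(2), of e] eE assms(3) by blast
  then show ?thesis using e path_edges_subset by fastforce
qed

lemma vertex_path_trace:
  assumes "path_edges xs \<subseteq> E" "v \<in> set xs" "length xs \<ge> 2"
  shows "pos v \<in> path_trace xs"
proof -
  obtain e where e: "e \<in> path_edges xs" "v \<in> e" using Union_path_edges[OF assms(3)] assms(2) by blast
  then have "path_image (\<gamma> e) \<inter> pos ` V = pos ` e" using vertices_on_edge assms(1) by blast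
  then show ?thesis using e unfolding path_trace_def by blast
qed

lemma edges_disjoint:
  assumes "distinct (a # b # p @ q)" "p \<noteq> []"
  shows "path_edges (a # p @ [b]) \<inter> path_edges (a # q @ [b]) = {}"
proof (rule ccontr)
  assume "\<not> ?thesis"
  then obtain e where e: "e \<in> path_edges (a # p @ [b])" "e \<in> path_edges (a # q @ [b])" by auto
  have "e \<subseteq> set (a # p @ [b]) \<inter> set (a # q @ [b])"
    using path_edges_subset[OF e(1)] path_edges_subset[OF e(2)] by blast
  moreover have "set (a # p @ [b]) \<inter> set (a # q @ [b]) = {a,b}" using assms by auto
  ultimately have "e \<subseteq> {a,b}" by blast
  moreover have dp: "distinct (a # p @ [b])" using assms by auto
  ultimately have "e = {a,b}" using path_edges_doubleton[OF dp e(1)] by blast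
  then show False using path_edges_ends[OF dp assms(2)] e(1) by blast
qed

context
  assumes graph: "E \<subseteq> Pow V"
    and outer: "pos ` V \<subseteq> frontier (outside (drawing V E pos \<gamma>))"
begin

text \<open>A vertex is a limit of points of the outer face. All these points lie in the outside of any closed part
  of the drawing, whereas the inside of such a part is open and disjoint from its outside.\<close>

lemma vertex_not_inside:
  assumes "v \<in> V" "S \<subseteq> drawing V E pos \<gamma>" "closed S"
  shows "pos v \<notin> inside S"
proof
  assume "pos v \<in> inside S"
  moreover have "open (inside S)" using assms by (simp add: open_inside)
  moreover have "pos v \<in> closure (outside (drawing V E pos \<gamma>))" using outer assms by (auto simp: frontier_def)
  ultimately have "inside S \<inter> outside (drawing V E pos \<gamma>) \<noteq> {}"
    using open_Int_closure_eq_empty[of "inside S" "outside (drawing V E pos \<gamma>)"] by blast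
  moreover have "outside (drawing V E pos \<gamma>) \<subseteq> outside S" using assms outside_mono by blast
  ultimately show False using inside_Int_outside[of S] by blast
qed

lemma path_trace_drawing: "path_edges xs \<subseteq> E \<Longrightarrow> path_trace xs \<subseteq> drawing V E pos \<gamma>"
  by (auto simp: path_trace_def drawing_def)

lemma path_trace_inter_ends:
  assumes "distinct (a # b # s @ t)" "s \<noteq> []" "path_edges (a # s @ [b]) \<subseteq> E" "path_edges (a # t @ [b]) \<subseteq> E"
  shows "path_trace (a # s @ [b]) \<inter> path_trace (a # t @ [b]) = {pos a, pos b}"
proof -
  have "path_trace (a # s @ [b]) \<inter> path_trace (a # t @ [b]) \<subseteq> pos ` (set (a # s @ [b]) \<inter> set (a # t @ [b]))"
    by (rule path_trace_inter[OF assms(3,4) edges_disjoint[OF assms(1,2)]])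
  moreover have "set (a # s @ [b]) \<inter> set (a # t @ [b]) = {a,b}" using assms(1) by auto
  ultimately have "path_trace (a # s @ [b]) \<inter> path_trace (a # t @ [b]) \<subseteq> {pos a, pos b}"
    by (simp only: image_insert image_empty)
  moreover have "pos a \<in> path_trace (a # s @ [b])" "pos b \<in> path_trace (a # s @ [b])" "pos a \<in> path_trace (a # t @ [b])" "pos b \<in> path_trace (a # t @ [b])"
    using vertex_path_trace[OF assms(3)] vertex_path_trace[OF assms(4)] by auto
  ultimately show ?thesis by blast
qed

lemma path_in_V:
  assumes "path_edges (a # s @ [b]) \<subseteq> E"
  shows "set (a # s @ [b]) \<subseteq> V"
proof -
  have "\<Union> (path_edges (a # s @ [b])) = set (a # s @ [b])" by (rule Union_path_edges) simp
  then show ?thesis using graph assms by blast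
qed

text \<open>An arc of the theta curve that runs inside the loop of the other two cannot have an inner vertex, by
  \<open>vertex_not_inside\<close>. Since such an arc exists, it must be the one without inner vertices.\<close>

lemma theta_paths:
  assumes d: "distinct (a # b # p @ q @ r)"
    and E: "path_edges (a # p @ [b]) \<subseteq> E" "path_edges (a # q @ [b]) \<subseteq> E" "path_edges (a # r @ [b]) \<subseteq> E"
    and ne: "p \<noteq> []" "q \<noteq> []"
  shows "r = []" "path_trace (a # r @ [b]) \<inter> inside (path_trace (a # p @ [b]) \<union> path_trace (a # q @ [b])) \<noteq> {}"
proof -
  let ?A = "path_trace (a # p @ [b])" let ?B = "path_trace (a # q @ [b])" let ?C = "path_trace (a # r @ [b])"
  obtain c1 where c1: "arc c1" "pathstart c1 = pos a" "pathfinish c1 = pos b" "path_image c1 = ?A"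
    using arc_of_path[of "a # p @ [b]"] d E by auto
  obtain c2 where c2: "arc c2" "pathstart c2 = pos a" "pathfinish c2 = pos b" "path_image c2 = ?B"
    using arc_of_path[of "a # q @ [b]"] d E by auto
  obtain c3 where c3: "arc c3" "pathstart c3 = pos a" "pathfinish c3 = pos b" "path_image c3 = ?C"
    using arc_of_path[of "a # r @ [b]"] d E by auto
  have i12: "?A \<inter> ?B = {pos a, pos b}" and i13: "?A \<inter> ?C = {pos a, pos b}" and i23: "?B \<inter> ?C = {pos a, pos b}"
    by (rule path_trace_inter_ends[OF _ _ E(1,2)] path_trace_inter_ends[OF _ _ E(1,3)] path_trace_inter_ends[OF _ _ E(2,3)]; use d ne in auto)+
  \<comment> \<open>An arc with an inner vertex cannot run inside the loop of the other two.\<close>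
  have key: "False" if h: "path_trace (a # s @ [b]) \<inter> inside (path_trace (a # t @ [b]) \<union> path_trace (a # u @ [b])) \<noteq> {}" 
    "s \<noteq> []" "distinct (a # b # s @ t @ u)" "path_edges (a # s @ [b]) \<subseteq> E" "path_edges (a # t @ [b]) \<subseteq> E" "path_edges (a # u @ [b]) \<subseteq> E"
    "path_trace (a # s @ [b]) \<inter> path_trace (a # t @ [b]) = {pos a, pos b}" "path_trace (a # s @ [b]) \<inter> path_trace (a # u @ [b]) = {pos a, pos b}" "path_trace (a # t @ [b]) \<inter> path_trace (a # u @ [b]) = {pos a, pos b}" for s t u
  proof -
    obtain d1 where d1: "arc d1" "pathstart d1 = pos a" "pathfinish d1 = pos b" "path_image d1 = path_trace (a # s @ [b])"
      using arc_of_path[of "a # s @ [b]"] h by auto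
    obtain d2 where d2: "arc d2" "pathstart d2 = pos a" "pathfinish d2 = pos b" "path_image d2 = path_trace (a # t @ [b])"
      using arc_of_path[of "a # t @ [b]"] h by auto
    obtain d3 where d3: "arc d3" "pathstart d3 = pos a" "pathfinish d3 = pos b" "path_image d3 = path_trace (a # u @ [b])"
      using arc_of_path[of "a # u @ [b]"] h by auto
    have int: "path_image d2 \<inter> path_image d3 = {pos a,pos b}" "path_image d2 \<inter> path_image d1 = {pos a,pos b}"
      "path_image d3 \<inter> path_image d1 = {pos a,pos b}" 
      "path_image d1 \<inter> inside (path_image d2 \<union> path_image d3) \<noteq> {}"
      using h(1,7,8,9) unfolding d1(4) d2(4) d3(4) by (simp_all add: Int_commute)
    have "path_image d1 - {pos a,pos b} \<subseteq> inside (path_image d2 \<union> path_image d3)"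
      using theta_split(2)[OF d2(1-3) d3(1-3) d1(1-3) int] by blast
    moreover obtain v where v: "v \<in> set s" using h(2) by (cases s) auto
    have "pos v \<in> path_image d1" using vertex_path_trace[OF h(4), of v] v d1 by simp
    moreover have "v \<in> V" using path_in_V[OF h(4)] v by auto
    moreover have "pos v \<noteq> pos a" "pos v \<noteq> pos b"
    proof -
      have "v \<noteq> a" "v \<noteq> b" "a \<in> V" "b \<in> V" using v h(3) path_in_V[OF h(4)] by auto
      then show "pos v \<noteq> pos a" "pos v \<noteq> pos b" using inj_onD[OF inj_pos] \<open>v \<in> V\<close> by blast+
    qed
    ultimately have "pos v \<in> inside (path_image d2 \<union> path_image d3)" by blast
    moreover have "pos v \<notin> inside (path_image d2 \<union> path_image d3)"
    proof (rule vertex_not_inside[OF \<open>v \<in> V\<close>])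
      show "path_image d2 \<union> path_image d3 \<subseteq> drawing V E pos \<gamma>"
        using path_trace_drawing h(5,6) unfolding d2(4) d3(4) by blast
      show "closed (path_image d2 \<union> path_image d3)" 
        by (intro closed_Un closed_arc_image d2(1) d3(1))
    qed
    ultimately show False by blast
  qed
  have th: "?A \<inter> inside (?B \<union> ?C) \<noteq> {} \<or> ?B \<inter> inside (?A \<union> ?C) \<noteq> {} \<or> ?C \<inter> inside (?A \<union> ?B) \<noteq> {}"
    using theta_enclosed[OF c1(1-3) c2(1-3) c3(1-3)] i12 i13 i23 unfolding c1(4) c2(4) c3(4) by blast
  have d': "distinct (a # b # q @ p @ r)" "distinct (a # b # r @ p @ q)" using d by auto
  have i21: "?B \<inter> ?A = {pos a, pos b}" and i31: "?C \<inter> ?A = {pos a, pos b}" and i32: "?C \<inter> ?B = {pos a, pos b}"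
    using i12 i13 i23 by (simp_all add: Int_commute)
  have k1: "?A \<inter> inside (?B \<union> ?C) = {}" 
    by (rule ccontr) (rule key[OF _ ne(1) d E i12 i13 i23])
  have k2: "?B \<inter> inside (?A \<union> ?C) = {}" 
    by (rule ccontr) (rule key[OF _ ne(2) d'(1) E(2,1,3) i21 i23 i13])
  show k3: "?C \<inter> inside (?A \<union> ?B) \<noteq> {}" using th unfolding k1 k2 by simp
  show "r = []" by (rule ccontr) (rule key[OF k3 _ d'(2) E(3,1,2) i31 i32 i12])
qed

text \<open>Each of the chords \<open>{a,c}\<close> and \<open>{b,d}\<close> runs inside the cycle. The chord \<open>{a,c}\<close> cuts this inside into two
  open discs, one for each arc of the cycle between \<open>a\<close> and \<open>c\<close>, and the chord \<open>{b,d}\<close> stays in one of them.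
  But \<open>b\<close> and \<open>d\<close> lie on different arcs, so neither disc has both of them in its closure.\<close>

lemma no_crossing_chords:
  assumes dist: "distinct (a # p1 @ b # p2 @ c # q1 @ d # q2)"
    and cyc: "path_edges (a # p1 @ b # p2 @ c # q1 @ d # q2 @ [a]) \<subseteq> E"
    and ac: "{a,c} \<in> E" and bd: "{b,d} \<in> E"
  shows False
proof -
  let ?P1 = "p1 @ b # p2" let ?Q1 = "rev (q1 @ d # q2)"
  let ?P2 = "p2 @ c # q1" let ?Q2 = "rev (q2 @ a # p1)"
  have pe: "path_edges (a # ?P1 @ [c]) = path_edges (a # p1 @ [b]) \<union> path_edges (b # p2 @ [c])"
    "path_edges (b # ?P2 @ [d]) = path_edges (b # p2 @ [c]) \<union> path_edges (c # q1 @ [d])"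
    "path_edges (c # q1 @ d # q2 @ [a]) = path_edges (c # q1 @ [d]) \<union> path_edges (d # q2 @ [a])"
    "path_edges (d # q2 @ a # p1 @ [b]) = path_edges (d # q2 @ [a]) \<union> path_edges (a # p1 @ [b])"
    "path_edges (a # p1 @ b # p2 @ c # q1 @ d # q2 @ [a]) = path_edges (a # p1 @ [b]) \<union> path_edges (b # p2 @ c # q1 @ d # q2 @ [a])"
    "path_edges (b # p2 @ c # q1 @ d # q2 @ [a]) = path_edges (b # p2 @ [c]) \<union> path_edges (c # q1 @ d # q2 @ [a])"
    using path_edges_append[of "a # p1" b "p2 @ [c]"] path_edges_append[of "b # p2" c "q1 @ [d]"]
      path_edges_append[of "c # q1" d "q2 @ [a]"] path_edges_append[of "d # q2" a "p1 @ [b]"]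
      path_edges_append[of "a # p1" b "p2 @ c # q1 @ d # q2 @ [a]"]
      path_edges_append[of "b # p2" c "q1 @ d # q2 @ [a]"] by simp_all
  have rv: "path_edges (a # ?Q1 @ [c]) = path_edges (c # q1 @ d # q2 @ [a])"
    "path_edges (b # ?Q2 @ [d]) = path_edges (d # q2 @ a # p1 @ [b])"
    using path_edges_rev[of "c # q1 @ d # q2 @ [a]"] path_edges_rev[of "d # q2 @ a # p1 @ [b]"] by simp_all
  have E: "path_edges (a # ?P1 @ [c]) \<subseteq> E" "path_edges (a # ?Q1 @ [c]) \<subseteq> E" "path_edges (a # [] @ [c]) \<subseteq> E"
    using cyc ac unfolding pe rv by auto
  have E': "path_edges (b # ?P2 @ [d]) \<subseteq> E" "path_edges (b # ?Q2 @ [d]) \<subseteq> E" "path_edges (b # [] @ [d]) \<subseteq> E"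
    using cyc bd unfolding pe rv by auto
  let ?A = "path_trace (a # ?P1 @ [c])" let ?B = "path_trace (a # ?Q1 @ [c])" let ?C = "path_trace (a # [] @ [c])" let ?Q = "path_trace (b # [] @ [d])"
  let ?A' = "path_trace (b # ?P2 @ [d])" let ?B' = "path_trace (b # ?Q2 @ [d])"
  \<comment> \<open>Cut at \<open>a\<close> and \<open>c\<close> or at \<open>b\<close> and \<open>d\<close>, it is the same cycle.\<close>
  have Z: "?A' \<union> ?B' = ?A \<union> ?B" unfolding path_trace_def pe rv by blast
  have D: "distinct (a # c # ?P1 @ ?Q1 @ [])" "distinct (b # d # ?P2 @ ?Q2 @ [])" using dist by auto
  have nP: "?C \<inter> inside (?A \<union> ?B) \<noteq> {}" by (rule theta_paths(2)[OF D(1) E]) auto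
  have nQ: "?Q \<inter> inside (?A' \<union> ?B') \<noteq> {}" by (rule theta_paths(2)[OF D(2) E']) auto
  have inV: "a \<in> V" "b \<in> V" "c \<in> V" "d \<in> V" using path_in_V[OF E(1)] path_in_V[OF E'(1)] by auto
  have AB: "?A \<inter> ?B = {pos a, pos c}" by (rule path_trace_inter_ends[OF _ _ E(1,2)]) (use D in auto)
  have AC: "?A \<inter> ?C = {pos a, pos c}" by (rule path_trace_inter_ends[OF _ _ E(1,3)]) (use D in auto)
  have BC: "?B \<inter> ?C = {pos a, pos c}" by (rule path_trace_inter_ends[OF _ _ E(2,3)]) (use D in auto)
  have AB': "?A' \<inter> ?B' = {pos b, pos d}" by (rule path_trace_inter_ends[OF _ _ E'(1,2)]) (use D in auto)
  have AQ': "?A' \<inter> ?Q = {pos b, pos d}" by (rule path_trace_inter_ends[OF _ _ E'(1,3)]) (use D in auto)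
  have BQ': "?B' \<inter> ?Q = {pos b, pos d}" by (rule path_trace_inter_ends[OF _ _ E'(2,3)]) (use D in auto)
  have arcs: "\<exists>g. arc g \<and> pathstart g = pos a \<and> pathfinish g = pos b \<and> path_image g = path_trace (a # s @ [b])"
    if "distinct (a # s @ [b])" "path_edges (a # s @ [b]) \<subseteq> E" for a s b
    using arc_of_path[OF that] by simp
  obtain g1 where g1: "arc g1" "pathstart g1 = pos a" "pathfinish g1 = pos c" "path_image g1 = ?A"
    using arcs[OF _ E(1)] D by auto
  obtain g2 where g2: "arc g2" "pathstart g2 = pos a" "pathfinish g2 = pos c" "path_image g2 = ?B"
    using arcs[OF _ E(2)] D by auto
  obtain g3 where g3: "arc g3" "pathstart g3 = pos a" "pathfinish g3 = pos c" "path_image g3 = ?C"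
    using arcs[OF _ E(3)] D by auto
  obtain h1 where h1: "arc h1" "pathstart h1 = pos b" "pathfinish h1 = pos d" "path_image h1 = ?A'"
    using arcs[OF _ E'(1)] D by auto
  obtain h2 where h2: "arc h2" "pathstart h2 = pos b" "pathfinish h2 = pos d" "path_image h2 = ?B'"
    using arcs[OF _ E'(2)] D by auto
  obtain h3 where h3: "arc h3" "pathstart h3 = pos b" "pathfinish h3 = pos d" "path_image h3 = ?Q"
    using arcs[OF _ E'(3)] D by auto
  have ne: "pos a \<noteq> pos c" "pos b \<noteq> pos d"
    using arc_distinct_ends[OF g1(1)] arc_distinct_ends[OF h1(1)] g1(2,3) h1(2,3) by simp_all
  have I: "inside (?A \<union> ?C) \<inter> inside (?B \<union> ?C) = {}"
    "inside (?A \<union> ?C) \<union> inside (?B \<union> ?C) \<union> (?C - {pos a, pos c}) = inside (?A \<union> ?B)"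
    by (rule theta_split[OF g1(1-3) g2(1-3) g3(1-3), unfolded g1(4) g2(4) g3(4), OF AB AC BC nP])+
  have "?Q - {pos b, pos d} \<subseteq> inside (?A' \<union> ?B')"
    using theta_split(2)[OF h1(1-3) h2(1-3) h3(1-3), unfolded h1(4) h2(4) h3(4), OF AB' AQ' BQ' nQ] by blast
  then have Qin: "?Q - {pos b, pos d} \<subseteq> inside (?A \<union> ?B)" unfolding Z .
  have "?Q \<inter> ?C = {}"
  proof -
    have "{b,d} \<noteq> {a,c}" using dist by (auto simp: doubleton_eq_iff)
    then have "path_edges (b # [] @ [d]) \<inter> path_edges (a # [] @ [c]) = {}" by simp
    from path_trace_inter[OF E'(3) E(3) this] show ?thesis using dist by auto
  qed
  then have Q12: "?Q - {pos b, pos d} \<subseteq> inside (?A \<union> ?C) \<union> inside (?B \<union> ?C)" using I(2) Qin by blast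
  note J1 = Jordan_inside_outside[OF arc_pair_loop(1,2)[OF g1(1-3) g3(1-3)], unfolded arc_pair_loop(3)[OF g1(1-3) g3(1-3)] g1(4) g3(4), OF AC AC, unfolded arc_pair_loop(3)[OF g1(1-3) g3(1-3), unfolded g1(4) g3(4), OF AC]]
  note J2 = Jordan_inside_outside[OF arc_pair_loop(1,2)[OF g2(1-3) g3(1-3)], unfolded arc_pair_loop(3)[OF g2(1-3) g3(1-3)] g2(4) g3(4), OF BC BC, unfolded arc_pair_loop(3)[OF g2(1-3) g3(1-3), unfolded g2(4) g3(4), OF BC]]
  have Qo: "connected (?Q - {pos b, pos d})"
    using connected_simple_path_endless[OF arc_imp_simple_path[OF h3(1)]] unfolding h3(2-4) .
  have Qc: "connected ?Q" using connected_arc_image[OF h3(1)] unfolding h3(4) .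
  have one: "?Q - {pos b, pos d} \<subseteq> inside (?A \<union> ?C) \<or> ?Q - {pos b, pos d} \<subseteq> inside (?B \<union> ?C)"
  proof (rule ccontr)
    assume "\<not> ?thesis"
    then have "inside (?A \<union> ?C) \<inter> (?Q - {pos b, pos d}) \<noteq> {}" "inside (?B \<union> ?C) \<inter> (?Q - {pos b, pos d}) \<noteq> {}"
      using Q12 by blast+
    moreover have "open (inside (?A \<union> ?C))" "open (inside (?B \<union> ?C))" using J1 J2 by blast+
    ultimately show False
      using connectedD[OF Qo, of "inside (?A \<union> ?C)" "inside (?B \<union> ?C)"] I(1) Q12 by blast
  qed
  \<comment> \<open>The chord cannot lie in the closed disc \<open>closure I\<close> up to a single end, because it is connected.\<close>
  have key: False if "?Q - {pos b, pos d} \<subseteq> I" "?Q \<inter> closure I \<noteq> {}" "y = b \<and> x = d \<or> y = d \<and> x = b" "pos y \<notin> closure I" "pos x \<in> closure I" for I x y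
  proof -
    have "?Q - {pos y} \<subseteq> closure I" using that closure_subset[of I] by blast
    moreover have "pos y \<in> ?Q" using that(3) vertex_path_trace[OF E'(3)] by auto
    ultimately show False
      using connected_closedD[OF Qc, of "closure I" "{pos y}"] that(2,4) by blast
  qed
  have cl: "closure (inside (?A \<union> ?C)) = inside (?A \<union> ?C) \<union> (?A \<union> ?C)"
     "closure (inside (?B \<union> ?C)) = inside (?B \<union> ?C) \<union> (?B \<union> ?C)"
    using J1 J2 closure_Un_frontier by metis+
  have cp: "closed ?A" "closed ?B" "closed ?C" 
    using closed_arc_image g1(1,4) g2(1,4) g3(1,4) by metis+
  have ni: "pos d \<notin> inside (?A \<union> ?C)" "pos b \<notin> inside (?B \<union> ?C)"
    using path_trace_drawing E by (intro vertex_not_inside inV closed_Un cp; blast)+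
  have nv: "pos d \<notin> ?A" "pos d \<notin> ?C" "pos b \<notin> ?B" "pos b \<notin> ?C"
    using path_trace_vertex[OF E(1) inV(4) graph] path_trace_vertex[OF E(3) inV(4) graph] path_trace_vertex[OF E(2) inV(2) graph] path_trace_vertex[OF E(3) inV(2) graph] dist
    by auto
  have yes: "pos b \<in> ?A" "pos d \<in> ?B" "pos b \<in> ?Q" "pos d \<in> ?Q" 
    using vertex_path_trace[OF E(1), of b] vertex_path_trace[OF E(2), of d] vertex_path_trace[OF E'(3)] by auto
  show False using one
  proof
    assume "?Q - {pos b, pos d} \<subseteq> inside (?A \<union> ?C)"
    then show False by (rule key[where y = d and x = b]) (use cl ni nv yes in auto)
  next
    assume "?Q - {pos b, pos d} \<subseteq> inside (?B \<union> ?C)"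
    then show False by (rule key[where y = b and x = d]) (use cl ni nv yes in auto)
  qed
qed

end
end

section \<open>Outerplanar graphs have a circular order without crossings\<close>

definition adj_in :: "'a set set \<Rightarrow> 'a set \<Rightarrow> ('a \<times> 'a) set" where
  "adj_in E X = {(x,y). x \<in> X \<and> y \<in> X \<and> {x,y} \<in> E}"

text \<open>Both ends are required to be in \<open>X\<close>, so that deleting a vertex \<open>w\<close> amounts to replacing \<open>X\<close> by \<open>X - {w}\<close>.\<close>

definition reach :: "'a set set \<Rightarrow> 'a set \<Rightarrow> 'a \<Rightarrow> 'a \<Rightarrow> bool" where
  "reach E X a b \<longleftrightarrow> a \<in> X \<and> b \<in> X \<and> (a,b) \<in> (adj_in E X)\<^sup>*"

definition conn :: "'a set set \<Rightarrow> 'a set \<Rightarrow> bool" where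
  "conn E X \<longleftrightarrow> (\<forall>a\<in>X. \<forall>b\<in>X. reach E X a b)"

text \<open>For \<open>w\<close> outside \<open>X\<close> this is connectedness of the whole graph.\<close>

definition biconn :: "'a set set \<Rightarrow> 'a set \<Rightarrow> bool" where
  "biconn E X \<longleftrightarrow> (\<forall>w. conn E (X - {w}))"

lemma reach_refl: "a \<in> X \<Longrightarrow> reach E X a a"
  by (simp add: reach_def)

lemma reach_trans: "reach E X a b \<Longrightarrow> reach E X b c \<Longrightarrow> reach E X a c"
  by (auto simp: reach_def)

lemma sym_adj_in: "sym (adj_in E X)"
  by (auto simp: sym_def adj_in_def insert_commute)

lemma reach_sym: "reach E X a b \<Longrightarrow> reach E X b a"
  using sym_rtrancl[OF sym_adj_in[of E X]] unfolding reach_def sym_def by blast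

lemma reach_edge: "{a,b} \<in> E \<Longrightarrow> a \<in> X \<Longrightarrow> b \<in> X \<Longrightarrow> reach E X a b"
  by (auto simp: reach_def adj_in_def)

lemma reach_mono:
  assumes "reach E X a b" "E \<subseteq> F" "X \<subseteq> Y" shows "reach F Y a b"
proof -
  have "adj_in E X \<subseteq> adj_in F Y" using assms by (auto simp: adj_in_def)
  then show ?thesis using assms rtrancl_mono[of "adj_in E X" "adj_in F Y"] unfolding reach_def by blast
qed

lemma reach_in: "reach E X a b \<Longrightarrow> a \<in> X" "reach E X a b \<Longrightarrow> b \<in> X"
  by (auto simp: reach_def)

lemma reach_induct [consumes 1, case_names base step]:
  assumes "reach E X a b"
    and "P a"
    and "\<And>y z. reach E X a y \<Longrightarrow> P y \<Longrightarrow> z \<in> X \<Longrightarrow> {y,z} \<in> E \<Longrightarrow> P z"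
  shows "P b"
proof -
  have aX: "a \<in> X" and "(a,b) \<in> (adj_in E X)\<^sup>*" using assms(1) by (auto simp: reach_def)
  from this(2) show ?thesis
  proof (induction rule: rtrancl_induct)
    case (step y z)
    then have "reach E X a y" "z \<in> X" "{y,z} \<in> E" using aX by (auto simp: reach_def adj_in_def)
    then show ?case using assms(3) step by blast
  qed (rule assms(2))
qed

text \<open>A walk from \<open>S\<close> to its complement uses an edge that leaves \<open>S\<close>.\<close>

lemma reach_cross:
  assumes "reach E X a b" "a \<in> S" "b \<notin> S"
  shows "\<exists>x y. x \<in> S \<inter> X \<and> y \<in> X - S \<and> {x,y} \<in> E"
proof (rule ccontr)
  assume n: "\<not> ?thesis"
  from assms(1) have "b \<in> S"
  proof (induction rule: reach_induct)
    case (step y z)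
    then show ?case using n reach_in(2)[OF step(1)] by blast
  qed (rule assms(2))
  then show False using assms by simp
qed

lemma reach_path:
  assumes "reach E X a b"
  shows "\<exists>xs. xs \<noteq> [] \<and> distinct xs \<and> hd xs = a \<and> last xs = b \<and> set xs \<subseteq> X \<and> path_edges xs \<subseteq> E"
  using assms
proof (induction rule: reach_induct)
  case base
  then show ?case using reach_in(1)[OF assms] by (intro exI[of _ "[a]"]) auto
next
  case (step y z)
  then obtain xs where xs: "xs \<noteq> []" "distinct xs" "hd xs = a" "last xs = y" "set xs \<subseteq> X" "path_edges xs \<subseteq> E"
    by blast
  show ?case
  proof (cases "z \<in> set xs")
    case True
    then obtain us vs where "xs = us @ z # vs" by (meson split_list)
    then show ?thesis using xs path_edges_append[of us z vs]
      by (intro exI[of _ "us @ [z]"]) (auto simp: hd_append split: if_splits)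
  next
    case False
    obtain ws where ws: "xs = ws @ [y]" using xs by (metis append_butlast_last_id)
    have "path_edges (ws @ y # [z]) = path_edges (ws @ [y]) \<union> path_edges [y,z]" by (rule path_edges_append)
    then show ?thesis using xs ws False step by (intro exI[of _ "xs @ [z]"]) (auto simp: hd_append)
  qed
qed

text \<open>The list stands for a circular order (\<open>crossfree_rotate\<close>), in which no two edges interleave.\<close>

definition crossfree :: "'a list \<Rightarrow> 'a set set \<Rightarrow> bool" where
  "crossfree xs E \<longleftrightarrow> (\<forall>u p q r s a b c d.
     xs = u @ a # p @ b # q @ c # r @ d # s \<longrightarrow> {a,c} \<in> E \<longrightarrow> {b,d} \<notin> E)"

text \<open>In other words, the graph has a book embedding with one page.\<close>

definition onepage :: "'a set \<Rightarrow> 'a set set \<Rightarrow> bool" where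
  "onepage V E \<longleftrightarrow> (\<exists>xs. distinct xs \<and> set xs = V \<and> crossfree xs E)"

lemma subseq_Cons_iff:
  "subseq (a # ys) xs \<longleftrightarrow> (\<exists>u v. xs = u @ a # v \<and> subseq ys v)"
proof
  assume "subseq (a # ys) xs"
  then show "\<exists>u v. xs = u @ a # v \<and> subseq ys v" using list_emb_ConsD[of "(=)" a ys xs] by auto
next
  assume "\<exists>u v. xs = u @ a # v \<and> subseq ys v"
  then show "subseq (a # ys) xs" by (auto intro: list_emb_append2 simp: subseq_drop_many)
qed

lemma crossfree_subseq:
  "crossfree xs E \<longleftrightarrow> (\<forall>a b c d. subseq [a,b,c,d] xs \<longrightarrow> {a,c} \<in> E \<longrightarrow> {b,d} \<notin> E)"
  unfolding crossfree_def subseq_Cons_iff by (simp; blast)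

text \<open>Whether two pairs interleave on a circle does not depend on the place where the circle is cut open.\<close>

lemma crossfree_rotate:
  assumes "crossfree (us @ vs) E" shows "crossfree (vs @ us) E"
  unfolding crossfree_subseq
proof (intro allI impI notI)
  fix a b c d assume h: "subseq [a,b,c,d] (vs @ us)" "{a,c} \<in> E" "{b,d} \<in> E"
  obtain p q where pq: "[a,b,c,d] = p @ q" "subseq p vs" "subseq q us"
    using h(1) by (auto elim: subseq_appendE)
  have sub: "subseq (q @ p) (us @ vs)" using pq by (simp add: list_emb_append_mono)
  have no: "False" if "subseq [x,y,z,w] (us @ vs)" "{x,z} \<in> E" "{y,w} \<in> E" for x y z w
    using that assms unfolding crossfree_subseq by blast
  have h': "{c,a} \<in> E" "{d,b} \<in> E" using h(2,3) by (simp_all add: insert_commute)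
  show False using pq(1) sub no[OF _ h(2,3)] no[OF _ h(3) h'(1)] no[OF _ h'(1,2)] no[OF _ h'(2) h(2)]
    by (auto simp: Cons_eq_append_conv)
qed

lemma crossfree_mono: "crossfree xs E \<Longrightarrow> F \<subseteq> E \<Longrightarrow> crossfree xs F"
  unfolding crossfree_def by blast

lemma crossfree_sub: "crossfree xs E \<Longrightarrow> subseq ys xs \<Longrightarrow> crossfree ys E"
  unfolding crossfree_subseq using subseq_order.trans by blast

lemma onepage_mono:
  assumes "onepage V E" "W \<subseteq> V" "F \<subseteq> E" shows "onepage W F"
proof -
  obtain xs where xs: "distinct xs" "set xs = V" "crossfree xs E" using assms by (auto simp: onepage_def)
  have "crossfree (filter (\<lambda>x. x \<in> W) xs) F"
    using xs assms by (meson crossfree_mono crossfree_sub subseq_filter_left)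
  then show ?thesis using xs assms
    unfolding onepage_def by (intro exI[of _ "filter (\<lambda>x. x \<in> W) xs"]) auto
qed

lemma onepage_starting_at:
  assumes "onepage V E" "v \<in> V"
  obtains ys where "distinct (v # ys)" "set (v # ys) = V" "crossfree (v # ys) E"
proof -
  obtain xs where xs: "distinct xs" "set xs = V" "crossfree xs E" using assms by (auto simp: onepage_def)
  then obtain us vs where s: "xs = us @ v # vs" using assms by (metis split_list)
  then have "crossfree ((v # vs) @ us) E" using xs crossfree_rotate by metis
  then show ?thesis using that[of "vs @ us"] xs s by auto
qed

lemma edge_ends: "{x,y} \<in> E \<Longrightarrow> E \<subseteq> nsets V 2 \<Longrightarrow> x \<in> V \<and> y \<in> V \<and> x \<noteq> y"
  using doubleton_in_nsets_2[of x y V] by blast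

lemma subseq_distinct: "subseq ys xs \<Longrightarrow> distinct xs \<Longrightarrow> distinct ys"
  by (auto simp: subseq_conv_nths)

text \<open>Edges of the same graph do not cross because the combined list restricts to the given one. The list \<open>v # ys\<close>
  is an interval of the combined list, and of its elements only \<open>v\<close>, the first one, can be an end of an edge in
  \<open>E1\<close>. Hence no end of an edge in \<open>E1\<close> lies strictly between the ends of an edge in \<open>E2\<close>.\<close>

lemma crossfree_insert:
  assumes xs: "distinct (us @ v # vs)" "crossfree (us @ v # vs) E1" "E1 \<subseteq> nsets (set (us @ v # vs)) 2"
    and ys: "distinct (v # ys)" "crossfree (v # ys) E2" "E2 \<subseteq> nsets (set (v # ys)) 2"
    and num_dissections: "set (us @ vs) \<inter> set ys = {}"
  shows "crossfree (us @ v # ys @ vs) (E1 \<union> E2)"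
  unfolding crossfree_subseq
proof (intro allI impI notI)
  fix a b c d assume h: "subseq [a,b,c,d] (us @ v # ys @ vs)" "{a,c} \<in> E1 \<union> E2" "{b,d} \<in> E1 \<union> E2"
  let ?V1 = "set (us @ v # vs)" let ?V2 = "set (v # ys)"
  have dl: "distinct (us @ v # ys @ vs)" using xs ys num_dissections by auto
  have dist: "distinct [a,b,c,d]" using subseq_distinct[OF h(1) dl] .
  have f1: "filter (\<lambda>x. x \<in> ?V1) (us @ v # ys @ vs) = us @ v # vs"
    using num_dissections ys(1) by (auto simp: filter_empty_conv filter_id_conv)
  have f2: "filter (\<lambda>x. x \<in> ?V2) (us @ v # ys @ vs) = v # ys"
  proof -
    have "filter (\<lambda>x. x \<in> ?V2) us = []" "filter (\<lambda>x. x \<in> ?V2) vs = []"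
      using num_dissections xs(1) by (auto simp: filter_empty_conv)
    moreover have "filter (\<lambda>x. x \<in> ?V2) (v # ys) = v # ys" by (auto simp: filter_id_conv)
    ultimately show ?thesis by simp
  qed
  obtain p q where pq: "[a,b,c,d] = p @ q" "subseq p us" "subseq q (v # ys @ vs)"
    using h(1) by (auto elim: subseq_appendE)
  have "subseq q ((v # ys) @ vs)" using pq(3) by simp
  then obtain q1 q2 where q: "q = q1 @ q2" "subseq q1 (v # ys)" "subseq q2 vs"
    by (rule subseq_appendE)
  have sp: "set p \<subseteq> set us" "set q1 \<subseteq> ?V2" "set q2 \<subseteq> set vs"
    using pq(2) q(2,3) by (auto dest: list_emb_set)
  have np: "x \<notin> set p" "x \<notin> set q2" if "x \<in> ?V2" for x
    using that sp dl by auto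
  have vfirst: "\<not> subseq (x # v # zs) (v # ys)" for x zs
  proof
    assume "subseq (x # v # zs) (v # ys)"
    then have "distinct (x # v # zs)" using ys(1) subseq_distinct by blast
    then have "x \<noteq> v" by auto
    then have "subseq (x # v # zs) ys" using subseq_Cons2_neq \<open>subseq (x # v # zs) (v # ys)\<close> by metis
    then obtain u w where "ys = u @ x # w" "subseq (v # zs) w" unfolding subseq_Cons_iff[of x] by blast
    then have "v \<in> set ys" unfolding subseq_Cons_iff[of v] by auto
    then show False using ys(1) by simp
  qed
  consider "{a,c} \<in> E1" "{b,d} \<in> E1" | "{a,c} \<in> E2" "{b,d} \<in> E2"
    | "{a,c} \<in> E1" "{b,d} \<in> E2" | "{a,c} \<in> E2" "{b,d} \<in> E1" using h(2,3) by blast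
  then show False
  proof cases
    case 1
    then have "a \<in> ?V1 \<and> c \<in> ?V1" "b \<in> ?V1 \<and> d \<in> ?V1" using edge_ends[OF _ xs(3)] by blast+
    then have "filter (\<lambda>x. x \<in> ?V1) [a,b,c,d] = [a,b,c,d]" by simp
    then have "subseq [a,b,c,d] (us @ v # vs)" using subseq_filter[OF h(1), of "\<lambda>x. x \<in> ?V1"] f1 by metis
    then show ?thesis using xs(2) 1 unfolding crossfree_subseq by blast
  next
    case 2
    then have "a \<in> ?V2 \<and> c \<in> ?V2" "b \<in> ?V2 \<and> d \<in> ?V2" using edge_ends[OF _ ys(3)] by blast+
    then have "filter (\<lambda>x. x \<in> ?V2) [a,b,c,d] = [a,b,c,d]" by simp
    then have "subseq [a,b,c,d] (v # ys)" using subseq_filter[OF h(1), of "\<lambda>x. x \<in> ?V2"] f2 by metis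
    then show ?thesis using ys(2) 2 unfolding crossfree_subseq by blast
  next
    case 3
    then have m: "a \<in> ?V1" "c \<in> ?V1" "b \<in> ?V2" "d \<in> ?V2" using edge_ends[OF _ xs(3)] edge_ends[OF _ ys(3)] by blast+
    have "b \<notin> set p" "d \<notin> set q2" using np m by blast+
    then have "\<exists>t. q1 = t @ [b,c,d] \<and> set t \<subseteq> {a}"
      using pq(1) q(1) by (auto simp: Cons_eq_append_conv append_eq_Cons_conv)
    then obtain t where t: "q1 = t @ [b,c,d]" by blast
    then have "c \<in> ?V2" using sp by auto
    then have "c = v" using m num_dissections dl by auto
    have "subseq [b,c,d] q1" using t by (simp add: subseq_drop_many)
    then have "subseq [b,c,d] (v # ys)" using q(2) subseq_order.trans by blast
    then show ?thesis using vfirst \<open>c = v\<close> by blast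
  next
    case 4
    then have m: "a \<in> ?V2" "c \<in> ?V2" "b \<in> ?V1" "d \<in> ?V1" using edge_ends[OF _ xs(3)] edge_ends[OF _ ys(3)] by blast+
    have "a \<notin> set p" "c \<notin> set q2" using np m by blast+
    then have "\<exists>t. q1 = a # b # c # t"
      using pq(1) q(1) by (auto simp: Cons_eq_append_conv append_eq_Cons_conv)
    then obtain t where t: "q1 = a # b # c # t" by blast
    then have "b \<in> ?V2" using sp by auto
    then have "b = v" using m num_dissections dl by auto
    then show ?thesis using vfirst q(2) t by blast
  qed
qed

lemma onepage_insert_isolated:
  assumes "onepage V E" "E \<subseteq> nsets V 2" "v \<notin> V"
  shows "onepage (insert v V) E"
proof -
  obtain xs where xs: "distinct xs" "set xs = V" "crossfree xs E" using assms by (auto simp: onepage_def)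
  have "crossfree (v # xs) E"
    unfolding crossfree_def
  proof (intro allI impI notI)
    fix u p q r s a b c d
    assume h: "v # xs = u @ a # p @ b # q @ c # r @ d # s" "{a,c} \<in> E" "{b,d} \<in> E"
    then have "a \<noteq> v" using edge_ends[OF h(2) assms(2)] assms(3) by auto
    then obtain u' where "xs = u' @ a # p @ b # q @ c # r @ d # s" using h(1) by (cases u) auto
    then show False using xs(3) h(2,3) unfolding crossfree_def by blast
  qed
  then show ?thesis using xs assms unfolding onepage_def by (intro exI[of _ "v # xs"]) auto
qed

text \<open>If the graphs share \<open>v\<close>, the order of the second one, rotated to start at \<open>v\<close>, is inserted into the order of
  the first one at \<open>v\<close>. Disjoint graphs are made to share a vertex by adding one as an isolated vertex.\<close>

lemma onepage_glue:
  assumes "onepage V1 E1" "onepage V2 E2" "E1 \<subseteq> nsets V1 2" "E2 \<subseteq> nsets V2 2" "V1 \<inter> V2 \<subseteq> {v}"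
  shows "onepage (V1 \<union> V2) (E1 \<union> E2)"
proof (cases "V1 = {}")
  case True
  then have "E1 = {}" using assms(3) nsets_eq_empty[of "{}" 2] by auto
  then show ?thesis using True assms by simp
next
  case ne: False
  have main: "onepage (V1 \<union> V2) (E1 \<union> E2)"
    if h: "onepage V2 E2" "E2 \<subseteq> nsets V2 2" "V1 \<inter> V2 = {v}" for V2 v
  proof -
    obtain xs where xs: "distinct xs" "set xs = V1" "crossfree xs E1" using assms by (auto simp: onepage_def)
    have "v \<in> set xs" using h(3) xs(2) by blast
    then obtain us vs where s: "xs = us @ v # vs" by (meson split_list)
    obtain ys where ys: "distinct (v # ys)" "set (v # ys) = V2" "crossfree (v # ys) E2"
      using onepage_starting_at[OF h(1), of v] h(3) by auto
    have d: "set (us @ vs) \<inter> set ys = {}" using xs ys s h(3) by auto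
    have "crossfree (us @ v # ys @ vs) (E1 \<union> E2)"
      by (rule crossfree_insert) (use xs ys s d h assms in auto)
    then show ?thesis using xs ys s d unfolding onepage_def
      by (intro exI[of _ "us @ v # ys @ vs"]) auto
  qed
  show ?thesis
  proof (cases "V1 \<inter> V2 = {}")
    case False
    then show ?thesis using main[OF assms(2,4)] assms(5) by blast
  next
    case True
    obtain w where w: "w \<in> V1" using ne by auto
    have "E2 \<subseteq> nsets (insert w V2) 2" using assms(4) nsets_mono[of V2 "insert w V2" 2] by blast
    then have "onepage (V1 \<union> insert w V2) (E1 \<union> E2)"
      using main[OF onepage_insert_isolated[OF assms(2,4)], of w w] w True by auto
    moreover have "V1 \<union> insert w V2 = V1 \<union> V2" using w by auto
    ultimately show ?thesis by simp
  qed
qed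

lemma onepage_small:
  assumes "finite V" "card V \<le> 3" shows "onepage V E"
proof -
  obtain xs where xs: "set xs = V" "distinct xs" using finite_distinct_list[OF assms(1)] by auto
  then have "length xs \<le> 3" using assms distinct_card by fastforce
  then have "crossfree xs E" by (auto simp: crossfree_def)
  then show ?thesis using xs by (auto simp: onepage_def)
qed

definition is_cycle :: "'a set set \<Rightarrow> 'a list \<Rightarrow> bool" where
  "is_cycle E xs \<longleftrightarrow> length xs \<ge> 3 \<and> distinct xs \<and> path_edges (xs @ [hd xs]) \<subseteq> E"

lemma cycle_edges_rotate:
  assumes "us \<noteq> []" "vs \<noteq> []"
  shows "path_edges ((us @ vs) @ [hd us]) = path_edges ((vs @ us) @ [hd vs])"
proof -
  obtain x us' where us: "us = x # us'" using assms by (cases us) auto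
  obtain y vs' where vs: "vs = y # vs'" using assms by (cases vs) auto
  show ?thesis
    using path_edges_append[of "x # us'" y "vs' @ [x]"] path_edges_append[of "y # vs'" x "us' @ [y]"] us vs
    by auto
qed

lemma is_cycle_rotate: "is_cycle E (us @ vs) \<Longrightarrow> is_cycle E (vs @ us)"
proof (cases "us = [] \<or> vs = []")
  case False
  then show "is_cycle E (us @ vs) \<Longrightarrow> is_cycle E (vs @ us)"
    using cycle_edges_rotate[of us vs] by (auto simp: is_cycle_def)
qed auto

text \<open>Some vertex has two neighbours, and a path between them that avoids this vertex closes to a cycle.\<close>

lemma cycle_exists:
  assumes bi: "biconn E V" and fin: "finite V" "card V \<ge> 3"
  shows "\<exists>xs. is_cycle E xs \<and> set xs \<subseteq> V"
proof -
  have nbr: "\<exists>y. y \<in> V - {w} \<and> y \<noteq> a \<and> {a,y} \<in> E" if "a \<in> V" "a \<noteq> w" for a w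
  proof -
    have "\<not> V \<subseteq> {w,a}" 
    proof
      assume "V \<subseteq> {w,a}"
      then have "card V \<le> card {w,a}" by (intro card_mono) auto
      also have "\<dots> \<le> 2" by (simp add: card_insert_if)
      finally show False using fin by simp
    qed
    then obtain c where c: "c \<in> V" "c \<noteq> w" "c \<noteq> a" by auto
    then have "reach E (V - {w}) a c" using bi that unfolding biconn_def conn_def by blast
    from reach_cross[OF this, of "{a}"] c show ?thesis by auto
  qed
  have "V \<noteq> {}" using fin by auto
  then obtain a where a: "a \<in> V" by auto
  obtain w0 where "w0 \<in> V" "w0 \<noteq> a"
  proof -
    have "\<not> V \<subseteq> {a}" using fin card_mono[of "{a}" V] by auto
    then show ?thesis using that by auto
  qed
  then obtain b where b: "b \<in> V" "b \<noteq> a" "{a,b} \<in> E" using nbr[OF a, of w0] by auto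
  obtain b' where b': "b' \<in> V" "b' \<noteq> b" "b' \<noteq> a" "{a,b'} \<in> E" using nbr[OF a, of b] b by auto
  have "reach E (V - {a}) b b'" using bi b b' unfolding biconn_def conn_def by blast
  then obtain xs where xs: "xs \<noteq> []" "distinct xs" "hd xs = b" "last xs = b'" "set xs \<subseteq> V - {a}" "path_edges xs \<subseteq> E"
    using reach_path by metis
  then obtain ys where ys: "xs = b # ys @ [b']" using b'(2)
    by (metis append_Nil append_butlast_last_id hd_append2 last.simps list.collapse list.sel(1))
  have "path_edges (a # xs @ [a]) = path_edges (a # [b]) \<union> (path_edges xs \<union> path_edges [b', a])"
    using path_edges_append[of "[a]" b "ys @ b' # [a]"] path_edges_append[of "b # ys" b' "[a]"] ys by auto
  also have "\<dots> \<subseteq> E" using xs b b' by (auto simp: insert_commute)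
  finally show ?thesis using xs ys a unfolding is_cycle_def
    by (intro exI[of _ "a # xs"]) (auto)
qed

text \<open>A longest cycle that misses a vertex has an ear: a path with an inner vertex between two vertices \<open>a\<close> and \<open>b\<close> of
  the cycle that avoids the cycle otherwise. The ear and the two arcs of the cycle form a theta, so one of the
  arcs is an edge. Replacing this edge by the ear gives a longer cycle.\<close>

lemma hamilton_of_no_theta:
  assumes th: "\<And>a b p q r. distinct (a # b # p @ q @ r) \<Longrightarrow> path_edges (a # p @ [b]) \<subseteq> E \<Longrightarrow>
      path_edges (a # q @ [b]) \<subseteq> E \<Longrightarrow> path_edges (a # r @ [b]) \<subseteq> E \<Longrightarrow> p \<noteq> [] \<Longrightarrow> q \<noteq> [] \<Longrightarrow> r = []"
    and bi: "biconn E V" and fin: "finite V" "card V \<ge> 3"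
  shows "\<exists>xs. is_cycle E xs \<and> set xs = V"
proof -
  let ?P = "\<lambda>xs. is_cycle E xs \<and> set xs \<subseteq> V"
  obtain ys0 where "?P ys0" using cycle_exists[OF bi fin] by blast
  moreover have "\<forall>ys. ?P ys \<longrightarrow> length ys < Suc (card V)"
    using fin by (metis card_mono distinct_card is_cycle_def le_imp_less_Suc)
  ultimately obtain xs where xs: "?P xs" and longest: "\<And>ys. ?P ys \<Longrightarrow> length ys \<le> length xs"
    using ex_has_greatest_nat[of ?P ys0 length "Suc (card V)"] by auto
  have "set xs = V"
  proof (rule ccontr)
    assume "set xs \<noteq> V"
    then obtain w0 where w0: "w0 \<in> V" "w0 \<notin> set xs" using xs by auto
    have len: "length xs \<ge> 3" using xs by (auto simp: is_cycle_def)
    then have h: "hd xs \<in> set xs" by (cases xs) auto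
    have notV: "\<exists>u. u \<in> V \<and> u \<noteq> x \<and> u \<noteq> y \<and> u \<in> set xs" for x y
    proof (rule ccontr)
      assume "\<not> ?thesis"
      then have "set xs \<subseteq> {x,y}" using xs by auto
      then have "card (set xs) \<le> card {x,y}" by (intro card_mono) auto
      also have "\<dots> \<le> 2" by (simp add: card_insert_if)
      finally show False using xs by (auto simp: is_cycle_def distinct_card)
    qed
    obtain u where u: "u \<in> V" "u \<noteq> w0" "u \<noteq> hd xs" using notV by blast
    have "reach E (V - {u}) (hd xs) w0" using bi u w0 h xs unfolding biconn_def conn_def by blast
    from reach_cross[OF this h w0(2)] obtain a w where aw: "a \<in> set xs" "w \<in> V" "w \<notin> set xs" "{a,w} \<in> E" by auto
    obtain us vs where "xs = us @ a # vs" using aw by (meson split_list)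
    then have cyc: "is_cycle E (a # vs @ us)" and sxs: "set xs = insert a (set (vs @ us))" and lxs: "length xs = length (a # vs @ us)"
      using is_cycle_rotate[of E us "a # vs"] xs by auto
    define ys where "ys = vs @ us"
    have cyc: "is_cycle E (a # ys)" and sxs: "set xs = insert a (set ys)" and lxs: "length xs = Suc (length ys)"
      using cyc sxs lxs by (auto simp: ys_def)
    have ysV: "set ys \<subseteq> V" "a \<in> V" "a \<notin> set ys" using sxs xs cyc by (auto simp: is_cycle_def)
    obtain v where v: "v \<in> set ys" using cyc by (cases ys) (auto simp: is_cycle_def)
    have "reach E (V - {a}) w v" using bi aw v ysV unfolding biconn_def conn_def by blast
    then obtain ps where ps: "ps \<noteq> []" "distinct ps" "hd ps = w" "last ps = v" "set ps \<subseteq> V - {a}" "path_edges ps \<subseteq> E"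
      using reach_path by metis
    have "\<exists>x\<in>set ps. x \<in> set ys" using ps v last_in_set by metis
    then obtain p1 b p2 where p: "ps = p1 @ b # p2" "b \<in> set ys" "\<forall>x\<in>set p1. x \<notin> set ys"
      using split_list_first_prop[of ps "\<lambda>x. x \<in> set ys"] by blast
    have p1: "p1 \<noteq> []" using p ps aw sxs by (cases p1) auto
    obtain p1' where p1': "p1 = w # p1'" using p1 p(1) ps(3) by (cases p1) auto
    obtain q r where ys: "ys = q @ b # r" using p(2) by (meson split_list)
    have pe1: "path_edges (p1 @ [b]) \<subseteq> E" using ps(6) path_edges_append[of p1 b p2] p(1) by auto
    have e1: "path_edges (a # p1 @ [b]) \<subseteq> E" using pe1 p1' aw(4) by auto
    have eq: "path_edges (a # q @ [b]) \<subseteq> E" "path_edges (b # r @ [a]) \<subseteq> E"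
      using cyc path_edges_append[of "a # q" b "r @ [a]"] ys by (auto simp: is_cycle_def)
    have er: "path_edges (a # rev r @ [b]) \<subseteq> E" using eq(2) path_edges_rev[of "b # r @ [a]"] by simp
    have dist: "distinct (a # b # q @ rev r @ p1)"
      using cyc ys p ps by (auto simp: is_cycle_def)
    have "q = [] \<or> r = []" using th[OF dist eq(1) er e1] p1 by auto
    then show False
    proof
      assume "q = []"
      have "is_cycle E (a # p1 @ b # r)"
        unfolding is_cycle_def using dist p1' path_edges_append[of "a # p1" b "r @ [a]"] e1 eq by auto
      moreover have "set (a # p1 @ b # r) \<subseteq> V" using ysV ys ps p by auto
      ultimately have "length (a # p1 @ b # r) \<le> length xs" using longest by blast
      then show False using lxs ys p1 \<open>q = []\<close> by simp
    next
      assume "r = []"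
      have "path_edges (b # rev p1 @ [a]) \<subseteq> E" using e1 path_edges_rev[of "a # p1 @ [b]"] by simp
      then have "is_cycle E (a # q @ b # rev p1)"
        unfolding is_cycle_def using dist p1' path_edges_append[of "a # q" b "rev p1 @ [a]"] e1 eq by auto
      moreover have "set (a # q @ b # rev p1) \<subseteq> V" using ysV ys ps p by auto
      ultimately have "length (a # q @ b # rev p1) \<le> length xs" using longest by blast
      then show False using lxs ys p1 \<open>r = []\<close> by simp
    qed
  qed
  then show ?thesis using xs by blast
qed

lemma finite_edges: "finite V \<Longrightarrow> E \<subseteq> nsets V 2 \<Longrightarrow> finite E"
  using finite_imp_finite_nsets finite_subset by metis

lemma nsets_sub: "E \<subseteq> nsets V 2 \<Longrightarrow> e \<in> E \<Longrightarrow> e \<subseteq> V"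
  by (auto simp: nsets_def)

lemma biconn_outerplanar_hamilton:
  assumes op: "outerplanar V E" and bi: "biconn E V" and fin: "finite V" "card V \<ge> 3" and E: "E \<subseteq> nsets V 2"
  shows "\<exists>xs. is_cycle E xs \<and> set xs = V \<and> crossfree xs E"
proof -
  obtain pos \<gamma> where emb: "plane_embedding V E pos \<gamma>" and fr: "pos ` V \<subseteq> frontier (outside (drawing V E pos \<gamma>))"
    using op unfolding outerplanar_def by blast
  have g: "E \<subseteq> Pow V" using nsets_sub[OF E] by blast
  note th = theta_paths(1)[OF emb g fr]
  note cr = no_crossing_chords[OF emb g fr]
  have "\<exists>xs. is_cycle E xs \<and> set xs = V" by (rule hamilton_of_no_theta[OF _ bi fin]) (rule th)
  then obtain xs where xs: "is_cycle E xs" "set xs = V" by blast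
  have "crossfree xs E"
    unfolding crossfree_def
  proof (intro allI impI notI)
    fix u p q r s a b c d
    assume h: "xs = u @ a # p @ b # q @ c # r @ d # s" "{a,c} \<in> E" "{b,d} \<in> E"
    have "is_cycle E ((a # p @ b # q @ c # r @ d # s) @ u)" using is_cycle_rotate xs h(1) by metis
    then have "is_cycle E (a # p @ b # q @ c # r @ d # (s @ u))" by simp
    then show False using cr[of a p b q c r d "s @ u"] h by (simp add: is_cycle_def)
  qed
  then show ?thesis using xs by blast
qed

text \<open>Removing a part of the drawing can only enlarge its outside.\<close>

lemma outerplanar_mono:
  assumes op: "outerplanar V E" and fin: "finite V" and E: "E \<subseteq> nsets V 2" and W: "W \<subseteq> V" "F \<subseteq> E" "F \<subseteq> nsets W 2"
  shows "outerplanar W F"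
proof -
  obtain pos \<gamma> where emb: "plane_embedding V E pos \<gamma>" and fr: "pos ` V \<subseteq> frontier (outside (drawing V E pos \<gamma>))"
    using op unfolding outerplanar_def by blast
  have emb': "plane_embedding W F pos \<gamma>"
    unfolding plane_embedding_def
  proof (intro conjI ballI impI)
    show "inj_on pos W" using inj_pos[OF emb] W inj_on_subset by blast
    fix e assume e: "e \<in> F"
    then have eE: "e \<in> E" using W by blast
    have eW: "e \<subseteq> W" using nsets_sub[OF W(3) e] .
    show "arc (\<gamma> e)" by (rule arc_edge[OF emb eE])
    show "{pathstart (\<gamma> e), pathfinish (\<gamma> e)} = pos ` e" by (rule ends_edge[OF emb eE])
    show "path_image (\<gamma> e) \<inter> pos ` W = pos ` e" using vertices_on_edge[OF emb eE] W(1) eW by blast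
    fix f assume "f \<in> F" "e \<noteq> f"
    then show "path_image (\<gamma> e) \<inter> path_image (\<gamma> f) \<subseteq> pos ` (e \<inter> f)" using edge_inter[OF emb eE] W by blast
  qed
  have sub: "drawing W F pos \<gamma> \<subseteq> drawing V E pos \<gamma>" using W by (auto simp: drawing_def)
  have cl: "closed (drawing W F pos \<gamma>)"
  proof -
    have fW: "finite W" using fin W finite_subset by blast
    have "finite F" using finite_edges[OF fW W(3)] .
    moreover have "\<And>e. e \<in> F \<Longrightarrow> closed (path_image (\<gamma> e))" using arc_edge[OF emb] W closed_arc_image by blast
    ultimately show ?thesis unfolding drawing_def using fW by (intro closed_Un closed_UN finite_imp_closed) auto
  qed
  have "pos ` W \<subseteq> frontier (outside (drawing W F pos \<gamma>))"
  proof
    fix z assume z: "z \<in> pos ` W"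
    have "z \<in> closure (outside (drawing V E pos \<gamma>))" using fr z W by (auto simp: frontier_def)
    then have "z \<in> closure (outside (drawing W F pos \<gamma>))"
      using closure_mono[OF outside_mono[OF sub]] by blast
    moreover have "z \<notin> outside (drawing W F pos \<gamma>)" using z by (auto simp: drawing_def outside_def)
    ultimately show "z \<in> frontier (outside (drawing W F pos \<gamma>))"
      using open_outside[OF cl] by (simp add: frontier_def interior_open)
  qed
  then show ?thesis using emb' unfolding outerplanar_def by blast
qed

lemma split_at_reach_component:
  assumes E: "E \<subseteq> nsets V 2" and A: "A = {x. reach E (V - {w}) a x}"
  shows "E = (E \<inter> nsets (insert w A \<inter> V) 2) \<union> (E \<inter> nsets (V - A) 2)"
proof -
  have "e \<in> nsets (insert w A \<inter> V) 2 \<or> e \<in> nsets (V - A) 2" if e: "e \<in> E" for e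
  proof -
    obtain x y where xy: "e = {x,y}" "x \<in> V" "y \<in> V" "x \<noteq> y" using e E nsets2_E by blast
    have st: "y \<in> A" if "x \<in> A" "{x,y} \<in> E" "y \<in> V" "y \<noteq> w" for x y
      using reach_trans[of E "V - {w}" a x y] reach_edge[of x y E "V - {w}"] that reach_in A by fastforce
    have "w \<notin> A" using A by (auto simp: reach_def)
    have "y \<in> A \<or> y = w" if "x \<in> A" using st[of x y] that xy e by auto
    moreover have "x \<in> A \<or> x = w" if "y \<in> A" using st[of y x] that xy e by (auto simp: insert_commute)
    ultimately show ?thesis using xy \<open>w \<notin> A\<close> by (auto simp: doubleton_in_nsets_2)
  qed
  then show ?thesis by blast
qed

text \<open>A 2-connected graph takes the order of its Hamilton cycle. Any other graph is the union of two smaller ones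
  with at most one common vertex, whose orders are glued.\<close>

theorem outerplanar_imp_onepage:
  assumes "finite V" "E \<subseteq> nsets V 2" "outerplanar V E"
  shows "onepage V E"
  using assms
proof (induction "card V" arbitrary: V E rule: less_induct)
  case less
  show ?case
  proof (cases "card V \<le> 3")
    case True
    then show ?thesis using onepage_small less by blast
  next
    case big: False
    show ?thesis
    proof (cases "biconn E V")
      case True
      then obtain xs where "is_cycle E xs" "set xs = V" "crossfree xs E"
        using biconn_outerplanar_hamilton less big by (metis nat_le_linear)
      then show ?thesis unfolding onepage_def is_cycle_def by blast
    next
      case False
      \<comment> \<open>If the graph is disconnected, \<open>w\<close> may lie outside \<open>V\<close>; otherwise it is a cut vertex.\<close>
      then obtain w a b where w: "a \<in> V - {w}" "b \<in> V - {w}" "\<not> reach E (V - {w}) a b"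
        unfolding biconn_def conn_def by blast
      define A where "A = {x. reach E (V - {w}) a x}"
      let ?V1 = "insert w A \<inter> V" let ?V2 = "V - A"
      have aA: "a \<in> A" and bA: "b \<notin> A" using w by (auto simp: A_def reach_def)
      have AV: "A \<subseteq> V - {w}" by (auto simp: A_def reach_def)
      have 1: "card ?V1 < card V" "card ?V2 < card V"
        using w aA bA less(2) by (intro psubset_card_mono; blast)+
      have "onepage ?V1 (E \<inter> nsets ?V1 2)" 
        by (rule less(1)[OF 1(1)]) (use less in \<open>auto intro: outerplanar_mono[OF less(4,2,3)]\<close>)
      moreover have "onepage ?V2 (E \<inter> nsets ?V2 2)"
        by (rule less(1)[OF 1(2)]) (use less in \<open>auto intro: outerplanar_mono[OF less(4,2,3)]\<close>)
      ultimately have "onepage (?V1 \<union> ?V2) ((E \<inter> nsets ?V1 2) \<union> (E \<inter> nsets ?V2 2))"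
        by (rule onepage_glue[where v = w]) auto
      moreover have "?V1 \<union> ?V2 = V" using AV by blast
      moreover have "(E \<inter> nsets ?V1 2) \<union> (E \<inter> nsets ?V2 2) = E"
        using split_at_reach_component[OF less(3) A_def] by simp
      ultimately show ?thesis by simp
    qed
  qed
qed

section \<open>Circular orders without crossings give outerplanar drawings\<close>

text \<open>By convexity of the parabola, chords that do not interleave meet at most in a common end, and
  everything strictly below the parabola is in the outer face.\<close>

definition ppt :: "nat \<Rightarrow> complex" where
  "ppt i = Complex (real i) (real i ^ 2)"

lemma chord_point:
  assumes "z \<in> closed_segment (ppt i) (ppt j)" "i \<le> j"
  shows "real i \<le> Re z" "Re z \<le> real j" "Im z = (real i + real j) * Re z - real i * real j"
proof -
  obtain t where t: "0 \<le> t" "t \<le> 1" "z = (1 - t) *\<^sub>R ppt i + t *\<^sub>R ppt j"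
    using assms(1) by (auto simp: in_segment)
  have re: "Re z = (1 - t) * real i + t * real j" and im: "Im z = (1 - t) * real i ^ 2 + t * real j ^ 2"
    using t by (simp_all add: ppt_def)
  have d: "Re z = real i + t * (real j - real i)" using re by (simp add: algebra_simps)
  have "t * (real j - real i) \<le> 1 * (real j - real i)" using t assms(2) by (intro mult_right_mono) auto
  then show "real i \<le> Re z" "Re z \<le> real j" using d t assms(2) by auto
  show "Im z = (real i + real j) * Re z - real i * real j"
    unfolding re im by (simp add: algebra_simps power2_eq_square)
qed

lemma ppt_eq: "z = ppt i \<longleftrightarrow> Re z = real i \<and> Im z = real i ^ 2"
  by (auto simp: ppt_def complex_eq_iff)

lemma chord_above:
  assumes "z \<in> closed_segment (ppt i) (ppt j)" "i \<le> j"
  shows "Im z - (Re z)\<^sup>2 = (Re z - real i) * (real j - Re z)" "Im z \<ge> (Re z)\<^sup>2"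
proof -
  show e: "Im z - (Re z)\<^sup>2 = (Re z - real i) * (real j - Re z)"
    using chord_point(3)[OF assms] by (simp add: algebra_simps power2_eq_square)
  have "(Re z - real i) * (real j - Re z) \<ge> 0" using chord_point[OF assms] by simp
  then show "Im z \<ge> (Re z)\<^sup>2" using e by simp
qed

lemma chord_vertex:
  assumes "ppt m \<in> closed_segment (ppt i) (ppt j)" "i \<le> j" shows "m = i \<or> m = j"
  using chord_above(1)[OF assms] by (auto simp: ppt_def)

text \<open>Over the abscissa \<open>x\<close>, the chord between \<open>ppt i\<close> and \<open>ppt j\<close> is at height \<open>(x - i) (j - x)\<close> above the parabola.
  For nested intervals the outer chord is strictly higher except over a common end.\<close>

lemma chord_inter:
  assumes z: "z \<in> closed_segment (ppt i) (ppt j)" "z \<in> closed_segment (ppt k) (ppt l)"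
    and ij: "i < j" "k < l" and ik: "i \<le> k" and ne: "(i,j) \<noteq> (k,l)" and nc: "\<not> (i < k \<and> k < j \<and> j < l)"
  shows "\<exists>m \<in> {i,j} \<inter> {k,l}. z = ppt m"
proof -
  note A = chord_point[OF z(1)] chord_above[OF z(1)] and B = chord_point[OF z(2)] chord_above[OF z(2)]
  \<comment> \<open>Both chords have the same height above the parabola at \<open>z\<close>.\<close>
  have eq: "(Re z - real i) * (real j - Re z) = (Re z - real k) * (real l - Re z)"
    using A(4) B(4) ij by linarith
  have onp: "z = ppt m" if "Re z = real m" "m \<in> {i,j}" for m
  proof -
    have "Im z - (Re z)\<^sup>2 = 0" using A(4) ij that by auto
    then show ?thesis using that by (simp add: ppt_eq)
  qed
  consider "j \<le> k" | "k < j" "i = k" | "k < j" "i < k" "l \<le> j" using ij ik nc by linarith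
  then show ?thesis
  proof cases
    case 1
    then have "Re z = real j" "j = k" using A(1,2) B(1,2) ij by (simp_all)
    then show ?thesis using onp by auto
  next
    case 2
    then have "(Re z - real i) * (real j - real l) = 0" using eq by (simp add: algebra_simps)
    then have "Re z = real i" using 2 ne by auto
    then show ?thesis using onp 2 by auto
  next
    case 3
    have "l = j"
    proof (rule ccontr)
      assume "l \<noteq> j"
      then have "l < j" using 3 by simp
      then have "(Re z - real k) * (real l - Re z) < (Re z - real i) * (real j - Re z)"
        using 3 A(1,2) B(1,2) ij by (intro mult_strict_mono') auto
      then show False using eq by simp
    qed
    then have "(real k - real i) * (real j - Re z) = 0" using eq by (simp add: algebra_simps)
    then have "Re z = real j" using 3 by auto
    then show ?thesis using onp \<open>l = j\<close> by auto
  qed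
qed

text \<open>The region below the parabola is a continuous image of a half plane, hence connected, and it is unbounded.\<close>

lemma below_parabola_outside:
  assumes "\<And>z. z \<in> D \<Longrightarrow> Im z \<ge> (Re z)\<^sup>2"
  shows "{z. Im z < (Re z)\<^sup>2} \<subseteq> outside D"
proof
  let ?L = "{z. Im z < (Re z)\<^sup>2}"
  let ?f = "\<lambda>z. complex_of_real (Re z) + \<i> * complex_of_real ((Re z)\<^sup>2 - Im z)"
  fix z assume z: "z \<in> ?L"
  have "connected {z. Im z > 0}" by (intro convex_connected convex_halfspace_Im_gt)
  then have "connected (?f ` {z. Im z > 0})"
    by (rule connected_continuous_image[rotated]) (intro continuous_intros)
  moreover have "?f ` {z. Im z > 0} = ?L"
  proof
    show "?L \<subseteq> ?f ` {z. Im z > 0}"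
    proof
      fix w assume "w \<in> ?L"
      then have "w = ?f (Complex (Re w) ((Re w)\<^sup>2 - Im w)) \<and> Complex (Re w) ((Re w)\<^sup>2 - Im w) \<in> {z. Im z > 0}"
        by (simp add: complex_eq_iff)
      then show "w \<in> ?f ` {z. Im z > 0}" by blast
    qed
  qed auto
  ultimately have con: "connected ?L" by simp
  have "?L \<subseteq> - D" using assms by fastforce
  then have sub: "?L \<subseteq> connected_component_set (- D) z"
    using z con by (intro connected_component_maximal) auto
  have "\<not> bounded ?L"
  proof
    assume "bounded ?L"
    then obtain B where B: "\<And>w. w \<in> ?L \<Longrightarrow> norm w \<le> B" by (auto simp: bounded_iff)
    have "Complex 0 (- (\<bar>B\<bar> + 1)) \<in> ?L" by simp
    from B[OF this] show False by (simp add: complex_norm)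
  qed
  then have "\<not> bounded (connected_component_set (- D) z)" using sub bounded_subset by blast
  moreover have "z \<notin> D" using z assms by fastforce
  ultimately show "z \<in> outside D" by (simp add: outside_def)
qed

text \<open>The vertices are placed on the parabola in their order and edges are drawn straight. Points just below a
  vertex belong to the outer face.\<close>

theorem onepage_imp_outerplanar:
  assumes "onepage V E" "E \<subseteq> nsets V 2"
  shows "outerplanar V E"
proof -
  obtain xs where xs: "distinct xs" "set xs = V" "crossfree xs E" using assms by (auto simp: onepage_def)
  define ix where "ix = (\<lambda>v. THE i. i < length xs \<and> xs ! i = v)"
  have ix: "ix v < length xs" "xs ! (ix v) = v" if "v \<in> V" for v
  proof -
    have "\<exists>!i. i < length xs \<and> xs ! i = v" using that xs by (metis distinct_Ex1)
    from theI'[OF this] show "ix v < length xs" "xs ! (ix v) = v" by (auto simp: ix_def)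
  qed
  have ixinj: "ix u = ix v \<longleftrightarrow> u = v" if "u \<in> V" "v \<in> V" for u v using ix that by metis
  define pos where "pos = (\<lambda>v. ppt (ix v))"
  define lo where "lo = (\<lambda>e. SOME x. x \<in> e \<and> (\<forall>y\<in>e. ix x \<le> ix y))"
  define hi where "hi = (\<lambda>e. SOME x. x \<in> e \<and> (\<forall>y\<in>e. ix y \<le> ix x))"
  define \<gamma> where "\<gamma> = (\<lambda>e. linepath (pos (lo e)) (pos (hi e)))"
  have edge: "e = {lo e, hi e}" "lo e \<in> V" "hi e \<in> V" "ix (lo e) < ix (hi e)" if eE: "e \<in> E" for e
  proof -
    obtain x y where xy: "e = {x,y}" "x \<in> V" "y \<in> V" "x \<noteq> y" using eE assms(2) nsets2_E[of e V] by blast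
    have "\<exists>u v. e = {u,v} \<and> u \<in> V \<and> v \<in> V \<and> ix u < ix v"
    proof (cases "ix x < ix y")
      case False
      then have "ix y < ix x" using ixinj xy by (metis linorder_neqE_nat)
      then show ?thesis using xy by blast
    qed (use xy in blast)
    then obtain u v where uv: "e = {u,v}" "u \<in> V" "v \<in> V" "ix u < ix v" by blast
    have "lo e = u" unfolding lo_def using uv by (intro some_equality) auto
    moreover have "hi e = v" unfolding hi_def using uv by (intro some_equality) auto
    ultimately show "e = {lo e, hi e}" "lo e \<in> V" "hi e \<in> V" "ix (lo e) < ix (hi e)" using uv by auto
  qed
  have path_trace: "path_image (\<gamma> e) = closed_segment (ppt (ix (lo e))) (ppt (ix (hi e)))" for e
    by (simp add: \<gamma>_def pos_def)
  have pne: "ppt i \<noteq> ppt j" if "i \<noteq> j" for i j using that by (auto simp: ppt_def)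
  have noX: "\<not> (ix (lo e) < ix (lo f) \<and> ix (lo f) < ix (hi e) \<and> ix (hi e) < ix (hi f))"
    if ef: "e \<in> E" "f \<in> E" for e f
  proof
    let ?i = "ix (lo e)" let ?j = "ix (lo f)" let ?k = "ix (hi e)" let ?l = "ix (hi f)"
    assume h: "?i < ?j \<and> ?j < ?k \<and> ?k < ?l"
    have lt: "?i < length xs" "?j < length xs" "?k < length xs" "?l < length xs" using ix edge ef by auto
    have "drop m xs = take (n - m) (drop m xs) @ xs ! n # drop (Suc n) xs" if "m \<le> n" "n < length xs" for m n
      using that id_take_nth_drop[of "n - m" "drop m xs"] by (simp add: add.commute)
    from this[of 0 ?i] this[of "Suc ?i" ?j] this[of "Suc ?j" ?k] this[of "Suc ?k" ?l]
    have "xs = take ?i xs @ lo e # take (?j - Suc ?i) (drop (Suc ?i) xs) @ lo f # take (?k - Suc ?j) (drop (Suc ?j) xs) @ hi e #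
        take (?l - Suc ?k) (drop (Suc ?k) xs) @ hi f # drop (Suc ?l) xs"
      using h lt ix(2) edge(2,3)[OF ef(1)] edge(2,3)[OF ef(2)] by simp
    moreover have "{lo e, hi e} \<in> E" "{lo f, hi f} \<in> E" using edge(1) ef by metis+
    ultimately show False using xs(3) unfolding crossfree_def by blast
  qed
  have emb: "plane_embedding V E pos \<gamma>"
    unfolding plane_embedding_def
  proof (intro conjI ballI impI)
    show "inj_on pos V" unfolding pos_def using pne ixinj by (metis (mono_tags, lifting) inj_onI)
    fix e assume e: "e \<in> E"
    note ed = edge[OF e]
    show "arc (\<gamma> e)" using ed pne unfolding \<gamma>_def pos_def by (intro arc_linepath) auto
    show "{pathstart (\<gamma> e), pathfinish (\<gamma> e)} = pos ` e"
      by (subst (3) ed(1)) (simp add: \<gamma>_def)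
    show "path_image (\<gamma> e) \<inter> pos ` V = pos ` e"
    proof
      show "path_image (\<gamma> e) \<inter> pos ` V \<subseteq> pos ` e"
      proof
        fix z assume z: "z \<in> path_image (\<gamma> e) \<inter> pos ` V"
        then obtain v where v: "v \<in> V" "z = ppt (ix v)" by (auto simp: pos_def)
        then have "ix v = ix (lo e) \<or> ix v = ix (hi e)" using chord_vertex z ed(4) unfolding path_trace by auto
        then have "v \<in> {lo e, hi e}" using ixinj v ed by auto
        then show "z \<in> pos ` e" using v ed(1) by (auto simp: pos_def)
      qed
      have "pos (lo e) \<in> path_image (\<gamma> e)" "pos (hi e) \<in> path_image (\<gamma> e)" by (simp_all add: \<gamma>_def)
      then have "pos ` {lo e, hi e} \<subseteq> path_image (\<gamma> e) \<inter> pos ` V" using ed(2,3) by auto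
      then show "pos ` e \<subseteq> path_image (\<gamma> e) \<inter> pos ` V" using ed(1) by simp
    qed
    fix f assume f: "f \<in> E" and ef: "e \<noteq> f"
    show "path_image (\<gamma> e) \<inter> path_image (\<gamma> f) \<subseteq> pos ` (e \<inter> f)"
    proof
      fix z assume z: "z \<in> path_image (\<gamma> e) \<inter> path_image (\<gamma> f)"
      note fd = edge[OF f]
      have ne: "(ix (lo e), ix (hi e)) \<noteq> (ix (lo f), ix (hi f))"
        using ef ed fd ixinj by (metis prod.inject)
      have "\<exists>m \<in> {ix (lo e), ix (hi e)} \<inter> {ix (lo f), ix (hi f)}. z = ppt m"
      proof (cases "ix (lo e) \<le> ix (lo f)")
        case True
        then show ?thesis using chord_inter[OF _ _ ed(4) fd(4) True ne noX[OF e f]] z unfolding path_trace by auto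
      next
        case False
        then show ?thesis using chord_inter[OF _ _ fd(4) ed(4) _ ne[symmetric] noX[OF f e]] z unfolding path_trace by auto
      qed
      then obtain m where m: "m \<in> {ix (lo e), ix (hi e)}" "m \<in> {ix (lo f), ix (hi f)}" "z = ppt m" by auto
      obtain u where u: "u \<in> e" "ix u = m" "u \<in> V" using m(1) ed by auto
      obtain v where v: "v \<in> f" "ix v = m" "v \<in> V" using m(2) fd by auto
      have "u = v" using ixinj u v by auto
      then show "z \<in> pos ` (e \<inter> f)" using u v m(3) by (auto simp: pos_def)
    qed
  qed
  let ?D = "drawing V E pos \<gamma>"
  have above: "Im z \<ge> (Re z)\<^sup>2" if "z \<in> ?D" for z
  proof -
    consider v where "v \<in> V" "z = pos v" | e where "e \<in> E" "z \<in> path_image (\<gamma> e)"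
      using \<open>z \<in> ?D\<close> by (auto simp: drawing_def)
    then show ?thesis
    proof cases
      case 1 then show ?thesis by (simp add: pos_def ppt_def)
    next
      case 2 then show ?thesis using chord_above(2) edge(4) unfolding path_trace by (meson less_imp_le)
    qed
  qed
  have "pos ` V \<subseteq> frontier (outside ?D)"
  proof
    fix z assume "z \<in> pos ` V"
    then obtain v where v: "v \<in> V" "z = ppt (ix v)" by (auto simp: pos_def)
    have "z \<in> ?D" using \<open>z \<in> pos ` V\<close> by (simp add: drawing_def)
    then have "z \<notin> outside ?D" by (simp add: outside_def)
    moreover have "z \<in> closure (outside ?D)"
      unfolding closure_approachable
    proof (intro allI impI)
      fix e :: real assume e: "e > 0"
      let ?y = "z - \<i> * complex_of_real (e/2)"
      have "?y \<in> {z. Im z < (Re z)\<^sup>2}" using v e by (simp add: ppt_def)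
      then have "?y \<in> outside ?D" using below_parabola_outside[of ?D] above by blast
      moreover have "dist ?y z < e" using e by (simp add: dist_norm norm_mult)
      ultimately show "\<exists>y\<in>outside ?D. dist y z < e" by blast
    qed
    ultimately show "z \<in> frontier (outside ?D)" using interior_subset by (auto simp: frontier_def)
  qed
  then show ?thesis using emb unfolding outerplanar_def by blast
qed

section \<open>Decomposition into components and blocks\<close>

text \<open>This is the common form of the decompositions below: the key read off from an edge set \<open>E\<close> tells where to cut
  \<open>E\<close> into two parts, and the key of a union of two admissible parts recovers the cut.\<close>

lemma card_split:
  assumes finI: "finite I" and fin: "\<And>A. A \<in> I \<Longrightarrow> finite (X A) \<and> finite (Y A)"
    and fwd: "\<And>E. E \<in> S \<Longrightarrow> key E \<in> I \<and> E \<inter> M (key E) \<in> X (key E) \<and> E - M (key E) \<in> Y (key E)"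
    and bwd: "\<And>A F G. A \<in> I \<Longrightarrow> F \<in> X A \<Longrightarrow> G \<in> Y A \<Longrightarrow>
        F \<union> G \<in> S \<and> key (F \<union> G) = A \<and> F \<subseteq> M A \<and> G \<inter> M A = {}"
  shows "card S = (\<Sum>A\<in>I. card (X A) * card (Y A))"
proof -
  have "bij_betw (\<lambda>E. (key E, E \<inter> M (key E), E - M (key E))) S (SIGMA A:I. X A \<times> Y A)"
  proof (rule bij_betw_byWitness[where f' = "\<lambda>(A,F,G). F \<union> G"])
    show "\<forall>E\<in>S. (case (key E, E \<inter> M (key E), E - M (key E)) of (A, F, G) \<Rightarrow> F \<union> G) = E"
      by (auto simp: Int_Diff_Un)
    show "\<forall>p\<in>SIGMA A:I. X A \<times> Y A. (key (case p of (A, F, G) \<Rightarrow> F \<union> G),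
        (case p of (A, F, G) \<Rightarrow> F \<union> G) \<inter> M (key (case p of (A, F, G) \<Rightarrow> F \<union> G)),
        (case p of (A, F, G) \<Rightarrow> F \<union> G) - M (key (case p of (A, F, G) \<Rightarrow> F \<union> G))) = p"
    proof
      fix p assume "p \<in> (SIGMA A:I. X A \<times> Y A)"
      then obtain A F G where p: "p = (A,F,G)" "A \<in> I" "F \<in> X A" "G \<in> Y A" by auto
      show "(key (case p of (A, F, G) \<Rightarrow> F \<union> G),
        (case p of (A, F, G) \<Rightarrow> F \<union> G) \<inter> M (key (case p of (A, F, G) \<Rightarrow> F \<union> G)),
        (case p of (A, F, G) \<Rightarrow> F \<union> G) - M (key (case p of (A, F, G) \<Rightarrow> F \<union> G))) = p"
        using bwd[OF p(2-4)] by (auto simp: p(1))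
    qed
    show "(\<lambda>E. (key E, E \<inter> M (key E), E - M (key E))) ` S \<subseteq> (SIGMA A:I. X A \<times> Y A)"
      using fwd by auto
    show "(\<lambda>(A, F, G). F \<union> G) ` (SIGMA A:I. X A \<times> Y A) \<subseteq> S"
      using bwd by fastforce
  qed
  then have "card S = card (SIGMA A:I. X A \<times> Y A)" by (rule bij_betw_same_card)
  also have "\<dots> = (\<Sum>A\<in>I. card (X A \<times> Y A))" using finI fin by (intro card_SigmaI) auto
  finally show ?thesis by (simp add: card_cartesian_product)
qed

text \<open>The families below are given by their edge sets. All graphs are outerplanar; \<open>c\<close> stands for connected and \<open>b\<close>
  for blocks. In \<open>rgraphs v U\<close> the root \<open>v\<close> is the only possible cut vertex, that is, every block contains \<open>v\<close>.
  In \<open>fgraphs U K\<close> every component contains exactly one of the roots in \<open>U\<close>.\<close>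

definition pgraphs :: "'a set \<Rightarrow> 'a set set set" where
  "pgraphs V = {E. E \<subseteq> nsets V 2 \<and> onepage V E}"

definition cgraphs :: "'a set \<Rightarrow> 'a set set set" where
  "cgraphs V = {E \<in> pgraphs V. conn E V}"

definition rgraphs :: "'a \<Rightarrow> 'a set \<Rightarrow> 'a set set set" where
  "rgraphs v U = {E \<in> pgraphs (insert v U). conn E (insert v U) \<and> (\<forall>w\<in>U. conn E (insert v U - {w}))}"

definition bgraphs :: "'a set \<Rightarrow> 'a set set set" where
  "bgraphs V = {E \<in> pgraphs V. conn E V \<and> (\<forall>w\<in>V. conn E (V - {w}))}"

definition fgraphs :: "'a set \<Rightarrow> 'a set \<Rightarrow> 'a set set set" where
  "fgraphs U K = {E \<in> pgraphs K. \<forall>y\<in>K. \<exists>!u. u \<in> U \<and> reach E K u y}"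

lemma finite_pgraphs: "finite V \<Longrightarrow> finite (pgraphs V)"
  by (rule finite_subset[of _ "Pow (nsets V 2)"]) (auto simp: pgraphs_def finite_imp_finite_nsets)

lemma finite_cgraphs: "finite V \<Longrightarrow> finite (cgraphs V)"
  using finite_pgraphs[of V] by (auto simp: cgraphs_def)

lemma finite_rgraphs: "finite U \<Longrightarrow> finite (rgraphs v U)"
  using finite_pgraphs[of "insert v U"] by (auto simp: rgraphs_def)

lemma finite_bgraphs: "finite V \<Longrightarrow> finite (bgraphs V)"
  using finite_pgraphs[of V] by (auto simp: bgraphs_def)

lemma finite_fgraphs: "finite K \<Longrightarrow> finite (fgraphs U K)"
  using finite_pgraphs[of K] by (auto simp: fgraphs_def)

text \<open>A walk that starts in a set which no edge leaves stays in this set.\<close>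

lemma reach_restrict:
  assumes "reach E X a b" "a \<in> S"
    and "\<And>y z. y \<in> S \<Longrightarrow> y \<in> X \<Longrightarrow> z \<in> X \<Longrightarrow> {y,z} \<in> E \<Longrightarrow> z \<in> S \<and> {y,z} \<in> F"
  shows "b \<in> S \<and> reach F (S \<inter> X) a b"
  using assms(1)
proof (induction rule: reach_induct)
  case base
  then show ?case using assms reach_in(1)[OF assms(1)] by (auto intro: reach_refl)
next
  case (step y z)
  then have "y \<in> X" using reach_in by fast
  then have "z \<in> S \<and> {y,z} \<in> F" using assms(3) step by blast
  then have "reach F (S \<inter> X) y z" using step \<open>y \<in> X\<close> by (intro reach_edge) auto
  then show ?case using step \<open>z \<in> S \<and> {y,z} \<in> F\<close> reach_trans by fast
qed

text \<open>If the only way out of \<open>S\<close> leads to \<open>v\<close>, a walk from \<open>S\<close> to \<open>v\<close> can be stopped at its first visit of \<open>v\<close>.\<close>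

lemma reach_exit:
  assumes "reach E X a v" "a \<in> S" "v \<notin> S"
    and "\<And>y z. y \<in> S \<Longrightarrow> y \<in> X \<Longrightarrow> z \<in> X \<Longrightarrow> {y,z} \<in> E \<Longrightarrow> z \<in> insert v S \<and> {y,z} \<in> F"
  shows "reach F (insert v S \<inter> X) a v"
proof -
  have vX: "v \<in> X" using reach_in assms by fast
  have "reach F (insert v S \<inter> X) a v \<or> (v \<in> S \<and> reach F (insert v S \<inter> X) a v)"
    using assms(1)
  proof (induction rule: reach_induct[where P = "\<lambda>z. reach F (insert v S \<inter> X) a v \<or> (z \<in> S \<and> reach F (insert v S \<inter> X) a z)"])
    case base
    then show ?case using assms reach_in(1)[OF assms(1)] by (auto intro: reach_refl)
  next
    case (step y z)
    show ?case
    proof (cases "reach F (insert v S \<inter> X) a v")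
      case False
      then have y: "y \<in> S" "reach F (insert v S \<inter> X) a y" "y \<in> X" using step reach_in(2)[OF step(1)] by auto
      then have z: "z \<in> insert v S \<and> {y,z} \<in> F" using assms(4) step by blast
      then have "reach F (insert v S \<inter> X) y z" using y step by (intro reach_edge) auto
      then have "reach F (insert v S \<inter> X) a z" using y reach_trans by fast
      then show ?thesis using z False by auto
    qed auto
  qed
  then show ?thesis by blast
qed

lemma conn_hub: "(\<And>y. y \<in> X \<Longrightarrow> reach E X y v) \<Longrightarrow> conn E X"
  unfolding conn_def using reach_trans reach_sym by fast

lemma edge_pair: 
  assumes "e \<in> E" "E \<subseteq> nsets V 2" obtains x y where "e = {x,y}" "x \<in> V" "y \<in> V" "x \<noteq> y"
proof -
  have "e \<in> nsets V 2" using assms by blast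
  then show ?thesis by (rule nsets2_E) (rule that)
qed

lemma nsets_Int_one: "A \<inter> B \<subseteq> {v} \<Longrightarrow> nsets A 2 \<inter> nsets B 2 = {}"
proof (rule ccontr)
  assume h: "A \<inter> B \<subseteq> {v}" "nsets A 2 \<inter> nsets B 2 \<noteq> {}"
  then obtain e where e: "e \<in> nsets A 2" "e \<in> nsets B 2" by auto
  then obtain x y where "e = {x,y}" "x \<noteq> y" "x \<in> A" "y \<in> A" by (meson nsets2_E)
  moreover have "x \<in> B" "y \<in> B" using e(2) \<open>e = {x,y}\<close> \<open>x \<noteq> y\<close> doubleton_in_nsets_2[of x y B] by auto
  ultimately show False using h(1) by auto
qed

lemma pgraphs_union:
  assumes "F \<in> pgraphs A" "G \<in> pgraphs B" "A \<inter> B \<subseteq> {v}"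
  shows "F \<union> G \<in> pgraphs (A \<union> B)"
proof -
  have "nsets A 2 \<subseteq> nsets (A \<union> B) 2" "nsets B 2 \<subseteq> nsets (A \<union> B) 2" by (auto intro!: nsets_mono)
  then show ?thesis using assms onepage_glue[of A F B G v] unfolding pgraphs_def by blast
qed

lemma pgraphs_sub:
  assumes "E \<in> pgraphs V" "F \<subseteq> E" "W \<subseteq> V" "F \<subseteq> nsets W 2" shows "F \<in> pgraphs W"
  using assms onepage_mono unfolding pgraphs_def by blast

lemma component_split:
  assumes E: "E \<subseteq> nsets V 2" and A: "A = {y. reach E V x y}"
  shows "E - nsets A 2 \<subseteq> nsets (V - A) 2"
    and "\<And>y z. y \<in> A \<Longrightarrow> {y,z} \<in> E \<Longrightarrow> z \<in> A \<and> {y,z} \<in> nsets A 2"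
    and "\<And>y z. y \<in> V - A \<Longrightarrow> {y,z} \<in> E \<Longrightarrow> z \<in> V - A \<and> {y,z} \<in> E - nsets A 2"
proof -
  have V: "y \<in> V \<and> z \<in> V \<and> y \<noteq> z" if "{y,z} \<in> E" for y z using edge_ends[OF that E] .
  have st: "z \<in> A" if "y \<in> A" "{y,z} \<in> E" for y z
    using that A V[OF that(2)] reach_trans[of E V x y z] reach_edge[of y z E V] by blast
  have AV: "A \<subseteq> V" using A reach_in by fast
  show 1: "\<And>y z. y \<in> A \<Longrightarrow> {y,z} \<in> E \<Longrightarrow> z \<in> A \<and> {y,z} \<in> nsets A 2"
    using st V by (auto simp: doubleton_in_nsets_2)
  show 2: "\<And>y z. y \<in> V - A \<Longrightarrow> {y,z} \<in> E \<Longrightarrow> z \<in> V - A \<and> {y,z} \<in> E - nsets A 2"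
  proof -
    fix y z assume h: "y \<in> V - A" "{y,z} \<in> E"
    have "z \<notin> A" using st[of z y] h by (auto simp: insert_commute)
    then show "z \<in> V - A \<and> {y,z} \<in> E - nsets A 2" using h V[OF h(2)] by (auto simp: doubleton_in_nsets_2)
  qed
  show "E - nsets A 2 \<subseteq> nsets (V - A) 2"
  proof
    fix e assume e: "e \<in> E - nsets A 2"
    obtain y z where yz: "e = {y,z}" "y \<in> V" "z \<in> V" "y \<noteq> z" by (rule edge_pair[OF _ E, of e]) (use e in auto)
    then have "y \<notin> A" using 1[of y z] e by auto
    then show "e \<in> nsets (V - A) 2" using 2[of y z] yz e by (auto simp: doubleton_in_nsets_2)
  qed
qed

lemma component_conn:
  assumes "x \<in> V" and E: "E \<subseteq> nsets V 2" and A: "A = {y. reach E V x y}"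
  shows "conn (E \<inter> nsets A 2) A" "x \<in> A" "A \<subseteq> V"
proof -
  show AV: "A \<subseteq> V" and xA: "x \<in> A" using A reach_in reach_refl assms(1) by fast+
  have "reach (E \<inter> nsets A 2) (A \<inter> V) x y" if "y \<in> A" for y
    using reach_restrict[of E V x y A "E \<inter> nsets A 2"] that A xA component_split(2)[OF E A] by blast
  then show "conn (E \<inter> nsets A 2) A" using AV by (intro conn_hub[of _ _ x]) (auto simp: Int_absorb2 intro: reach_sym)
qed

lemma component_union:
  assumes F: "F \<subseteq> nsets A 2" and G: "G \<subseteq> nsets B 2" and AB: "A \<inter> B = {}" and "conn F A" "x \<in> A"
  shows "{y. reach (F \<union> G) (A \<union> B) x y} = A"
proof
  show "A \<subseteq> {y. reach (F \<union> G) (A \<union> B) x y}"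
    using assms(4,5) reach_mono[of F A x _ "F \<union> G" "A \<union> B"] unfolding conn_def by blast
  have "z \<in> A" if "y \<in> A" "{y,z} \<in> F \<union> G" for y z
  proof -
    have "{y,z} \<notin> G" using edge_ends[OF _ G, of y z] that AB by blast
    then show ?thesis using edge_ends[OF _ F, of y z] that by blast
  qed
  then show "{y. reach (F \<union> G) (A \<union> B) x y} \<subseteq> A"
    using reach_restrict[of "F \<union> G" "A \<union> B" x _ A "F \<union> G"] assms(5) by blast
qed

text \<open>The component \<open>A\<close> of \<open>x\<close> is split off.\<close>

lemma pgraphs_split:
  assumes fin: "finite V" and x: "x \<in> V"
  shows "card (pgraphs V) = (\<Sum>A | A \<subseteq> V \<and> x \<in> A. card (cgraphs A) * card (pgraphs (V - A)))"
proof (rule card_split[where key = "\<lambda>E. {y. reach E V x y}" and M = "\<lambda>A. nsets A 2"])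
  show "finite {A. A \<subseteq> V \<and> x \<in> A}" using fin by simp
  show "finite (cgraphs A) \<and> finite (pgraphs (V - A))" if "A \<in> {A. A \<subseteq> V \<and> x \<in> A}" for A
    using that fin finite_cgraphs[of A] finite_pgraphs[of "V - A"] finite_subset by auto
next
  fix E assume E: "E \<in> pgraphs V"
  let ?A = "{y. reach E V x y}"
  have E2: "E \<subseteq> nsets V 2" using E by (auto simp: pgraphs_def)
  note cc = component_conn[OF x E2 refl]
  have "E \<inter> nsets ?A 2 \<in> pgraphs ?A" using pgraphs_sub[OF E _ cc(3)] by blast
  moreover have "E - nsets ?A 2 \<in> pgraphs (V - ?A)"
    using pgraphs_sub[OF E _ _ component_split(1)[OF E2 refl]] by blast
  ultimately show "?A \<in> {A. A \<subseteq> V \<and> x \<in> A} \<and> E \<inter> nsets ?A 2 \<in> cgraphs ?A \<and> E - nsets ?A 2 \<in> pgraphs (V - ?A)"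
    using cc unfolding cgraphs_def by blast
next
  fix A F G assume h: "A \<in> {A. A \<subseteq> V \<and> x \<in> A}" "F \<in> cgraphs A" "G \<in> pgraphs (V - A)"
  have AV: "A \<union> (V - A) = V" using h by auto
  have F: "F \<subseteq> nsets A 2" "F \<in> pgraphs A" "conn F A" and G: "G \<subseteq> nsets (V - A) 2"
    using h by (auto simp: pgraphs_def cgraphs_def)
  have "F \<union> G \<in> pgraphs V" using pgraphs_union[OF F(2) h(3)] AV by auto
  moreover have "{y. reach (F \<union> G) V x y} = A" using component_union[OF F(1) G _ F(3), of x] h AV by auto
  moreover have "G \<inter> nsets A 2 = {}" using nsets_Int_one[of "V - A" A x] G by blast
  ultimately show "F \<union> G \<in> pgraphs V \<and> {y. reach (F \<union> G) V x y} = A \<and> F \<subseteq> nsets A 2 \<and> G \<inter> nsets A 2 = {}"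
    using F by blast
qed

text \<open>The component \<open>A\<close> of the root \<open>u\<close> is split off.\<close>

lemma fgraphs_split:
  assumes fin: "finite K" and u: "u \<in> U" and UK: "U \<subseteq> K"
  shows "card (fgraphs U K) = (\<Sum>A | A \<subseteq> K \<and> A \<inter> U = {u}. card (cgraphs A) * card (fgraphs (U - {u}) (K - A)))"
proof (rule card_split[where key = "\<lambda>E. {y. reach E K u y}" and M = "\<lambda>A. nsets A 2"])
  show "finite {A. A \<subseteq> K \<and> A \<inter> U = {u}}" using fin by simp
  show "finite (cgraphs A) \<and> finite (fgraphs (U - {u}) (K - A))" if "A \<in> {A. A \<subseteq> K \<and> A \<inter> U = {u}}" for A
    using that fin finite_cgraphs[of A] finite_fgraphs[of "K - A"] finite_subset by auto
next
  fix E assume E: "E \<in> fgraphs U K"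
  let ?A = "{y. reach E K u y}"
  have Ep: "E \<in> pgraphs K" and E2: "E \<subseteq> nsets K 2" and uniq: "\<And>y. y \<in> K \<Longrightarrow> \<exists>!u. u \<in> U \<and> reach E K u y"
    using E by (auto simp: pgraphs_def fgraphs_def)
  have uK: "u \<in> K" using u UK by auto
  note cc = component_conn[OF uK E2 refl] and cs = component_split[where x = u, OF E2 refl]
  have AU: "?A \<inter> U = {u}"
  proof -
    have "y = u" if "y \<in> ?A" "y \<in> U" for y
      using uniq[of y] that u UK reach_refl[of y K E] by blast
    then show ?thesis using u cc(2) by blast
  qed
  have p1: "E \<inter> nsets ?A 2 \<in> pgraphs ?A" using pgraphs_sub[OF Ep _ cc(3)] by blast
  have p2: "E - nsets ?A 2 \<in> pgraphs (K - ?A)"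
    using pgraphs_sub[OF Ep _ _ cs(1)] by blast
  have ex1: "\<exists>!u'. u' \<in> U - {u} \<and> reach (E - nsets ?A 2) (K - ?A) u' y" if y: "y \<in> K - ?A" for y
  proof -
    obtain u' where u': "u' \<in> U" "reach E K u' y" and un: "\<And>u''. u'' \<in> U \<Longrightarrow> reach E K u'' y \<Longrightarrow> u'' = u'"
      using uniq[of y] y by blast
    have nu: "u' \<noteq> u" using u'(2) y by blast
    have "u' \<in> K - ?A" using AU u'(1) nu UK by blast
    then have "reach (E - nsets ?A 2) ((K - ?A) \<inter> K) u' y"
      using reach_restrict[OF u'(2), of "K - ?A" "E - nsets ?A 2"] cs(3) by blast
    moreover have "(K - ?A) \<inter> K = K - ?A" by blast
    ultimately have "reach (E - nsets ?A 2) (K - ?A) u' y" by simp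
    moreover have "u'' = u'" if "u'' \<in> U - {u}" "reach (E - nsets ?A 2) (K - ?A) u'' y" for u''
      using un[of u''] that reach_mono[OF that(2), of E K] by blast
    ultimately show ?thesis using u'(1) nu by blast
  qed
  have "E \<inter> nsets ?A 2 \<in> cgraphs ?A" unfolding cgraphs_def using p1 cc(1) by simp
  moreover have "E - nsets ?A 2 \<in> fgraphs (U - {u}) (K - ?A)" unfolding fgraphs_def using p2 ex1 by simp
  moreover have "?A \<in> {A. A \<subseteq> K \<and> A \<inter> U = {u}}" using cc(3) AU by simp
  ultimately show "?A \<in> {A. A \<subseteq> K \<and> A \<inter> U = {u}} \<and> E \<inter> nsets ?A 2 \<in> cgraphs ?A \<and> E - nsets ?A 2 \<in> fgraphs (U - {u}) (K - ?A)"
    by (intro conjI)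
next
  fix A F G assume h: "A \<in> {A. A \<subseteq> K \<and> A \<inter> U = {u}}" "F \<in> cgraphs A" "G \<in> fgraphs (U - {u}) (K - A)"
  have AV: "A \<union> (K - A) = K" and uA: "u \<in> A" and AU: "A \<inter> U = {u}" using h by auto
  have F: "F \<subseteq> nsets A 2" "F \<in> pgraphs A" "conn F A" and G: "G \<subseteq> nsets (K - A) 2" "G \<in> pgraphs (K - A)"
    and uniq: "\<And>y. y \<in> K - A \<Longrightarrow> \<exists>!u'. u' \<in> U - {u} \<and> reach G (K - A) u' y"
    using h by (auto simp: pgraphs_def cgraphs_def fgraphs_def)
  have FG: "F \<union> G \<in> pgraphs K" using pgraphs_union[OF F(2) G(2)] AV by auto
  have comp: "{y. reach (F \<union> G) K x y} = A" if "x \<in> A" for x using component_union[OF F(1) G(1) _ F(3) that] AV by auto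
  have ex1: "\<exists>!u'. u' \<in> U \<and> reach (F \<union> G) K u' y" if y: "y \<in> K" for y
  proof (cases "y \<in> A")
    case True
    then have "reach (F \<union> G) K u y" using comp[OF uA] by blast
    moreover have "u' = u" if "u' \<in> U" "reach (F \<union> G) K u' y" for u'
      using comp[OF True] reach_sym[OF that(2)] that(1) AU by blast
    ultimately show ?thesis using u by blast
  next
    case False
    then obtain u' where u': "u' \<in> U - {u}" "reach G (K - A) u' y" 
      and un: "\<And>u''. u'' \<in> U - {u} \<Longrightarrow> reach G (K - A) u'' y \<Longrightarrow> u'' = u'" using uniq[of y] y by blast
    have "reach (F \<union> G) K u' y" by (rule reach_mono[OF u'(2)]) auto
    moreover have "u'' = u'" if hu: "u'' \<in> U" "reach (F \<union> G) K u'' y" for u''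
    proof -
      have nA: "u'' \<notin> A" using comp[of u''] hu(2) False by blast
      have st: "z \<in> K - A \<and> {w,z} \<in> G" if "w \<in> K - A" "{w,z} \<in> F \<union> G" for w z
      proof -
        have "{w,z} \<notin> F" using edge_ends[OF _ F(1), of w z] that(1) by blast
        then show ?thesis using edge_ends[OF _ G(1), of w z] that by blast
      qed
      have "reach G ((K - A) \<inter> K) u'' y"
        using reach_restrict[OF hu(2), of "K - A" G] nA hu(1) UK st by blast
      moreover have "(K - A) \<inter> K = K - A" by blast
      ultimately have "reach G (K - A) u'' y" by simp
      then show ?thesis using un[of u''] hu(1) nA uA by blast
    qed
    ultimately show ?thesis using u'(1) by blast
  qed
  then have "F \<union> G \<in> fgraphs U K" unfolding fgraphs_def using FG by simp
  moreover have "G \<inter> nsets A 2 = {}" using nsets_Int_one[of "K - A" A u] G(1) by blast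
  ultimately show "F \<union> G \<in> fgraphs U K \<and> {y. reach (F \<union> G) K u y} = A \<and> F \<subseteq> nsets A 2 \<and> G \<inter> nsets A 2 = {}"
    using F(1) comp[OF uA] by (intro conjI)
qed

text \<open>Let \<open>A\<close> be the component of \<open>x\<close> after deletion of \<open>v\<close>. Since all blocks contain \<open>v\<close>, the graph induced on
  \<open>insert v A\<close> is the block that contains \<open>v\<close> and \<open>x\<close>, and it is split off.\<close>

lemma rgraphs_split:
  assumes fin: "finite U" and x: "x \<in> U" and v: "v \<notin> U"
  shows "card (rgraphs v U) = (\<Sum>A | A \<subseteq> U \<and> x \<in> A. card (bgraphs (insert v A)) * card (rgraphs v (U - A)))"
proof (rule card_split[where key = "\<lambda>E. {y. reach E U x y}" and M = "\<lambda>A. nsets (insert v A) 2"])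
  show "finite {A. A \<subseteq> U \<and> x \<in> A}" using fin by simp
  show "finite (bgraphs (insert v A)) \<and> finite (rgraphs v (U - A))" if "A \<in> {A. A \<subseteq> U \<and> x \<in> A}" for A
    using that fin finite_bgraphs[of "insert v A"] finite_rgraphs[of "U - A"] finite_subset by auto
next
  fix E assume E: "E \<in> rgraphs v U"
  let ?A = "{y. reach E U x y}" let ?W = "insert v U" let ?M = "nsets (insert v {y. reach E U x y}) 2"
  have Ep: "E \<in> pgraphs ?W" and E2: "E \<subseteq> nsets ?W 2" and rob0: "conn E ?W" and rob1: "\<And>w. w \<in> U \<Longrightarrow> conn E (?W - {w})"
    using E by (auto simp: pgraphs_def rgraphs_def)
  have xA: "x \<in> ?A" and AU: "?A \<subseteq> U" using x reach_refl reach_in by fast+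
  have V: "y \<in> ?W \<and> z \<in> ?W \<and> y \<noteq> z" if "{y,z} \<in> E" for y z using edge_ends[OF that E2] .
  have stA: "z \<in> insert v ?A \<and> {y,z} \<in> E \<inter> ?M" if "y \<in> ?A" "{y,z} \<in> E" for y z
  proof -
    have "z \<in> insert v ?A"
      using that V[OF that(2)] reach_trans[of E U x y z] reach_edge[of y z E U] AU by blast
    then show ?thesis using that V[OF that(2)] by (auto simp: doubleton_in_nsets_2)
  qed
  have stB: "z \<in> insert v (U - ?A) \<and> {y,z} \<in> E - ?M" if "y \<in> U - ?A" "{y,z} \<in> E" for y z
  proof -
    have "z \<notin> ?A" using stA[of z y] that v by (auto simp: insert_commute)
    then show ?thesis using that V[OF that(2)] v by (auto simp: doubleton_in_nsets_2)
  qed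
  have subB: "E - ?M \<subseteq> nsets (insert v (U - ?A)) 2"
  proof
    fix e assume e: "e \<in> E - ?M"
    obtain y z where yz: "e = {y,z}" "y \<in> ?W" "z \<in> ?W" "y \<noteq> z" by (rule edge_pair[OF _ E2, of e]) (use e in auto)
    have n: "y \<notin> ?A" "z \<notin> ?A" using stA[of y z] stA[of z y] yz e by (auto simp: insert_commute)
    have "y \<in> insert v (U - ?A)" "z \<in> insert v (U - ?A)" using n yz by blast+
    then show "e \<in> nsets (insert v (U - ?A)) 2" using yz by (auto simp: doubleton_in_nsets_2)
  qed
  have Ap: "E \<inter> ?M \<in> pgraphs (insert v ?A)" using AU by (intro pgraphs_sub[OF Ep]) auto
  have Bp: "E - ?M \<in> pgraphs (insert v (U - ?A))" using subB by (intro pgraphs_sub[OF Ep]) auto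
  have hubA: "reach (E \<inter> ?M) (insert v ?A \<inter> X) y v" if "y \<in> ?A" "reach E X y v" for X y
    using reach_exit[OF that(2,1), of "E \<inter> ?M"] stA v AU by blast
  have hubB: "reach (E - ?M) (insert v (U - ?A) \<inter> X) y v" if "y \<in> U - ?A" "reach E X y v" for X y
    using reach_exit[OF that(2,1), of "E - ?M"] stB v by blast
  have rA: "conn (E \<inter> ?M) (insert v ?A \<inter> X)" if "conn E X" "v \<in> X" "X \<subseteq> ?W" for X
  proof (rule conn_hub[of _ _ v])
    fix y assume y: "y \<in> insert v ?A \<inter> X"
    show "reach (E \<inter> ?M) (insert v ?A \<inter> X) y v"
    proof (cases "y = v")
      case False
      then show ?thesis using hubA[of y X] y that unfolding conn_def by blast
    qed (use that in \<open>auto intro: reach_refl\<close>)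
  qed
  have rB: "conn (E - ?M) (insert v (U - ?A) \<inter> X)" if "conn E X" "v \<in> X" "X \<subseteq> ?W" for X
  proof (rule conn_hub[of _ _ v])
    fix y assume y: "y \<in> insert v (U - ?A) \<inter> X"
    show "reach (E - ?M) (insert v (U - ?A) \<inter> X) y v"
    proof (cases "y = v")
      case False
      then show ?thesis using hubB[of y X] y that unfolding conn_def by blast
    qed (use that in \<open>auto intro: reach_refl\<close>)
  qed
  have cA0: "conn (E \<inter> ?M) (insert v ?A)" using rA[OF rob0] AU by (auto simp: Int_absorb2)
  have cA1: "conn (E \<inter> ?M) (insert v ?A - {w})" if w: "w \<in> insert v ?A" for w
  proof (cases "w = v")
    case False
    then have "conn (E \<inter> ?M) (insert v ?A \<inter> (?W - {w}))" using w AU by (intro rA rob1) auto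
    moreover have "insert v ?A \<inter> (?W - {w}) = insert v ?A - {w}" using AU by blast
    ultimately show ?thesis by simp
  next
    case True
    have "reach (E \<inter> ?M) (?A \<inter> U) x y" if "y \<in> ?A" for y
    proof -
      have r: "reach E U x y" using that by simp
      have "z \<in> ?A \<and> {y,z} \<in> E \<inter> ?M" if "y \<in> ?A" "z \<in> U" "{y,z} \<in> E" for y z using stA[OF that(1,3)] that(2) v by auto
      then show ?thesis using reach_restrict[OF r xA, of "E \<inter> ?M"] by blast
    qed
    then have "conn (E \<inter> ?M) ?A" using AU by (intro conn_hub[of _ _ x]) (auto simp: Int_absorb2 intro: reach_sym)
    moreover have "insert v ?A - {w} = ?A" using True AU v by blast
    ultimately show ?thesis by simp
  qed
  have cB0: "conn (E - ?M) (insert v (U - ?A))"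
  proof -
    have "insert v (U - ?A) \<inter> ?W = insert v (U - ?A)" by blast
    then show ?thesis using rB[OF rob0] by simp
  qed
  have cB1: "conn (E - ?M) (insert v (U - ?A) - {w})" if w: "w \<in> U - ?A" for w
  proof -
    have "conn (E - ?M) (insert v (U - ?A) \<inter> (?W - {w}))" using w v by (intro rB rob1) auto
    moreover have "insert v (U - ?A) \<inter> (?W - {w}) = insert v (U - ?A) - {w}" by blast
    ultimately show ?thesis by simp
  qed
  have "E \<inter> ?M \<in> bgraphs (insert v ?A)" unfolding bgraphs_def by (intro CollectI conjI ballI Ap cA0 cA1)
  moreover have "E - ?M \<in> rgraphs v (U - ?A)" unfolding rgraphs_def by (intro CollectI conjI ballI Bp cB0 cB1)
  moreover have "?A \<in> {A. A \<subseteq> U \<and> x \<in> A}" using xA AU by simp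
  ultimately show "?A \<in> {A. A \<subseteq> U \<and> x \<in> A} \<and> E \<inter> ?M \<in> bgraphs (insert v ?A) \<and> E - ?M \<in> rgraphs v (U - ?A)"
    by (intro conjI)
next
  fix A F G assume h: "A \<in> {A. A \<subseteq> U \<and> x \<in> A}" "F \<in> bgraphs (insert v A)" "G \<in> rgraphs v (U - A)"
  let ?W = "insert v U" let ?B = "insert v (U - A)"
  have AU: "A \<subseteq> U" and xA: "x \<in> A" using h by auto
  have WU: "insert v A \<union> ?B = ?W" using AU by auto
  have F: "F \<subseteq> nsets (insert v A) 2" "F \<in> pgraphs (insert v A)" "conn F (insert v A)" "\<And>w. w \<in> insert v A \<Longrightarrow> conn F (insert v A - {w})"
    and G: "G \<subseteq> nsets ?B 2" "G \<in> pgraphs ?B" "conn G ?B" "\<And>w. w \<in> U - A \<Longrightarrow> conn G (?B - {w})"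
    using h by (auto simp: pgraphs_def bgraphs_def rgraphs_def)
  have int: "insert v A \<inter> ?B \<subseteq> {v}" by auto
  have FG: "F \<union> G \<in> pgraphs ?W" using pgraphs_union[OF F(2) G(2) int] WU by simp
  have num_dissections: "G \<inter> nsets (insert v A) 2 = {}" using nsets_Int_one[of ?B "insert v A" v] G(1) by blast
  have glue: "conn (F \<union> G) (X \<union> Y)" if "conn F X" "conn G Y" "v \<in> X" "v \<in> Y" for X Y
  proof (rule conn_hub[of _ _ v])
    fix y assume "y \<in> X \<union> Y"
    then have "reach F X y v \<or> reach G Y y v" using that unfolding conn_def by blast
    then show "reach (F \<union> G) (X \<union> Y) y v" using reach_mono[of F X y v "F \<union> G" "X \<union> Y"] reach_mono[of G Y y v "F \<union> G" "X \<union> Y"] by blast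
  qed
  have c0: "conn (F \<union> G) ?W" using glue[OF F(3) G(3)] WU by simp
  have c1: "conn (F \<union> G) (?W - {w})" if w: "w \<in> U" for w
  proof (cases "w \<in> A")
    case True
    then have "conn (F \<union> G) ((insert v A - {w}) \<union> ?B)" using v AU by (intro glue F(4) G(3)) auto
    moreover have "(insert v A - {w}) \<union> ?B = ?W - {w}" using True AU v by auto
    ultimately show ?thesis by simp
  next
    case False
    then have "conn (F \<union> G) (insert v A \<union> (?B - {w}))" using v w by (intro glue F(3) G(4)) auto
    moreover have "insert v A \<union> (?B - {w}) = ?W - {w}" using False AU v w by auto
    ultimately show ?thesis by simp
  qed
  have key: "{y. reach (F \<union> G) U x y} = A"
  proof
    have "insert v A - {v} = A" using v AU by blast
    then have cA: "conn F A" using F(4)[of v] by simp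
    then show "A \<subseteq> {y. reach (F \<union> G) U x y}"
      using xA AU reach_mono[of F A x _ "F \<union> G" U] unfolding conn_def by blast
    have st: "z \<in> A" if "y \<in> A" "{y,z} \<in> F \<union> G" "z \<in> U" for y z
    proof -
      have "{y,z} \<notin> G" using edge_ends[OF _ G(1), of y z] that v AU by blast
      then show ?thesis using edge_ends[OF _ F(1), of y z] that v by blast
    qed
    then show "{y. reach (F \<union> G) U x y} \<subseteq> A"
      using reach_restrict[of "F \<union> G" U x _ A "F \<union> G"] xA by blast
  qed
  have "F \<union> G \<in> rgraphs v U" unfolding rgraphs_def using FG c0 c1 by simp
  then show "F \<union> G \<in> rgraphs v U \<and> {y. reach (F \<union> G) U x y} = A \<and> F \<subseteq> nsets (insert v A) 2 \<and> G \<inter> nsets (insert v A) 2 = {}"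
    using F(1) key num_dissections by (intro conjI)
qed

text \<open>These are the vertices that share a block with \<open>v\<close> if the graph is connected.\<close>

definition block_mates :: "'a \<Rightarrow> 'a set \<Rightarrow> 'a set set \<Rightarrow> 'a set" where
  "block_mates v K E = {u \<in> K. \<forall>w \<in> K - {u}. reach E (insert v K - {w}) u v}"

text \<open>The components of the forest are attached one after the other; each meets the graph built so far only in its root.\<close>

lemma pgraphs_attach_forest:
  assumes fin: "finite S" and S: "S \<subseteq> U" and UK: "U \<subseteq> K" and v: "v \<notin> K"
    and T: "T \<in> pgraphs (insert v U)" and F: "F \<in> fgraphs U K"
  shows "T \<union> (F \<inter> nsets {y. \<exists>u\<in>S. reach F K u y} 2) \<in> pgraphs (insert v U \<union> {y. \<exists>u\<in>S. reach F K u y})"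
  using fin S
proof (induction S rule: finite_induct)
  case empty
  then show ?case using T by (simp add: nsets_eq_empty[of "{}" 2])
next
  case (insert u S)
  let ?A = "{y. reach F K u y}" let ?C = "{y. \<exists>u\<in>S. reach F K u y}" let ?D = "{y. \<exists>u\<in>insert u S. reach F K u y}"
  have Fp: "F \<in> pgraphs K" and F2: "F \<subseteq> nsets K 2" and uniq: "\<And>y. y \<in> K \<Longrightarrow> \<exists>!u. u \<in> U \<and> reach F K u y"
    using F by (auto simp: pgraphs_def fgraphs_def)
  have uU: "u \<in> U" "u \<in> K" "S \<subseteq> U" using insert UK by auto
  have AK: "?A \<subseteq> K" using reach_in by fast
  have D: "?D = ?C \<union> ?A" by blast
  have IH: "T \<union> (F \<inter> nsets ?C 2) \<in> pgraphs (insert v U \<union> ?C)" using insert by blast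
  have Ap: "F \<inter> nsets ?A 2 \<in> pgraphs ?A" using pgraphs_sub[OF Fp _ AK] by blast
  have "(insert v U \<union> ?C) \<inter> ?A \<subseteq> {u}"
  proof
    fix y assume y: "y \<in> (insert v U \<union> ?C) \<inter> ?A"
    then have yK: "y \<in> K" and ry: "reach F K u y" using AK by auto
    have "y \<noteq> v" using yK v by blast
    moreover have "y \<notin> ?C"
    proof
      assume "y \<in> ?C"
      then obtain u' where "u' \<in> S" "reach F K u' y" by blast
      then have "u' = u" using uniq[OF yK] ry uU by blast
      then show False using \<open>u' \<in> S\<close> insert(2) by simp
    qed
    ultimately have "y \<in> U" using y by blast
    then have "y = u" using uniq[OF yK] ry uU reach_refl[OF yK, of F] by blast
    then show "y \<in> {u}" by simp
  qed
  from pgraphs_union[OF IH Ap this]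
  have "T \<union> (F \<inter> nsets ?C 2) \<union> (F \<inter> nsets ?A 2) \<in> pgraphs (insert v U \<union> ?C \<union> ?A)" .
  moreover have "T \<union> (F \<inter> nsets ?C 2) \<union> (F \<inter> nsets ?A 2) = T \<union> (F \<inter> nsets ?D 2)"
  proof -
    have "e \<in> nsets ?C 2 \<or> e \<in> nsets ?A 2" if e: "e \<in> F" "e \<in> nsets ?D 2" for e
    proof -
      obtain y z where yz: "e = {y,z}" "y \<in> ?D" "z \<in> ?D" "y \<noteq> z" using nsets2_E[OF e(2)] by blast
      have K: "y \<in> K" "z \<in> K" using yz reach_in by fast+
      have ry: "reach F K y z" using reach_edge[of y z F K] e yz K by blast
      have "y \<in> ?A \<Longrightarrow> z \<in> ?A" "y \<in> ?C \<Longrightarrow> z \<in> ?C" using reach_trans[OF _ ry] by blast+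
      then show ?thesis using yz D by (auto simp: doubleton_in_nsets_2)
    qed
    moreover have "nsets ?C 2 \<subseteq> nsets ?D 2" "nsets ?A 2 \<subseteq> nsets ?D 2" unfolding D by (auto intro!: nsets_mono)
    ultimately show ?thesis by blast
  qed
  moreover have "insert v U \<union> ?C \<union> ?A = insert v U \<union> ?D" using D by blast
  ultimately show ?case by simp
qed

context
  fixes v :: 'a and K :: "'a set" and E :: "'a set set"
  assumes v: "v \<notin> K" and E2: "E \<subseteq> nsets (insert v K) 2" and con: "conn E (insert v K)"
begin

text \<open>\<open>Gm\<close> consists of the edges outside the blocks through \<open>v\<close>.\<close>

abbreviation (input) "Um \<equiv> block_mates v K E"
abbreviation (input) "Gm \<equiv> E - nsets (insert v (block_mates v K E)) 2"

lemma block_mates_edge: "{y,z} \<in> E \<Longrightarrow> y \<in> insert v K \<and> z \<in> insert v K \<and> y \<noteq> z"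
  using edge_ends[OF _ E2] .

lemma block_mates_nbr: "{y,v} \<in> E \<Longrightarrow> y \<in> Um"
proof -
  assume h: "{y,v} \<in> E"
  then have yK: "y \<in> K" using block_mates_edge by blast
  have "reach E (insert v K - {w}) y v" if "w \<in> K - {y}" for w
    using that yK v by (intro reach_edge[OF h]) auto
  then show ?thesis using yK unfolding block_mates_def by simp
qed

lemma rest_sub: "Gm \<subseteq> nsets K 2"
proof
  fix e assume e: "e \<in> Gm"
  obtain y z where yz: "e = {y,z}" "y \<in> insert v K" "z \<in> insert v K" "y \<noteq> z" by (rule edge_pair[OF _ E2, of e]) (use e in auto)
  have "v \<noteq> y" using block_mates_nbr[of z] yz e by (auto simp: insert_commute doubleton_in_nsets_2)
  moreover have "v \<noteq> z" using block_mates_nbr[of y] yz e by (auto simp: doubleton_in_nsets_2)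
  ultimately show "e \<in> nsets K 2" using yz by (auto simp: doubleton_in_nsets_2)
qed

text \<open>A walk that leaves \<open>u\<close> along an edge outside the blocks through \<open>v\<close> enters the part that \<open>u\<close> separates
  from \<open>v\<close>, and it can leave this part only through \<open>u\<close>.\<close>

lemma block_mates_unique:
  assumes u: "u \<in> Um" and u': "u' \<in> Um" and r: "reach Gm K u u'"
  shows "u' = u"
proof -
  let ?W = "insert v K"
  have uK: "u \<in> K" using u by (simp add: block_mates_def)
  from r have "u' = u \<or> (u' \<in> K - Um \<and> \<not> reach E (?W - {u}) u' v)"
  proof (induction rule: reach_induct)
    case (step y z)
    have yz: "{y,z} \<in> E" "{y,z} \<notin> nsets (insert v Um) 2" "y \<in> K" "z \<in> K" "y \<noteq> z"
      using step block_mates_edge[of y z] reach_in(2)[OF step(1)] by auto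
    show ?case
    proof (cases "z = u")
      case zu: False
      show ?thesis
      proof (cases "y = u")
        case True
        then have zU: "z \<notin> Um" using yz u by (auto simp: doubleton_in_nsets_2)
        then obtain w where w: "w \<in> K - {z}" "\<not> reach E (?W - {w}) z v" using yz(4) unfolding block_mates_def by blast
        have "w = u"
        proof (rule ccontr)
          assume "w \<noteq> u"
          then have "reach E (?W - {w}) u v" using u w unfolding block_mates_def by blast
          moreover have "reach E (?W - {w}) z u" using yz True w \<open>w \<noteq> u\<close> by (intro reach_edge) (auto simp: insert_commute)
          ultimately show False using w reach_trans by fast
        qed
        then show ?thesis using w zU yz by blast
      next
        case False
        then have y: "\<not> reach E (?W - {u}) y v" using step by blast
        have "reach E (?W - {u}) y z" using yz zu False by (intro reach_edge) auto
        then have nz: "\<not> reach E (?W - {u}) z v" using y reach_trans by fast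
        moreover have "z \<notin> Um" using nz zu uK unfolding block_mates_def by blast
        ultimately show ?thesis using yz by blast
      qed
    qed simp
  qed simp
  then show ?thesis using u' by blast
qed

text \<open>A walk from \<open>v\<close> to \<open>y\<close> visits a last block mate of \<open>v\<close>; after that it uses only edges of \<open>Gm\<close>.\<close>

lemma block_mates_root:
  assumes "y \<in> K" shows "\<exists>u\<in>Um. reach Gm K u y"
proof -
  have "reach E (insert v K) v y" using con assms unfolding conn_def by blast
  then have "y = v \<or> (\<exists>u\<in>Um. reach Gm K u y)"
  proof (induction rule: reach_induct)
    case (step y z)
    have self: "?case" if "z \<in> Um" using that reach_refl[of z K] by (auto simp: block_mates_def)
    show ?case
    proof (cases "z = v \<or> z \<in> Um")
      case True then show ?thesis using self by blast
    next
      case False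
      then have zK: "z \<in> K" using step by blast
      have "y \<noteq> v" using False block_mates_nbr[of z] step by (auto simp: insert_commute)
      then obtain u where u: "u \<in> Um" "reach Gm K u y" using step by blast
      have "{y,z} \<in> Gm" using step False by (auto simp: doubleton_in_nsets_2)
      then have "reach Gm K y z" using reach_in(2)[OF u(2)] zK by (intro reach_edge) auto
      then show ?thesis using u reach_trans by fast
    qed
  qed simp
  then show ?thesis using assms v by blast
qed

text \<open>By \<open>block_mates_unique\<close>, a walk that leaves the blocks through \<open>v\<close> returns to them at the vertex where it left.
  Such excursions can be cut out.\<close>

lemma block_mates_robust:
  assumes u: "u \<in> Um" and r: "reach E X u v" and X: "X \<subseteq> insert v K"
  shows "reach (E \<inter> nsets (insert v Um) 2) (insert v Um \<inter> X) u v"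
proof -
  let ?T = "E \<inter> nsets (insert v Um) 2" let ?R = "{z. reach ?T (insert v Um \<inter> X) u z}"
  have "u \<in> ?R" using u reach_in[OF r] by (auto intro: reach_refl)
  from r have "\<exists>r\<in>?R. r = v \<or> reach Gm K r v"
  proof (induction rule: reach_induct[where P = "\<lambda>z. \<exists>r\<in>?R. r = z \<or> reach Gm K r z"])
    case (step y z)
    then obtain r where r: "r \<in> ?R" "r = y \<or> reach Gm K r y" by blast
    have rU: "r \<in> insert v Um" "r \<in> X" using r(1) reach_in(2) by fast+
    have yz: "y \<in> insert v K" "z \<in> insert v K" "y \<noteq> z" using block_mates_edge step by blast+
    show ?case
    proof (cases "{y,z} \<in> nsets (insert v Um) 2")
      case True
      then have yU: "y \<in> insert v Um" "z \<in> insert v Um" by (auto simp: doubleton_in_nsets_2)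
      have "r = y"
      proof (rule ccontr)
        assume "r \<noteq> y"
        then have ry: "reach Gm K r y" using r by blast
        then have "r \<in> Um" "y \<in> Um" using rU(1) yU(1) v reach_in[OF ry] by blast+
        then show False using block_mates_unique[OF _ _ ry] \<open>r \<noteq> y\<close> by blast
      qed
      then have "reach ?T (insert v Um \<inter> X) r z" using True step yU rU by (intro reach_edge) auto
      then have "z \<in> ?R" using r(1) reach_trans by fast
      then show ?thesis by blast
    next
      case False
      then have G: "{y,z} \<in> Gm" using step by blast
      then have K: "y \<in> K" "z \<in> K" using edge_ends[OF G rest_sub] by blast+
      have "reach Gm K y z" using G K by (intro reach_edge) auto
      then have "reach Gm K r z" using r(2) reach_trans by fast
      then show ?thesis using r(1) by blast
    qed
  qed (use \<open>u \<in> ?R\<close> in blast)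
  then show ?thesis using reach_in(2)[of Gm K _ v] v by blast
qed

end

text \<open>The blocks through \<open>v\<close> form a graph in \<open>rgraphs v U\<close>, where \<open>U\<close> is the set of block mates of \<open>v\<close>. The
  remaining edges form connected graphs, one hanging at every element of \<open>U\<close>.\<close>

lemma cgraphs_split:
  assumes fin: "finite K" and v: "v \<notin> K"
  shows "card (cgraphs (insert v K)) = (\<Sum>U\<in>Pow K. card (rgraphs v U) * card (fgraphs U K))"
proof (rule card_split[where key = "block_mates v K" and M = "\<lambda>U. nsets (insert v U) 2"])
  show "finite (Pow K)" using fin by simp
  show "finite (rgraphs v U) \<and> finite (fgraphs U K)" if "U \<in> Pow K" for U
    using that fin finite_rgraphs[of U] finite_fgraphs[of K] finite_subset[of U K] by auto
next
  fix E assume E: "E \<in> cgraphs (insert v K)"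
  let ?U = "block_mates v K E" let ?W = "insert v K" let ?M = "nsets (insert v ?U) 2"
  have Ep: "E \<in> pgraphs ?W" and E2: "E \<subseteq> nsets ?W 2" and con: "conn E ?W"
    using E by (auto simp: pgraphs_def cgraphs_def)
  note ctx = v E2 con
  have UK: "?U \<subseteq> K" by (auto simp: block_mates_def)
  have rob: "conn (E \<inter> ?M) (insert v ?U \<inter> X)" if h: "\<And>u. u \<in> ?U \<inter> X \<Longrightarrow> reach E X u v" "v \<in> X" "X \<subseteq> ?W" for X
  proof (rule conn_hub[of _ _ v])
    fix y assume y: "y \<in> insert v ?U \<inter> X"
    show "reach (E \<inter> ?M) (insert v ?U \<inter> X) y v"
    proof (cases "y = v")
      case False
      then show ?thesis using block_mates_robust[OF ctx _ _ h(3), of y] h(1) y by blast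
    qed (use h in \<open>auto intro: reach_refl\<close>)
  qed
  have "conn (E \<inter> ?M) (insert v ?U \<inter> ?W)" using con UK by (intro rob) (auto simp: conn_def)
  moreover have "insert v ?U \<inter> ?W = insert v ?U" using UK by blast
  ultimately have c0: "conn (E \<inter> ?M) (insert v ?U)" by simp
  have c1: "conn (E \<inter> ?M) (insert v ?U - {w})" if w: "w \<in> ?U" for w
  proof -
    have "conn (E \<inter> ?M) (insert v ?U \<inter> (?W - {w}))" using w UK v by (intro rob) (auto simp: block_mates_def)
    moreover have "insert v ?U \<inter> (?W - {w}) = insert v ?U - {w}" using UK by blast
    ultimately show ?thesis by simp
  qed
  have p1: "E \<inter> ?M \<in> pgraphs (insert v ?U)" using UK by (intro pgraphs_sub[OF Ep]) auto
  have p2: "E - ?M \<in> pgraphs K" using rest_sub[OF ctx] by (intro pgraphs_sub[OF Ep]) auto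
  have ex1: "\<exists>!u. u \<in> ?U \<and> reach (E - ?M) K u y" if y: "y \<in> K" for y
  proof -
    obtain u where u: "u \<in> ?U" "reach (E - ?M) K u y" using block_mates_root[OF ctx y] by blast
    have "u' = u" if "u' \<in> ?U" "reach (E - ?M) K u' y" for u'
      using block_mates_unique[OF ctx u(1) that(1)] reach_trans[OF u(2) reach_sym[OF that(2)]] by blast
    then show ?thesis using u by blast
  qed
  have "E \<inter> ?M \<in> rgraphs v ?U" unfolding rgraphs_def using p1 c0 c1 by simp
  moreover have "E - ?M \<in> fgraphs ?U K" unfolding fgraphs_def using p2 ex1 by simp
  ultimately show "?U \<in> Pow K \<and> E \<inter> ?M \<in> rgraphs v ?U \<and> E - ?M \<in> fgraphs ?U K"
    using UK by simp
next
  fix U T F assume h: "U \<in> Pow K" "T \<in> rgraphs v U" "F \<in> fgraphs U K"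
  let ?W = "insert v K" let ?E = "T \<union> F"
  have UK: "U \<subseteq> K" using h by simp
  have T: "T \<in> pgraphs (insert v U)" "T \<subseteq> nsets (insert v U) 2" "conn T (insert v U)" "\<And>w. w \<in> U \<Longrightarrow> conn T (insert v U - {w})"
    and F: "F \<in> pgraphs K" "F \<subseteq> nsets K 2" and uniq: "\<And>y. y \<in> K \<Longrightarrow> \<exists>!u. u \<in> U \<and> reach F K u y"
    using h by (auto simp: pgraphs_def rgraphs_def fgraphs_def)
  have same: "a = b" if "a \<in> U" "b \<in> U" "reach F K a b" for a b
    using uniq[of b] that UK reach_refl[of b K F] by blast
  have cov: "{y. \<exists>u\<in>U. reach F K u y} = K" using uniq reach_in(2) by fast
  have pE: "?E \<in> pgraphs ?W"
  proof -
    have "finite U" using UK fin finite_subset by blast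
    from pgraphs_attach_forest[OF this order_refl UK v T(1) h(3)]
    have "T \<union> (F \<inter> nsets K 2) \<in> pgraphs (insert v U \<union> K)" unfolding cov .
    moreover have "F \<inter> nsets K 2 = F" "insert v U \<union> K = ?W" using F UK by blast+
    ultimately show ?thesis by simp
  qed
  have cE: "conn ?E ?W"
  proof (rule conn_hub[of _ _ v])
    fix y assume y: "y \<in> ?W"
    show "reach ?E ?W y v"
    proof (cases "y = v")
      case False
      then obtain u where u: "u \<in> U" "reach F K u y" using uniq y by blast
      have "reach ?E ?W y u" using reach_mono[OF reach_sym[OF u(2)]] by blast
      moreover have "reach T (insert v U) u v" using T(3) u unfolding conn_def by blast
      then have "reach ?E ?W u v" using reach_mono UK by (metis Un_upper1 insert_mono)
      ultimately show ?thesis using reach_trans by fast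
    qed (simp add: reach_refl)
  qed
  have key: "block_mates v K ?E = U"
  proof
    show "U \<subseteq> block_mates v K ?E"
    proof
      fix u assume u: "u \<in> U"
      have "reach ?E (?W - {w}) u v" if w: "w \<in> K - {u}" for w
      proof (cases "w \<in> U")
        case True
        then have "reach T (insert v U - {w}) u v" using T(4)[of w] u w v UK unfolding conn_def by blast
        then show ?thesis using reach_mono[of T _ u v ?E "?W - {w}"] UK by blast
      next
        case False
        have "reach T (insert v U) u v" using T(3) u unfolding conn_def by blast
        then show ?thesis using reach_mono[of T _ u v ?E "?W - {w}"] UK False w v by blast
      qed
      then show "u \<in> block_mates v K ?E" using u UK unfolding block_mates_def by blast
    qed
    show "block_mates v K ?E \<subseteq> U"
    proof
      fix y assume y: "y \<in> block_mates v K ?E"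
      then have yK: "y \<in> K" by (simp add: block_mates_def)
      obtain u where u: "u \<in> U" "reach F K u y" using uniq yK by blast
      have "y = u"
      proof (rule ccontr)
        assume "y \<noteq> u"
        then have r: "reach ?E (?W - {u}) y v" using y u UK unfolding block_mates_def by blast
        let ?S = "{z. reach F K u z} - {u}"
        have st: "z \<in> ?S" if a: "a \<in> ?S" "{a,z} \<in> ?E" "z \<in> ?W - {u}" for a z
        proof -
          have aK: "a \<in> K" and ra: "reach F K u a" using a reach_in(2) by fast+
          have "{a,z} \<notin> T"
          proof
            assume "{a,z} \<in> T"
            then have "a \<in> U" using edge_ends[OF _ T(2), of a z] aK v by blast
            then show False using same[OF u(1) _ ra] a by blast
          qed
          then have f: "{a,z} \<in> F" using a by blast
          then have "z \<in> K" using edge_ends[OF _ F(2), of a z] by blast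
          then have "reach F K a z" using f aK by (intro reach_edge) auto
          then show ?thesis using ra a(3) reach_trans by fast
        qed
        have "v \<in> ?S" using reach_restrict[OF r, of ?S ?E] st u \<open>y \<noteq> u\<close> by blast
        then show False using reach_in(2)[of F K u v] v by blast
      qed
      then show "y \<in> U" using u by simp
    qed
  qed
  have "F \<inter> nsets (insert v U) 2 = {}"
  proof (rule ccontr)
    assume "\<not> ?thesis"
    then obtain e where e: "e \<in> F" "e \<in> nsets (insert v U) 2" by blast
    obtain a b where ab: "e = {a,b}" "a \<in> insert v U" "b \<in> insert v U" "a \<noteq> b" using nsets2_E[OF e(2)] by blast
    have K: "a \<in> K" "b \<in> K" using edge_ends[OF _ F(2), of a b] e ab by blast+
    then have "reach F K a b" using e ab by (intro reach_edge) auto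
    then show False using same[of a b] ab K v by blast
  qed
  then show "T \<union> F \<in> cgraphs ?W \<and> block_mates v K (T \<union> F) = U \<and> T \<subseteq> nsets (insert v U) 2 \<and> F \<inter> nsets (insert v U) 2 = {}"
    using pE cE key T(2) by (simp add: cgraphs_def)
qed

section \<open>Polygon dissections\<close>

text \<open>These are the dissections, by pairwise noncrossing chords, of the polygon whose vertices are \<open>xs\<close> in this
  circular order. For two vertices the polygon degenerates to an edge.\<close>

definition polys :: "'a list \<Rightarrow> 'a set set set" where
  "polys xs = {E. E \<subseteq> nsets (set xs) 2 \<and> path_edges (xs @ [hd xs]) \<subseteq> E \<and> crossfree xs E}"

lemma finite_polys: "finite (polys xs)"
  by (rule finite_subset[of _ "Pow (nsets (set xs) 2)"]) (auto simp: polys_def finite_imp_finite_nsets)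

lemma path_edges_map: "path_edges (map f xs) = (`) f ` path_edges xs"
  by (induction xs rule: path_edges.induct) auto

lemma crossfree_map:
  assumes "inj_on f (set xs)" "E \<subseteq> nsets (set xs) 2"
  shows "crossfree (map f xs) ((`) f ` E) \<longleftrightarrow> crossfree xs E"
proof -
  have mem: "{f a, f c} \<in> (`) f ` E \<longleftrightarrow> {a,c} \<in> E" if "a \<in> set xs" "c \<in> set xs" for a c
  proof
    assume "{f a, f c} \<in> (`) f ` E"
    then obtain e where e: "e \<in> E" "f ` {a,c} = f ` e" by auto
    then have "e \<subseteq> set xs" using assms nsets_sub by blast
    then have "{a,c} = e" using inj_on_image_eq_iff[OF assms(1), of "{a,c}" e] e that by auto
    then show "{a,c} \<in> E" using e by simp
  next
    assume "{a,c} \<in> E" then show "{f a, f c} \<in> (`) f ` E" by (force intro: image_eqI[of _ _ "{a,c}"])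
  qed
  show ?thesis
  proof
    assume h: "crossfree (map f xs) ((`) f ` E)"
    show "crossfree xs E" unfolding crossfree_def
    proof (intro allI impI notI)
      fix u p q r s a b c d assume x: "xs = u @ a # p @ b # q @ c # r @ d # s" "{a,c} \<in> E" "{b,d} \<in> E"
      then have "{f a, f c} \<in> (`) f ` E" "{f b, f d} \<in> (`) f ` E" using mem by auto
      moreover have "map f xs = map f u @ f a # map f p @ f b # map f q @ f c # map f r @ f d # map f s" using x by simp
      ultimately show False using h unfolding crossfree_def by blast
    qed
  next
    assume h: "crossfree xs E"
    show "crossfree (map f xs) ((`) f ` E)" unfolding crossfree_subseq
    proof (intro allI impI notI)
      fix a b c d assume x: "subseq [a,b,c,d] (map f xs)" "{a,c} \<in> (`) f ` E" "{b,d} \<in> (`) f ` E"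
      obtain N where "[a,b,c,d] = map f (nths xs N)"
        using x(1) unfolding subseq_conv_nths nths_map by (elim exE) (rule that)
      then obtain a' b' c' d' where y: "nths xs N = [a',b',c',d']" "a = f a'" "b = f b'" "c = f c'" "d = f d'"
        by (auto simp: Cons_eq_map_conv)
      then have sub: "subseq [a',b',c',d'] xs" by (metis subseq_conv_nths)
      then have "set [a',b',c',d'] \<subseteq> set xs" using y(1) set_nths_subset by metis
      then have "{a',c'} \<in> E" "{b',d'} \<in> E" using mem[of a' c'] mem[of b' d'] x(2,3) y by auto
      then show False using h sub unfolding crossfree_subseq by blast
    qed
  qed
qed

lemma card_polys_map:
  assumes inj: "inj_on f (set xs)" and ne: "xs \<noteq> []"
  shows "card (polys (map f xs)) = card (polys xs)"
proof -
  have bn: "bij_betw ((`) f) (nsets (set xs) 2) (nsets (f ` set xs) 2)"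
    by (rule bij_betw_nsets) (simp add: inj_on_imp_bij_betw inj)
  have bP: "bij_betw ((`) ((`) f)) (Pow (nsets (set xs) 2)) (Pow (nsets (f ` set xs) 2))"
    using bij_betw_Pow[OF bn] .
  have iff: "(`) f ` E \<in> polys (map f xs) \<longleftrightarrow> E \<in> polys xs" if E: "E \<in> Pow (nsets (set xs) 2)" for E
  proof -
    have 1: "path_edges (map f xs @ [hd (map f xs)]) = (`) f ` path_edges (xs @ [hd xs])"
      using path_edges_map[of f "xs @ [hd xs]"] ne by (simp add: hd_map)
    have "path_edges (xs @ [hd xs]) \<subseteq> Pow (set xs)" using path_edges_subset[of _ "xs @ [hd xs]"] ne by fastforce
    moreover have "E \<subseteq> Pow (set xs)" using E nsets_sub by blast
    ultimately have 2: "(`) f ` path_edges (xs @ [hd xs]) \<subseteq> (`) f ` E \<longleftrightarrow> path_edges (xs @ [hd xs]) \<subseteq> E"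
      by (rule inj_on_image_subset_iff[OF inj_on_image_Pow[OF inj]])
    have "(`) f ` E \<subseteq> nsets (f ` set xs) 2" using bij_betw_imp_surj_on[OF bn] E by blast
    then show ?thesis using 1 2 crossfree_map[OF inj, of E] E by (auto simp: polys_def)
  qed
  have "polys (map f xs) = (`) ((`) f) ` polys xs"
  proof
    show "(`) ((`) f) ` polys xs \<subseteq> polys (map f xs)"
    proof
      fix F assume "F \<in> (`) ((`) f) ` polys xs"
      then obtain E where E: "E \<in> polys xs" "F = (`) f ` E" by blast
      then have "E \<in> Pow (nsets (set xs) 2)" by (simp add: polys_def)
      then show "F \<in> polys (map f xs)" using iff E by blast
    qed
    show "polys (map f xs) \<subseteq> (`) ((`) f) ` polys xs"
    proof
      fix F assume F: "F \<in> polys (map f xs)"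
      then have "F \<in> Pow (nsets (f ` set xs) 2)" by (auto simp: polys_def)
      then have "F \<in> (`) ((`) f) ` Pow (nsets (set xs) 2)"
        unfolding bij_betw_imp_surj_on[OF bP] .
      then obtain E where "E \<in> Pow (nsets (set xs) 2)" "F = (`) f ` E" by (rule imageE) (rule that)
      then show "F \<in> (`) ((`) f) ` polys xs" using iff F by blast
    qed
  qed
  moreover have "inj_on ((`) ((`) f)) (polys xs)"
    by (rule inj_on_subset[OF bij_betw_imp_inj_on[OF bP]]) (auto simp: polys_def)
  ultimately show ?thesis by (simp add: card_image)
qed

text \<open>The polygon has \<open>k + 1\<close> vertices: the index does not count the root vertex.\<close>

definition num_dissections :: "nat \<Rightarrow> nat" where "num_dissections k = card (polys [0..<Suc k])"

lemma card_polys: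
  assumes "distinct xs" "length xs = Suc k" shows "card (polys xs) = num_dissections k"
proof -
  have "map ((!) xs) [0..<Suc k] = xs" using assms(2) by (metis map_nth)
  moreover have "inj_on ((!) xs) (set [0..<Suc k])" using assms by (auto simp: inj_on_def nth_eq_iff_index_eq)
  ultimately show ?thesis using card_polys_map[of "(!) xs" "[0..<Suc k]"] by (simp add: num_dissections_def)
qed

text \<open>Here the side between the last and the first vertex is optional.\<close>

definition pathpolys :: "'a list \<Rightarrow> 'a set set set" where
  "pathpolys xs = {E. E \<subseteq> nsets (set xs) 2 \<and> path_edges xs \<subseteq> E \<and> crossfree xs E}"

lemma finite_pathpolys: "finite (pathpolys xs)"
  by (rule finite_subset[of _ "Pow (nsets (set xs) 2)"]) (auto simp: pathpolys_def finite_imp_finite_nsets)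

lemma crossfree_add_ends:
  assumes "crossfree (a # m @ [c]) E" "distinct (a # m @ [c])"
  shows "crossfree (a # m @ [c]) (insert {a,c} E)"
  unfolding crossfree_def
proof (intro allI impI notI)
  fix u p q r s x y z w
  assume h: "a # m @ [c] = u @ x # p @ y # q @ z # r @ w # s" "{x,z} \<in> insert {a,c} E" "{y,w} \<in> insert {a,c} E"
  have dist: "distinct (u @ x # p @ y # q @ z # r @ w # s)" using h assms(2) by metis
  have "a = hd (u @ x # p @ y # q @ z # r @ w # s)" using h(1) by (metis list.sel(1))
  then have "a \<in> set (u @ [x])" by (cases u) auto
  then have na: "a \<noteq> y" "a \<noteq> z" "a \<noteq> w" using dist by auto
  have "c = last (u @ x # p @ y # q @ z # r @ w # s)" using h(1) by (metis append_Cons last_snoc)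
  then have "c \<in> set (w # s)" by simp
  then have nc: "c \<noteq> x" "c \<noteq> y" "c \<noteq> z" using dist by auto
  have "{x,z} \<in> E" "{y,w} \<in> E" using h(2,3) na nc by (auto simp: doubleton_eq_iff)
  then show False using assms(1) h(1) unfolding crossfree_def by blast
qed

lemma polys_ends: "polys (b # q @ [c]) = {G \<in> pathpolys (b # q @ [c]). {b,c} \<in> G}"
proof -
  have "path_edges ((b # q @ [c]) @ [b]) = insert {b,c} (path_edges (b # q @ [c]))"
    using path_edges_append[of "b # q" c "[b]"] by (auto simp: insert_commute)
  then show ?thesis by (auto simp: polys_def pathpolys_def)
qed

text \<open>The side \<open>{b,c}\<close> crosses nothing, so it can be added or removed freely, unless it is the path itself.\<close>

lemma card_pathpolys:
  assumes dist: "distinct (b # q @ [c])"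
  shows "card (pathpolys (b # q @ [c])) = (if q = [] then 1 else 2 * num_dissections (Suc (length q)))"
proof (cases "q = []")
  case True
  have "nsets {b,c} 2 = {{b,c}}" using dist True by (auto simp: nsets_doubleton_2_eq)
  moreover have "crossfree [b,c] E" for E :: "'a set set" unfolding crossfree_def 
    by (auto simp: Cons_eq_append_conv)
  ultimately have "pathpolys [b,c] = {{{b,c}}}" by (auto simp: pathpolys_def)
  then show ?thesis using True by simp
next
  case False
  let ?P = "pathpolys (b # q @ [c])" let ?Q = "{G \<in> ?P. {b,c} \<notin> G}"
  have bc: "b \<noteq> c" using dist by auto
  have ins: "insert {b,c} G \<in> polys (b # q @ [c])" if "G \<in> ?Q" for G
  proof -
    have "{b,c} \<in> nsets (set (b # q @ [c])) 2" using bc by (simp add: doubleton_in_nsets_2)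
    then show ?thesis using that crossfree_add_ends[OF _ dist, of G] unfolding polys_ends by (auto simp: pathpolys_def)
  qed
  have rem: "G - {{b,c}} \<in> ?Q" if "G \<in> polys (b # q @ [c])" for G
  proof -
    have "{b,c} \<notin> path_edges (b # q @ [c])" by (rule path_edges_ends[OF dist False])
    then show ?thesis using that crossfree_mono[of "b # q @ [c]" G "G - {{b,c}}"] unfolding polys_ends by (auto simp: pathpolys_def)
  qed
  have "bij_betw (insert {b,c}) ?Q (polys (b # q @ [c]))"
    by (rule bij_betw_byWitness[where f' = "\<lambda>G. G - {{b,c}}"])
       (use ins rem in \<open>auto simp: polys_ends\<close>)
  then have cQ: "card ?Q = card (polys (b # q @ [c]))" by (rule bij_betw_same_card)
  have "?P = polys (b # q @ [c]) \<union> ?Q" unfolding polys_ends by blast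
  moreover have "polys (b # q @ [c]) \<inter> ?Q = {}" unfolding polys_ends by blast
  ultimately have "card ?P = card (polys (b # q @ [c])) + card ?Q"
    using card_Un_disjoint[of "polys (b # q @ [c])" ?Q] finite_polys finite_pathpolys by (metis finite_Un)
  then show ?thesis using cQ card_polys[OF dist, of "Suc (length q)"] False by simp
qed

text \<open>No edge crosses \<open>{a,b}\<close>, and \<open>a\<close> has no neighbour in \<open>q\<close>.\<close>

lemma edges_of_ear:
  assumes dist: "distinct (a # p1 @ b # q @ [c])" and E2: "E \<subseteq> nsets (set (a # p1 @ b # q @ [c])) 2"
    and cf: "crossfree (a # p1 @ b # q @ [c]) E" and ab: "{a,b} \<in> E" and nonbr: "\<And>y. y \<in> set q \<Longrightarrow> {a,y} \<notin> E"
    and e: "e \<in> E"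
  shows "e \<in> nsets (set (a # p1 @ [b])) 2 \<or> e \<in> nsets (set (b # q @ [c])) 2 \<or> e = {a,c}"
proof -
  have wlog: "e \<in> nsets (set (a # p1 @ [b])) 2 \<or> e \<in> nsets (set (b # q @ [c])) 2 \<or> e = {a,c}"
    if xy: "e = {x,y}" "x \<in> set (a # p1)" "y \<in> set (a # p1 @ b # q @ [c])" "x \<noteq> y" for x y
  proof (cases "y \<in> set (a # p1 @ [b])")
    case True
    then show ?thesis using xy by (auto simp: doubleton_in_nsets_2)
  next
    case False
    then have y: "y \<in> set (q @ [c])" using xy by auto
    show ?thesis
    proof (cases "x = a")
      case True
      then show ?thesis using nonbr[of y] xy e y by auto
    next
      case False
      then obtain s t where s: "p1 = s @ x # t" using xy by (metis set_ConsD split_list)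
      obtain s' t' where t: "q @ [c] = s' @ y # t'" using y by (meson split_list)
      have "a # p1 @ b # q @ [c] = [] @ a # s @ x # t @ b # s' @ y # t'" using s t by simp
      then show ?thesis using cf ab e xy(1) unfolding crossfree_def by blast
    qed
  qed
  obtain x y where xy: "e = {x,y}" "x \<in> set (a # p1 @ b # q @ [c])" "y \<in> set (a # p1 @ b # q @ [c])" "x \<noteq> y"
    by (rule edge_pair[OF e E2])
  show ?thesis
  proof (cases "x \<in> set (a # p1) \<or> y \<in> set (a # p1)")
    case True
    then show ?thesis using wlog[of x y] wlog[of y x] xy by (auto simp: insert_commute)
  next
    case False
    then show ?thesis using xy by (auto simp: doubleton_in_nsets_2)
  qed
qed

text \<open>Let \<open>ps ! i\<close> be the last neighbour of \<open>a\<close> before \<open>c\<close>. The edge from \<open>a\<close> to it separates a dissected polygon from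
  a region that is bounded by \<open>{a,c}\<close>, this edge, and a graph on the remaining vertices, in which the side
  between \<open>ps ! i\<close> and \<open>c\<close> is optional.\<close>

lemma polys_recursion:
  assumes dist: "distinct (a # ps @ [c])" and ne: "ps \<noteq> []"
  shows "card (polys (a # ps @ [c])) =
     (\<Sum>i<length ps. card (polys (a # take (Suc i) ps)) * card (pathpolys (drop i ps @ [c])))"
proof -
  let ?xs = "a # ps @ [c]"
  let ?key = "\<lambda>E. Max {i. i < length ps \<and> {a, ps ! i} \<in> E}"
  \<comment> \<open>The side \<open>{a,c}\<close> belongs to neither piece; it is added to the first one to make the cut a partition.\<close>
  let ?M = "\<lambda>i. insert {a,c} (nsets (set (a # take (Suc i) ps)) 2)"
  let ?X = "\<lambda>i. insert {a,c} ` polys (a # take (Suc i) ps)"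
  have dec: "ps = take i ps @ ps ! i # drop (Suc i) ps" "take (Suc i) ps = take i ps @ [ps ! i]" "drop i ps = ps ! i # drop (Suc i) ps"
    if "i < length ps" for i
    using that by (auto simp: id_take_nth_drop take_Suc_conv_app_nth Cons_nth_drop_Suc)
  have cnot: "c \<notin> set (a # take (Suc i) ps)" "a \<notin> set (drop i ps @ [c])" "a \<noteq> c" for i
    using dist set_take_subset[of "Suc i" ps] set_drop_subset[of i ps] by auto
  have "card (polys ?xs) = (\<Sum>i\<in>{..<length ps}. card (?X i) * card (pathpolys (drop i ps @ [c])))"
  proof (rule card_split[where key = ?key and M = ?M])
    show "finite {..<length ps}" by simp
    show "finite (?X i) \<and> finite (pathpolys (drop i ps @ [c]))" for i
      using finite_polys finite_pathpolys by blast
  next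
    fix E assume E: "E \<in> polys ?xs"
    let ?S = "{i. i < length ps \<and> {a, ps ! i} \<in> E}"
    define i where "i = Max ?S"
    have E2: "E \<subseteq> nsets (set ?xs) 2" and cyc: "path_edges (?xs @ [a]) \<subseteq> E" and cf: "crossfree ?xs E"
      using E by (auto simp: polys_def)
    have pe: "path_edges ?xs \<subseteq> E" "{a,c} \<in> E"
      using cyc path_edges_append[of "a # ps" c "[a]"] by (auto simp: insert_commute)
    have "0 \<in> ?S" using ne pe by (cases ps) auto
    then have iS: "i \<in> ?S" unfolding i_def by (intro Max_in) auto
    have mx: "j \<le> i" if "j \<in> ?S" for j unfolding i_def using that by (intro Max_ge) auto
    have il: "i < length ps" and ab: "{a, ps ! i} \<in> E" using iS by auto
    note d = dec[OF il]
    let ?p1 = "take i ps" let ?b = "ps ! i" let ?q = "drop (Suc i) ps"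
    have xs: "?xs = a # ?p1 @ ?b # ?q @ [c]" using d(1) by simp
    have dist': "distinct (a # ?p1 @ ?b # ?q @ [c])" using dist xs by metis
    have nonbr: "{a,y} \<notin> E" if "y \<in> set ?q" for y
    proof
      assume h: "{a,y} \<in> E"
      obtain j where j: "j < length ?q" "?q ! j = y" using \<open>y \<in> set ?q\<close> by (auto simp: in_set_conv_nth)
      then have "Suc i + j \<in> ?S" using h il by auto
      then show False using mx[of "Suc i + j"] by simp
    qed
    note ear = edges_of_ear[OF dist' _ _ ab nonbr, folded xs, OF E2 cf]
    have pes: "path_edges ?xs = path_edges (a # ?p1 @ [?b]) \<union> path_edges (?b # ?q @ [c])"
      unfolding xs using path_edges_append[of "a # ?p1" ?b "?q @ [c]"] by simp
    have sub1: "subseq (a # ?p1 @ [?b]) ?xs" "subseq (?b # ?q @ [c]) ?xs"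
      unfolding xs by (auto intro: list_emb_append_mono simp: subseq_drop_many)
    have Fp: "E \<inter> nsets (set (a # take (Suc i) ps)) 2 \<in> polys (a # take (Suc i) ps)"
    proof -
      have "path_edges ((a # ?p1 @ [?b]) @ [a]) = insert {a,?b} (path_edges (a # ?p1 @ [?b]))"
        using path_edges_append[of "a # ?p1" ?b "[a]"] by (auto simp: insert_commute)
      then have "path_edges ((a # ?p1 @ [?b]) @ [a]) \<subseteq> E" using pes pe ab by auto
      moreover have "path_edges ((a # ?p1 @ [?b]) @ [a]) \<subseteq> nsets (set (a # ?p1 @ [?b])) 2"
      proof
        fix e assume e: "e \<in> path_edges ((a # ?p1 @ [?b]) @ [a])"
        then have "e \<subseteq> set (a # ?p1 @ [?b])" using path_edges_subset by fastforce
        moreover have "card e = 2" "finite e" using e calculation \<open>path_edges ((a # ?p1 @ [?b]) @ [a]) \<subseteq> E\<close> E2 by (auto simp: nsets_def)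
        ultimately show "e \<in> nsets (set (a # ?p1 @ [?b])) 2" by (simp add: nsets_def)
      qed
      moreover have "crossfree (a # ?p1 @ [?b]) (E \<inter> nsets (set (a # ?p1 @ [?b])) 2)"
        using crossfree_mono[OF crossfree_sub[OF cf sub1(1)]] by blast
      ultimately show ?thesis unfolding d(2) by (simp add: polys_def)
    qed
    have "E \<inter> ?M i = insert {a,c} (E \<inter> nsets (set (a # take (Suc i) ps)) 2)" using pe(2) by blast
    then have X: "E \<inter> ?M i \<in> ?X i" using Fp by blast
    have "E - ?M i \<in> pathpolys (?b # ?q @ [c])"
    proof -
      have s1: "E - ?M i \<subseteq> nsets (set (?b # ?q @ [c])) 2"
        using ear unfolding d(2) by blast
      have int: "set (?b # ?q @ [c]) \<inter> set (a # ?p1 @ [?b]) \<subseteq> {?b}" using dist' by auto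
      have s2: "path_edges (?b # ?q @ [c]) \<subseteq> E - ?M i"
      proof
        fix e assume e: "e \<in> path_edges (?b # ?q @ [c])"
        then have eE: "e \<in> E" using pes pe by blast
        have es: "e \<subseteq> set (?b # ?q @ [c])" using path_edges_subset[OF e] .
        then have "e \<in> nsets (set (?b # ?q @ [c])) 2" using eE E2 by (auto simp: nsets_def)
        then have "e \<notin> nsets (set (a # take (Suc i) ps)) 2" using nsets_Int_one[OF int] unfolding d(2) by auto
        moreover have "e \<noteq> {a,c}" using es cnot(2)[of i] unfolding d(3) by auto
        ultimately show "e \<in> E - ?M i" using eE by blast
      qed
      have "crossfree (?b # ?q @ [c]) (E - ?M i)"
        using crossfree_mono[OF crossfree_sub[OF cf sub1(2)]] by blast
      then show ?thesis using s1 s2 by (simp add: pathpolys_def)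
    qed
    then have "E - ?M i \<in> pathpolys (drop i ps @ [c])" unfolding d(3) by simp
    then show "?key E \<in> {..<length ps} \<and> E \<inter> ?M (?key E) \<in> ?X (?key E) \<and> E - ?M (?key E) \<in> pathpolys (drop (?key E) ps @ [c])"
      using X il unfolding i_def by simp
  next
    fix i F' G assume h: "i \<in> {..<length ps}" "F' \<in> ?X i" "G \<in> pathpolys (drop i ps @ [c])"
    then have il: "i < length ps" by simp
    note d = dec[OF il]
    let ?p1 = "take i ps" let ?b = "ps ! i" let ?q = "drop (Suc i) ps"
    have xs: "?xs = a # ?p1 @ ?b # ?q @ [c]" using d(1) by simp
    have dist': "distinct (a # ?p1 @ ?b # ?q @ [c])" using dist xs by metis
    obtain F where F': "F' = insert {a,c} F" and F: "F \<in> polys (a # ?p1 @ [?b])" using h(2) unfolding d(2) by auto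
    have G: "G \<subseteq> nsets (set (?b # ?q @ [c])) 2" "path_edges (?b # ?q @ [c]) \<subseteq> G" "crossfree (?b # ?q @ [c]) G"
      using h(3) unfolding d(3) pathpolys_def by auto
    have F2: "F \<subseteq> nsets (set (a # ?p1 @ [?b])) 2" "path_edges ((a # ?p1 @ [?b]) @ [a]) \<subseteq> F" "crossfree (a # ?p1 @ [?b]) F"
      using F unfolding polys_def by auto
    have pF: "path_edges (a # ?p1 @ [?b]) \<subseteq> F" "{a,?b} \<in> F"
      using F2(2) path_edges_append[of "a # ?p1" ?b "[a]"] by (auto simp: insert_commute)
    have pes0: "path_edges ?xs = path_edges (a # ?p1 @ [?b]) \<union> path_edges (?b # ?q @ [c])"
      unfolding xs using path_edges_append[of "a # ?p1" ?b "?q @ [c]"] by simp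
    have pes: "path_edges (?xs @ [a]) = insert {a,c} (path_edges (a # ?p1 @ [?b]) \<union> path_edges (?b # ?q @ [c]))"
      unfolding pes0[symmetric] using path_edges_append[of "a # ps" c "[a]"] by (auto simp: insert_commute)
    have cf: "crossfree ?xs (F \<union> G)" unfolding xs
      using crossfree_insert[of "a # ?p1" ?b "[]" F "?q @ [c]" G] F2 G dist' by auto
    have cf2: "crossfree ?xs (F' \<union> G)" using crossfree_add_ends[OF cf dist] F' by simp
    have sets: "set (a # ?p1 @ [?b]) \<subseteq> set ?xs" "set (?b # ?q @ [c]) \<subseteq> set ?xs" unfolding xs by auto
    have "F' \<union> G \<subseteq> nsets (set ?xs) 2"
      using F2(1) G(1) nsets_mono[OF sets(1), of 2] nsets_mono[OF sets(2), of 2] cnot(3) unfolding F' by (auto simp: doubleton_in_nsets_2)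
    moreover have "path_edges (?xs @ [a]) \<subseteq> F' \<union> G" unfolding pes F' using pF(1) G(2) by blast
    ultimately have mem: "F' \<union> G \<in> polys ?xs" using cf2 by (simp add: polys_def)
    have aG: "a \<notin> set (?b # ?q @ [c])" using dist' by auto
    have key: "?key (F' \<union> G) = i"
    proof (rule Max_eqI)
      show "i \<in> {i. i < length ps \<and> {a, ps ! i} \<in> F' \<union> G}" using il pF F' by blast
      fix j assume j: "j \<in> {i. i < length ps \<and> {a, ps ! i} \<in> F' \<union> G}"
      show "j \<le> i"
      proof (rule ccontr)
        assume "\<not> j \<le> i"
        then have "ps ! j \<in> set ?q" using j by (auto simp: in_set_conv_nth intro!: exI[of _ "j - Suc i"])
        then have nj: "ps ! j \<notin> set (a # ?p1 @ [?b])" "ps ! j \<noteq> c" using dist' by auto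
        have "{a, ps ! j} \<notin> F" using edge_ends[OF _ F2(1), of a "ps ! j"] nj by blast
        moreover have "{a, ps ! j} \<noteq> {a,c}" using nj cnot(3) by (auto simp: doubleton_eq_iff)
        moreover have "{a, ps ! j} \<notin> G" using edge_ends[OF _ G(1), of a "ps ! j"] aG by blast
        ultimately show False using j F' by blast
      qed
    qed simp
    have "G \<inter> ?M i = {}"
    proof -
      have int: "set (?b # ?q @ [c]) \<inter> set (a # ?p1 @ [?b]) \<subseteq> {?b}" using dist' by auto
      have "{a,c} \<notin> G" using edge_ends[OF _ G(1), of a c] aG by blast
      then show ?thesis using nsets_Int_one[OF int] G(1) unfolding d(2) by blast
    qed
    moreover have "F' \<subseteq> ?M i" using F' F2(1) unfolding d(2) by blast
    ultimately show "F' \<union> G \<in> polys ?xs \<and> ?key (F' \<union> G) = i \<and> F' \<subseteq> ?M i \<and> G \<inter> ?M i = {}"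
      using mem key by blast
  qed
  moreover have "card (?X i) = card (polys (a # take (Suc i) ps))" for i
  proof (rule card_image, rule inj_onI)
    fix F H assume h: "F \<in> polys (a # take (Suc i) ps)" "H \<in> polys (a # take (Suc i) ps)" "insert {a,c} F = insert {a,c} H"
    have "{a,c} \<notin> F" if "F \<in> polys (a # take (Suc i) ps)" for F
      using that edge_ends[of a c F "set (a # take (Suc i) ps)"] cnot(1)[of i] unfolding polys_def by blast
    then show "F = H" using h by (metis insert_ident)
  qed
  ultimately show ?thesis by simp
qed

lemma num_dissections_1: "num_dissections 1 = 1"
proof -
  have "polys ((0::nat) # [] @ [1]) = {G \<in> pathpolys (0 # [] @ [1]). {0,1} \<in> G}" by (rule polys_ends)
  also have "\<dots> = pathpolys (0 # [] @ [1])" by (auto simp: pathpolys_def)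
  finally have "card (polys [0::nat,1]) = 1" using card_pathpolys[of "0::nat" "[]" 1] by simp
  then show ?thesis by (simp add: num_dissections_def)
qed

lemma num_dissections_recursion:
  assumes "k \<ge> 2"
  shows "num_dissections k = (\<Sum>i<k-1. num_dissections (Suc i) * (if k - 1 - i = 1 then 1 else 2 * num_dissections (k - 1 - i)))"
proof -
  define ps where "ps = [1..<k]"
  have xs: "[0..<Suc k] = 0 # ps @ [k]" using assms unfolding ps_def
    by (metis One_nat_def Suc_le_eq not_less_eq_eq numeral_2_eq_2 upt_Suc upt_conv_Cons zero_less_Suc append_Cons le_SucI less_eq_nat.simps(1))
  have len: "length ps = k - 1" by (simp add: ps_def)
  have dist: "distinct (0 # ps @ [k])" using xs by (metis distinct_upt)
  have "ps \<noteq> []" using len assms by auto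
  from polys_recursion[OF dist this]
  have "num_dissections k = (\<Sum>i<length ps. card (polys (0 # take (Suc i) ps)) * card (pathpolys (drop i ps @ [k])))"
    unfolding num_dissections_def xs .
  also have "\<dots> = (\<Sum>i<k-1. num_dissections (Suc i) * (if k - 1 - i = 1 then 1 else 2 * num_dissections (k - 1 - i)))"
  proof (intro sum.cong, simp add: len)
    fix i assume i: "i \<in> {..<k-1}"
    have 1: "card (polys (0 # take (Suc i) ps)) = num_dissections (Suc i)"
      by (rule card_polys) (use dist i len set_take_subset[of "Suc i" ps] in auto)
    have d: "drop i ps = ps ! i # drop (Suc i) ps" using i len by (simp add: Cons_nth_drop_Suc)
    have "distinct (drop i (ps @ [k]))" using dist by (intro distinct_drop) simp
    then have "distinct (ps ! i # drop (Suc i) ps @ [k])" using d i len by simp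
    then have 2: "card (pathpolys (drop i ps @ [k])) = (if drop (Suc i) ps = [] then 1 else 2 * num_dissections (Suc (length (drop (Suc i) ps))))"
      unfolding d using card_pathpolys[of "ps ! i" "drop (Suc i) ps" k] by simp
    have 3: "drop (Suc i) ps = [] \<longleftrightarrow> k - 1 - i = 1" "Suc (length (drop (Suc i) ps)) = k - 1 - i" using i len by auto
    show "card (polys (0 # take (Suc i) ps)) * card (pathpolys (drop i ps @ [k])) = num_dissections (Suc i) * (if k - 1 - i = 1 then 1 else 2 * num_dissections (k - 1 - i))"
      unfolding 1 2 3 ..
  qed
  finally show ?thesis .
qed

section \<open>Blocks are dissected polygons\<close>

lemma path_conn:
  assumes "path_edges xs \<subseteq> E" "set xs \<subseteq> X" "a \<in> set xs" "b \<in> set xs"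
  shows "reach E X a b"
  using assms
proof (induction xs arbitrary: a b rule: path_edges.induct)
  case (2 x)
  then show ?case by (auto intro: reach_refl)
next
  case (3 x y zs)
  have IH: "\<And>a b. a \<in> set (y # zs) \<Longrightarrow> b \<in> set (y # zs) \<Longrightarrow> reach E X a b" using 3 by simp
  have xy: "reach E X x y" using 3 by (intro reach_edge) auto
  have xX: "reach E X x x" using 3 by (intro reach_refl) auto
  have x1: "reach E X x c" if "c \<in> set (y # zs)" for c using reach_trans[OF xy IH[of y c]] that by simp
  show ?case
  proof (cases "a = x"; cases "b = x")
    assume "a = x" "b = x" then show ?thesis using xX by simp
  next
    assume "a = x" "b \<noteq> x" then show ?thesis using x1 3 by auto
  next
    assume "a \<noteq> x" "b = x" then show ?thesis using reach_sym[OF x1[of a]] 3 by auto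
  next
    assume "a \<noteq> x" "b \<noteq> x" then show ?thesis using IH 3 by auto
  qed
qed simp

lemma path_conn': "path_edges xs \<subseteq> E \<Longrightarrow> conn E (set xs)"
  unfolding conn_def using path_conn[of xs E "set xs"] by blast

lemma crossfree_rev: "crossfree xs E \<Longrightarrow> crossfree (rev xs) E"
  unfolding crossfree_def
proof (intro allI impI notI)
  fix u p q r s a b c d
  assume h: "\<forall>u p q r s a b c d. xs = u @ a # p @ b # q @ c # r @ d # s \<longrightarrow> {a, c} \<in> E \<longrightarrow> {b, d} \<notin> E"
    and x: "rev xs = u @ a # p @ b # q @ c # r @ d # s" "{a,c} \<in> E" "{b,d} \<in> E"
  have "xs = rev (rev xs)" by simp
  also have "\<dots> = rev s @ d # rev r @ c # rev q @ b # rev p @ a # rev u" unfolding x(1) by simp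
  finally have "{d,b} \<in> E \<longrightarrow> {c,a} \<notin> E" using h by blast
  then show False using x(2,3) by (simp add: insert_commute)
qed

lemma path_edges_infix: "path_edges ys \<subseteq> path_edges (us @ ys @ vs)"
proof -
  have 1: "path_edges ys \<subseteq> path_edges (ys @ vs)"
    by (induction ys rule: path_edges.induct) auto
  have "path_edges zs \<subseteq> path_edges (us @ zs)" for zs
  proof (induction us)
    case (Cons u us)
    then show ?case by (cases "us @ zs") auto
  qed simp
  from 1 this[of "ys @ vs"] show ?thesis by simp
qed

definition cyc :: "'a list \<Rightarrow> 'a set set" where "cyc xs = path_edges (xs @ [hd xs])"

lemma cyc_rotate: "cyc (us @ vs) = cyc (vs @ us)"
proof (cases "us = [] \<or> vs = []")
  case False
  then show ?thesis using cycle_edges_rotate[of us vs] by (simp add: cyc_def)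
qed auto

lemma polys_rotate: "polys (us @ vs) = polys (vs @ us)"
  using cyc_rotate[of us vs] crossfree_rotate[of us vs] crossfree_rotate[of vs us]
  by (auto simp: polys_def cyc_def Un_commute)

lemma cyc_rev: "cyc (v # rev zs) = cyc (v # zs)"
proof -
  have "rev (v # zs @ [v]) = v # rev zs @ [v]" by simp
  then show ?thesis unfolding cyc_def using path_edges_rev[of "v # zs @ [v]"] by simp
qed

lemma polys_rev: "polys (v # rev zs) = polys (v # zs)"
proof -
  have "crossfree (v # rev zs) E" if "crossfree (v # zs) E" for E zs
    using crossfree_rotate[of "rev zs" "[v]" E] crossfree_rev[OF that] by simp
  from this[of zs] this[of "rev zs"] show ?thesis
    using cyc_rev[of v zs] by (auto simp: polys_def cyc_def)
qed

text \<open>Deleting the ends of a side leaves a path. Deleting the ends of a proper chord separates its two sides, since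
  an edge between them would cross the chord. Hence the cycle is determined by the graph alone.\<close>

lemma cyc_poly:
  assumes E: "E \<in> polys xs" and dist: "distinct xs" and len: "length xs \<ge> 3"
  shows "cyc xs = {e \<in> E. conn E (set xs - e)}"
proof
  have sub: "cyc xs \<subseteq> E" using E by (simp add: polys_def cyc_def)
  have E2: "E \<subseteq> nsets (set xs) 2" using E by (simp add: polys_def)
  show "cyc xs \<subseteq> {e \<in> E. conn E (set xs - e)}"
  proof
    fix e assume e: "e \<in> cyc xs"
    have two: "\<exists>us x y vs. ys = us @ x # y # vs \<and> e = {x,y}" if "e \<in> path_edges ys" for ys :: "'a list"
      using that
    proof (induction ys rule: path_edges.induct)
      case (3 x y zs)
      then consider "e = {x,y}" | "e \<in> path_edges (y # zs)" by auto
      then show ?case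
      proof cases
        case 1 then show ?thesis by (intro exI[of _ "[]"]) auto
      next
        case 2
        then obtain us x' y' vs where "y # zs = us @ x' # y' # vs" "e = {x',y'}" using 3 by blast
        then show ?thesis by (intro exI[of _ "x # us"] exI[of _ x'] exI[of _ y'] exI[of _ vs]) simp
      qed
    qed auto
    obtain us x y vs where uv: "xs @ [hd xs] = us @ x # y # vs" "e = {x,y}" using two e unfolding cyc_def by blast
    have "\<exists>ys. set xs - e = set ys \<and> path_edges ys \<subseteq> E"
    proof (cases "vs = []")
      case True
      then have xs: "xs = us @ [x]" "hd xs = y" using uv(1) by auto
      obtain u us' where us: "us = u # us'" using len xs(1) by (cases us) auto
      have x2: "xs = y # us' @ [x]" using xs us by simp
      have "path_edges us' \<subseteq> path_edges (y # us' @ [x])" using path_edges_infix[of us' "[y]" "[x]"] by simp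
      moreover have "path_edges (y # us' @ [x]) \<subseteq> cyc xs" unfolding cyc_def x2
        using path_edges_infix[of "y # us' @ [x]" "[]" "[y]"] by simp
      moreover have "set xs - e = set us'" using x2 dist uv(2) by auto
      ultimately show ?thesis using sub by blast
    next
      case False
      then have "xs @ [hd xs] = (us @ x # y # butlast vs) @ [last vs]" using uv(1) by simp
      then have xs: "xs = us @ x # y # butlast vs" by (simp only: append1_eq_conv)
      then have rot: "cyc xs = cyc (x # y # butlast vs @ us)" using cyc_rotate[of us "x # y # butlast vs"] by simp
      let ?ys = "butlast vs @ us"
      have "path_edges ?ys \<subseteq> path_edges (x # y # ?ys @ [x])" using path_edges_infix[of ?ys "[x,y]" "[x]"] by simp
      moreover have "path_edges (x # y # ?ys @ [x]) = cyc xs" unfolding rot by (simp add: cyc_def)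
      ultimately have "path_edges ?ys \<subseteq> E" using sub by blast
      moreover have "set xs - e = set ?ys" using xs dist uv(2) by auto
      ultimately show ?thesis by blast
    qed
    then have "conn E (set xs - e)" using path_conn' by metis
    then show "e \<in> {e \<in> E. conn E (set xs - e)}" using sub e by blast
  qed
  show "{e \<in> E. conn E (set xs - e)} \<subseteq> cyc xs"
  proof
    fix e assume "e \<in> {e \<in> E. conn E (set xs - e)}"
    then have e: "e \<in> E" and con: "conn E (set xs - e)" by auto
    obtain a c where ac: "e = {a,c}" "a \<in> set xs" "c \<in> set xs" "a \<noteq> c" by (rule edge_pair[OF e E2])
    obtain us vs where xs: "xs = us @ a # vs" using ac(2) by (meson split_list)
    define ws where "ws = vs @ us"
    have r: "polys xs = polys (a # ws)" "cyc xs = cyc (a # ws)" "set xs = set (a # ws)" "distinct (a # ws)"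
      using polys_rotate[of us "a # vs"] cyc_rotate[of us "a # vs"] dist xs by (auto simp: ws_def)
    then obtain p q where pq: "ws = p @ c # q" using ac by (metis set_ConsD split_list)
    have "E \<in> polys (a # p @ c # q)" using E r(1) pq by simp
    then have cf: "crossfree (a # p @ c # q) E" by (simp add: polys_def)
    show "e \<in> cyc xs"
    proof (rule ccontr)
      assume n: "e \<notin> cyc xs"
      have "p \<noteq> []"
      proof
        assume "p = []" then show False using n r pq ac by (simp add: cyc_def)
      qed
      moreover have "q \<noteq> []"
      proof
        assume "q = []"
        then have "path_edges ((a # ws) @ [a]) = path_edges (a # p @ [c]) \<union> path_edges [c,a]"
          using path_edges_append[of "a # p" c "[a]"] pq by simp
        then show False using n r ac by (auto simp: cyc_def insert_commute)
      qed
      ultimately obtain b0 d0 where bd0: "b0 \<in> set p" "d0 \<in> set q" using last_in_set by blast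
      have dd: "set xs - e = set p \<union> set q" "set p \<inter> set q = {}" using r pq ac by auto
      have "reach E (set xs - e) b0 d0" using con bd0 dd unfolding conn_def by blast
      from reach_cross[OF this bd0(1)] bd0 dd obtain b d where bd: "b \<in> set p" "d \<in> set q" "{b,d} \<in> E" by blast
      obtain p1 p2 where p: "p = p1 @ b # p2" using bd by (meson split_list)
      obtain q1 q2 where q: "q = q1 @ d # q2" using bd by (meson split_list)
      have "a # p @ c # q = [] @ a # p1 @ b # p2 @ c # q1 @ d # q2" using p q by simp
      then show False using cf e ac(1) bd(3) unfolding crossfree_def by blast
    qed
  qed
qed

lemma cyc_neighbour:
  assumes "distinct (us @ [w,x] @ ys)" "{x,z} \<in> cyc (us @ [w,x] @ ys)"
  shows "z = w \<or> z = hd (ys @ [hd (us @ [w])])"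
proof -
  let ?h = "hd (us @ [w])"
  have h: "hd (us @ [w,x] @ ys) = ?h" by (cases us) auto
  have hx: "?h \<noteq> x" using assms(1) by (cases us) auto
  have 1: "path_edges ((us @ [w,x] @ ys) @ [?h]) = path_edges (us @ [w]) \<union> insert {w,x} (path_edges (x # ys @ [?h]))"
    using path_edges_append[of us w "x # ys @ [?h]"] by simp
  obtain k ks where k: "ys @ [?h] = k # ks" by (cases "ys @ [?h]") auto
  have 2: "path_edges (x # ys @ [?h]) = insert {x,k} (path_edges (ys @ [?h]))" unfolding k by simp
  have n1: "{x,z} \<notin> path_edges (us @ [w])" using path_edges_subset[of "{x,z}" "us @ [w]"] assms(1) by auto
  have n2: "{x,z} \<notin> path_edges (ys @ [?h])" using path_edges_subset[of "{x,z}" "ys @ [?h]"] assms(1) hx by auto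
  have "{x,z} = {w,x} \<or> {x,z} = {x,k}" using assms(2) n1 n2 unfolding cyc_def h 1 2 by blast
  moreover have "k = hd (ys @ [?h])" using k by simp
  ultimately show ?thesis by (auto simp: doubleton_eq_iff)
qed

lemma cyc_next:
  "{x, hd (ys @ [hd (us @ [w])])} \<in> cyc (us @ [w,x] @ ys)"
proof -
  let ?h = "hd (us @ [w])"
  have h: "hd (us @ [w,x] @ ys) = ?h" by (cases us) auto
  obtain k ks where k: "ys @ [?h] = k # ks" by (cases "ys @ [?h]") auto
  have "path_edges ((us @ [w,x] @ ys) @ [?h]) = path_edges (us @ [w]) \<union> insert {w,x} (path_edges (x # k # ks))"
    using path_edges_append[of us w "x # ys @ [?h]"] k by simp
  then show ?thesis unfolding cyc_def h k by simp
qed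

text \<open>The edges at the last common vertex fix the next vertex, so the orders agree step by step.\<close>

lemma cyc_determines:
  assumes "distinct (us @ [w,x] @ ys)" "distinct (us @ [w,x] @ zs)" "cyc (us @ [w,x] @ ys) = cyc (us @ [w,x] @ zs)"
  shows "length ys \<le> length zs \<Longrightarrow> set ys = set zs \<Longrightarrow> ys = zs"
  using assms
proof (induction ys arbitrary: us w x zs)
  case Nil
  then show ?case by simp
next
  case (Cons y ys)
  have "{x,y} \<in> cyc (us @ [w,x] @ y # ys)" using cyc_next[of x "y # ys" us w] by simp
  then have "{x,y} \<in> cyc (us @ [w,x] @ zs)" using Cons by simp
  from cyc_neighbour[OF Cons(5) this] have "y = w \<or> y = hd (zs @ [hd (us @ [w])])" .
  moreover have "y \<noteq> w" using Cons(4) by auto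
  moreover have "zs \<noteq> []" using Cons(2) by auto
  ultimately obtain zs' where zs: "zs = y # zs'" by (cases zs) auto
  have "ys = zs'"
  proof (rule Cons.IH[of zs' "us @ [w]" x y])
    show "length ys \<le> length zs'" using Cons(2) zs by simp
    show "set ys = set zs'" using Cons(3,4,5) zs by auto
    show "distinct ((us @ [w]) @ [x, y] @ ys)" "distinct ((us @ [w]) @ [x, y] @ zs')"
      "cyc ((us @ [w]) @ [x, y] @ ys) = cyc ((us @ [w]) @ [x, y] @ zs')"
      using Cons(4-6) zs by auto
  qed
  then show ?case using zs by simp
qed

text \<open>A cycle that starts at \<open>v\<close> can only be traversed in its two directions.\<close>

lemma cyc_two_orders:
  assumes d: "distinct (v # ys)" "distinct (v # zs)" and s: "set ys = set zs" and c: "cyc (v # ys) = cyc (v # zs)"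
  shows "zs = ys \<or> zs = rev ys"
proof (cases ys)
  case Nil
  then show ?thesis using s by simp
next
  case (Cons y ys')
  have len: "length ys = length zs" using d s by (metis distinct.simps(2) distinct_card)
  obtain z zs' where zs: "zs = z # zs'" using Cons s by (cases zs) auto
  have key: "ys = zs" if "hd ys = hd zs" "distinct (v # ys)" "distinct (v # zs)" "set ys = set zs" "cyc (v # ys) = cyc (v # zs)" "length ys = length zs" "ys \<noteq> []" for ys zs
  proof -
    define y where "y = hd ys"
    have "zs \<noteq> []" using that by auto
    then have e: "ys = y # tl ys" "zs = y # tl zs" unfolding y_def using that(7) by (simp, simp add: that(1))
    have d: "distinct ([] @ [v,y] @ tl ys)" "distinct ([] @ [v,y] @ tl zs)" "cyc ([] @ [v,y] @ tl ys) = cyc ([] @ [v,y] @ tl zs)"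
      using that(2,3,5) e by auto
    have "insert y (set (tl ys)) = insert y (set (tl zs))" using that(4) e by (metis list.simps(15))
    then have "set (tl ys) = set (tl zs)" using insert_ident[of y "set (tl ys)" "set (tl zs)"] d(1,2) by simp
    then have "tl ys = tl zs" using that(6) by (intro cyc_determines[OF d]) simp_all
    then show ?thesis using e by metis
  qed
  show ?thesis
  proof (cases "zs' = []")
    case True
    then have "length ys = 1" using len zs by simp
    then show ?thesis using s zs True Cons by auto
  next
    case False
    have "{v,z} \<in> cyc (v # zs)" using zs by (simp add: cyc_def)
    then have "{v,z} \<in> cyc (v # ys)" using c by simp
    moreover have "cyc (v # ys) = insert {v,y} (path_edges ys \<union> {{last ys, v}})"
    proof -
      have "ys \<noteq> []" using Cons by simp
      then obtain ks k where ks: "ys = ks @ [k]" by (metis rev_exhaust)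
      have "path_edges (ks @ k # [v]) = path_edges (ks @ [k]) \<union> path_edges [k, v]"
        by (rule path_edges_append)
      then have "path_edges (ys @ [v]) = path_edges ys \<union> {{last ys, v}}" unfolding ks by simp
      then show ?thesis using Cons by (simp add: cyc_def)
    qed
    moreover have "{v,z} \<notin> path_edges ys" using path_edges_subset[of "{v,z}" ys] d by auto
    ultimately have "z = y \<or> z = last ys" by (auto simp: doubleton_eq_iff)
    then show ?thesis
    proof
      assume "z = y"
      then have "ys = zs" using d s c len Cons zs by (intro key) auto
      then show ?thesis by simp
    next
      assume "z = last ys"
      then have "rev ys = zs" using d s c len Cons zs cyc_rev[of v ys] by (intro key) (auto simp: hd_rev)
      then show ?thesis by simp
    qed
  qed
qed

lemma polys_in_bgraphs:
  assumes E: "E \<in> polys xs" and dist: "distinct xs" and len: "length xs \<ge> 2"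
  shows "E \<in> bgraphs (set xs)"
proof -
  have sub: "cyc xs \<subseteq> E" using E by (simp add: polys_def cyc_def)
  have p: "E \<in> pgraphs (set xs)" using E dist by (auto simp: pgraphs_def onepage_def polys_def)
  have path: "path_edges ys \<subseteq> cyc ys" if "ys \<noteq> []" for ys :: "'a list"
    using path_edges_infix[of ys "[]" "[hd ys]"] by (simp add: cyc_def)
  have "xs \<noteq> []" using len by auto
  then have "path_edges xs \<subseteq> E" using path sub by blast
  then have "conn E (set xs)" by (rule path_conn')
  moreover have "conn E (set xs - {w})" if w: "w \<in> set xs" for w
  proof -
    obtain us vs where xs: "xs = us @ w # vs" using w by (meson split_list)
    then have "cyc xs = cyc (w # vs @ us)" using cyc_rotate[of us "w # vs"] by simp
    then have "path_edges (w # vs @ us) \<subseteq> E" using path[of "w # vs @ us"] sub by simp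
    then have "path_edges (vs @ us) \<subseteq> E" by (cases "vs @ us") auto
    then have "conn E (set (vs @ us))" by (rule path_conn')
    moreover have "set (vs @ us) = set xs - {w}" using xs dist by auto
    ultimately show ?thesis by simp
  qed
  ultimately show ?thesis using p unfolding bgraphs_def by blast
qed

lemma card_orders:
  assumes "finite A" "v \<notin> A"
  shows "card {xs. distinct xs \<and> set xs = insert v A \<and> hd xs = v} = fact (card A)"
proof -
  have "{xs. distinct xs \<and> set xs = insert v A \<and> hd xs = v} = (#) v ` permutations_of_set A"
  proof
    show "{xs. distinct xs \<and> set xs = insert v A \<and> hd xs = v} \<subseteq> (#) v ` permutations_of_set A"
    proof
      fix xs assume h: "xs \<in> {xs. distinct xs \<and> set xs = insert v A \<and> hd xs = v}"
      then obtain ys where xs: "xs = v # ys" by (cases xs) auto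
      then have "ys \<in> permutations_of_set A" using h assms by (auto simp: permutations_of_set_def)
      then show "xs \<in> (#) v ` permutations_of_set A" using xs by blast
    qed
    show "(#) v ` permutations_of_set A \<subseteq> {xs. distinct xs \<and> set xs = insert v A \<and> hd xs = v}"
      using assms by (auto simp: permutations_of_set_def)
  qed
  moreover have "card ((#) v ` permutations_of_set A) = card (permutations_of_set A)" by (intro card_image) auto
  ultimately show ?thesis using assms by simp
qed

text \<open>The pairs of a graph and a circular order starting at \<open>v\<close> for which it is a dissected polygon are counted in
  two ways. Every order carries \<open>num_dissections (card A)\<close> graphs, and every block has exactly two orders, the two
  directions of its Hamilton cycle.\<close>

lemma card_bgraphs:
  assumes fin: "finite A" and v: "v \<notin> A" and n: "card A \<ge> 2"
  shows "2 * card (bgraphs (insert v A)) = fact (card A) * num_dissections (card A)"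
proof -
  let ?V = "insert v A"
  let ?O = "{xs. distinct xs \<and> set xs = ?V \<and> hd xs = v}"
  have cV: "card ?V = Suc (card A)" using fin v by simp
  have len: "length xs = Suc (card A)" if "xs \<in> ?O" for xs using that cV distinct_card by fastforce
  have fO: "finite ?O" using card_orders[OF fin v] by (intro card_ge_0_finite) simp
  have fB: "finite (bgraphs ?V)" using finite_bgraphs fin by blast
  have inB: "E \<in> bgraphs ?V" if "xs \<in> ?O" "E \<in> polys xs" for xs E
    using polys_in_bgraphs[OF that(2)] len[OF that(1)] that(1) n by auto
  have two: "card {xs \<in> ?O. E \<in> polys xs} = 2" if E: "E \<in> bgraphs ?V" for E
  proof -
    have E2: "E \<subseteq> nsets ?V 2" and op: "onepage ?V E" using E by (auto simp: bgraphs_def pgraphs_def)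
    have bi: "biconn E ?V" unfolding biconn_def
    proof
      fix w show "conn E (?V - {w})" using E by (cases "w \<in> ?V") (auto simp: bgraphs_def)
    qed
    obtain xs where xs: "is_cycle E xs" "set xs = ?V" "crossfree xs E"
      using biconn_outerplanar_hamilton[OF onepage_imp_outerplanar[OF op E2] bi _ _ E2] fin cV n by auto
    have mem: "E \<in> polys xs" using xs E2 by (simp add: polys_def is_cycle_def)
    obtain us vs where uv: "xs = us @ v # vs" using xs(2) by (metis insertI1 split_list)
    define zs where "zs = vs @ us"
    have z: "E \<in> polys (v # zs)" "distinct (v # zs)" "set (v # zs) = ?V"
      using mem polys_rotate[of us "v # vs"] uv xs by (auto simp: zs_def is_cycle_def)
    have lz: "length zs = card A" using len[of "v # zs"] z by simp
    have "{xs \<in> ?O. E \<in> polys xs} = {v # zs, v # rev zs}"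
    proof
      show "{v # zs, v # rev zs} \<subseteq> {xs \<in> ?O. E \<in> polys xs}"
        using z polys_rev[of v zs] by auto
      show "{xs \<in> ?O. E \<in> polys xs} \<subseteq> {v # zs, v # rev zs}"
      proof
        fix ys assume h: "ys \<in> {xs \<in> ?O. E \<in> polys xs}"
        then obtain ws where ys: "ys = v # ws" by (cases ys) auto
        have w: "E \<in> polys (v # ws)" "distinct (v # ws)" "set (v # ws) = ?V" using h ys by auto
        have "length ws = card A" using len[of "v # ws"] w by simp
        then have "cyc (v # zs) = cyc (v # ws)"
          using cyc_poly[OF z(1,2)] cyc_poly[OF w(1,2)] z(3) w(3) lz n by simp
        moreover have "set zs = set ws" using z w by auto
        ultimately have "ws = zs \<or> ws = rev zs" using cyc_two_orders z(2) w(2) by metis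
        then show "ys \<in> {v # zs, v # rev zs}" using ys by auto
      qed
    qed
    moreover have "zs \<noteq> rev zs"
    proof
      assume h: "zs = rev zs"
      obtain a b ws where "zs = a # b # ws" using lz n by (cases zs rule: path_edges.cases) auto
      then have "a = last (b # ws)" using h by (metis hd_rev last.simps list.distinct(1) list.sel(1))
      then have "a \<in> set (b # ws)" using last_in_set by blast
      then show False using z(2) \<open>zs = a # b # ws\<close> by auto
    qed
    ultimately show ?thesis by simp
  qed
  have "(\<Sum>xs\<in>?O. card (polys xs)) = (\<Sum>xs\<in>?O. card {E \<in> bgraphs ?V. E \<in> polys xs})"
    by (intro sum.cong refl arg_cong[where f = card]) (use inB in blast)
  also have "\<dots> = (\<Sum>E\<in>bgraphs ?V. card {xs \<in> ?O. E \<in> polys xs})"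
    using fO fB by (intro sum_multicount_gen) auto
  also have "\<dots> = 2 * card (bgraphs ?V)" using two by simp
  finally have "2 * card (bgraphs ?V) = (\<Sum>xs\<in>?O. card (polys xs))" by simp
  also have "\<dots> = (\<Sum>xs\<in>?O. num_dissections (card A))"
    using len by (intro sum.cong refl card_polys) auto
  also have "\<dots> = fact (card A) * num_dissections (card A)" using card_orders[OF fin v] by simp
  finally show ?thesis .
qed

lemma card_bgraphs_edge:
  assumes "x \<noteq> v" shows "card (bgraphs {v,x}) = 1"
proof -
  have ns: "nsets {v,x} 2 = {{v,x}}" using assms by (simp add: nsets_doubleton_2_eq)
  have "bgraphs {v,x} = {{{v,x}}}"
  proof
    show "{{{v,x}}} \<subseteq> bgraphs {v,x}"
    proof -
      have "conn {{v,x}} {v,x}" using path_conn'[of "[v,x]" "{{v,x}}"] by simp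
      moreover have "conn {{v,x}} ({v,x} - {w})" if "w \<in> {v,x}" for w
        using that assms by (auto simp: conn_def insert_Diff_if intro: reach_refl)
      moreover have "onepage {v,x} {{v,x}}" using assms by (intro onepage_small) auto
      moreover have "{{v,x}} \<subseteq> nsets {v,x} 2" using ns by simp
      ultimately show ?thesis unfolding bgraphs_def pgraphs_def by blast
    qed
    show "bgraphs {v,x} \<subseteq> {{{v,x}}}"
    proof
      fix E assume E: "E \<in> bgraphs {v,x}"
      then have sub: "E \<subseteq> {{v,x}}" and "reach E {v,x} v x" using ns by (auto simp: bgraphs_def pgraphs_def conn_def)
      from reach_cross[OF this(2), of "{v}"] assms have "E \<noteq> {}" by auto
      then show "E \<in> {{{v,x}}}" using sub by auto
    qed
  qed
  then show ?thesis by simp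
qed

section \<open>Generating functions\<close>

lemma reach_map:
  assumes "reach E X a b" shows "reach ((`) f ` E) (f ` X) (f a) (f b)"
  using assms
proof (induction rule: reach_induct)
  case base
  then show ?case using reach_in(1)[OF assms] by (intro reach_refl) simp
next
  case (step y z)
  have "{f y, f z} \<in> (`) f ` E" using imageI[OF \<open>{y,z} \<in> E\<close>, of "image f"] by simp
  then have "reach ((`) f ` E) (f ` X) (f y) (f z)" using step reach_in(2)[OF step(1)] by (intro reach_edge) auto
  then show ?case using step reach_trans by fast
qed

lemma cgraphs_iso:
  assumes f: "bij_betw f V W" and E: "E \<in> cgraphs V"
  shows "(`) f ` E \<in> cgraphs W"
proof -
  have E2: "E \<subseteq> nsets V 2" and c: "conn E V" and op: "onepage V E" using E by (auto simp: cgraphs_def pgraphs_def)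
  have fV: "f ` V = W" and inj: "inj_on f V" using f by (auto simp: bij_betw_def)
  have "(`) f ` nsets V 2 = nsets W 2" using bij_betw_nsets[OF f] by (rule bij_betw_imp_surj_on)
  then have 1: "(`) f ` E \<subseteq> nsets W 2" using E2 by blast
  obtain xs where xs: "distinct xs" "set xs = V" "crossfree xs E" using op by (auto simp: onepage_def)
  have "crossfree (map f xs) ((`) f ` E)" using crossfree_map[of f xs E] xs inj E2 by simp
  then have 2: "onepage W ((`) f ` E)"
    unfolding onepage_def using xs inj fV by (intro exI[of _ "map f xs"]) (auto simp: distinct_map)
  have "conn ((`) f ` E) W"
    unfolding conn_def
  proof (intro ballI)
    fix a b assume "a \<in> W" "b \<in> W"
    then obtain a' b' where "a = f a'" "b = f b'" "a' \<in> V" "b' \<in> V" using fV by blast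
    then show "reach ((`) f ` E) W a b" using c reach_map[of E V a' b' f] fV unfolding conn_def by auto
  qed
  then show ?thesis using 1 2 by (simp add: cgraphs_def pgraphs_def)
qed

text \<open>Relabelling along \<open>f\<close> is injective. Applied also to the inverse, this makes the number of connected graphs a
  function of the number of vertices.\<close>

lemma card_cgraphs_le:
  assumes f: "bij_betw f V W" and "finite W"
  shows "card (cgraphs V) \<le> card (cgraphs W)"
proof (rule card_inj_on_le)
  have "inj_on f V" using f by (simp add: bij_betw_def)
  then have "inj_on ((`) ((`) f)) (Pow (Pow V))" by (intro inj_on_image_Pow)
  moreover have "cgraphs V \<subseteq> Pow (Pow V)" using nsets_sub by (fastforce simp: cgraphs_def pgraphs_def)
  ultimately show "inj_on ((`) ((`) f)) (cgraphs V)" by (rule inj_on_subset)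
  show "(`) ((`) f) ` cgraphs V \<subseteq> cgraphs W" using cgraphs_iso[OF f] by blast
  show "finite (cgraphs W)" using finite_cgraphs assms by blast
qed

definition cnum :: "nat \<Rightarrow> nat" where "cnum n = card (cgraphs {..<n})"

lemma card_cgraphs:
  fixes V :: "nat set"
  assumes "finite V" shows "card (cgraphs V) = cnum (card V)"
proof -
  obtain f where f: "bij_betw f V {..<card V}" using assms by (metis ex_bij_betw_finite_nat atLeast0LessThan)
  have "card (cgraphs V) \<le> card (cgraphs {..<card V})" by (rule card_cgraphs_le[OF f]) simp
  moreover have "card (cgraphs {..<card V}) \<le> card (cgraphs V)" by (rule card_cgraphs_le[OF bij_betw_inv_into[OF f] assms])
  ultimately show ?thesis by (simp add: cnum_def)
qed

lemma sum_Pow_card: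
  fixes g :: "nat \<Rightarrow> real"
  assumes "finite S"
  shows "(\<Sum>A\<in>Pow S. g (card A)) = (\<Sum>k\<le>card S. real (card S choose k) * g k)"
proof -
  have "(\<Sum>A\<in>Pow S. g (card A)) = (\<Sum>k\<in>{..card S}. \<Sum>A\<in>{A \<in> Pow S. card A = k}. g (card A))"
    using assms by (intro sum.group[symmetric]) (auto intro: card_mono)
  also have "\<dots> = (\<Sum>k\<le>card S. real (card S choose k) * g k)"
  proof (intro sum.cong refl)
    fix k
    have "(\<Sum>A\<in>{A \<in> Pow S. card A = k}. g (card A)) = real (card {A \<in> Pow S. card A = k}) * g k" by simp
    also have "{A \<in> Pow S. card A = k} = {A. A \<subseteq> S \<and> card A = k}" by auto
    finally show "(\<Sum>A\<in>{A \<in> Pow S. card A = k}. g (card A)) = real (card S choose k) * g k"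
      using n_subsets[OF assms, of k] by simp
  qed
  finally show ?thesis .
qed

lemma sum_Pow_containing:
  assumes "x \<in> S"
  shows "(\<Sum>A | A \<subseteq> S \<and> x \<in> A. f A) = (\<Sum>A\<in>Pow (S - {x}). f (insert x A))"
proof (rule sum.reindex_bij_witness[of _ "insert x" "\<lambda>A. A - {x}"])
qed (use assms in \<open>auto simp: insert_absorb\<close>)

lemma fact_choose: "k \<le> n \<Longrightarrow> real (n choose k) * fact k * fact (n - k) = fact n"
  by (simp add: binomial_fact)

lemma fact_choose_Suc:
  assumes "k \<le> n"
  shows "real (n choose k) * (fact (Suc k) * a * (fact (n - k) * b)) = fact n * (real (Suc k) * a * b)"
proof -
  have "real (n choose k) * (fact (Suc k) * a * (fact (n - k) * b)) = (real (n choose k) * fact k * fact (n - k)) * (real (Suc k) * a * b)"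
    by (simp add: algebra_simps)
  then show ?thesis unfolding fact_choose[OF assms] .
qed

lemma fps_exp_compose_rec:
  fixes A :: "real fps"
  assumes "fps_nth A 0 = 0"
  shows "real (Suc n) * fps_nth (fps_exp 1 oo A) (Suc n) =
     (\<Sum>j\<le>n. real (Suc j) * fps_nth A (Suc j) * fps_nth (fps_exp 1 oo A) (n - j))"
proof -
  have "fps_deriv (fps_exp 1 oo A) = (fps_exp 1 oo A) * fps_deriv A"
    using fps_compose_deriv[OF assms, of "fps_exp 1"] by simp
  then have "fps_nth (fps_deriv (fps_exp 1 oo A)) n = fps_nth (fps_deriv A * (fps_exp 1 oo A)) n" by (simp add: mult.commute)
  then show ?thesis by (simp add: fps_mult_nth atMost_atLeast0)
qed

text \<open>\<open>Cf\<close> and \<open>Hf\<close> are the exponential generating functions of connected and of all graphs, \<open>Df\<close> is the ordinary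
  generating function of dissections, and \<open>Bf\<close> is the derivative of the exponential generating function of
  blocks: the term \<open>fps_X\<close> makes up for the factor \<open>1/2\<close>, since a single edge has only one
  circular order from its root, whereas larger blocks have two. \<open>Ef\<close> counts the graphs all of whose blocks contain the root.\<close>

definition Cf :: "real fps" where "Cf = Abs_fps (\<lambda>n. if n = 0 then 0 else real (cnum n) / fact n)"
definition Df :: "real fps" where "Df = Abs_fps (\<lambda>n. if n = 0 then 0 else real (num_dissections n))"
definition Bf :: "real fps" where "Bf = fps_const (1/2) * (fps_X + Df)"
definition Ef :: "real fps" where "Ef = fps_exp 1 oo Bf"
definition Hf :: "real fps" where "Hf = fps_exp 1 oo Cf"

lemma Bf_0 [simp]: "fps_nth Bf 0 = 0" by (simp add: Bf_def Df_def)
lemma Cf_0 [simp]: "fps_nth Cf 0 = 0" by (simp add: Cf_def)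
lemma Ef_0 [simp]: "fps_nth Ef 0 = 1" by (simp add: Ef_def)

text \<open>This is \<open>num_dissections_recursion\<close>; the factor \<open>2 * Df - fps_X\<close> counts the graphs with an optional side.\<close>

lemma Df_eq: "Df = fps_X + Df * (2 * Df - fps_X)"
proof (rule fps_ext)
  fix k :: nat
  have two: "fps_nth (2 * Df - fps_X) i = 2 * fps_nth Df i - (if i = 1 then 1 else 0)" for i
    by (simp add: fps_X_def fps_mult_numeral_left)
  consider "k = 0" | "k = 1" | "k \<ge> 2" by linarith
  then show "fps_nth Df k = fps_nth (fps_X + Df * (2 * Df - fps_X)) k"
  proof cases
    case 1
    then show ?thesis by (simp add: Df_def)
  next
    case 2
    have "fps_nth (Df * (2 * Df - fps_X)) 1 = 0"
      by (simp add: fps_mult_nth two Df_def)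
    then show ?thesis using 2 num_dissections_1 by (simp add: Df_def)
  next
    case 3
    have "fps_nth (Df * (2 * Df - fps_X)) k = (\<Sum>i\<in>{0..k}. fps_nth Df i * fps_nth (2 * Df - fps_X) (k - i))"
      by (rule fps_mult_nth)
    also have "\<dots> = (\<Sum>i\<in>{1..<k}. fps_nth Df i * fps_nth (2 * Df - fps_X) (k - i))"
    proof (rule sum.mono_neutral_right)
      show "\<forall>i\<in>{0..k} - {1..<k}. fps_nth Df i * fps_nth (2 * Df - fps_X) (k - i) = 0"
      proof
        fix i assume "i \<in> {0..k} - {1..<k}"
        then have "i = 0 \<or> i = k" by auto
        then show "fps_nth Df i * fps_nth (2 * Df - fps_X) (k - i) = 0" by (auto simp: Df_def)
      qed
    qed auto
    also have "\<dots> = (\<Sum>i<k-1. fps_nth Df (Suc i) * fps_nth (2 * Df - fps_X) (k - Suc i))"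
      using 3 by (intro sum.reindex_bij_witness[of _ Suc "\<lambda>i. i - 1"]) auto
    also have "\<dots> = (\<Sum>i<k-1. real (num_dissections (Suc i) * (if k - 1 - i = 1 then 1 else 2 * num_dissections (k - 1 - i))))"
    proof (intro sum.cong refl)
      fix i assume i: "i \<in> {..<k-1}"
      then have e: "k - Suc i = k - 1 - i" "k - 1 - i \<noteq> 0" by auto
      show "fps_nth Df (Suc i) * fps_nth (2 * Df - fps_X) (k - Suc i) = real (num_dissections (Suc i) * (if k - 1 - i = 1 then 1 else 2 * num_dissections (k - 1 - i)))"
        unfolding two e(1) using e(2) num_dissections_1 by (auto simp: Df_def)
    qed
    also have "\<dots> = real (num_dissections k)" using num_dissections_recursion[OF 3] by simp
    finally show ?thesis using 3 by (simp add: Df_def)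
  qed
qed

lemma card_bgraphs_fps:
  assumes "finite A" "v \<notin> A" "A \<noteq> {}"
  shows "real (card (bgraphs (insert v A))) = fact (card A) * fps_nth Bf (card A)"
proof (cases "card A \<ge> 2")
  case True
  then have "2 * real (card (bgraphs (insert v A))) = fact (card A) * real (num_dissections (card A))"
    using arg_cong[OF card_bgraphs[OF assms(1,2) True], of real] by simp
  then show ?thesis using True by (simp add: Bf_def Df_def fps_X_def)
next
  case False
  moreover have "card A > 0" using assms by (simp add: card_gt_0_iff)
  ultimately have "card A = 1" by linarith
  then obtain x where "A = {x}" by (auto simp: card_1_singleton_iff)
  then show ?thesis using card_bgraphs_edge[of x v] assms num_dissections_1 by (simp add: Bf_def Df_def fps_X_def)
qed

text \<open>By \<open>rgraphs_split\<close> the numbers satisfy the coefficient form of \<open>Ef' = Bf' Ef\<close>.\<close>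

lemma card_rgraphs_fps:
  assumes "finite U" "v \<notin> U"
  shows "real (card (rgraphs v U)) = fact (card U) * fps_nth Ef (card U)"
  using assms
proof (induction "card U" arbitrary: U rule: less_induct)
  case less
  show ?case
  proof (cases "U = {}")
    case True
    have "nsets {v} 2 = {}" by (simp add: nsets_singleton_iff)
    moreover have "conn {} {v}" by (auto simp: conn_def intro: reach_refl)
    moreover have "onepage {v} {}" by (rule onepage_small) auto
    ultimately have "rgraphs v {} = {{}}" by (auto simp: rgraphs_def pgraphs_def)
    then show ?thesis using True by simp
  next
    case False
    then obtain x where x: "x \<in> U" by auto
    define n where "n = card (U - {x})"
    have cU: "card U = Suc n" unfolding n_def using card_Suc_Diff1[OF less(2) x] by simp
    have "real (card (rgraphs v U)) = (\<Sum>A\<in>Pow (U - {x}). real (card (bgraphs (insert v (insert x A)))) * real (card (rgraphs v (U - insert x A))))"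
      unfolding rgraphs_split[OF less(2) x less(3)] sum_Pow_containing[OF x] by simp
    also have "\<dots> = (\<Sum>A\<in>Pow (U - {x}). (\<lambda>k. fact (Suc k) * fps_nth Bf (Suc k) * (fact (n - k) * fps_nth Ef (n - k))) (card A))"
    proof (intro sum.cong refl)
      fix A assume A: "A \<in> Pow (U - {x})"
      have fA: "finite A" using A less(2) finite_subset by auto
      have cA: "card (insert x A) = Suc (card A)" using A fA by (subst card_insert_disjoint) auto
      have cR: "card (U - insert x A) = n - card A" using A fA cU cA x by (subst card_Diff_subset) auto
      have "card (U - insert x A) < card U" using cR cU by simp
      then have 1: "real (card (rgraphs v (U - insert x A))) = fact (n - card A) * fps_nth Ef (n - card A)"
        using less(1)[of "U - insert x A"] less(2,3) cR by simp
      have 2: "real (card (bgraphs (insert v (insert x A)))) = fact (Suc (card A)) * fps_nth Bf (Suc (card A))"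
        using card_bgraphs_fps[of "insert x A" v] fA A x less(3) cA by auto
      show "real (card (bgraphs (insert v (insert x A)))) * real (card (rgraphs v (U - insert x A))) =
         fact (Suc (card A)) * fps_nth Bf (Suc (card A)) * (fact (n - card A) * fps_nth Ef (n - card A))" unfolding 1 2 ..
    qed
    also have "\<dots> = (\<Sum>k\<le>n. real (n choose k) * (fact (Suc k) * fps_nth Bf (Suc k) * (fact (n - k) * fps_nth Ef (n - k))))"
      using less(2) unfolding n_def by (intro sum_Pow_card) auto
    also have "\<dots> = (\<Sum>k\<le>n. fact n * (real (Suc k) * fps_nth Bf (Suc k) * fps_nth Ef (n - k)))"
      by (intro sum.cong refl fact_choose_Suc) simp
    also have "\<dots> = fact n * (real (Suc n) * fps_nth Ef (Suc n))"
      using fps_exp_compose_rec[of Bf n] by (simp only: sum_distrib_left[symmetric] Bf_0 Ef_def)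
    also have "\<dots> = fact (card U) * fps_nth Ef (card U)" unfolding cU by (simp add: algebra_simps)
    finally show ?thesis .
  qed
qed

text \<open>By \<open>pgraphs_split\<close> the numbers satisfy the coefficient form of \<open>Hf' = Cf' Hf\<close>.\<close>

lemma card_pgraphs_fps:
  fixes V :: "nat set"
  assumes "finite V"
  shows "real (card (pgraphs V)) = fact (card V) * fps_nth Hf (card V)"
  using assms
proof (induction "card V" arbitrary: V rule: less_induct)
  case less
  show ?case
  proof (cases "V = {}")
    case True
    have "nsets ({}::nat set) 2 = {}" by (simp add: nsets_empty_iff)
    moreover have "onepage ({}::nat set) {}" by (rule onepage_small) auto
    ultimately have "pgraphs ({}::nat set) = {{}}" by (auto simp: pgraphs_def)
    then show ?thesis using True by (simp add: Hf_def)
  next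
    case False
    then obtain x where x: "x \<in> V" by auto
    define n where "n = card (V - {x})"
    have cV: "card V = Suc n" unfolding n_def using card_Suc_Diff1[OF less(2) x] by simp
    have "real (card (pgraphs V)) = (\<Sum>A\<in>Pow (V - {x}). real (card (cgraphs (insert x A))) * real (card (pgraphs (V - insert x A))))"
      unfolding pgraphs_split[OF less(2) x] sum_Pow_containing[OF x] by simp
    also have "\<dots> = (\<Sum>A\<in>Pow (V - {x}). (\<lambda>k. fact (Suc k) * fps_nth Cf (Suc k) * (fact (n - k) * fps_nth Hf (n - k))) (card A))"
    proof (intro sum.cong refl)
      fix A assume A: "A \<in> Pow (V - {x})"
      have fA: "finite A" using A less(2) finite_subset by auto
      have cA: "card (insert x A) = Suc (card A)" using A fA by (subst card_insert_disjoint) auto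
      have cR: "card (V - insert x A) = n - card A" using A fA cV cA x by (subst card_Diff_subset) auto
      have "card (V - insert x A) < card V" using cR cV by simp
      then have 1: "real (card (pgraphs (V - insert x A))) = fact (n - card A) * fps_nth Hf (n - card A)"
        using less(1)[of "V - insert x A"] less(2) cR by simp
      have 2: "real (card (cgraphs (insert x A))) = fact (Suc (card A)) * fps_nth Cf (Suc (card A))"
        using card_cgraphs[of "insert x A"] fA cA by (simp add: Cf_def)
      show "real (card (cgraphs (insert x A))) * real (card (pgraphs (V - insert x A))) =
         fact (Suc (card A)) * fps_nth Cf (Suc (card A)) * (fact (n - card A) * fps_nth Hf (n - card A))" unfolding 1 2 ..
    qed
    also have "\<dots> = (\<Sum>k\<le>n. real (n choose k) * (fact (Suc k) * fps_nth Cf (Suc k) * (fact (n - k) * fps_nth Hf (n - k))))"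
      using less(2) unfolding n_def by (intro sum_Pow_card) auto
    also have "\<dots> = (\<Sum>k\<le>n. fact n * (real (Suc k) * fps_nth Cf (Suc k) * fps_nth Hf (n - k)))"
      by (intro sum.cong refl fact_choose_Suc) simp
    also have "\<dots> = fact n * (real (Suc n) * fps_nth Hf (Suc n))"
      using fps_exp_compose_rec[of Cf n] by (simp only: sum_distrib_left[symmetric] Cf_0 Hf_def)
    also have "\<dots> = fact (card V) * fps_nth Hf (card V)" unfolding cV by (simp add: algebra_simps)
    finally show ?thesis .
  qed
qed

lemma deriv_Cf_nth: "fps_nth (fps_deriv Cf) n = real (cnum (Suc n)) / fact n"
  by (simp add: Cf_def)

text \<open>Each root in \<open>U\<close> carries a connected graph whose root is not counted, which contributes a factor \<open>Cf'\<close>.\<close>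

lemma card_fgraphs_fps:
  fixes K :: "nat set"
  assumes "finite K" "U \<subseteq> K"
  shows "real (card (fgraphs U K)) = fact (card K - card U) * fps_nth (fps_deriv Cf ^ card U) (card K - card U)"
  using assms
proof (induction "card U" arbitrary: U K)
  case 0
  then have U: "U = {}" using finite_subset by fastforce
  show ?case
  proof (cases "K = {}")
    case True
    have "nsets ({}::nat set) 2 = {}" by (simp add: nsets_empty_iff)
    moreover have "onepage ({}::nat set) {}" by (rule onepage_small) auto
    ultimately have "fgraphs {} ({}::nat set) = {{}}" by (auto simp: fgraphs_def pgraphs_def)
    then show ?thesis using True U by simp
  next
    case False
    then have "fgraphs {} K = {}" by (auto simp: fgraphs_def)
    moreover have "card K > 0" using False 0 by (simp add: card_gt_0_iff)
    ultimately show ?thesis using U by simp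
  qed
next
  case (Suc k)
  then obtain u where u: "u \<in> U" by fastforce
  have fU: "finite U" using Suc finite_subset by blast
  have ck: "card (U - {u}) = k" using Suc(2) u fU by simp
  define n where "n = card (K - U)"
  have cK: "card K - card U = n" using Suc fU by (simp add: n_def card_Diff_subset)
  have reix: "(\<Sum>A | A \<subseteq> K \<and> A \<inter> U = {u}. f A) = (\<Sum>A\<in>Pow (K - U). f (insert u A))" for f :: "nat set \<Rightarrow> real"
    using u Suc(4) by (intro sum.reindex_bij_witness[of _ "insert u" "\<lambda>A. A - {u}"]) (auto intro!: arg_cong[where f = f])
  have "real (card (fgraphs U K)) = (\<Sum>A\<in>Pow (K - U). real (card (cgraphs (insert u A))) * real (card (fgraphs (U - {u}) (K - insert u A))))"
    unfolding fgraphs_split[OF Suc(3) u Suc(4)] by (simp add: reix)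
  also have "\<dots> = (\<Sum>A\<in>Pow (K - U). (\<lambda>j. real (cnum (Suc j)) * (fact (n - j) * fps_nth (fps_deriv Cf ^ k) (n - j))) (card A))"
  proof (intro sum.cong refl)
    fix A assume A: "A \<in> Pow (K - U)"
    have fA: "finite A" using A Suc(3) finite_subset by auto
    have cA: "card (insert u A) = Suc (card A)" using A fA u by (subst card_insert_disjoint) auto
    have "card (K - insert u A) = card K - Suc (card A)" using A fA cA u Suc(4) by (subst card_Diff_subset) auto
    then have cR: "card (K - insert u A) - card (U - {u}) = n - card A" using cK ck Suc(2) by simp
    have sub: "U - {u} \<subseteq> K - insert u A" using A Suc(4) by auto
    have 1: "real (card (fgraphs (U - {u}) (K - insert u A))) = fact (n - card A) * fps_nth (fps_deriv Cf ^ k) (n - card A)"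
      using Suc(1)[of "U - {u}" "K - insert u A"] ck sub Suc(3) cR by simp
    have 2: "card (cgraphs (insert u A)) = cnum (Suc (card A))" using card_cgraphs[of "insert u A"] fA cA by simp
    show "real (card (cgraphs (insert u A))) * real (card (fgraphs (U - {u}) (K - insert u A))) =
      real (cnum (Suc (card A))) * (fact (n - card A) * fps_nth (fps_deriv Cf ^ k) (n - card A))" unfolding 1 2 ..
  qed
  also have "\<dots> = (\<Sum>j\<le>n. real (n choose j) * (real (cnum (Suc j)) * (fact (n - j) * fps_nth (fps_deriv Cf ^ k) (n - j))))"
    using Suc(3) unfolding n_def by (intro sum_Pow_card) auto
  also have "\<dots> = (\<Sum>j\<le>n. fact n * (fps_nth (fps_deriv Cf) j * fps_nth (fps_deriv Cf ^ k) (n - j)))"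
  proof (intro sum.cong refl)
    fix j assume "j \<in> {..n}"
    then have "fact n = real (n choose j) * fact j * fact (n - j)" by (intro fact_choose[symmetric]) auto
    then show "real (n choose j) * (real (cnum (Suc j)) * (fact (n - j) * fps_nth (fps_deriv Cf ^ k) (n - j))) = fact n * (fps_nth (fps_deriv Cf) j * fps_nth (fps_deriv Cf ^ k) (n - j))"
      unfolding deriv_Cf_nth by (simp del: fps_deriv_nth)
  qed
  also have "\<dots> = fact n * fps_nth (fps_deriv Cf ^ Suc k) n"
    by (simp only: sum_distrib_left[symmetric] power_Suc fps_mult_nth atMost_atLeast0)
  finally show ?case using cK Suc(2) by simp
qed

text \<open>This is \<open>cgraphs_split\<close> summed over the size of the set of block mates of the root.\<close>

lemma deriv_Cf_eq: "fps_deriv Cf = Ef oo (fps_X * fps_deriv Cf)"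
proof (rule fps_ext)
  fix n :: nat
  let ?K = "{..<n}" let ?W = "insert n {..<n}"
  have "card ?W = Suc n" by simp
  have "real (cnum (Suc n)) = real (card (cgraphs ?W))" using card_cgraphs[of ?W] by simp
  also have "\<dots> = (\<Sum>U\<in>Pow ?K. real (card (rgraphs n U)) * real (card (fgraphs U ?K)))"
    using cgraphs_split[of ?K n] by simp
  also have "\<dots> = (\<Sum>U\<in>Pow ?K. (\<lambda>k. fact k * fps_nth Ef k * (fact (n - k) * fps_nth (fps_deriv Cf ^ k) (n - k))) (card U))"
  proof (intro sum.cong refl)
    fix U assume U: "U \<in> Pow ?K"
    then have "finite U" "n \<notin> U" using finite_subset by auto
    then show "real (card (rgraphs n U)) * real (card (fgraphs U ?K)) = fact (card U) * fps_nth Ef (card U) * (fact (n - card U) * fps_nth (fps_deriv Cf ^ card U) (n - card U))"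
      using card_rgraphs_fps[of U n] card_fgraphs_fps[of ?K U] U by simp
  qed
  also have "\<dots> = (\<Sum>k\<le>n. real (n choose k) * (fact k * fps_nth Ef k * (fact (n - k) * fps_nth (fps_deriv Cf ^ k) (n - k))))"
    using sum_Pow_card[of ?K] by simp
  also have "\<dots> = (\<Sum>k\<le>n. fact n * (fps_nth Ef k * fps_nth ((fps_X * fps_deriv Cf) ^ k) n))"
  proof (intro sum.cong refl)
    fix k assume k: "k \<in> {..n}"
    then have 1: "fact n = real (n choose k) * fact k * fact (n - k)" by (intro fact_choose[symmetric]) auto
    have "fps_nth ((fps_X * fps_deriv Cf) ^ k) n = fps_nth (fps_deriv Cf ^ k) (n - k)"
      using k by (simp add: power_mult_distrib fps_X_power_mult_nth)
    then show "real (n choose k) * (fact k * fps_nth Ef k * (fact (n - k) * fps_nth (fps_deriv Cf ^ k) (n - k))) = fact n * (fps_nth Ef k * fps_nth ((fps_X * fps_deriv Cf) ^ k) n)"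
      using 1 by simp
  qed
  also have "\<dots> = fact n * fps_nth (Ef oo (fps_X * fps_deriv Cf)) n"
    by (simp only: sum_distrib_left[symmetric] fps_compose_nth atMost_atLeast0)
  finally show "fps_nth (fps_deriv Cf) n = fps_nth (Ef oo (fps_X * fps_deriv Cf)) n"
    unfolding deriv_Cf_nth by (simp add: field_simps)
qed

text \<open>The inverse of \<open>R\<close> under composition is \<open>P = z / \<phi>\<close>. The coefficient of \<open>\<phi>\<^sup>n (P\<^sup>i)'\<close> at \<open>n - 1\<close> is the residue of
  \<open>(P\<^sup>i)' / P\<^sup>n\<close>, which vanishes for \<open>i \<noteq> n\<close> because then the quotient is, up to a factor, a derivative, and is
  \<open>n\<close> for \<open>i = n\<close>. So multiplying \<open>(R oo P)' = 1\<close> by \<open>\<phi>\<^sup>n\<close> extracts the coefficient of \<open>R\<close>.\<close>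

lemma lagrange_inversion:
  fixes R \<phi> :: "real fps"
  assumes R: "R = fps_X * (\<phi> oo R)" and \<phi>0: "fps_nth \<phi> 0 = 1" and n: "n \<ge> 1"
  shows "real n * fps_nth R n = fps_nth (\<phi> ^ n) (n - 1)"
proof -
  define \<psi> where "\<psi> = inverse \<phi>"
  define P where "P = fps_X * \<psi>"
  have \<psi>: "\<psi> * \<phi> = 1" using \<phi>0 by (simp add: \<psi>_def inverse_mult_eq_1)
  have R0: "fps_nth R 0 = 0" by (subst R) simp
  have \<psi>0: "fps_nth \<psi> 0 = 1" using \<phi>0 by (simp add: \<psi>_def)
  have P0: "fps_nth P 0 = 0" and P1: "fps_nth P 1 = 1" using \<psi>0 by (simp_all add: P_def)
  have "P oo R = R * (\<psi> oo R)" using R0 by (simp add: P_def fps_compose_mult_distrib)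
  also have "\<dots> = fps_X * ((\<phi> oo R) * (\<psi> oo R))" by (subst (1) R) (simp add: mult.assoc)
  also have "(\<phi> oo R) * (\<psi> oo R) = 1" using R0 \<psi> by (metis fps_compose_mult_distrib fps_compose_1 mult.commute)
  finally have PR: "P oo R = fps_X" by simp
  have "R = fps_X oo R" by (simp add: R0)
  also have "\<dots> = (fps_inv P oo P) oo R" using fps_inv[OF P0] P1 by simp
  also have "\<dots> = fps_inv P oo (P oo R)" using P0 R0 by (intro fps_compose_assoc[symmetric]) auto
  also have "\<dots> = fps_inv P" unfolding PR by simp
  finally have RP: "R oo P = fps_X" using fps_inv[OF P0] P1 by simp
  have low: "fps_nth (P ^ i) m = 0" if "m < i" for i m
    using that by (simp add: P_def power_mult_distrib fps_X_power_mult_nth)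
  \<comment> \<open>The quotient \<open>(P\<^sup>i)' / P\<^sup>n\<close> is expressed by powers of \<open>\<phi>\<close>; with \<open>m = n - i\<close>, both terms of \<open>d\<close> below cancel for \<open>m > 0\<close>.\<close>
  have key: "fps_nth (\<phi> ^ n * fps_deriv (P ^ i)) (n - 1) = (if i = n then real n else 0)" if i: "i \<le> n" for i
  proof (cases "i = 0")
    case True then show ?thesis using n by simp
  next
    case False
    then obtain i' where i': "i = Suc i'" by (cases i) auto
    define m where "m = n - i"
    have nm: "n = m + i" using i by (simp add: m_def)
    have PX: "P ^ i * \<phi> ^ i = fps_X ^ i" by (simp add: P_def power_mult_distrib[symmetric] mult.assoc \<psi>)
    have dp: "fps_deriv (\<phi> ^ i) = fps_const (real i) * fps_deriv \<phi> * \<phi> ^ i'"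
      and dx: "fps_deriv ((fps_X :: real fps) ^ i) = fps_const (real i) * fps_X ^ i'"
      using fps_deriv_power[of \<phi> i] fps_deriv_power[of "fps_X :: real fps" i] by (simp_all add: i' del: of_nat_Suc)
    have "fps_deriv (P ^ i * \<phi> ^ i) = fps_const (real i) * fps_X ^ i'" unfolding PX dx ..
    then have a: "fps_deriv (P ^ i) * \<phi> ^ i = fps_const (real i) * fps_X ^ i' - P ^ i * (fps_const (real i) * fps_deriv \<phi> * \<phi> ^ i')"
      unfolding fps_deriv_mult dp by (simp add: algebra_simps)
    have b: "P ^ i * \<phi> ^ i' = fps_X ^ i * \<psi>"
    proof -
      have "P ^ i * \<phi> ^ i' = P ^ i * \<phi> ^ i' * (\<psi> * \<phi>)" using \<psi> by simp
      also have "\<dots> = (P ^ i * \<phi> ^ i) * \<psi>" unfolding i' by (simp add: algebra_simps)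
      finally show ?thesis using PX by simp
    qed
    have "\<phi> ^ n * fps_deriv (P ^ i) = \<phi> ^ m * (fps_deriv (P ^ i) * \<phi> ^ i)" unfolding nm power_add by (simp add: algebra_simps)
    also have "\<dots> = fps_const (real i) * (fps_X ^ i' * \<phi> ^ m) - fps_const (real i) * ((P ^ i * \<phi> ^ i') * fps_deriv \<phi> * \<phi> ^ m)"
      unfolding a by (simp add: algebra_simps)
    finally have c: "\<phi> ^ n * fps_deriv (P ^ i) = fps_const (real i) * (fps_X ^ i' * \<phi> ^ m) - fps_const (real i) * (fps_X ^ i * (\<psi> * fps_deriv \<phi> * \<phi> ^ m))"
      unfolding b by (simp add: mult.assoc)
    have ni: "n - 1 - i' = m" "\<not> n - 1 < i'" using nm i' by auto
    have d: "fps_nth (\<phi> ^ n * fps_deriv (P ^ i)) (n - 1) = real i * fps_nth (\<phi> ^ m) m - real i * fps_nth (fps_X ^ i * (\<psi> * fps_deriv \<phi> * \<phi> ^ m)) (n - 1)"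
      unfolding c using ni by (simp add: fps_X_power_mult_nth)
    show ?thesis
    proof (cases m)
      case 0
      then have "n - 1 < i" using nm n by simp
      then show ?thesis using d 0 nm by (simp add: fps_X_power_mult_nth)
    next
      case (Suc m')
      have "\<psi> * fps_deriv \<phi> * \<phi> ^ m = (\<psi> * \<phi>) * fps_deriv \<phi> * \<phi> ^ m'" unfolding Suc by (simp add: algebra_simps)
      then have e: "\<psi> * fps_deriv \<phi> * \<phi> ^ m = fps_deriv \<phi> * \<phi> ^ m'" using \<psi> by simp
      have "fps_deriv (\<phi> ^ m) = fps_const (real m) * (fps_deriv \<phi> * \<phi> ^ m')"
        using fps_deriv_power[of \<phi> m] by (simp add: Suc mult.assoc del: of_nat_Suc)
      then have "fps_nth (fps_deriv (\<phi> ^ m)) m' = real m * fps_nth (fps_deriv \<phi> * \<phi> ^ m') m'" by (simp del: fps_deriv_nth)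
      moreover have "fps_nth (fps_deriv (\<phi> ^ m)) m' = real m * fps_nth (\<phi> ^ m) m"
        unfolding fps_deriv_nth using Suc by (simp del: power_Suc)
      ultimately have f: "fps_nth (\<phi> ^ m) m = fps_nth (fps_deriv \<phi> * \<phi> ^ m') m'" using Suc by (simp del: power_Suc fps_deriv_nth of_nat_Suc)
      have "n - 1 - i = m'" "\<not> n - 1 < i" using nm Suc by auto
      then have "fps_nth (fps_X ^ i * (\<psi> * fps_deriv \<phi> * \<phi> ^ m)) (n - 1) = fps_nth (\<phi> ^ m) m"
        unfolding e f by (simp add: fps_X_power_mult_nth)
      then show ?thesis using d nm Suc by simp
    qed
  qed
  have coef: "fps_nth (fps_deriv (R oo P)) m = (\<Sum>i\<le>n. fps_nth R i * fps_nth (fps_deriv (P ^ i)) m)" if m: "m \<le> n - 1" for m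
  proof -
    have "fps_nth (fps_deriv (R oo P)) m = (\<Sum>i=0..Suc m. fps_nth R i * fps_nth (fps_deriv (P ^ i)) m)"
      by (simp add: fps_compose_nth sum_distrib_left algebra_simps)
    also have "\<dots> = (\<Sum>i\<le>n. fps_nth R i * fps_nth (fps_deriv (P ^ i)) m)"
    proof (rule sum.mono_neutral_left)
      show "\<forall>i\<in>{..n} - {0..Suc m}. fps_nth R i * fps_nth (fps_deriv (P ^ i)) m = 0"
        using low by simp
    qed (use m n in auto)
    finally show ?thesis .
  qed
  have "fps_nth (\<phi> ^ n) (n - 1) = fps_nth (\<phi> ^ n * fps_deriv (R oo P)) (n - 1)" unfolding RP by simp
  also have "\<dots> = (\<Sum>j=0..n-1. fps_nth (\<phi> ^ n) j * (\<Sum>i\<le>n. fps_nth R i * fps_nth (fps_deriv (P ^ i)) (n - 1 - j)))"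
    unfolding fps_mult_nth by (intro sum.cong refl) (subst coef, auto)
  also have "\<dots> = (\<Sum>i\<le>n. fps_nth R i * fps_nth (\<phi> ^ n * fps_deriv (P ^ i)) (n - 1))"
    unfolding fps_mult_nth sum_distrib_left by (subst sum.swap) (intro sum.cong refl, simp add: algebra_simps)
  also have "\<dots> = (\<Sum>i\<le>n. if i = n then real n * fps_nth R n else 0)"
    by (intro sum.cong refl) (subst key, auto)
  also have "\<dots> = real n * fps_nth R n" by simp
  finally show ?thesis by simp
qed

lemma Cf_nth:
  assumes "n \<ge> 1"
  shows "fps_nth Cf n = fps_nth (Ef ^ n) (n - 1) / real n ^ 2"
proof -
  have "real n * fps_nth (fps_X * fps_deriv Cf) n = fps_nth (Ef ^ n) (n - 1)"
  proof (rule lagrange_inversion[OF _ Ef_0 assms])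
    show "fps_X * fps_deriv Cf = fps_X * (Ef oo fps_X * fps_deriv Cf)" by (subst deriv_Cf_eq) simp
  qed
  moreover have "fps_nth (fps_X * fps_deriv Cf) n = real n * fps_nth Cf n" using assms by simp
  ultimately show ?thesis using assms by (simp add: power2_eq_square field_simps)
qed

lemma num_outerplanar_fps: "real (num_outerplanar n) = fact n * fps_nth Hf n"
proof -
  have "{E. E \<subseteq> nsets {1..n} 2 \<and> outerplanar {1..n} E} = pgraphs {1..n}"
    unfolding pgraphs_def using outerplanar_imp_onepage[of "{1..n}"] onepage_imp_outerplanar[of "{1..n}"] by blast
  then show ?thesis using card_pgraphs_fps[of "{1..n}"] by (simp add: num_outerplanar_def)
qed

section \<open>The generating function of blocks and its saddle point\<close>

text \<open>This is the smaller zero of \<open>1 - 6 x + x\<^sup>2\<close>, where the square root in \<open>B'\<close> is singular.\<close>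

definition sing :: real where "sing = 3 - 2 * sqrt 2"

lemma sing_bounds: "0 < sing" "sing < 1"
proof -
  have "sqrt 2 < 3/2" by (rule real_less_lsqrt) (auto simp: power2_eq_square)
  moreover have "1 < sqrt 2" by simp
  ultimately show "0 < sing" "sing < 1" by (auto simp: sing_def)
qed

lemma discr_factor: "1 - 6 * x + x\<^sup>2 = (3 - x)\<^sup>2 - (2 * sqrt 2)\<^sup>2"
  by (simp add: power2_eq_square algebra_simps)

lemma discr_nonneg: "x \<le> sing \<Longrightarrow> 1 - 6 * x + x\<^sup>2 \<ge> 0"
proof -
  assume "x \<le> sing"
  then have "2 * sqrt 2 \<le> 3 - x" by (simp add: sing_def)
  then have "(2 * sqrt 2)\<^sup>2 \<le> (3 - x)\<^sup>2" by (intro power_mono) auto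
  then show ?thesis unfolding discr_factor by simp
qed

lemma discr_pos: "x < sing \<Longrightarrow> 1 - 6 * x + x\<^sup>2 > 0"
proof -
  assume "x < sing"
  then have "2 * sqrt 2 < 3 - x" by (simp add: sing_def)
  then have "(2 * sqrt 2)\<^sup>2 < (3 - x)\<^sup>2" by (intro power_strict_mono) auto
  then show ?thesis unfolding discr_factor by simp
qed

lemma discr_pos_imp: "x < 3 \<Longrightarrow> 1 - 6 * x + x\<^sup>2 > 0 \<Longrightarrow> x < sing"
proof -
  assume "x < 3" "1 - 6 * x + x\<^sup>2 > 0"
  then have "(2 * sqrt 2)\<^sup>2 < (3 - x)\<^sup>2" unfolding discr_factor by simp
  then have "2 * sqrt 2 < 3 - x" by (rule power_less_imp_less_base) (use \<open>x < 3\<close> in auto)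
  then show ?thesis by (simp add: sing_def)
qed

text \<open>This is the solution of \<open>d = x + d (2 d - x)\<close> that vanishes at \<open>x = 0\<close>.\<close>

definition Dval :: "real \<Rightarrow> real" where "Dval x = (1 + x - sqrt (1 - 6 * x + x\<^sup>2)) / 4"

lemma Dval_props:
  assumes "0 \<le> x" "x \<le> sing"
  shows "Dval x = x + Dval x * (2 * Dval x - x)" "x \<le> 2 * Dval x" "0 \<le> Dval x"
proof -
  let ?s = "sqrt (1 - 6 * x + x\<^sup>2)"
  have s: "?s\<^sup>2 = 1 - 6 * x + x\<^sup>2" using discr_nonneg[OF assms(2)] by simp
  show "Dval x = x + Dval x * (2 * Dval x - x)"
    using s unfolding Dval_def by (simp add: field_simps power2_eq_square)
  have "x < 1" using assms sing_bounds by linarith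
  have "?s \<le> 1 - x" by (rule real_le_lsqrt) (use assms \<open>x < 1\<close> in \<open>auto simp: power2_eq_square algebra_simps\<close>)
  then show "x \<le> 2 * Dval x" by (simp add: Dval_def)
  then show "0 \<le> Dval x" using assms by simp
qed

text \<open>As both constant terms vanish, the terms of the product up to index \<open>N + 1\<close> only involve terms of the
  factors up to index \<open>N\<close>.\<close>

lemma trunc_mult_le:
  fixes f g :: "real fps"
  assumes "\<And>n. fps_nth f n \<ge> 0" "\<And>n. fps_nth g n \<ge> 0" "fps_nth f 0 = 0" "fps_nth g 0 = 0" "x \<ge> 0"
  shows "(\<Sum>k\<le>Suc N. fps_nth (f * g) k * x ^ k) \<le> (\<Sum>k\<le>N. fps_nth f k * x ^ k) * (\<Sum>k\<le>N. fps_nth g k * x ^ k)"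
proof -
  let ?h = "\<lambda>i j. (fps_nth f i * x ^ i) * (fps_nth g j * x ^ j)"
  have "(\<Sum>k\<le>Suc N. fps_nth (f * g) k * x ^ k) = (\<Sum>k\<le>Suc N. \<Sum>i\<le>k. ?h i (k - i))"
  proof (intro sum.cong refl)
    fix k
    have "fps_nth (f * g) k * x ^ k = (\<Sum>i\<le>k. fps_nth f i * fps_nth g (k - i) * x ^ k)"
      by (simp add: fps_mult_nth atMost_atLeast0 sum_distrib_right)
    also have "\<dots> = (\<Sum>i\<le>k. ?h i (k - i))"
    proof (intro sum.cong refl)
      fix i assume "i \<in> {..k}"
      then have "x ^ k = x ^ i * x ^ (k - i)" by (simp add: power_add[symmetric])
      then show "fps_nth f i * fps_nth g (k - i) * x ^ k = ?h i (k - i)" by simp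
    qed
    finally show "fps_nth (f * g) k * x ^ k = (\<Sum>i\<le>k. ?h i (k - i))" .
  qed
  also have "\<dots> = (\<Sum>(i,j)\<in>{(i,j). i + j \<le> Suc N}. ?h i j)" by (rule sum.triangle_reindex_eq[symmetric])
  also have "\<dots> = (\<Sum>(i,j)\<in>{(i,j). i + j \<le> Suc N} \<inter> ({..N} \<times> {..N}). ?h i j)"
  proof (rule sum.mono_neutral_right)
    show "finite {(i::nat,j). i + j \<le> Suc N}"
      by (rule finite_subset[of _ "{..Suc N} \<times> {..Suc N}"]) auto
    show "\<forall>p\<in>{(i, j). i + j \<le> Suc N} - {(i, j). i + j \<le> Suc N} \<inter> {..N} \<times> {..N}. (case p of (i, j) \<Rightarrow> ?h i j) = 0"
    proof (clarify)
      fix i j assume h: "i + j \<le> Suc N" "(i,j) \<notin> {(i, j). i + j \<le> Suc N} \<inter> {..N} \<times> {..N}"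
      then have "i = 0 \<or> j = 0" by auto
      then show "?h i j = 0" using assms by auto
    qed
  qed auto
  also have "\<dots> \<le> (\<Sum>(i,j)\<in>{..N} \<times> {..N}. ?h i j)"
    using assms by (intro sum_mono2) auto
  also have "\<dots> = (\<Sum>k\<le>N. fps_nth f k * x ^ k) * (\<Sum>k\<le>N. fps_nth g k * x ^ k)"
    by (simp add: sum_product sum.cartesian_product)
  finally show ?thesis .
qed

lemma Df_nonneg: "fps_nth Df n \<ge> 0" by (simp add: Df_def)

lemma twoDf_nth: "fps_nth (2 * Df - fps_X) i = 2 * fps_nth Df i - (if i = 1 then 1 else 0)"
  by (simp add: fps_X_def fps_mult_numeral_left)

lemma twoDf_nonneg: "fps_nth (2 * Df - fps_X) n \<ge> 0"
  unfolding twoDf_nth using Df_nonneg[of n] num_dissections_1 by (auto simp: Df_def)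

text \<open>Going from one partial sum of \<open>Df\<close> to the next one is dominated by a step of the monotone iteration
  \<open>d \<mapsto> x + d (2 d - x)\<close>, which cannot exceed its fixed point \<open>Dval x\<close>. This yields convergence up to \<open>sing\<close>.\<close>

lemma Df_partial:
  assumes "0 \<le> x" "x \<le> sing"
  shows "(\<Sum>k\<le>N. fps_nth Df k * x ^ k) \<le> Dval x"
proof (induction N)
  case 0
  then show ?case using Dval_props[OF assms] by (simp add: Df_def)
next
  case (Suc N)
  let ?S = "\<Sum>k\<le>N. fps_nth Df k * x ^ k" let ?T = "\<Sum>k\<le>N. fps_nth (2 * Df - fps_X) k * x ^ k"
  have z: "fps_nth Df 0 = 0" "fps_nth (2 * Df - fps_X) 0 = 0" by (simp_all add: Df_def)
  have T: "?T \<le> 2 * Dval x - x"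
  proof (cases N)
    case 0
    then show ?thesis using Dval_props[OF assms] z by simp
  next
    case (Suc M)
    have "?T = 2 * ?S - (\<Sum>k\<le>N. (if k = 1 then 1 else 0) * x ^ k)"
      unfolding twoDf_nth by (simp add: sum_subtractf sum_distrib_left algebra_simps)
    also have "(\<Sum>k\<le>N. (if k = 1 then 1 else 0) * x ^ k) = (\<Sum>k\<le>N. if k = 1 then x else 0)"
      by (intro sum.cong) auto
    also have "\<dots> = x" using Suc by simp
    finally show ?thesis using Suc.IH by simp
  qed
  have "(\<Sum>k\<le>Suc N. fps_nth Df k * x ^ k) = (\<Sum>k\<le>Suc N. fps_nth (fps_X + Df * (2 * Df - fps_X)) k * x ^ k)"
    using Df_eq by simp
  also have "\<dots> = (\<Sum>k\<le>Suc N. (if k = 1 then x else 0)) + (\<Sum>k\<le>Suc N. fps_nth (Df * (2 * Df - fps_X)) k * x ^ k)"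
    unfolding sum.distrib[symmetric] by (intro sum.cong refl) (simp add: fps_X_def algebra_simps)
  also have "(\<Sum>k\<le>Suc N. (if k = 1 then x else 0)) = x" by simp
  also have "(\<Sum>k\<le>Suc N. fps_nth (Df * (2 * Df - fps_X)) k * x ^ k) \<le> ?S * ?T"
    by (rule trunc_mult_le[OF Df_nonneg twoDf_nonneg z assms(1)])
  also have "?S * ?T \<le> Dval x * (2 * Dval x - x)"
    using Suc T Dval_props[OF assms] assms(1) twoDf_nonneg by (intro mult_mono) (auto intro!: sum_nonneg)
  also have "x + Dval x * (2 * Dval x - x) = Dval x" using Dval_props(1)[OF assms] by simp
  finally show ?case by simp
qed

lemma summable_Df:
  assumes "0 \<le> x" "x \<le> sing"
  shows "summable (\<lambda>k. fps_nth Df k * x ^ k)"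
proof (rule summableI_nonneg_bounded)
  show "(\<Sum>k<n. fps_nth Df k * x ^ k) \<le> Dval x" for n
  proof -
    have "(\<Sum>k<n. fps_nth Df k * x ^ k) \<le> (\<Sum>k\<le>n. fps_nth Df k * x ^ k)"
      using assms Df_nonneg by (intro sum_mono2) auto
    then show ?thesis using Df_partial[OF assms, of n] by linarith
  qed
qed (use assms Df_nonneg in auto)

lemma radius_Df: "fps_conv_radius Df \<ge> ereal sing"
proof -
  have "norm sing \<le> conv_radius (fps_nth Df)"
    using summable_Df[of sing] sing_bounds by (intro conv_radius_geI) auto
  then show ?thesis using sing_bounds by (simp add: fps_conv_radius_def)
qed

lemma radius_ge: "ereal sing \<le> r \<Longrightarrow> norm (x::'a::real_normed_vector) < sing \<Longrightarrow> ereal (norm x) < r"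
  by (meson ereal_less_ereal_Ex less_ereal.simps(1) order_less_le_trans)

text \<open>The sum is one of the two solutions of the quadratic equation, and by \<open>Df_partial\<close> it is at most the smaller one.\<close>

lemma eval_Df:
  assumes "0 \<le> x" "x < sing"
  shows "eval_fps Df x = Dval x"
proof -
  let ?D = "eval_fps Df x"
  have le: "?D \<le> Dval x" unfolding eval_fps_def
  proof (rule suminf_le_const)
    show "summable (\<lambda>n. fps_nth Df n * x ^ n)" using summable_Df assms by simp
    show "(\<Sum>k<n. fps_nth Df k * x ^ k) \<le> Dval x" for n
    proof -
      have "(\<Sum>k<n. fps_nth Df k * x ^ k) \<le> (\<Sum>k\<le>n. fps_nth Df k * x ^ k)"
        using assms Df_nonneg by (intro sum_mono2) auto
      then show ?thesis using Df_partial[of x n] assms by linarith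
    qed
  qed
  have r: "ereal (norm x) < fps_conv_radius Df" using radius_ge[OF radius_Df, of x] assms by simp
  have e2: "2 * Df = fps_const 2 * Df" by (simp add: numeral_fps_const)
  have r2: "ereal (norm x) < fps_conv_radius (2 * Df)" unfolding e2 using r by (subst fps_conv_radius_cmult_left) auto
  have r3: "ereal (norm x) < fps_conv_radius (2 * Df - fps_X)"
    by (rule less_le_trans[OF _ fps_conv_radius_diff]) (use r2 in simp)
  have r4: "ereal (norm x) < fps_conv_radius (Df * (2 * Df - fps_X))"
    by (rule less_le_trans[OF _ fps_conv_radius_mult]) (use r r3 in simp)
  have "?D = eval_fps (fps_X + Df * (2 * Df - fps_X)) x" using Df_eq by simp
  also have "\<dots> = x + ?D * (2 * ?D - x)"
    using r r2 r3 r4 by (simp add: eval_fps_add eval_fps_mult eval_fps_diff)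
  finally have q: "?D = x + ?D * (2 * ?D - x)" .
  let ?s = "sqrt (1 - 6 * x + x\<^sup>2)"
  have s: "?s\<^sup>2 = 1 - 6 * x + x\<^sup>2" "?s > 0" using discr_pos[OF assms(2)] by simp_all
  have "(4 * ?D - (1 + x))\<^sup>2 = ?s\<^sup>2" using q unfolding s(1) by (simp add: power2_eq_square algebra_simps)
  then have "4 * ?D - (1 + x) = ?s \<or> 4 * ?D - (1 + x) = - ?s" by (simp add: power2_eq_iff)
  moreover have "4 * ?D - (1 + x) \<noteq> ?s"
  proof
    assume h: "4 * ?D - (1 + x) = ?s"
    have gen: False if "4 * d - (1 + x) = r" "d \<le> (1 + x - r) / 4" "r > 0" for d r :: real
      using that by (simp add: field_simps)
    show False by (rule gen[OF h le[unfolded Dval_def] s(2)])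
  qed
  ultimately have "4 * ?D - (1 + x) = - ?s" by blast
  then show ?thesis by (simp add: Dval_def)
qed

lemma radius_Bf: "fps_conv_radius Bf \<ge> ereal sing"
proof -
  have "ereal sing \<le> min (fps_conv_radius (fps_X :: real fps)) (fps_conv_radius Df)" using radius_Df by simp
  also have "\<dots> \<le> fps_conv_radius (fps_X + Df)" by (rule fps_conv_radius_add)
  also have "\<dots> = fps_conv_radius Bf" unfolding Bf_def by (subst fps_conv_radius_cmult_left) auto
  finally show ?thesis .
qed

lemma eval_Bf:
  assumes "0 \<le> x" "x < sing"
  shows "eval_fps Bf x = B' x"
proof -
  have r: "ereal (norm x) < fps_conv_radius Df" using radius_ge[OF radius_Df, of x] assms by simp
  have r1: "ereal (norm x) < fps_conv_radius (fps_X + Df)"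
    by (rule less_le_trans[OF _ fps_conv_radius_add]) (use r in simp)
  have "eval_fps Bf x = 1/2 * (x + eval_fps Df x)"
    unfolding Bf_def using r r1 by (simp add: eval_fps_mult eval_fps_add)
  then show ?thesis using eval_Df[OF assms] by (simp add: Dval_def B'_def field_simps)
qed

text \<open>In terms of the exponential generating function \<open>B\<close> of blocks, \<open>b1\<close> and \<open>b2\<close> are its second and third derivative.\<close>

definition b1 :: "real \<Rightarrow> real" where "b1 x = (5 + (3 - x) / sqrt (1 - 6 * x + x\<^sup>2)) / 8"
definition b2 :: "real \<Rightarrow> real" where "b2 x = 1 / (sqrt (1 - 6 * x + x\<^sup>2)) ^ 3"

lemma DERIV_sqrt_discr:
  assumes "x < sing"
  shows "((\<lambda>x. sqrt (1 - 6 * x + x\<^sup>2)) has_real_derivative (x - 3) / sqrt (1 - 6 * x + x\<^sup>2)) (at x)"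
  using discr_pos[OF assms] by (auto intro!: derivative_eq_intros simp: field_simps)

lemma DERIV_B': "x < sing \<Longrightarrow> (B' has_real_derivative b1 x) (at x)"
  unfolding B'_def[abs_def] b1_def
  by (rule derivative_eq_intros DERIV_sqrt_discr refl | assumption | simp)+ (simp add: field_simps diff_divide_distrib)

lemma DERIV_b1: 
  assumes "x < sing" shows "(b1 has_real_derivative b2 x) (at x)"
proof -
  let ?s = "sqrt (1 - 6 * x + x\<^sup>2)"
  have s: "?s > 0" "?s\<^sup>2 = 1 - 6 * x + x\<^sup>2" using discr_pos[OF assms] by simp_all
  have num: "((\<lambda>x. 3 - x) has_real_derivative (-1)) (at x)"
    by (auto intro!: derivative_eq_intros)
  have nz: "?s \<noteq> 0" using s(1) by (rule less_imp_neq[symmetric])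
  have "(b1 has_real_derivative (0 + ((-1) * ?s - (3 - x) * ((x - 3) / ?s)) / (?s * ?s)) / 8) (at x)"
    unfolding b1_def[abs_def]
    by (rule DERIV_cdivide[OF DERIV_add[OF DERIV_const DERIV_divide[OF num DERIV_sqrt_discr[OF assms] nz]]])
  moreover have "((-1) * ?s - (3 - x) * ((x - 3) / ?s)) / (?s * ?s) / 8 = b2 x"
  proof -
    have "((-1) * ?s - (3 - x) * ((x - 3) / ?s)) = ((3 - x)\<^sup>2 - ?s\<^sup>2) / ?s"
      using s(1) by (simp add: field_simps power2_eq_square)
    also have "(3 - x)\<^sup>2 - ?s\<^sup>2 = 8" unfolding s(2) by (simp add: power2_eq_square algebra_simps)
    finally have eq: "(-1) * ?s - (3 - x) * ((x - 3) / ?s) = 8 / ?s" .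
    have gen: "8 / r / (r * r) / 8 = 1 / r ^ 3" if "r > 0" for r :: real
      using that by (simp add: power3_eq_cube)
    show ?thesis unfolding eq b2_def by (rule gen[OF s(1)])
  qed
  ultimately show ?thesis by (simp only: add_0)
qed

text \<open>\<open>K1\<close> and \<open>K2\<close> arise from \<open>Bf\<close> by applying the operator \<open>x d/dx\<close> once and twice.\<close>

definition K1 :: "real fps" where "K1 = fps_X * fps_deriv Bf"
definition K2 :: "real fps" where "K2 = fps_X * fps_deriv K1"

lemma K1_nth: "fps_nth K1 n = real n * fps_nth Bf n" by (cases n) (simp_all add: K1_def)
lemma K2_nth: "fps_nth K2 n = real n ^ 2 * fps_nth Bf n"
  by (cases n) (simp_all add: K2_def K1_nth power2_eq_square)

lemma radius_X_deriv:
  fixes f :: "real fps"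
  assumes "ereal sing \<le> fps_conv_radius f"
  shows "ereal sing \<le> fps_conv_radius (fps_deriv f)" "ereal sing \<le> fps_conv_radius (fps_X * fps_deriv f)"
proof -
  show 1: "ereal sing \<le> fps_conv_radius (fps_deriv f)" using fps_conv_radius_deriv[of f] assms by (rule order_trans[rotated])
  have "ereal sing \<le> min (fps_conv_radius (fps_X :: real fps)) (fps_conv_radius (fps_deriv f))" using 1 by simp
  also have "\<dots> \<le> fps_conv_radius (fps_X * fps_deriv f)" by (rule fps_conv_radius_mult)
  finally show "ereal sing \<le> fps_conv_radius (fps_X * fps_deriv f)" .
qed

lemma eval_X_deriv:
  fixes f :: "real fps"
  assumes r: "ereal sing \<le> fps_conv_radius f" and x: "0 < x" "x < sing"
    and g: "\<And>y. 0 < y \<Longrightarrow> y < sing \<Longrightarrow> eval_fps f y = g y" and d: "(g has_real_derivative d) (at x)"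
  shows "eval_fps (fps_X * fps_deriv f) x = x * d"
proof -
  have "(eval_fps f has_real_derivative eval_fps (fps_deriv f) x) (at x)"
    using radius_ge[OF r, of x] x by (intro has_field_derivative_eval_fps) auto
  then have "(g has_real_derivative eval_fps (fps_deriv f) x) (at x)"
    by (rule has_field_derivative_transform_within_open[where S = "{0<..<sing}"]) (use g x in auto)
  then have "eval_fps (fps_deriv f) x = d" using d DERIV_unique by blast
  then show ?thesis using radius_ge[OF radius_X_deriv(1)[OF r], of x] x by (simp add: eval_fps_mult)
qed

lemma radius_K: "ereal sing \<le> fps_conv_radius K1" "ereal sing \<le> fps_conv_radius K2"
proof -
  show 1: "ereal sing \<le> fps_conv_radius K1" unfolding K1_def by (rule radius_X_deriv(2)[OF radius_Bf])
  show "ereal sing \<le> fps_conv_radius K2" unfolding K2_def by (rule radius_X_deriv(2)[OF 1])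
qed

lemma eval_K1: "0 < x \<Longrightarrow> x < sing \<Longrightarrow> eval_fps K1 x = x * b1 x"
  unfolding K1_def by (rule eval_X_deriv[OF radius_Bf _ _ _ DERIV_B']) (auto simp: eval_Bf)

lemma eval_K2: "0 < x \<Longrightarrow> x < sing \<Longrightarrow> eval_fps K2 x = x * b1 x + x\<^sup>2 * b2 x"
proof -
  assume x: "0 < x" "x < sing"
  have "((\<lambda>x. x * b1 x) has_real_derivative (b1 x + x * b2 x)) (at x)"
    using DERIV_mult[OF DERIV_ident DERIV_b1[OF x(2)]] by (simp add: mult.commute)
  then have "eval_fps K2 x = x * (b1 x + x * b2 x)"
    unfolding K2_def using x by (intro eval_X_deriv[OF radius_K(1)]) (auto simp: eval_K1)
  then show ?thesis by (simp add: algebra_simps power2_eq_square)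
qed

definition quart :: "real \<Rightarrow> real" where "quart u = 3 * u ^ 4 - 28 * u ^ 3 + 70 * u ^ 2 - 58 * u + 8"

lemma quart_decreasing:
  assumes "0 \<le> u" "u < v" "v \<le> 1/5" shows "quart v < quart u"
proof (rule DERIV_neg_imp_decreasing[OF assms(2)])
  fix x assume x: "u \<le> x" "x \<le> v"
  have "(quart has_real_derivative 12 * x ^ 3 - 84 * x ^ 2 + 140 * x - 58) (at x)"
    unfolding quart_def[abs_def] by (auto intro!: derivative_eq_intros)
  moreover have "12 * x ^ 3 - 84 * x ^ 2 + 140 * x - 58 < 0"
  proof -
    have gen: "12 * a - 84 * b + 140 * c - 58 < 0" if "a \<le> 1/125" "b \<ge> 0" "c \<le> 1/5" for a b c :: real
      using that by linarith
    have "x ^ 3 \<le> (1/5) ^ 3" using x assms by (intro power_mono) auto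
    also have "(1/5 :: real) ^ 3 = 1/125" by (simp add: power3_eq_cube)
    finally show ?thesis using x assms by (intro gen) auto
  qed
  ultimately show "\<exists>y. (quart has_real_derivative y) (at x) \<and> y < 0" by blast
qed

text \<open>The polynomial decreases on \<open>[0, 1/5]\<close>, so a sign change there brackets its smallest positive root.\<close>

lemma tau_root: "quart tau = 0" "0.17076498681 < tau" "tau < 0.17076498682"
proof -
  have lo: "quart 0.17076498681 > 0" and hi: "quart 0.17076498682 < 0" by (simp_all add: quart_def power_numeral_reduce)
  have "\<exists>x\<ge>0.17076498681. x \<le> 0.17076498682 \<and> quart x = 0"
  proof (rule IVT2')
    show "continuous_on {0.17076498681..0.17076498682} quart" unfolding quart_def[abs_def] by (intro continuous_intros)
  qed (use lo hi in auto)
  then obtain t where t: "t \<ge> 0.17076498681" "t \<le> 0.17076498682" "quart t = 0" by blast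
  let ?S = "{u. 0 < u \<and> 3 * u ^ 4 - 28 * u ^ 3 + 70 * u ^ 2 - 58 * u + 8 = (0::real)}"
  have S: "?S = {u. 0 < u \<and> quart u = 0}" by (simp add: quart_def)
  have "finite {u. poly [:8, -58, 70, -28, 3:] u = (0::real)}" by (rule poly_roots_finite) simp
  moreover have "?S \<subseteq> {u. poly [:8, -58, 70, -28, 3:] u = 0}" by (auto simp: algebra_simps power_numeral_reduce)
  ultimately have fin: "finite ?S" using finite_subset by blast
  have "Min ?S = t"
  proof (rule Min_eqI[OF fin])
    show "t \<in> ?S" unfolding S using t by simp
    fix u assume "u \<in> ?S"
    then have u: "0 < u" "quart u = 0" unfolding S by auto
    show "t \<le> u"
    proof (rule ccontr)
      assume "\<not> t \<le> u"
      then have "quart t < quart u" using u t by (intro quart_decreasing) auto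
      then show False using u t by simp
    qed
  qed
  then have "tau = t" by (simp add: tau_def)
  moreover have "t \<noteq> 0.17076498681" using t(3) lo by (metis less_irrefl)
  moreover have "t \<noteq> 0.17076498682" using t(3) hi by (metis less_irrefl)
  ultimately show "quart tau = 0" "0.17076498681 < tau" "tau < 0.17076498682" using t by auto
qed

lemma tau_pos: "0 < tau" using tau_root by simp

lemma sqrt_discr_tau: "sqrt (1 - 6 * tau + tau\<^sup>2) = tau * (3 - tau) / (8 - 5 * tau)"
proof -
  have "(8 - 5 * tau)\<^sup>2 * (1 - 6 * tau + tau\<^sup>2) = (tau * (3 - tau))\<^sup>2 - 0 + 8 * quart tau"
    unfolding quart_def by (simp add: power2_eq_square power_numeral_reduce algebra_simps)
  then have "1 - 6 * tau + tau\<^sup>2 = (tau * (3 - tau) / (8 - 5 * tau))\<^sup>2"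
    using tau_root by (simp add: power_divide field_simps)
  then show ?thesis using tau_root by (intro real_sqrt_unique) auto
qed

lemma tau_less_sing: "tau < sing"
proof (rule discr_pos_imp)
  have "sqrt (1 - 6 * tau + tau\<^sup>2) > 0" unfolding sqrt_discr_tau using tau_root by simp
  then show "1 - 6 * tau + tau\<^sup>2 > 0" by simp
qed (use tau_root in simp)

text \<open>Equivalently, the derivative of \<open>Psi\<close> vanishes at \<open>tau\<close>. The equation \<open>u B''(u) = 1\<close> amounts to the formula
  \<open>sqrt_discr_tau\<close> for the square root, and squaring that formula produces the quartic equation that defines \<open>tau\<close>.\<close>

lemma saddle: "tau * b1 tau = 1"
proof -
  have "tau * (3 - tau) \<noteq> 0" "8 - 5 * tau \<noteq> 0" using tau_root by auto
  then show ?thesis unfolding b1_def sqrt_discr_tau using tau_root by (simp add: field_simps)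
qed

text \<open>The second derivative of \<open>\<theta> \<mapsto> B'(tau e\<^sup>i\<^sup>\<theta>) - i \<theta>\<close> at \<open>0\<close> is \<open>- sig2\<close>: it is the sum of the terms
  \<open>- n\<^sup>2 Bf\<^sub>n tau\<^sup>n\<close> (\<open>sums_tau\<close>).\<close>

definition sig2 :: real where "sig2 = 1 + tau\<^sup>2 * b2 tau"

lemma sig2_pos: "sig2 \<ge> 1"
  unfolding sig2_def b2_def using discr_pos[OF tau_less_sing] by simp

lemma Bf_nonneg: "fps_nth Bf n \<ge> 0"
  using Df_nonneg[of n] by (simp add: Bf_def fps_X_def)

lemma Bf_1: "fps_nth Bf 1 = 1" using num_dissections_1 by (simp add: Bf_def Df_def)

lemma sums_tau:
  "(\<lambda>n. fps_nth Bf n * tau ^ n) sums B' tau"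
  "(\<lambda>n. real n * fps_nth Bf n * tau ^ n) sums 1"
  "(\<lambda>n. real n ^ 2 * fps_nth Bf n * tau ^ n) sums sig2"
proof -
  have t: "0 < tau" "tau < sing" using tau_pos tau_less_sing by auto
  show "(\<lambda>n. fps_nth Bf n * tau ^ n) sums B' tau"
    using sums_eval_fps[of tau Bf] radius_ge[OF radius_Bf, of tau] eval_Bf[of tau] t by simp
  show "(\<lambda>n. real n * fps_nth Bf n * tau ^ n) sums 1"
    using sums_eval_fps[of tau K1] radius_ge[OF radius_K(1), of tau] eval_K1[of tau] t saddle by (simp add: K1_nth)
  show "(\<lambda>n. real n ^ 2 * fps_nth Bf n * tau ^ n) sums sig2"
    using sums_eval_fps[of tau K2] radius_ge[OF radius_K(2), of tau] eval_K2[of tau] t saddle by (simp add: K2_nth sig2_def)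
qed

lemma rho_pos: "rho > 0" by (simp add: rho_def Psi_def tau_pos)

section \<open>Saddle point asymptotics for connected graphs\<close>

definition cBf :: "complex fps" where "cBf = Abs_fps (\<lambda>n. complex_of_real (fps_nth Bf n))"
definition cB :: "complex \<Rightarrow> complex" where "cB = eval_fps cBf"

lemma radius_cBf: "fps_conv_radius cBf \<ge> ereal sing"
proof -
  have "conv_radius (fps_nth cBf) = conv_radius (fps_nth Bf)"
    unfolding conv_radius_def cBf_def by simp
  then show ?thesis using radius_Bf by (simp add: fps_conv_radius_def)
qed

lemma holo_cB: "cB holomorphic_on ball 0 sing"
  unfolding cB_def
  by (rule holomorphic_on_eval_fps) (rule ball_eball_mono[OF radius_cBf])

lemma deriv_Ef: "fps_deriv Ef = Ef * fps_deriv Bf"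
  unfolding Ef_def using fps_compose_deriv[of Bf "fps_exp 1"] by simp

lemma Ef_power_rec:
  "real (Suc m) * fps_nth (Ef ^ n) (Suc m) =
     (\<Sum>j\<le>m. real n * (real (Suc j) * fps_nth Bf (Suc j)) * fps_nth (Ef ^ n) (m - j))"
proof (cases n)
  case 0
  then show ?thesis by simp
next
  case (Suc n')
  have "fps_deriv (Ef ^ n) = fps_const (real n) * (fps_deriv Bf * Ef ^ n)"
    using fps_deriv_power[of Ef n] by (simp add: Suc deriv_Ef mult_ac del: of_nat_Suc)
  then have "fps_nth (fps_deriv (Ef ^ n)) m = fps_nth (fps_const (real n) * (fps_deriv Bf * Ef ^ n)) m" by simp
  then show ?thesis by (simp add: fps_mult_nth[of "fps_deriv Bf"] atMost_atLeast0 sum_distrib_left mult.assoc del: of_nat_Suc)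
qed

definition en :: "nat \<Rightarrow> complex \<Rightarrow> complex" where "en n w = exp (of_nat n * cB w)"

lemma holo_en: "en n holomorphic_on ball 0 sing"
  unfolding en_def[abs_def] by (intro holomorphic_intros holo_cB)

text \<open>The Taylor coefficients of \<open>en n\<close> and the coefficients of \<open>Ef ^ n\<close> obey the same recursion, that of the equation
  \<open>F' = n B'' F\<close>, with the same initial value.\<close>

lemma en_deriv:
  "(deriv ^^ m) (en n) 0 = fact m * complex_of_real (fps_nth (Ef ^ n) m)"
proof -
  define F where "F = fps_expansion (en n) 0"
  have cn: "fps_nth cBf k = complex_of_real (fps_nth Bf k)" for k by (simp add: cBf_def)
  have F: "en n has_fps_expansion F" unfolding F_def
    by (rule has_fps_expansion_fps_expansion[OF open_ball _ holo_en]) (use sing_bounds in simp)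
  have r: "fps_conv_radius cBf > 0" using radius_cBf sing_bounds
    by (metis ereal_less(2) order_less_le_trans)
  have B: "cB has_fps_expansion cBf" unfolding cB_def by (rule eval_fps_has_fps_expansion[OF r])
  have dB: "deriv cB has_fps_expansion fps_deriv cBf" by (rule has_fps_expansion_deriv[OF B])
  have d1: "deriv (en n) has_fps_expansion fps_deriv F" by (rule has_fps_expansion_deriv[OF F])
  have d2: "(\<lambda>w. of_nat n * (deriv cB w * en n w)) has_fps_expansion fps_const (of_nat n) * (fps_deriv cBf * F)"
    by (intro has_fps_expansion_cmult_left has_fps_expansion_mult dB F)
  have "eventually (\<lambda>w. w \<in> ball 0 sing) (nhds (0::complex))"
    using sing_bounds by (intro eventually_nhds_in_open) auto
  then have ev: "eventually (\<lambda>w. deriv (en n) w = of_nat n * (deriv cB w * en n w)) (nhds 0)"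
  proof eventually_elim
    case (elim w)
    have "(cB has_field_derivative deriv cB w) (at w)"
      using elim holomorphic_derivI[OF holo_cB open_ball elim] by simp
    then have "(en n has_field_derivative (en n w * (of_nat n * deriv cB w))) (at w)"
      unfolding en_def[abs_def] by (auto intro!: derivative_eq_intros)
    then show ?case by (simp add: DERIV_imp_deriv algebra_simps)
  qed
  have "deriv (en n) has_fps_expansion fps_const (of_nat n) * (fps_deriv cBf * F)"
    using d2 has_fps_expansion_cong[OF ev refl] by blast
  then have eq: "fps_deriv F = fps_const (of_nat n) * (fps_deriv cBf * F)"
    using d1 fps_expansion_unique_complex by blast
  have cB0: "cB 0 = 0" by (simp add: cB_def eval_fps_at_0 cBf_def)
  have F0: "fps_nth F 0 = 1" using fps_nth_fps_expansion[OF F, of 0] cB0 by (simp add: en_def)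
  have "fps_nth F m = complex_of_real (fps_nth (Ef ^ n) m)" for m
  proof (induction m rule: less_induct)
    case (less m)
    show ?case
    proof (cases m)
      case 0
      then show ?thesis using F0 by (simp add: fps_nth_power_0)
    next
      case (Suc m')
      have "of_nat (Suc m') * fps_nth F (Suc m') = fps_nth (fps_deriv F) m'" by simp
      also have "\<dots> = (\<Sum>j\<le>m'. of_nat n * (of_nat (Suc j) * complex_of_real (fps_nth Bf (Suc j))) * fps_nth F (m' - j))"
        unfolding eq by (simp add: fps_mult_nth[of "fps_deriv cBf"] atMost_atLeast0 sum_distrib_left mult.assoc cn del: of_nat_Suc)
      also have "\<dots> = (\<Sum>j\<le>m'. of_nat n * (of_nat (Suc j) * complex_of_real (fps_nth Bf (Suc j))) * complex_of_real (fps_nth (Ef ^ n) (m' - j)))"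
        using less Suc by (intro sum.cong refl) simp
      also have "\<dots> = complex_of_real (\<Sum>j\<le>m'. real n * (real (Suc j) * fps_nth Bf (Suc j)) * fps_nth (Ef ^ n) (m' - j))"
        by (simp del: of_nat_Suc)
      also have "\<dots> = complex_of_real (real (Suc m') * fps_nth (Ef ^ n) (Suc m'))" unfolding Ef_power_rec ..
      finally have "of_nat (Suc m') * fps_nth F (Suc m') = of_nat (Suc m') * complex_of_real (fps_nth (Ef ^ n) (Suc m'))"
        by (simp del: of_nat_Suc)
      then show ?thesis using Suc by (simp del: of_nat_Suc)
    qed
  qed
  then show ?thesis using fps_nth_fps_expansion[OF F, of m] by (simp add: field_simps)
qed

lemma tau_cis_ball: "norm (complex_of_real tau * cis \<theta>) < sing"
  using tau_pos tau_less_sing by (simp add: norm_mult)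

text \<open>This is the Cauchy integral formula on the circle of radius \<open>tau\<close>. The circle is parametrised from \<open>- tau\<close>, so that
  the saddle point \<open>tau\<close> is reached at \<open>1/2\<close>, in the middle of the interval.\<close>

lemma coeff_integral:
  "integral {0..1} (\<lambda>x. en n (- (complex_of_real tau * cis (2 * pi * x))) * cis (- (2 * pi * real m * x))) =
     complex_of_real tau ^ m * (-1) ^ m * complex_of_real (fps_nth (Ef ^ n) m)"
proof -
  let ?f = "\<lambda>w. en n (- w)"
  have hf: "?f holomorphic_on ball 0 sing"
  proof -
    have "(en n \<circ> uminus) holomorphic_on ball 0 sing"
      by (rule holomorphic_on_compose_gen[OF _ holo_en]) (auto intro!: holomorphic_intros)
    then show ?thesis by (simp add: o_def)
  qed
  have cb: "cball 0 tau \<subseteq> ball (0::complex) sing" using tau_less_sing by auto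
  have "contour_integral (circlepath 0 tau) (\<lambda>u. ?f u / (u - 0) ^ Suc m) = (2 * pi * \<i>) * (deriv ^^ m) ?f 0 / fact m"
  proof (rule Cauchy_contour_integral_circlepath)
    show "continuous_on (cball 0 tau) ?f" using holomorphic_on_imp_continuous_on[OF holomorphic_on_subset[OF hf cb]] .
    show "?f holomorphic_on ball 0 tau" by (rule holomorphic_on_subset[OF hf]) (use tau_less_sing in auto)
  qed (use tau_pos in auto)
  moreover have "(deriv ^^ m) ?f 0 = (-1) ^ m * (deriv ^^ m) (en n) 0"
  proof -
    have "(deriv ^^ m) (\<lambda>w. en n (-1 * w)) 0 = (-1) ^ m * (deriv ^^ m) (en n) (-1 * 0)"
      by (rule higher_deriv_compose_linear[OF holo_en, of "ball 0 sing"]) (use sing_bounds in auto)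
    then show ?thesis by simp
  qed
  ultimately have 1: "contour_integral (circlepath 0 tau) (\<lambda>u. ?f u / u ^ Suc m) = (2 * pi * \<i>) * ((-1) ^ m * complex_of_real (fps_nth (Ef ^ n) m))"
    unfolding en_deriv by simp
  have "contour_integral (circlepath 0 tau) (\<lambda>u. ?f u / u ^ Suc m) =
    integral {0..1} (\<lambda>x. ?f (circlepath 0 tau x) / circlepath 0 tau x ^ Suc m * vector_derivative (circlepath 0 tau) (at x))"
    by (rule contour_integral_integral)
  also have "\<dots> = integral {0..1} (\<lambda>x. (2 * pi * \<i> / complex_of_real tau ^ m) * (en n (- (complex_of_real tau * cis (2 * pi * x))) * cis (- (2 * pi * real m * x))))"
  proof (rule integral_cong)
    fix x :: real
    have e: "exp (2 * complex_of_real pi * \<i> * complex_of_real x) = cis (2 * pi * x)"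
      by (simp only: cis_conv_exp) (simp add: mult_ac)
    have c: "circlepath 0 tau x = complex_of_real tau * cis (2 * pi * x)" unfolding circlepath e by simp
    have v: "vector_derivative (circlepath 0 tau) (at x) = 2 * pi * \<i> * complex_of_real tau * cis (2 * pi * x)"
      using has_vector_derivative_circlepath[of 0 tau x] unfolding e by (simp add: vector_derivative_at)
    have p: "cis (2 * pi * x) ^ m * cis (- (2 * pi * real m * x)) = 1"
      by (simp add: Complex.DeMoivre cis_mult mult_ac)
    have nz: "complex_of_real tau \<noteq> 0" "cis (2 * pi * x) \<noteq> 0" using tau_pos by simp_all
    have "(complex_of_real tau * cis (2 * pi * x)) / (complex_of_real tau * cis (2 * pi * x)) ^ Suc m = cis (- (2 * pi * real m * x)) / complex_of_real tau ^ m"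
      using nz p by (simp add: power_mult_distrib field_simps)
    then show "?f (circlepath 0 tau x) / circlepath 0 tau x ^ Suc m * vector_derivative (circlepath 0 tau) (at x) =
      (2 * pi * \<i> / complex_of_real tau ^ m) * (en n (- (complex_of_real tau * cis (2 * pi * x))) * cis (- (2 * pi * real m * x)))"
      unfolding c v by (simp add: mult_ac divide_inverse del: power_Suc) 
  qed
  also have "\<dots> = (2 * pi * \<i> / complex_of_real tau ^ m) * integral {0..1} (\<lambda>x. en n (- (complex_of_real tau * cis (2 * pi * x))) * cis (- (2 * pi * real m * x)))"
    by (rule integral_mult_right)
  finally show ?thesis using 1 tau_pos by (simp add: field_simps)
qed

text \<open>This is the exponent of the integrand per unit of \<open>n\<close>, normalised to vanish at the saddle point.\<close>

definition phi :: "real \<Rightarrow> complex" where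
  "phi \<theta> = cB (complex_of_real tau * cis \<theta>) - complex_of_real (B' tau) - \<i> * complex_of_real \<theta>"

text \<open>This is the integrand after the substitution \<open>x = 1/2 + s / sqrt n\<close>, which magnifies the neighbourhood of the
  saddle point, extended by zero to the real line.\<close>

definition Gint :: "nat \<Rightarrow> real \<Rightarrow> complex" where
  "Gint n s = indicator {- (sqrt (real n) / 2) .. sqrt (real n) / 2} s *\<^sub>R
     (exp (of_nat n * phi (2 * pi * s / sqrt (real n))) * cis (2 * pi * s / sqrt (real n)))"

lemma continuous_en_circle: "continuous_on UNIV (\<lambda>x. en n (- (complex_of_real tau * cis (2 * pi * x))))"
proof -
  have "continuous_on UNIV (\<lambda>x. - (complex_of_real tau * cis (2 * pi * x)))" by (intro continuous_intros)
  moreover have "range (\<lambda>x. - (complex_of_real tau * cis (2 * pi * x))) \<subseteq> ball 0 sing" using tau_cis_ball by auto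
  ultimately show ?thesis
    using continuous_on_compose2[OF holomorphic_on_imp_continuous_on[OF holo_en]] by blast
qed

lemma cis_shift: "- cis (2 * pi * (1/2 + y)) = cis (2 * pi * y)"
proof -
  have "2 * pi * (1/2 + y) = pi + 2 * pi * y" by (simp add: algebra_simps)
  then have "cis (2 * pi * (1/2 + y)) = cis pi * cis (2 * pi * y)" by (simp only: cis_mult)
  then show ?thesis by simp
qed

lemma coeff_eq_Gint:
  assumes n: "n \<ge> 1"
  shows "complex_of_real (sqrt (real n) * tau ^ (n - 1) * exp (- (real n * B' tau)) * fps_nth (Ef ^ n) (n - 1)) = (LINT s|lborel. Gint n s)"
proof -
  let ?m = "n - 1" let ?q = "sqrt (real n)"
  let ?h = "\<lambda>x. en n (- (complex_of_real tau * cis (2 * pi * x))) * cis (- (2 * pi * real ?m * x))"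
  have q: "?q > 0" using n by simp
  have ch: "continuous_on {0..1} ?h"
    by (intro continuous_intros continuous_on_subset[OF continuous_en_circle]) auto
  have "integral {0..1} ?h = (LINT x:{0..1}|lborel. ?h x)"
    using set_borel_integral_eq_integral(2)[OF borel_integrable_atLeastAtMost'[OF ch]] by simp
  also have "\<dots> = (LINT x|lborel. indicator {0..1} x *\<^sub>R ?h x)" by (simp add: set_lebesgue_integral_def)
  also have "\<dots> = \<bar>1 / ?q\<bar> *\<^sub>R (LINT s|lborel. indicator {0..1} (1/2 + 1/?q * s) *\<^sub>R ?h (1/2 + 1/?q * s))"
    using q by (intro lborel_integral_real_affine) auto
  also have "(LINT s|lborel. indicator {0..1} (1/2 + 1/?q * s) *\<^sub>R ?h (1/2 + 1/?q * s)) =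
     (LINT s|lborel. (-1) ^ ?m * exp (of_nat n * complex_of_real (B' tau)) * Gint n s)"
  proof (rule Bochner_Integration.integral_cong[OF refl])
    fix s :: real
    let ?\<theta> = "2 * pi * s / ?q"
    have t: "2 * pi * (1/?q * s) = ?\<theta>" by simp
    have ind: "indicator {0..1} (1/2 + 1/?q * s) = (indicator {- (?q/2) .. ?q/2} s :: real)"
      using q by (auto simp: indicator_def field_simps)
    have a1: "- (complex_of_real tau * cis (2 * pi * (1/2 + 1/?q * s))) = complex_of_real tau * cis ?\<theta>"
      using cis_shift[of "1/?q * s"] unfolding t by (metis mult_minus_right)
    have "- (2 * pi * real ?m * (1/2 + 1/?q * s)) = real ?m * (- pi) + - (real ?m * ?\<theta>)" by (simp add: field_simps)
    then have "cis (- (2 * pi * real ?m * (1/2 + 1/?q * s))) = cis (- pi) ^ ?m * cis (- (real ?m * ?\<theta>))"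
      unfolding Complex.DeMoivre by (simp only: cis_mult)
    also have "cis (- pi) = -1" by (simp add: complex_eq_iff)
    also have "cis (- (real ?m * ?\<theta>)) = cis (- (real n * ?\<theta>)) * cis ?\<theta>"
    proof -
      have "- ((a - 1) * t) = - (a * t) + t" for a t :: real by (simp add: algebra_simps)
      moreover have "real ?m = real n - 1" using n by (simp add: of_nat_diff)
      ultimately show ?thesis by (simp only: cis_mult)
    qed
    finally have a2: "cis (- (2 * pi * real ?m * (1/2 + 1/?q * s))) = (-1) ^ ?m * (cis (- (real n * ?\<theta>)) * cis ?\<theta>)" .
    have a3: "en n (complex_of_real tau * cis ?\<theta>) * cis (- (real n * ?\<theta>)) = exp (of_nat n * complex_of_real (B' tau)) * exp (of_nat n * phi ?\<theta>)"
    proof -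
      have "cis (- (real n * ?\<theta>)) = exp (- (of_nat n * (\<i> * complex_of_real ?\<theta>)))"
        by (simp add: cis_conv_exp mult_ac)
      then show ?thesis unfolding en_def exp_add[symmetric] phi_def by (simp add: exp_add[symmetric] algebra_simps)
    qed
    show "indicator {0..1} (1/2 + 1/?q * s) *\<^sub>R ?h (1/2 + 1/?q * s) = (-1) ^ ?m * exp (of_nat n * complex_of_real (B' tau)) * Gint n s"
      unfolding ind a1 a2 Gint_def using a3 by (simp add: mult_ac scaleR_conv_of_real)
  qed
  also have "\<dots> = (-1) ^ ?m * exp (of_nat n * complex_of_real (B' tau)) * (LINT s|lborel. Gint n s)"
    by (rule integral_mult_right_zero)
  finally have "complex_of_real tau ^ ?m * (-1) ^ ?m * complex_of_real (fps_nth (Ef ^ n) ?m) =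
     (1 / complex_of_real ?q) * ((-1) ^ ?m * exp (of_nat n * complex_of_real (B' tau)) * (LINT s|lborel. Gint n s))"
    unfolding coeff_integral using q by (simp add: scaleR_conv_of_real)
  then have "complex_of_real ?q * complex_of_real tau ^ ?m * complex_of_real (fps_nth (Ef ^ n) ?m) = exp (of_nat n * complex_of_real (B' tau)) * (LINT s|lborel. Gint n s)"
    using q by (simp add: field_simps)
  then have "exp (- (of_nat n * complex_of_real (B' tau))) * (complex_of_real ?q * complex_of_real tau ^ ?m * complex_of_real (fps_nth (Ef ^ n) ?m)) = (LINT s|lborel. Gint n s)"
    by (simp add: exp_minus field_simps)
  moreover have "exp (- (of_nat n * complex_of_real (B' tau))) = complex_of_real (exp (- (real n * B' tau)))"
    by (simp add: exp_of_real[symmetric])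
  ultimately show ?thesis by (simp add: mult_ac)
qed

text \<open>The linear terms add up to \<open>i \<theta>\<close> because the sum of \<open>n Bf\<^sub>n tau\<^sup>n\<close> is \<open>1\<close> at the saddle point.\<close>

lemma phi_sums:
  "(\<lambda>k. complex_of_real (fps_nth Bf k * tau ^ k) * (iexp (real k * \<theta>) - 1 - \<i> * complex_of_real (real k * \<theta>))) sums phi \<theta>"
proof -
  have "(\<lambda>k. fps_nth cBf k * (complex_of_real tau * cis \<theta>) ^ k) sums cB (complex_of_real tau * cis \<theta>)"
    unfolding cB_def using radius_ge[OF radius_cBf tau_cis_ball] by (rule sums_eval_fps)
  moreover have "fps_nth cBf k * (complex_of_real tau * cis \<theta>) ^ k = complex_of_real (fps_nth Bf k * tau ^ k) * iexp (real k * \<theta>)" for k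
  proof -
    have "iexp (real k * \<theta>) = cis \<theta> ^ k" by (simp only: cis_conv_exp[symmetric] Complex.DeMoivre)
    then show ?thesis by (simp add: cBf_def power_mult_distrib)
  qed
  ultimately have 1: "(\<lambda>k. complex_of_real (fps_nth Bf k * tau ^ k) * iexp (real k * \<theta>)) sums cB (complex_of_real tau * cis \<theta>)" by simp
  have 2: "(\<lambda>k. complex_of_real (fps_nth Bf k * tau ^ k)) sums complex_of_real (B' tau)"
    using sums_tau(1) by (rule sums_of_real)
  have "(\<lambda>k. \<i> * complex_of_real \<theta> * complex_of_real (real k * fps_nth Bf k * tau ^ k)) sums (\<i> * complex_of_real \<theta> * complex_of_real 1)"
    by (intro sums_mult sums_of_real sums_tau(2))
  from sums_diff[OF sums_diff[OF 1 2] this] show ?thesis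
    unfolding phi_def by (simp add: algebra_simps)
qed

lemma iexp_quadratic: "norm (iexp x - 1 - \<i> * complex_of_real x) \<le> x\<^sup>2 / 2"
  using iexp_approx1[of x 1] by (simp add: power2_eq_square diff_diff_eq numeral_2_eq_2)

lemma iexp_cubic: "norm (iexp x - 1 - \<i> * complex_of_real x + complex_of_real (x\<^sup>2 / 2)) \<le> \<bar>x\<bar> ^ 3 / 6"
proof -
  have "(\<Sum>k\<le>2. (\<i> * complex_of_real x) ^ k / fact k) = 1 + \<i> * complex_of_real x - complex_of_real (x\<^sup>2 / 2)"
    by (simp add: numeral_2_eq_2 power2_eq_square algebra_simps)
  then show ?thesis using iexp_approx1[of x 2] by (simp add: algebra_simps fact_numeral eval_nat_numeral)
qed

lemma cos_upper: "\<bar>x\<bar> \<le> pi \<Longrightarrow> cos x \<le> 1 - x\<^sup>2 / 12"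
proof -
  assume x: "\<bar>x\<bar> \<le> pi"
  have S: "(\<Sum>k\<le>3. (\<i> * complex_of_real x) ^ k / fact k) = 1 + \<i> * complex_of_real x - complex_of_real (x\<^sup>2 / 2) - \<i> * complex_of_real (x ^ 3 / 6)"
    by (simp add: numeral_3_eq_3 power2_eq_square power3_eq_cube algebra_simps)
  have T: "\<bar>x\<bar> ^ Suc 3 / fact (Suc 3) = x ^ 4 / 24" by (simp add: fact_numeral)
  have "norm (iexp x - (1 + \<i> * complex_of_real x - complex_of_real (x\<^sup>2 / 2) - \<i> * complex_of_real (x ^ 3 / 6))) \<le> x ^ 4 / 24"
    using iexp_approx1[of x 3] unfolding S T .
  then have "\<bar>Re (iexp x - (1 + \<i> * complex_of_real x - complex_of_real (x\<^sup>2 / 2) - \<i> * complex_of_real (x ^ 3 / 6)))\<bar> \<le> x ^ 4 / 24"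
    using abs_Re_le_cmod order_trans by blast
  moreover have "Re (iexp x) = cos x" by (simp add: Re_exp)
  ultimately have "\<bar>cos x - (1 - x\<^sup>2 / 2)\<bar> \<le> x ^ 4 / 24" by simp
  moreover have "x ^ 4 \<le> 10 * x\<^sup>2"
  proof -
    have "x\<^sup>2 \<le> 10"
    proof -
      have "\<bar>x\<bar> \<le> 3.15" using x pi_approx by simp
      then have "\<bar>x\<bar>\<^sup>2 \<le> 3.15\<^sup>2" by (intro power_mono) auto
      then show ?thesis by (simp add: power2_eq_square)
    qed
    then have "x\<^sup>2 * x\<^sup>2 \<le> 10 * x\<^sup>2" by (intro mult_right_mono) auto
    then show ?thesis by (simp add: power_numeral_reduce power2_eq_square)
  qed
  moreover have gen: "c \<le> 1 - q / 12" if "\<bar>c - (1 - q / 2)\<bar> \<le> f / 24" "f \<le> 10 * q" for c q f :: real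
    using that by linarith
  ultimately show ?thesis by blast
qed

text \<open>All terms of the real part of \<open>phi_sums\<close> are nonpositive, and the one with index \<open>1\<close> alone is at most the right
  hand side, since \<open>Bf\<^sub>1 = 1\<close>.\<close>

lemma Re_phi_le:
  assumes "\<bar>\<theta>\<bar> \<le> pi" shows "Re (phi \<theta>) \<le> - (tau * \<theta>\<^sup>2 / 12)"
proof -
  have s: "(\<lambda>k. fps_nth Bf k * tau ^ k * (cos (real k * \<theta>) - 1)) sums Re (phi \<theta>)"
    using sums_Re[OF phi_sums[of \<theta>]] by (simp add: Re_exp)
  have "Re (phi \<theta>) = (\<Sum>k. fps_nth Bf k * tau ^ k * (cos (real k * \<theta>) - 1))" using s sums_unique by blast
  have np: "fps_nth Bf k * tau ^ k * (cos (real k * \<theta>) - 1) \<le> 0" for k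
    using Bf_nonneg[of k] tau_pos by (intro mult_nonneg_nonpos) auto
  have m: "(\<lambda>k. - (fps_nth Bf k * tau ^ k * (cos (real k * \<theta>) - 1))) sums (- Re (phi \<theta>))" using sums_minus[OF s] .
  have "(\<Sum>k\<in>{1}. - (fps_nth Bf k * tau ^ k * (cos (real k * \<theta>) - 1))) \<le> (\<Sum>k. - (fps_nth Bf k * tau ^ k * (cos (real k * \<theta>) - 1)))"
    using np sums_summable[OF m] by (intro sum_le_suminf) auto
  also have "\<dots> = - Re (phi \<theta>)" using m by (rule sums_unique[symmetric])
  finally have "(\<Sum>k\<in>{1}. - (fps_nth Bf k * tau ^ k * (cos (real k * \<theta>) - 1))) \<le> - Re (phi \<theta>)" .
  then have "Re (phi \<theta>) \<le> tau * (cos \<theta> - 1)" using Bf_1 by simp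
  also have "\<dots> \<le> tau * (- (\<theta>\<^sup>2 / 12))" using cos_upper[OF assms] tau_pos by (intro mult_left_mono) auto
  finally show ?thesis by simp
qed

text \<open>In \<open>phi_sums\<close> only the quadratic part of each term survives; the bound \<open>iexp_quadratic\<close> allows to exchange sum
  and limit.\<close>

lemma phi_limit:
  "(\<lambda>n. of_nat (Suc n) * phi (2 * pi * s / sqrt (real (Suc n)))) \<longlonglongrightarrow> complex_of_real (- (sig2 * (2 * pi * s)\<^sup>2 / 2))"
proof -
  let ?y = "2 * pi * s"
  let ?t = "\<lambda>k n. of_nat (Suc n) * (complex_of_real (fps_nth Bf k * tau ^ k) *
       (iexp (real k * (?y / sqrt (real (Suc n)))) - 1 - \<i> * complex_of_real (real k * (?y / sqrt (real (Suc n))))))"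
  let ?b = "\<lambda>k. complex_of_real (- (real k ^ 2 * fps_nth Bf k * tau ^ k * (?y\<^sup>2 / 2)))"
  have "(\<lambda>n. \<Sum>k. ?t k n) \<longlonglongrightarrow> (\<Sum>k. ?b k)"
  proof (rule tannerys_theorem[THEN conjunct2, THEN conjunct2])
    show "summable (\<lambda>k. real k ^ 2 * fps_nth Bf k * tau ^ k * (?y\<^sup>2 / 2))"
      using sums_summable[OF sums_tau(3)] by (rule summable_mult2)
    have "norm (?t k n) \<le> real k ^ 2 * fps_nth Bf k * tau ^ k * (?y\<^sup>2 / 2)" for k n
    proof -
      have a: "0 \<le> fps_nth Bf k * tau ^ k" using Bf_nonneg tau_pos by simp
      have "norm (?t k n) = real (Suc n) * (fps_nth Bf k * tau ^ k) * norm (iexp (real k * (?y / sqrt (real (Suc n)))) - 1 - \<i> * complex_of_real (real k * (?y / sqrt (real (Suc n)))))"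
        using a by (simp only: norm_mult norm_of_nat norm_of_real abs_of_nonneg mult.assoc)
      also have "\<dots> \<le> real (Suc n) * (fps_nth Bf k * tau ^ k) * ((real k * (?y / sqrt (real (Suc n))))\<^sup>2 / 2)"
        using a by (intro mult_left_mono iexp_quadratic) auto
      also have "(real k * (?y / sqrt (real (Suc n))))\<^sup>2 = real k ^ 2 * ?y\<^sup>2 / real (Suc n)"
        by (simp add: power_mult_distrib power_divide del: of_nat_Suc)
      finally show ?thesis by (simp add: field_simps del: of_nat_Suc)
    qed
    then show "eventually (\<lambda>(k,n). norm (?t k n) \<le> real k ^ 2 * fps_nth Bf k * tau ^ k * (?y\<^sup>2 / 2)) (at_top \<times>\<^sub>F sequentially)"
      by (intro always_eventually) auto
    fix k
    let ?x = "\<lambda>n. real k * (?y / sqrt (real (Suc n)))"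
    let ?a = "complex_of_real (fps_nth Bf k * tau ^ k)"
    have e: "?t k n - ?b k = ?a * (of_nat (Suc n) * (iexp (?x n) - 1 - \<i> * complex_of_real (?x n) + complex_of_real ((?x n)\<^sup>2 / 2)))" for n
    proof -
      have "complex_of_real (real (Suc n) * ((?x n)\<^sup>2 / 2)) = complex_of_real (real k ^ 2 * (?y\<^sup>2 / 2))"
        by (simp add: power_mult_distrib power_divide del: of_nat_Suc)
      then have "of_nat (Suc n) * complex_of_real ((?x n)\<^sup>2 / 2) = complex_of_real (real k ^ 2 * (?y\<^sup>2 / 2))"
        by (simp del: of_nat_Suc)
      then have "?a * (of_nat (Suc n) * complex_of_real ((?x n)\<^sup>2 / 2)) = - ?b k" by (simp add: algebra_simps del: of_nat_Suc)
      then show ?thesis by (simp only: distrib_left) (simp add: algebra_simps del: of_nat_Suc)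
    qed
    have "(\<lambda>n. ?t k n - ?b k) \<longlonglongrightarrow> 0"
    proof (rule Lim_null_comparison)
      show "eventually (\<lambda>n. norm (?t k n - ?b k) \<le> norm ?a * (\<bar>real k * ?y\<bar> ^ 3 / 6 / sqrt (real (Suc n)))) sequentially"
      proof (intro always_eventually allI)
        fix n
        have "norm (?t k n - ?b k) = norm ?a * (real (Suc n) * norm (iexp (?x n) - 1 - \<i> * complex_of_real (?x n) + complex_of_real ((?x n)\<^sup>2 / 2)))"
          unfolding e by (simp only: norm_mult norm_of_nat)
        also have "\<dots> \<le> norm ?a * (real (Suc n) * (\<bar>?x n\<bar> ^ 3 / 6))"
          by (intro mult_left_mono iexp_cubic) auto
        also have "real (Suc n) * (\<bar>?x n\<bar> ^ 3 / 6) = \<bar>real k * ?y\<bar> ^ 3 / 6 / sqrt (real (Suc n))"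
        proof -
          have "\<bar>?x n\<bar> = \<bar>real k * ?y\<bar> / sqrt (real (Suc n))" by (simp add: abs_mult abs_divide del: of_nat_Suc)
          moreover have "sqrt (real (Suc n)) ^ 3 = real (Suc n) * sqrt (real (Suc n))"
            by (simp add: power3_eq_cube del: of_nat_Suc)
          ultimately have "\<bar>?x n\<bar> ^ 3 = \<bar>real k * ?y\<bar> ^ 3 / (real (Suc n) * sqrt (real (Suc n)))"
            by (simp only: power_divide)
          moreover have gen: "r * (A / (r * q) / 6) = A / 6 / q" if "r > 0" for r A q :: real
            using that by simp
          ultimately show ?thesis using gen[of "real (Suc n)"] by (simp only: of_nat_0_less_iff zero_less_Suc)
        qed
        finally show "norm (?t k n - ?b k) \<le> norm ?a * (\<bar>real k * ?y\<bar> ^ 3 / 6 / sqrt (real (Suc n)))" .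
      qed
      have "(\<lambda>n. norm ?a * (\<bar>real k * ?y\<bar> ^ 3 / 6 / sqrt (real (Suc n)))) \<longlonglongrightarrow> norm ?a * 0"
        by (intro tendsto_mult tendsto_const tendsto_divide_0[OF tendsto_const]
            filterlim_compose[OF filterlim_at_top_imp_at_infinity filterlim_Suc]
            filterlim_at_top_imp_at_infinity filterlim_compose[OF sqrt_at_top] filterlim_compose[OF filterlim_real_sequentially filterlim_Suc])
      then show "(\<lambda>n. norm ?a * (\<bar>real k * ?y\<bar> ^ 3 / 6 / sqrt (real (Suc n)))) \<longlonglongrightarrow> 0" by simp
    qed
    then show "(\<lambda>n. ?t k n) \<longlonglongrightarrow> ?b k" by (simp only: LIM_zero_iff)
  qed simp
  moreover have "(\<Sum>k. ?t k n) = of_nat (Suc n) * phi (?y / sqrt (real (Suc n)))" for n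
    by (rule sums_unique[symmetric], intro sums_mult phi_sums)
  moreover have "(\<Sum>k. ?b k) = complex_of_real (- (sig2 * (?y\<^sup>2 / 2)))"
    by (rule sums_unique[symmetric], intro sums_of_real sums_minus sums_mult2 sums_tau(3))
  ultimately show ?thesis by simp
qed

text \<open>The integrands converge pointwise to a Gaussian and, by \<open>Re_phi_le\<close>, are dominated by one.\<close>

lemma saddle_point_limit:
  "(\<lambda>n. sqrt (real (Suc n)) * tau ^ n * exp (- (real (Suc n) * B' tau)) * fps_nth (Ef ^ Suc n) n) \<longlonglongrightarrow> 1 / sqrt (2 * pi * sig2)"
proof -
  let ?g = "\<lambda>s. exp (complex_of_real (- (sig2 * (2 * pi * s)\<^sup>2 / 2)))"
  have "(\<lambda>n. LINT s|lborel. Gint (Suc n) s) \<longlonglongrightarrow> (LINT s|lborel. ?g s)"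
  proof (rule integral_dominated_convergence[where w = "\<lambda>s. sqrt (2 * pi) * std_normal_density s"])
    show "integrable lborel (\<lambda>s. sqrt (2 * pi) * std_normal_density s)" by simp
    show "?g \<in> borel_measurable lborel" by measurable
    show "Gint (Suc n) \<in> borel_measurable lborel" for n
    proof -
      have "continuous_on UNIV (\<lambda>s. cB (complex_of_real tau * cis (2 * pi * s / sqrt (real (Suc n)))))"
      proof (rule continuous_on_compose2[OF holomorphic_on_imp_continuous_on[OF holo_cB]])
        show "continuous_on UNIV (\<lambda>s. complex_of_real tau * cis (2 * pi * s / sqrt (real (Suc n))))"
          by (intro continuous_intros) auto
        show "range (\<lambda>s. complex_of_real tau * cis (2 * pi * s / sqrt (real (Suc n)))) \<subseteq> ball 0 sing"
          using tau_cis_ball by auto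
      qed
      then have "continuous_on UNIV (\<lambda>s. exp (of_nat (Suc n) * phi (2 * pi * s / sqrt (real (Suc n)))) * cis (2 * pi * s / sqrt (real (Suc n))))"
        unfolding phi_def by (intro continuous_intros) auto
      then have "(\<lambda>s. exp (of_nat (Suc n) * phi (2 * pi * s / sqrt (real (Suc n)))) * cis (2 * pi * s / sqrt (real (Suc n)))) \<in> borel_measurable borel"
        by (rule borel_measurable_continuous_onI)
      then show ?thesis unfolding Gint_def[abs_def] by measurable
    qed
    show "AE s in lborel. (\<lambda>n. Gint (Suc n) s) \<longlonglongrightarrow> ?g s"
    proof (rule AE_I2)
      fix s :: real
      have "filterlim (\<lambda>n. sqrt (real (Suc n))) at_top sequentially"
        by (intro filterlim_compose[OF sqrt_at_top] filterlim_compose[OF filterlim_real_sequentially filterlim_Suc])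
      then have "eventually (\<lambda>n. 2 * \<bar>s\<bar> \<le> sqrt (real (Suc n))) sequentially" by (simp add: filterlim_at_top)
      then have ev: "eventually (\<lambda>n. exp (of_nat (Suc n) * phi (2 * pi * s / sqrt (real (Suc n)))) * cis (2 * pi * s / sqrt (real (Suc n))) = Gint (Suc n) s) sequentially"
        by eventually_elim (auto simp: Gint_def indicator_def)
      have z: "(\<lambda>n. 2 * pi * s / sqrt (real (Suc n))) \<longlonglongrightarrow> 0"
        using \<open>filterlim (\<lambda>n. sqrt (real (Suc n))) at_top sequentially\<close>
        by (intro tendsto_divide_0[OF tendsto_const] filterlim_at_top_imp_at_infinity)
      have "continuous_on UNIV (\<lambda>x. cis x)" by (intro continuous_intros)
      then have "isCont cis 0" by (simp add: continuous_on_eq_continuous_at)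
      then have "(\<lambda>n. cis (2 * pi * s / sqrt (real (Suc n)))) \<longlonglongrightarrow> cis 0"
        using z by (rule isCont_tendsto_compose)
      then have "(\<lambda>n. exp (of_nat (Suc n) * phi (2 * pi * s / sqrt (real (Suc n)))) * cis (2 * pi * s / sqrt (real (Suc n)))) \<longlonglongrightarrow> ?g s * cis 0"
        by (intro tendsto_mult tendsto_exp phi_limit)
      then show "(\<lambda>n. Gint (Suc n) s) \<longlonglongrightarrow> ?g s"
        using Lim_transform_eventually[OF _ ev] by simp
    qed
    show "AE s in lborel. norm (Gint (Suc n) s) \<le> sqrt (2 * pi) * std_normal_density s" for n
    proof (rule AE_I2)
      fix s :: real
      let ?q = "sqrt (real (Suc n))" let ?\<theta> = "2 * pi * s / ?q"
      have rhs: "sqrt (2 * pi) * std_normal_density s = exp (- s\<^sup>2 / 2)" by (simp add: std_normal_density_def)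
      show "norm (Gint (Suc n) s) \<le> sqrt (2 * pi) * std_normal_density s"
      proof (cases "s \<in> {- (?q / 2) .. ?q / 2}")
        case False
        then have "indicat_real {- (?q / 2) .. ?q / 2} s = 0" unfolding indicator_def by (simp only: if_False of_bool_eq)
        then have "Gint (Suc n) s = 0" unfolding Gint_def by (simp only: scaleR_zero_left)
        then show ?thesis unfolding rhs by simp
      next
        case True
        have q: "?q > 0" by simp
        have "\<bar>s\<bar> \<le> ?q / 2" using True by auto
        then have "2 * pi * \<bar>s\<bar> / ?q \<le> 2 * pi * (?q / 2) / ?q" by (intro divide_right_mono mult_left_mono) auto
        also have "\<dots> = pi" using q by (simp del: real_sqrt_gt_0_iff)
        finally have th: "\<bar>?\<theta>\<bar> \<le> pi" by (simp add: abs_mult)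
        have "norm (Gint (Suc n) s) = exp (real (Suc n) * Re (phi ?\<theta>))"
          using True by (simp add: Gint_def norm_mult norm_exp_eq_Re del: of_nat_Suc)
        also have "\<dots> \<le> exp (- s\<^sup>2 / 2)"
        proof -
          have "real (Suc n) * Re (phi ?\<theta>) \<le> real (Suc n) * (- (tau * ?\<theta>\<^sup>2 / 12))"
            by (intro mult_left_mono Re_phi_le th) auto
          also have "?\<theta>\<^sup>2 = (2 * pi * s)\<^sup>2 / real (Suc n)" by (simp add: power_divide del: of_nat_Suc)
          also have "real (Suc n) * (- (tau * ((2 * pi * s)\<^sup>2 / real (Suc n)) / 12)) = - ((tau * pi\<^sup>2 / 3) * s\<^sup>2)"
            by (simp add: power_mult_distrib field_simps del: of_nat_Suc)
          \<comment> \<open>The dominating function needs \<open>tau pi\<^sup>2 / 3 \<ge> 1/2\<close>, which holds as \<open>tau > 1/6\<close> and \<open>pi > 3\<close>.\<close>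
          also have "\<dots> \<le> - ((1/2) * s\<^sup>2)"
          proof -
            have "3\<^sup>2 \<le> pi\<^sup>2" using pi_gt3 by (intro power_mono) auto
            then have "(1/6) * 9 \<le> tau * pi\<^sup>2" using tau_root(2) by (intro mult_mono) auto
            then have "(1/2) * s\<^sup>2 \<le> (tau * pi\<^sup>2 / 3) * s\<^sup>2" by (intro mult_right_mono) auto
            then show ?thesis by simp
          qed
          finally show ?thesis by simp
        qed
        finally show ?thesis unfolding rhs .
      qed
    qed
  qed
  moreover have "(LINT s|lborel. ?g s) = complex_of_real (1 / sqrt (2 * pi * sig2))"
  proof -
    \<comment> \<open>The limit is a multiple of the normal density with this standard deviation.\<close>
    define \<sigma> where "\<sigma> = 1 / (2 * pi * sqrt sig2)"
    have s: "sig2 > 0" using sig2_pos by linarith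
    have \<sigma>: "\<sigma> > 0" "\<sigma>\<^sup>2 = 1 / (4 * pi\<^sup>2 * sig2)" using s by (simp_all add: \<sigma>_def power_divide power_mult_distrib)
    have c: "sqrt (2 * pi * \<sigma>\<^sup>2) = 1 / sqrt (2 * pi * sig2)"
    proof -
      have "2 * pi * \<sigma>\<^sup>2 = 1 / (2 * pi * sig2)" unfolding \<sigma>(2) using s by (simp add: field_simps power2_eq_square)
      then show ?thesis by (simp add: real_sqrt_divide)
    qed
    have "?g x = complex_of_real (sqrt (2 * pi * \<sigma>\<^sup>2) * normal_density 0 \<sigma> x)" for x
    proof -
      have "sqrt (2 * pi * \<sigma>\<^sup>2) \<noteq> 0" using \<sigma>(1) by simp
      then have "sqrt (2 * pi * \<sigma>\<^sup>2) * normal_density 0 \<sigma> x = exp (- x\<^sup>2 / (2 * \<sigma>\<^sup>2))" by (simp add: normal_density_def)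
      also have "- x\<^sup>2 / (2 * \<sigma>\<^sup>2) = - (sig2 * (2 * pi * x)\<^sup>2 / 2)" unfolding \<sigma>(2) using s by (simp add: field_simps power2_eq_square)
      finally show ?thesis by (simp add: exp_of_real[symmetric])
    qed
    then have "(LINT s|lborel. ?g s) = (LINT s|lborel. complex_of_real (sqrt (2 * pi * \<sigma>\<^sup>2) * normal_density 0 \<sigma> s))" by simp
    also have "\<dots> = complex_of_real (LINT s|lborel. sqrt (2 * pi * \<sigma>\<^sup>2) * normal_density 0 \<sigma> s)"
      by (rule integral_complex_of_real)
    also have "(LINT s|lborel. sqrt (2 * pi * \<sigma>\<^sup>2) * normal_density 0 \<sigma> s) = sqrt (2 * pi * \<sigma>\<^sup>2)"
      using \<sigma>(1) by simp
    finally show ?thesis unfolding c .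
  qed
  moreover have "(LINT s|lborel. Gint (Suc n) s) = complex_of_real (sqrt (real (Suc n)) * tau ^ n * exp (- (real (Suc n) * B' tau)) * fps_nth (Ef ^ Suc n) n)" for n
    using coeff_eq_Gint[of "Suc n"] by simp
  ultimately have "(\<lambda>n. complex_of_real (sqrt (real (Suc n)) * tau ^ n * exp (- (real (Suc n) * B' tau)) * fps_nth (Ef ^ Suc n) n)) \<longlonglongrightarrow> complex_of_real (1 / sqrt (2 * pi * sig2))" by simp
  then show ?thesis by (simp only: tendsto_of_real_iff)
qed

text \<open>The factor \<open>1 / n\<^sup>2\<close> of \<open>Cf_nth\<close> and the factor \<open>1 / sqrt n\<close> of the Gaussian integral make up the exponent \<open>5/2\<close>.\<close>

lemma Cf_asymptotics:
  "(\<lambda>n. fps_nth Cf n * rho ^ n * real n powr (5/2)) \<longlonglongrightarrow> tau / sqrt (2 * pi * sig2)"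
proof (rule LIMSEQ_imp_Suc)
  have "fps_nth Cf (Suc n) * rho ^ Suc n * real (Suc n) powr (5/2) =
     tau * (sqrt (real (Suc n)) * tau ^ n * exp (- (real (Suc n) * B' tau)) * fps_nth (Ef ^ Suc n) n)" for n
  proof -
    have "rho ^ Suc n = tau * tau ^ n * exp (- (real (Suc n) * B' tau))"
      unfolding rho_def Psi_def power_mult_distrib exp_of_nat_mult[symmetric] by (simp del: of_nat_Suc)
    moreover have "real (Suc n) powr (5/2) = (real (Suc n))\<^sup>2 * sqrt (real (Suc n))"
    proof -
      have "real (Suc n) powr (5/2) = real (Suc n) powr (2 + 1/2)" by simp
      also have "\<dots> = real (Suc n) powr 2 * real (Suc n) powr (1/2)" by (rule powr_add)
      finally show ?thesis by (simp add: powr_half_sqrt powr_numeral del: of_nat_Suc)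
    qed
    ultimately show ?thesis using Cf_nth[of "Suc n"] by (simp del: of_nat_Suc power_Suc)
  qed
  moreover have "(\<lambda>n. tau * (sqrt (real (Suc n)) * tau ^ n * exp (- (real (Suc n) * B' tau)) * fps_nth (Ef ^ Suc n) n)) \<longlonglongrightarrow> tau * (1 / sqrt (2 * pi * sig2))"
    by (intro tendsto_mult tendsto_const saddle_point_limit)
  ultimately show "(\<lambda>n. fps_nth Cf (Suc n) * rho ^ Suc n * real (Suc n) powr (5/2)) \<longlonglongrightarrow> tau / sqrt (2 * pi * sig2)" by simp
qed

section \<open>Exponentials of subexponential sequences\<close>

text \<open>The shift by one keeps the weight positive at \<open>0\<close>, so that all coefficients can be compared with it.\<close>

definition wt :: "nat \<Rightarrow> real" where "wt n = (real n + 1) powr (-5/2)"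

lemma wt_pos: "wt n > 0" by (simp add: wt_def)

lemma wt_0: "wt 0 = 1" by (simp add: wt_def)

lemma summable_wt: "summable wt"
proof -
  have "summable (\<lambda>n. real n powr (-5/2))" by (simp add: summable_real_powr_iff)
  then have "summable (\<lambda>n. real (Suc n) powr (-5/2))" by (subst summable_Suc_iff)
  then show ?thesis unfolding wt_def by (simp add: add.commute)
qed

lemma wt_half:
  assumes "2 * k \<le> n" shows "wt (n - k) \<le> 8 * wt n"
proof -
  have kn: "k \<le> n" using assms by simp
  have "(real n + 1) / 2 \<le> real (n - k) + 1" using assms kn by (simp add: of_nat_diff)
  then have "wt (n - k) \<le> ((real n + 1) / 2) powr (-5/2)"
    unfolding wt_def by (intro powr_mono2') auto
  also have "\<dots> = wt n * (2 powr (5/2))"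
    by (simp add: wt_def powr_divide powr_minus_divide)
  also have "(2::real) powr (5/2) \<le> 2 powr 3" by (intro powr_mono) auto
  then have "wt n * (2 powr (5/2)) \<le> wt n * 8" using wt_pos[of n] by (intro mult_left_mono) auto
  finally show ?thesis by simp
qed

lemma wt_shift: "(\<lambda>n. wt (n - k) / wt n) \<longlonglongrightarrow> 1"
proof (rule LIMSEQ_offset[where k = k])
  have "(\<lambda>n. inverse (real (Suc n))) \<longlonglongrightarrow> 0" by (rule LIMSEQ_inverse_real_of_nat)
  then have "(\<lambda>n. (1 + real k * inverse (real (Suc n))) powr (5/2)) \<longlonglongrightarrow> (1 + real k * 0) powr (5/2)"
    by (intro tendsto_intros) simp_all
  moreover have "wt (n + k - k) / wt (n + k) = (1 + real k * inverse (real (Suc n))) powr (5/2)" for n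
  proof -
    have "wt n / wt (n + k) = ((real n + 1) / (real (n + k) + 1)) powr (-5/2)" unfolding wt_def by (rule powr_divide[symmetric])
    also have "\<dots> = ((real (n + k) + 1) / (real n + 1)) powr (5/2)"
      by (simp add: powr_divide powr_minus_divide)
    also have "(real (n + k) + 1) / (real n + 1) = 1 + real k * inverse (real (Suc n))" by (simp add: field_simps)
    finally show ?thesis by simp
  qed
  ultimately show "(\<lambda>n. wt (n + k - k) / wt (n + k)) \<longlonglongrightarrow> 1" by simp
qed

text \<open>The coefficient \<open>n\<close> of \<open>f * g\<close> is split according to which of the two factors has the smaller index: \<open>lowconv f g\<close> has
  the terms in which this is \<open>f\<close> or both are equal, and \<open>lowconv' g f\<close> the others (\<open>mult_split\<close>). The smaller index is the
  summation variable.\<close>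

definition lowconv :: "real fps \<Rightarrow> real fps \<Rightarrow> nat \<Rightarrow> nat \<Rightarrow> real" where
  "lowconv f g n k = (if 2 * k \<le> n then fps_nth f k * fps_nth g (n - k) else 0)"
definition lowconv' :: "real fps \<Rightarrow> real fps \<Rightarrow> nat \<Rightarrow> nat \<Rightarrow> real" where
  "lowconv' f g n k = (if 2 * k < n then fps_nth f k * fps_nth g (n - k) else 0)"

lemma mult_split:
  "fps_nth (f * g) n = (\<Sum>k. lowconv f g n k) + (\<Sum>k. lowconv' g f n k)"
proof -
  have 1: "(\<Sum>k. lowconv f g n k) = (\<Sum>k\<in>{k. k \<le> n \<and> 2 * k \<le> n}. fps_nth f k * fps_nth g (n - k))"
  proof -
    have "(\<Sum>k. lowconv f g n k) = (\<Sum>k\<in>{k. k \<le> n \<and> 2 * k \<le> n}. lowconv f g n k)"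
      by (rule suminf_finite) (auto simp: lowconv_def)
    then show ?thesis by (simp add: lowconv_def)
  qed
  have "(\<Sum>k. lowconv' g f n k) = (\<Sum>k\<in>{k. k \<le> n \<and> 2 * k < n}. lowconv' g f n k)"
    by (rule suminf_finite) (auto simp: lowconv'_def)
  also have "\<dots> = (\<Sum>k\<in>{k. k \<le> n \<and> 2 * k < n}. fps_nth g k * fps_nth f (n - k))"
    by (intro sum.cong) (auto simp: lowconv'_def)
  also have "\<dots> = (\<Sum>k\<in>{k. k \<le> n \<and> \<not> 2 * k \<le> n}. fps_nth f k * fps_nth g (n - k))"
    by (rule sum.reindex_bij_witness[of _ "\<lambda>k. n - k" "\<lambda>k. n - k"]) auto
  finally have 2: "(\<Sum>k. lowconv' g f n k) = (\<Sum>k\<in>{k. k \<le> n \<and> \<not> 2 * k \<le> n}. fps_nth f k * fps_nth g (n - k))" .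
  have "fps_nth (f * g) n = (\<Sum>k\<in>{0..n}. fps_nth f k * fps_nth g (n - k))" by (rule fps_mult_nth)
  also have "{0..n} = {k. k \<le> n \<and> 2 * k \<le> n} \<union> {k. k \<le> n \<and> \<not> 2 * k \<le> n}" by auto
  also have "(\<Sum>k\<in>{k. k \<le> n \<and> 2 * k \<le> n} \<union> {k. k \<le> n \<and> \<not> 2 * k \<le> n}. fps_nth f k * fps_nth g (n - k)) =
    (\<Sum>k\<in>{k. k \<le> n \<and> 2 * k \<le> n}. fps_nth f k * fps_nth g (n - k)) + (\<Sum>k\<in>{k. k \<le> n \<and> \<not> 2 * k \<le> n}. fps_nth f k * fps_nth g (n - k))"
    by (rule sum.union_disjoint) auto
  finally show ?thesis using 1 2 by simp
qed

definition wbound :: "real fps \<Rightarrow> real \<Rightarrow> bool" where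
  "wbound f M \<longleftrightarrow> (\<forall>n. \<bar>fps_nth f n\<bar> \<le> M * wt n)"

lemma wbound_summable: "wbound f M \<Longrightarrow> summable (\<lambda>n. \<bar>fps_nth f n\<bar>)"
  by (rule summable_comparison_test'[of "\<lambda>n. M * wt n" 0]) (auto simp: wbound_def intro: summable_mult summable_wt)

lemma wbound_nonneg: "wbound f M \<Longrightarrow> M \<ge> 0"
  unfolding wbound_def using wt_0 by (metis abs_ge_zero mult.right_neutral order_trans)

lemma wbound_of_limit:
  assumes "(\<lambda>n. fps_nth f n / wt n) \<longlonglongrightarrow> \<alpha>"
  obtains M where "wbound f M"
proof -
  have "Bseq (\<lambda>n. fps_nth f n / wt n)" using assms by (intro convergent_imp_Bseq) (auto simp: convergent_def)
  then obtain M where M: "\<And>n. norm (fps_nth f n / wt n) \<le> M" unfolding Bseq_def by blast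
  have "\<bar>fps_nth f n\<bar> \<le> M * wt n" for n
    using M[of n] wt_pos[of n] by (simp add: abs_divide pos_divide_le_eq)
  then have "wbound f M" by (simp add: wbound_def)
  then show ?thesis by (rule that)
qed

lemma low_term_bound:
  assumes "wbound f M" "wbound g N" "2 * k \<le> n"
  shows "\<bar>fps_nth f k * fps_nth g (n - k)\<bar> \<le> \<bar>fps_nth f k\<bar> * (8 * N) * wt n"
proof -
  have "\<bar>fps_nth g (n - k)\<bar> \<le> N * wt (n - k)" using assms by (simp add: wbound_def)
  also have "\<dots> \<le> N * (8 * wt n)" using wt_half[OF assms(3)] wbound_nonneg[OF assms(2)] by (intro mult_left_mono)
  finally have "\<bar>fps_nth f k\<bar> * \<bar>fps_nth g (n - k)\<bar> \<le> \<bar>fps_nth f k\<bar> * (N * (8 * wt n))" by (intro mult_left_mono) auto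
  then show ?thesis by (simp add: abs_mult mult_ac)
qed

lemma lowconv_bound:
  assumes "wbound f M" "wbound g N"
  shows "\<bar>lowconv f g n k\<bar> \<le> \<bar>fps_nth f k\<bar> * (8 * N) * wt n" "\<bar>lowconv' f g n k\<bar> \<le> \<bar>fps_nth f k\<bar> * (8 * N) * wt n"
  using low_term_bound[OF assms, of k n] wbound_nonneg[OF assms(2)] wt_pos[of n]
  by (auto simp: lowconv_def lowconv'_def intro!: mult_nonneg_nonneg)

text \<open>For a fixed index of \<open>f\<close>, the other factor takes over the growth, since a fixed shift of the index does not change \<open>wt\<close> asymptotically (\<open>wt_shift\<close>). The bound
  \<open>low_term_bound\<close> allows to exchange sum and limit.\<close>

lemma lowconv_limit:
  assumes f: "wbound f M" and g: "wbound g N" and lim: "(\<lambda>n. fps_nth g n / wt n) \<longlonglongrightarrow> \<beta>"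
  shows "(\<lambda>n. (\<Sum>k. lowconv f g n k) / wt n) \<longlonglongrightarrow> (\<Sum>k. fps_nth f k) * \<beta>"
    and "(\<lambda>n. (\<Sum>k. lowconv' f g n k) / wt n) \<longlonglongrightarrow> (\<Sum>k. fps_nth f k) * \<beta>"
proof -
  have sf: "summable (\<lambda>k. fps_nth f k)" using summable_rabs_cancel[OF wbound_summable[OF f]] .
  have main: "(\<lambda>n. (\<Sum>k. L n k) / wt n) \<longlonglongrightarrow> (\<Sum>k. fps_nth f k) * \<beta>"
    if L: "\<And>n k. \<bar>L n k\<bar> \<le> \<bar>fps_nth f k\<bar> * (8 * N) * wt n" "\<And>n k. 2 * k < n \<Longrightarrow> L n k = fps_nth f k * fps_nth g (n - k)"
      "\<And>n. summable (L n)" for L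
  proof -
    have "(\<lambda>n. \<Sum>k. L n k / wt n) \<longlonglongrightarrow> (\<Sum>k. fps_nth f k * \<beta>)"
    proof (rule tannerys_theorem[THEN conjunct2, THEN conjunct2])
      show "summable (\<lambda>k. \<bar>fps_nth f k\<bar> * (8 * N))" by (intro summable_mult2 wbound_summable[OF f])
      have "norm (L n k / wt n) \<le> \<bar>fps_nth f k\<bar> * (8 * N)" for n k
        using L(1)[of n k] wt_pos[of n] by (simp add: abs_divide field_simps)
      then show "eventually (\<lambda>(k,n). norm (L n k / wt n) \<le> \<bar>fps_nth f k\<bar> * (8 * N)) (at_top \<times>\<^sub>F sequentially)"
        by (intro always_eventually) auto
      fix k
      have "(\<lambda>n. fps_nth g (n - k) / wt (n - k)) \<longlonglongrightarrow> \<beta>"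
        by (rule LIMSEQ_offset[where k = k]) (use lim in simp)
      then have "(\<lambda>n. fps_nth f k * ((fps_nth g (n - k) / wt (n - k)) * (wt (n - k) / wt n))) \<longlonglongrightarrow> fps_nth f k * (\<beta> * 1)"
        by (intro tendsto_mult tendsto_const wt_shift)
      moreover have "eventually (\<lambda>n. fps_nth f k * ((fps_nth g (n - k) / wt (n - k)) * (wt (n - k) / wt n)) = L n k / wt n) sequentially"
      proof (rule eventually_sequentiallyI[of "2 * k + 1"])
        fix n assume "n \<ge> 2 * k + 1"
        then have "L n k = fps_nth f k * fps_nth g (n - k)" using L(2) by simp
        then show "fps_nth f k * ((fps_nth g (n - k) / wt (n - k)) * (wt (n - k) / wt n)) = L n k / wt n"
          using wt_pos[of "n - k"] by simp
      qed
      ultimately show "(\<lambda>n. L n k / wt n) \<longlonglongrightarrow> fps_nth f k * \<beta>" using Lim_transform_eventually by fastforce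
    qed simp
    moreover have "(\<Sum>k. L n k / wt n) = (\<Sum>k. L n k) / wt n" for n by (rule suminf_divide[OF L(3)])
    moreover have "(\<Sum>k. fps_nth f k * \<beta>) = (\<Sum>k. fps_nth f k) * \<beta>" by (rule suminf_mult2[OF sf, symmetric])
    ultimately show ?thesis by simp
  qed
  have fin: "summable (lowconv f g n)" "summable (lowconv' f g n)" for n
    by (rule summable_finite[of "{..n}"]; auto simp: lowconv_def lowconv'_def)+
  show "(\<lambda>n. (\<Sum>k. lowconv f g n k) / wt n) \<longlonglongrightarrow> (\<Sum>k. fps_nth f k) * \<beta>"
    by (rule main[OF lowconv_bound(1)[OF f g] _ fin(1)]) (simp add: lowconv_def)
  show "(\<lambda>n. (\<Sum>k. lowconv' f g n k) / wt n) \<longlonglongrightarrow> (\<Sum>k. fps_nth f k) * \<beta>"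
    by (rule main[OF lowconv_bound(2)[OF f g] _ fin(2)]) (simp add: lowconv'_def)
qed

lemma mult_limit:
  assumes f: "(\<lambda>n. fps_nth f n / wt n) \<longlonglongrightarrow> \<alpha>" and g: "(\<lambda>n. fps_nth g n / wt n) \<longlonglongrightarrow> \<beta>"
  shows "(\<lambda>n. fps_nth (f * g) n / wt n) \<longlonglongrightarrow> (\<Sum>k. fps_nth f k) * \<beta> + (\<Sum>k. fps_nth g k) * \<alpha>"
proof -
  obtain M where M: "wbound f M" using wbound_of_limit[OF f] .
  obtain N where N: "wbound g N" using wbound_of_limit[OF g] .
  show ?thesis unfolding mult_split add_divide_distrib
    by (intro tendsto_add lowconv_limit(1)[OF M N g] lowconv_limit(2)[OF N M f])
qed

definition Kw :: real where "Kw = 16 * suminf wt"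

text \<open>The larger of the two indices is at least \<open>n / 2\<close>, so its weight is at most \<open>8\<close> times that of \<open>n\<close>, and
  the sum over the smaller index converges. The factor \<open>16\<close> in \<open>Kw\<close> counts both halves.\<close>

lemma mult_wbound:
  assumes f: "wbound f M" and g: "wbound g N"
  shows "wbound (f * g) (Kw * M * N)"
  unfolding wbound_def
proof
  fix n
  have half: "\<bar>\<Sum>k. L k\<bar> \<le> 8 * suminf wt * M * N * wt n"
    if L: "\<And>k. \<bar>L k\<bar> \<le> \<bar>fps_nth f k\<bar> * (8 * N) * wt n" and f: "wbound f M" and g: "wbound g N" for L f M g N
  proof -
    have b: "\<bar>L k\<bar> \<le> wt k * (8 * M * N * wt n)" for k
    proof -
      have "\<bar>fps_nth f k\<bar> * ((8 * N) * wt n) \<le> (M * wt k) * ((8 * N) * wt n)"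
        using f wbound_nonneg[OF g] wt_pos[of n] unfolding wbound_def by (intro mult_right_mono) auto
      then show ?thesis using L[of k] by (simp add: mult_ac)
    qed
    have s: "summable (\<lambda>k. wt k * (8 * M * N * wt n))" by (intro summable_mult2 summable_wt)
    have s2: "summable (\<lambda>k. \<bar>L k\<bar>)" by (rule summable_comparison_test'[OF s, of 0]) (use b in simp)
    have "\<bar>\<Sum>k. L k\<bar> \<le> (\<Sum>k. \<bar>L k\<bar>)" by (rule summable_rabs[OF s2])
    also have "\<dots> \<le> (\<Sum>k. wt k * (8 * M * N * wt n))" using b s2 s by (rule suminf_le)
    also have "\<dots> = suminf wt * (8 * M * N * wt n)" by (rule suminf_mult2[OF summable_wt, symmetric])
    finally show ?thesis by (simp add: mult_ac)
  qed
  have "\<bar>fps_nth (f * g) n\<bar> \<le> \<bar>\<Sum>k. lowconv f g n k\<bar> + \<bar>\<Sum>k. lowconv' g f n k\<bar>"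
    unfolding mult_split by (rule abs_triangle_ineq)
  also have "\<dots> \<le> 8 * suminf wt * M * N * wt n + 8 * suminf wt * N * M * wt n"
    by (intro add_mono half[OF lowconv_bound(1)[OF f g] f g] half[OF lowconv_bound(2)[OF g f] g f])
  also have "\<dots> = Kw * M * N * wt n" by (simp add: Kw_def mult_ac)
  finally show "\<bar>fps_nth (f * g) n\<bar> \<le> Kw * M * N * wt n" .
qed

lemma Kw_nonneg: "Kw \<ge> 0"
  unfolding Kw_def using suminf_nonneg[OF summable_wt] wt_pos by (simp add: less_imp_le)

lemma power_wbound:
  assumes f: "wbound f M" shows "wbound (f ^ i) (((Kw + 1) * (M + 1)) ^ i)"
proof (induction i)
  case 0
  have "\<bar>fps_nth 1 n\<bar> \<le> 1 * wt n" for n using wt_0 wt_pos[of n] by (cases n) auto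
  then show ?case by (simp add: wbound_def)
next
  case (Suc i)
  have M: "M \<ge> 0" using wbound_nonneg[OF f] .
  have "wbound (f ^ Suc i) (Kw * M * ((Kw + 1) * (M + 1)) ^ i)" using mult_wbound[OF f Suc] by simp
  moreover have "Kw * M \<le> (Kw + 1) * (M + 1)" using M Kw_nonneg by (intro mult_mono) auto
  then have "Kw * M * ((Kw + 1) * (M + 1)) ^ i \<le> ((Kw + 1) * (M + 1)) ^ Suc i"
    using M Kw_nonneg by (simp add: mult_right_mono)
  ultimately show ?case unfolding wbound_def using wt_pos by (meson less_imp_le mult_right_mono order_trans)
qed

lemma power_sums:
  assumes f: "wbound f M" shows "(\<lambda>n. fps_nth (f ^ i) n) sums ((\<Sum>k. fps_nth f k) ^ i)"
proof (induction i)
  case 0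
  have "(\<lambda>n. if n = 0 then 1 else 0 :: real) sums 1" using sums_single[of 0 "\<lambda>_. 1::real"] by simp
  then show ?case by (simp add: fps_one_nth)
next
  case (Suc i)
  have "(\<lambda>n. \<Sum>k\<le>n. fps_nth f k * fps_nth (f ^ i) (n - k)) sums ((\<Sum>k. fps_nth f k) * (\<Sum>k. fps_nth (f ^ i) k))"
    using wbound_summable[OF f] wbound_summable[OF power_wbound[OF f]] by (intro Cauchy_product_sums) auto
  moreover have "(\<Sum>k. fps_nth (f ^ i) k) = (\<Sum>k. fps_nth f k) ^ i" using Suc sums_unique by metis
  ultimately show ?case by (simp add: fps_mult_nth atMost_atLeast0)
qed

lemma power_limit:
  assumes f: "(\<lambda>n. fps_nth f n / wt n) \<longlonglongrightarrow> \<alpha>"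
  shows "(\<lambda>n. fps_nth (f ^ i) n / wt n) \<longlonglongrightarrow> real i * (\<Sum>k. fps_nth f k) ^ (i - 1) * \<alpha>"
proof (induction i)
  case 0
  have "eventually (\<lambda>n. fps_nth (f ^ 0) n / wt n = 0) sequentially"
    by (rule eventually_sequentiallyI[of 1]) simp
  then show ?case by (simp add: tendsto_eventually)
next
  case (Suc i)
  obtain M where M: "wbound f M" using wbound_of_limit[OF f] .
  let ?A = "\<Sum>k. fps_nth f k"
  have "(\<Sum>k. fps_nth (f ^ i) k) = ?A ^ i" using power_sums[OF M] sums_unique by metis
  then have "(\<lambda>n. fps_nth (f ^ Suc i) n / wt n) \<longlonglongrightarrow> ?A * (real i * ?A ^ (i - 1) * \<alpha>) + ?A ^ i * \<alpha>"
    using mult_limit[OF f Suc] by simp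
  moreover have "?A * (real i * ?A ^ (i - 1) * \<alpha>) + ?A ^ i * \<alpha> = real (Suc i) * ?A ^ (Suc i - 1) * \<alpha>"
    by (cases i) (simp_all add: algebra_simps)
  ultimately show ?case by simp
qed

text \<open>The coefficients of the powers of \<open>f\<close> grow as in \<open>power_limit\<close>, with a bound that is only geometric in the exponent
  (\<open>power_wbound\<close>), so the limit can be taken term by term in the exponential series.\<close>

theorem exp_subexponential:
  assumes f: "(\<lambda>n. fps_nth f n / wt n) \<longlonglongrightarrow> \<alpha>" and f0: "fps_nth f 0 = 0"
  shows "(\<lambda>n. fps_nth (fps_exp 1 oo f) n / wt n) \<longlonglongrightarrow> \<alpha> * exp (\<Sum>k. fps_nth f k)"
proof -
  obtain M where M: "wbound f M" using wbound_of_limit[OF f] .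
  let ?A = "\<Sum>k. fps_nth f k" let ?c = "(Kw + 1) * (M + 1)"
  let ?L = "\<lambda>i. inverse (fact i) * (real i * ?A ^ (i - 1) * \<alpha>)"
  have "(\<lambda>n. \<Sum>i. inverse (fact i) * (fps_nth (f ^ i) n / wt n)) \<longlonglongrightarrow> (\<Sum>i. ?L i)"
  proof (rule tannerys_theorem[THEN conjunct2, THEN conjunct2])
    show "summable (\<lambda>i. inverse (fact i) * ?c ^ i)" by (rule summable_exp)
    have "norm (inverse (fact i) * (fps_nth (f ^ i) n / wt n)) \<le> inverse (fact i) * ?c ^ i" for i n
    proof -
      have "\<bar>fps_nth (f ^ i) n\<bar> \<le> ?c ^ i * wt n" using power_wbound[OF M, of i] by (simp add: wbound_def)
      then have "\<bar>fps_nth (f ^ i) n / wt n\<bar> \<le> ?c ^ i" using wt_pos[of n] by (simp add: abs_divide field_simps)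
      then have "inverse (fact i) * \<bar>fps_nth (f ^ i) n / wt n\<bar> \<le> inverse (fact i) * ?c ^ i" by (intro mult_left_mono) auto
      moreover have "norm (inverse (fact i) * (fps_nth (f ^ i) n / wt n)) = inverse (fact i) * \<bar>fps_nth (f ^ i) n / wt n\<bar>"
        by (simp only: real_norm_def abs_mult) simp
      ultimately show ?thesis by linarith
    qed
    then show "eventually (\<lambda>(i,n). norm (inverse (fact i) * (fps_nth (f ^ i) n / wt n)) \<le> inverse (fact i) * ?c ^ i) (at_top \<times>\<^sub>F sequentially)"
      by (intro always_eventually) auto
    show "(\<lambda>n. inverse (fact i) * (fps_nth (f ^ i) n / wt n)) \<longlonglongrightarrow> ?L i" for i
      by (intro tendsto_mult tendsto_const power_limit[OF f])
  qed simp
  moreover have "(\<Sum>i. inverse (fact i) * (fps_nth (f ^ i) n / wt n)) = fps_nth (fps_exp 1 oo f) n / wt n" for n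
  proof -
    have z: "fps_nth (f ^ i) n = 0" if "i > n" for i using startsby_zero_power_prefix[OF f0, of i] that by simp
    have "(\<Sum>i. inverse (fact i) * (fps_nth (f ^ i) n / wt n)) = (\<Sum>i\<in>{0..n}. inverse (fact i) * (fps_nth (f ^ i) n / wt n))"
      by (rule suminf_finite) (auto simp: z)
    also have "\<dots> = (\<Sum>i\<in>{0..n}. fps_nth (fps_exp 1) i * fps_nth (f ^ i) n) / wt n"
      by (simp add: sum_divide_distrib field_simps)
    finally show ?thesis by (simp add: fps_compose_nth)
  qed
  moreover have "?L sums (\<alpha> * exp ?A)"
  proof -
    have "(\<lambda>i. ?A ^ i /\<^sub>R fact i) sums exp ?A" by (rule exp_converges)
    then have "(\<lambda>i. \<alpha> * (?A ^ i /\<^sub>R fact i)) sums (\<alpha> * exp ?A)" by (rule sums_mult)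
    moreover have "?L (Suc i) = \<alpha> * (?A ^ i /\<^sub>R fact i)" for i
    proof -
      have "inverse (fact (Suc i)) * real (Suc i) = (inverse (fact i) :: real)"
        unfolding fact_Suc inverse_mult_distrib by (simp del: of_nat_Suc)
      then have "inverse (fact (Suc i)) * real (Suc i) * (?A ^ i * \<alpha>) = inverse (fact i) * (?A ^ i * \<alpha>)" by presburger
      then show ?thesis by (simp only: diff_Suc_1 real_scaleR_def mult_ac)
    qed
    ultimately have "(\<lambda>i. ?L (Suc i)) sums (\<alpha> * exp ?A)" by presburger
    then show ?thesis using sums_Suc_iff[of ?L "\<alpha> * exp ?A"] by simp
  qed
  ultimately show ?thesis using sums_unique by fastforce
qed

definition rescale :: "real \<Rightarrow> real fps \<Rightarrow> real fps" where "rescale c f = f oo (fps_const c * fps_X)"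

lemma rescale_nth: "fps_nth (rescale c f) n = fps_nth f n * c ^ n"
  by (simp add: rescale_def fps_compose_linear)

lemma rescale_compose: "fps_nth g 0 = 0 \<Longrightarrow> rescale c (f oo g) = f oo rescale c g"
  unfolding rescale_def by (rule fps_compose_assoc[symmetric]) simp_all

lemma rescale_mult: "rescale c (f * g) = rescale c f * rescale c g"
  unfolding rescale_def by (rule fps_compose_mult_distrib) simp

text \<open>Rescaling by \<open>rho\<close> removes the exponential growth.\<close>

definition Cs :: "real fps" where "Cs = rescale rho Cf"

lemma scale_Hf: "fps_nth (fps_exp 1 oo Cs) n = fps_nth Hf n * rho ^ n"
  by (simp add: Cs_def Hf_def rescale_nth rescale_compose[symmetric])

lemma wt_powr_limit: "(\<lambda>n. wt n * real n powr (5/2)) \<longlonglongrightarrow> 1"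
proof (rule LIMSEQ_imp_Suc)
  have "wt (Suc n) * real (Suc n) powr (5/2) = wt (Suc n) / wt n" for n
    by (simp add: wt_def powr_minus_divide add.commute)
  moreover have "(\<lambda>n. inverse (wt (Suc n - 1) / wt (Suc n))) \<longlonglongrightarrow> inverse 1"
    by (intro tendsto_inverse LIMSEQ_Suc[OF wt_shift[of 1]]) simp
  ultimately show "(\<lambda>n. wt (Suc n) * real (Suc n) powr (5/2)) \<longlonglongrightarrow> 1" by simp
qed

lemma Cs_limit: "(\<lambda>n. fps_nth Cs n / wt n) \<longlonglongrightarrow> tau / sqrt (2 * pi * sig2)"
proof -
  have "(\<lambda>n. (fps_nth Cf n * rho ^ n * real n powr (5/2)) / (wt n * real n powr (5/2))) \<longlonglongrightarrow> (tau / sqrt (2 * pi * sig2)) / 1"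
    by (intro tendsto_divide Cf_asymptotics wt_powr_limit) simp
  moreover have "eventually (\<lambda>n. (fps_nth Cf n * rho ^ n * real n powr (5/2)) / (wt n * real n powr (5/2)) = fps_nth Cs n / wt n) sequentially"
    by (rule eventually_sequentiallyI[of 1]) (simp add: Cs_def rescale_nth)
  ultimately show ?thesis using Lim_transform_eventually by fastforce
qed

lemma Hf_asymptotics:
  "(\<lambda>n. fps_nth Hf n * rho ^ n * real n powr (5/2)) \<longlonglongrightarrow> tau / sqrt (2 * pi * sig2) * exp (\<Sum>k. fps_nth Cs k)"
proof -
  have "(\<lambda>n. fps_nth (fps_exp 1 oo Cs) n / wt n * (wt n * real n powr (5/2))) \<longlonglongrightarrow> tau / sqrt (2 * pi * sig2) * exp (\<Sum>k. fps_nth Cs k) * 1"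
    by (intro tendsto_mult exp_subexponential[OF Cs_limit] wt_powr_limit) (simp add: Cs_def rescale_nth)
  moreover have "fps_nth (fps_exp 1 oo Cs) n / wt n * (wt n * real n powr (5/2)) = fps_nth Hf n * rho ^ n * real n powr (5/2)" for n
    using wt_pos[of n] by (simp add: scale_Hf)
  ultimately show ?thesis by simp
qed

section \<open>The value of the generating function of connected graphs at its singularity\<close>

lemma power_nonneg_coeff:
  fixes g :: "real fps"
  assumes "\<And>n. fps_nth g n \<ge> 0" shows "fps_nth (g ^ k) n \<ge> 0"
proof (induction k arbitrary: n)
  case 0 then show ?case by (simp add: fps_one_nth)
next
  case (Suc k) then show ?case by (auto simp: fps_mult_nth intro!: sum_nonneg mult_nonneg_nonneg assms)
qed

lemma compose_nonneg_coeff: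
  fixes f g :: "real fps"
  assumes "\<And>n. fps_nth f n \<ge> 0" "\<And>n. fps_nth g n \<ge> 0" shows "fps_nth (f oo g) n \<ge> 0"
  unfolding fps_compose_nth by (intro sum_nonneg mult_nonneg_nonneg assms power_nonneg_coeff)

lemma mult_sums_nonneg:
  fixes f g :: "real fps"
  assumes "\<And>n. fps_nth f n \<ge> 0" "\<And>n. fps_nth g n \<ge> 0" "fps_nth f sums F" "fps_nth g sums G"
  shows "fps_nth (f * g) sums (F * G)"
proof -
  have "summable (\<lambda>n. norm (fps_nth f n))" "summable (\<lambda>n. norm (fps_nth g n))"
    using assms by (auto simp: sums_iff)
  from Cauchy_product_sums[OF this] show ?thesis
    using assms(3,4) by (simp add: sums_iff fps_mult_nth[abs_def] atMost_atLeast0)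
qed

lemma power_sums_nonneg:
  fixes g :: "real fps"
  assumes "\<And>n. fps_nth g n \<ge> 0" "fps_nth g sums G"
  shows "fps_nth (g ^ k) sums (G ^ k)"
proof (induction k)
  case 0
  have "(\<lambda>n. if n = 0 then 1 else 0 :: real) sums 1" using sums_single[of 0 "\<lambda>_. 1::real"] by simp
  then show ?case by (simp add: fps_one_nth[abs_def])
next
  case (Suc k) then show ?case using mult_sums_nonneg[OF assms(1) power_nonneg_coeff[OF assms(1)] assms(2)] by simp
qed

text \<open>On the right, the square of index pairs replaces the triangle.\<close>

lemma power_partial_sum_le:
  fixes g :: "real fps"
  assumes g: "\<And>n. fps_nth g n \<ge> 0"
  shows "(\<Sum>n\<le>N. fps_nth (g ^ k) n) \<le> (\<Sum>n\<le>N. fps_nth g n) ^ k"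
proof (induction k)
  case 0 show ?case by (simp add: fps_one_nth)
next
  case (Suc k)
  let ?h = "\<lambda>i j. fps_nth g i * fps_nth (g ^ k) j"
  have nn: "?h i j \<ge> 0" for i j using g power_nonneg_coeff[OF g] by simp
  have "(\<Sum>n\<le>N. fps_nth (g ^ Suc k) n) = (\<Sum>n\<le>N. \<Sum>i\<le>n. ?h i (n - i))"
    by (simp add: fps_mult_nth atMost_atLeast0)
  also have "\<dots> = (\<Sum>(i,j)\<in>{(i,j). i + j \<le> N}. ?h i j)" by (rule sum.triangle_reindex_eq[symmetric])
  also have "\<dots> \<le> (\<Sum>(i,j)\<in>{..N} \<times> {..N}. ?h i j)" using nn by (intro sum_mono2) auto
  also have "\<dots> = (\<Sum>n\<le>N. fps_nth g n) * (\<Sum>n\<le>N. fps_nth (g ^ k) n)"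
    by (simp add: sum_product sum.cartesian_product)
  also have "\<dots> \<le> (\<Sum>n\<le>N. fps_nth g n) * (\<Sum>n\<le>N. fps_nth g n) ^ k"
    using Suc g by (intro mult_left_mono sum_nonneg) auto
  finally show ?case by simp
qed

lemma compose_partial_sum:
  fixes f g :: "real fps"
  assumes g0: "fps_nth g 0 = 0"
  shows "(\<Sum>n\<le>N. fps_nth (f oo g) n) = (\<Sum>k\<le>N. fps_nth f k * (\<Sum>n\<le>N. fps_nth (g ^ k) n))"
proof -
  have "fps_nth (f oo g) n = (\<Sum>k\<le>N. fps_nth f k * fps_nth (g ^ k) n)" if "n \<le> N" for n
    unfolding fps_compose_nth
    by (rule sum.mono_neutral_left) (use that startsby_zero_power_prefix[OF g0] in auto)
  then have "(\<Sum>n\<le>N. fps_nth (f oo g) n) = (\<Sum>n\<le>N. \<Sum>k\<le>N. fps_nth f k * fps_nth (g ^ k) n)" by simp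
  also have "\<dots> = (\<Sum>k\<le>N. \<Sum>n\<le>N. fps_nth f k * fps_nth (g ^ k) n)" by (rule sum.swap)
  finally show ?thesis by (simp add: sum_distrib_left)
qed

lemma compose_partial_sum_le:
  fixes f g :: "real fps"
  assumes f: "\<And>n. fps_nth f n \<ge> 0" and g: "\<And>n. fps_nth g n \<ge> 0" and g0: "fps_nth g 0 = 0"
    and G: "(\<Sum>n\<le>N. fps_nth g n) \<le> G" and S: "(\<lambda>k. fps_nth f k * G ^ k) sums S"
  shows "(\<Sum>n\<le>N. fps_nth (f oo g) n) \<le> S"
proof -
  have G0: "G \<ge> 0" using sum_nonneg[of "{..N}" "fps_nth g"] g G by (meson order_trans)
  have "(\<Sum>n\<le>N. fps_nth (f oo g) n) \<le> (\<Sum>k\<le>N. fps_nth f k * G ^ k)"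
    unfolding compose_partial_sum[OF g0]
  proof (intro sum_mono mult_left_mono f)
    fix k
    have "(\<Sum>n\<le>N. fps_nth g n) ^ k \<le> G ^ k" using G g by (intro power_mono sum_nonneg) auto
    then show "(\<Sum>n\<le>N. fps_nth (g ^ k) n) \<le> G ^ k" using power_partial_sum_le[OF g, where k = k and N = N] by linarith
  qed
  also have "\<dots> \<le> (\<Sum>k. fps_nth f k * G ^ k)"
    using S f G0 by (intro sum_le_suminf) (auto simp: sums_iff)
  finally show ?thesis using S by (simp add: sums_iff)
qed

lemma sums_nonneg_bounded:
  fixes a :: "nat \<Rightarrow> real"
  assumes "\<And>n. a n \<ge> 0" "\<And>N. (\<Sum>n\<le>N. a n) \<le> S" shows "summable a" "suminf a \<le> S"
proof -
  have b: "sum a {..<N} \<le> S" for N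
    using assms(2)[of N] sum_mono2[of "{..N}" "{..<N}" a] assms(1) by force
  show s: "summable a" by (rule summableI_nonneg_bounded[OF assms(1) b])
  show "suminf a \<le> S" by (rule suminf_le_const[OF s b])
qed

text \<open>For nonnegative coefficients the double sum over the powers of \<open>g\<close> may be rearranged. Both inequalities are
  obtained from finite sums.\<close>

lemma compose_sums:
  fixes f g :: "real fps"
  assumes f: "\<And>n. fps_nth f n \<ge> 0" and g: "\<And>n. fps_nth g n \<ge> 0" and g0: "fps_nth g 0 = 0"
    and G: "fps_nth g sums G" and S: "(\<lambda>k. fps_nth f k * G ^ k) sums S"
  shows "fps_nth (f oo g) sums S"
proof -
  have nn: "fps_nth (f oo g) n \<ge> 0" for n by (rule compose_nonneg_coeff[OF f g])
  have "(\<Sum>n\<le>N. fps_nth g n) \<le> G" for N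
    using G g by (auto simp: sums_iff intro!: sum_le_suminf)
  then have part: "(\<Sum>n\<le>N. fps_nth (f oo g) n) \<le> S" for N
    by (rule compose_partial_sum_le[OF f g g0 _ S])
  note s = sums_nonneg_bounded[OF nn part]
  have "(\<Sum>k<K. fps_nth f k * G ^ k) \<le> suminf (fps_nth (f oo g))" for K
  proof -
    have "(\<lambda>n. \<Sum>k<K. fps_nth f k * fps_nth (g ^ k) n) sums (\<Sum>k<K. fps_nth f k * G ^ k)"
      by (intro sums_sum sums_mult power_sums_nonneg g G)
    then have a: "summable (\<lambda>n. \<Sum>k<K. fps_nth f k * fps_nth (g ^ k) n)"
      "(\<Sum>n. \<Sum>k<K. fps_nth f k * fps_nth (g ^ k) n) = (\<Sum>k<K. fps_nth f k * G ^ k)" by (simp_all add: sums_iff)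
    have "(\<Sum>k<K. fps_nth f k * fps_nth (g ^ k) n) \<le> fps_nth (f oo g) n" for n
    proof -
      have "(\<Sum>k<K. fps_nth f k * fps_nth (g ^ k) n) = (\<Sum>k\<in>{..<K} \<inter> {0..n}. fps_nth f k * fps_nth (g ^ k) n)"
        by (rule sum.mono_neutral_right) (auto simp: startsby_zero_power_prefix[OF g0, rule_format] not_le)
      also have "\<dots> \<le> (\<Sum>k\<in>{0..n}. fps_nth f k * fps_nth (g ^ k) n)"
        using f power_nonneg_coeff[OF g] by (intro sum_mono2) auto
      finally show ?thesis by (simp add: fps_compose_nth)
    qed
    from suminf_le[OF this a(1) s(1)] show ?thesis unfolding a(2) .
  qed
  then have "S \<le> suminf (fps_nth (f oo g))" using S suminf_le_const[of "\<lambda>k. fps_nth f k * G ^ k"] by (simp add: sums_iff)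
  with s show ?thesis by (simp add: sums_iff)
qed

lemma Ef_nonneg: "fps_nth Ef n \<ge> 0"
  unfolding Ef_def by (rule compose_nonneg_coeff) (simp_all add: Bf_nonneg)

text \<open>\<open>Ef\<close> is the exponential of \<open>Bf\<close> also as a function, by \<open>compose_sums\<close> for the series \<open>Bf\<close> rescaled by \<open>x\<close>.\<close>

lemma Ef_sums:
  assumes "0 \<le> x" "x < sing" shows "(\<lambda>n. fps_nth Ef n * x ^ n) sums exp (B' x)"
proof -
  have "(\<lambda>n. fps_nth Bf n * x ^ n) sums B' x"
    using sums_eval_fps[of x Bf] radius_ge[OF radius_Bf, of x] eval_Bf[OF assms] assms by simp
  then have "fps_nth (rescale x Bf) sums B' x" by (simp add: rescale_nth[abs_def])
  moreover have "(\<lambda>k. fps_nth (fps_exp 1) k * B' x ^ k) sums exp (B' x)"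
    using exp_converges[of "B' x"] by (simp add: scaleR_conv_of_real divide_inverse mult.commute)
  ultimately have "fps_nth (fps_exp 1 oo rescale x Bf) sums exp (B' x)"
    using Bf_nonneg assms by (intro compose_sums) (auto simp: rescale_nth)
  then show ?thesis by (simp add: Ef_def rescale_compose[symmetric] rescale_nth[abs_def])
qed

text \<open>This is the exponential generating function of connected graphs with a root.\<close>

definition Rf :: "real fps" where "Rf = fps_X * fps_deriv Cf"
definition Rs :: "real fps" where "Rs = rescale rho Rf"

lemma Cf_nonneg: "fps_nth Cf n \<ge> 0" by (simp add: Cf_def)

lemma Rf_0 [simp]: "fps_nth Rf 0 = 0" by (simp add: Rf_def)

lemma Rf_nonneg: "fps_nth Rf n \<ge> 0"
  unfolding Rf_def by (cases n) (simp_all add: Cf_nonneg)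

lemma Rf_eq: "Rf = fps_X * (Ef oo Rf)"
  using deriv_Cf_eq unfolding Rf_def by simp

lemma Rs_0 [simp]: "fps_nth Rs 0 = 0" by (simp add: Rs_def rescale_nth)

lemma Rs_nonneg: "fps_nth Rs n \<ge> 0"
  using rho_pos Rf_nonneg by (simp add: Rs_def rescale_nth)

lemma Rs_Suc: "fps_nth Rs (Suc n) = rho * fps_nth (Ef oo Rs) n"
proof -
  have "fps_nth Rf (Suc n) = fps_nth (Ef oo Rf) n" by (subst Rf_eq) simp
  then show ?thesis by (simp add: Rs_def rescale_nth rescale_compose[symmetric])
qed

lemma rho_exp: "rho * exp (B' tau) = tau"
  by (simp add: rho_def Psi_def exp_minus)

text \<open>As in \<open>Df_partial\<close>, the partial sums are dominated by the iteration of \<open>r \<mapsto> rho e\<^sup>B\<^sup>'\<^sup>(\<^sup>r\<^sup>)\<close>, which has the fixed point \<open>tau\<close>.\<close>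

lemma Rs_partial: "(\<Sum>n\<le>N. fps_nth Rs n) \<le> tau"
proof (induction N)
  case 0 show ?case using tau_pos by simp
next
  case (Suc N)
  have "(\<Sum>n\<le>Suc N. fps_nth Rs n) = rho * (\<Sum>n\<le>N. fps_nth (Ef oo Rs) n)"
    by (subst sum.atMost_Suc_shift) (simp add: Rs_Suc sum_distrib_left)
  also have "\<dots> \<le> rho * exp (B' tau)"
    using rho_pos tau_pos tau_less_sing
    by (intro mult_left_mono compose_partial_sum_le[OF Ef_nonneg Rs_nonneg Rs_0 Suc] Ef_sums) auto
  finally show ?case by (simp add: rho_exp)
qed

lemma xb1_strict: 
  assumes "0 \<le> x" "x < y" "y < sing" shows "x * b1 x < y * b1 y"
proof -
  have b1_pos: "b1 z > 0" if "z < sing" for z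
  proof -
    have "3 - z > 0" using that sing_bounds by simp
    then show ?thesis unfolding b1_def using discr_pos[OF that] by (simp add: add_pos_pos)
  qed
  have "b1 x < b1 y"
  proof (rule DERIV_pos_imp_increasing[OF assms(2)])
    fix z assume "x \<le> z" "z \<le> y"
    then have z: "z < sing" using assms by simp
    then have "b2 z > 0" using discr_pos[OF z] by (simp add: b2_def)
    then show "\<exists>d. (b1 has_real_derivative d) (at z) \<and> d > 0" using DERIV_b1[OF z] by blast
  qed
  then show ?thesis using assms b1_pos[of x] by (intro mult_strict_mono) auto
qed

text \<open>The derivative of \<open>Psi\<close> has the sign of \<open>1 - u B''(u)\<close>, and \<open>u B''(u)\<close> increases to \<open>1\<close> at \<open>tau\<close>.\<close>

lemma Psi_strict:
  assumes "0 \<le> x" "x < tau" shows "Psi x < Psi tau"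
proof (rule DERIV_pos_imp_increasing_open[OF assms(2)])
  have d: "(Psi has_real_derivative exp (- B' z) * (1 - z * b1 z)) (at z)" if "z < sing" for z
    unfolding Psi_def[abs_def]
    by (rule derivative_eq_intros DERIV_B'[OF that] refl)+ (simp add: algebra_simps)
  fix z assume z: "x < z" "z < tau"
  then have "z * b1 z < 1" using xb1_strict[of z tau] saddle tau_less_sing assms by simp
  then have "exp (- B' z) * (1 - z * b1 z) > 0" by simp
  then show "\<exists>y. (Psi has_real_derivative y) (at z) \<and> y > 0" using d[of z] z tau_less_sing by force
next
  show "continuous_on {x..tau} Psi" unfolding Psi_def[abs_def] B'_def[abs_def] by (intro continuous_intros) auto
qed

text \<open>The sum \<open>r \<le> tau\<close> satisfies \<open>r = rho e\<^sup>B\<^sup>'\<^sup>(\<^sup>r\<^sup>)\<close>, that is \<open>Psi r = Psi tau\<close>, and by \<open>Psi_strict\<close> this forces \<open>r = tau\<close>.\<close>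

lemma Rs_sums: "fps_nth Rs sums tau"
proof -
  note s = sums_nonneg_bounded[OF Rs_nonneg Rs_partial]
  define r where "r = suminf (fps_nth Rs)"
  have r: "fps_nth Rs sums r" using s(1) by (simp add: r_def summable_sums)
  have r0: "0 \<le> r" "r \<le> tau" using s suminf_nonneg[OF s(1)] Rs_nonneg by (auto simp: r_def)
  have "fps_nth (Ef oo Rs) sums exp (B' r)"
    using r0 tau_less_sing by (intro compose_sums[OF Ef_nonneg Rs_nonneg Rs_0 r] Ef_sums) auto
  then have "(\<lambda>n. fps_nth Rs (Suc n)) sums (rho * exp (B' r))" unfolding Rs_Suc by (rule sums_mult)
  then have "fps_nth Rs sums (rho * exp (B' r))" using sums_Suc_iff[of "fps_nth Rs"] by simp
  then have "r = rho * exp (B' r)" using r sums_unique2 by blast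
  then have "Psi r = Psi tau" by (simp add: Psi_def[of r] rho_def[symmetric] exp_minus field_simps)
  then have "r = tau" using Psi_strict[of r] r0 by (cases "r = tau") auto
  then show ?thesis using r by simp
qed

text \<open>This is the exponential generating function \<open>B\<close> of blocks.\<close>

definition Bi :: "real fps" where "Bi = fps_integral0 Bf"

lemma Bi_nth: "fps_nth Bi 0 = 0" "fps_nth Bi (Suc n) = fps_nth Bf n / real (Suc n)"
  by (simp_all add: Bi_def divide_inverse mult.commute)

lemma Bi_nonneg: "fps_nth Bi n \<ge> 0" by (cases n) (simp_all add: Bi_nth Bf_nonneg)

text \<open>Both sides have the same derivative: differentiating \<open>C' = exp (B'(R))\<close> and \<open>R = z C'\<close> gives
  \<open>C' = R' - R B''(R) R'\<close>.\<close>

lemma Cf_dissymmetry: "Cf = Rf - Rf * (Bf oo Rf) + (Bi oo Rf)"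
proof -
  have E: "Ef oo Rf = fps_deriv Cf" using deriv_Cf_eq by (simp add: Rf_def)
  have "fps_deriv (fps_deriv Cf) = fps_deriv Cf * (fps_deriv Bf oo Rf) * fps_deriv Rf"
    unfolding E[symmetric] fps_compose_deriv[OF Rf_0] deriv_Ef fps_compose_mult_distrib[OF Rf_0] by (rule refl)
  then have "fps_deriv Rf = fps_deriv Cf + fps_X * (fps_deriv Cf * (fps_deriv Bf oo Rf) * fps_deriv Rf)"
    by (simp add: Rf_def)
  also have "fps_X * (fps_deriv Cf * (fps_deriv Bf oo Rf) * fps_deriv Rf) = Rf * (fps_deriv Bf oo Rf) * fps_deriv Rf"
    by (simp add: Rf_def mult.assoc)
  finally have "fps_deriv Cf = fps_deriv (Rf - Rf * (Bf oo Rf) + (Bi oo Rf))"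
    by (simp add: fps_compose_deriv Bi_def algebra_simps fps_deriv_fps_integral)
  then have "Cf = fps_const (fps_nth Cf 0 - fps_nth (Rf - Rf * (Bf oo Rf) + (Bi oo Rf)) 0) + (Rf - Rf * (Bf oo Rf) + (Bi oo Rf))"
    unfolding fps_deriv_eq_iff .
  moreover have "fps_nth Cf 0 - fps_nth (Rf - Rf * (Bf oo Rf) + (Bi oo Rf)) 0 = 0" by (simp add: Bi_nth)
  ultimately show ?thesis by simp
qed

text \<open>This is an antiderivative of \<open>B'\<close>.\<close>

definition Bint :: "real \<Rightarrow> real" where
  "Bint u = (u + 5 * u\<^sup>2 / 2 - (u - 3) * sqrt (1 - 6 * u + u\<^sup>2) / 2 + 4 * ln (3 - u - sqrt (1 - 6 * u + u\<^sup>2))) / 8"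

lemma DERIV_Bint_aux:
  assumes S: "(S has_real_derivative d) (at x)" and lt: "3 - x - S x > 0"
  shows "((\<lambda>u. (u + 5 * u\<^sup>2 / 2 - (u - 3) * S u / 2 + 4 * ln (3 - u - S u)) / 8) has_real_derivative
     (1 + 5 * x - (S x + (x - 3) * d) / 2 + 4 * ((- 1 - d) / (3 - x - S x))) / 8) (at x)"
proof -
  have d1: "((\<lambda>u. u + 5 * u\<^sup>2 / 2) has_real_derivative 1 + 5 * x) (at x)"
    by (auto intro!: derivative_eq_intros)
  have d2: "((\<lambda>u. (u - 3) * S u) has_real_derivative S x + (x - 3) * d) (at x)"
    using S by (auto intro!: derivative_eq_intros)
  have "((\<lambda>u. 3 - u - S u) has_real_derivative - 1 - d) (at x)"
    using S by (auto intro!: derivative_eq_intros)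
  then have d3: "((\<lambda>u. ln (3 - u - S u)) has_real_derivative 1 / (3 - x - S x) * (- 1 - d)) (at x)"
    by (rule DERIV_chain2[where f = ln and g = "\<lambda>u. 3 - u - S u", OF DERIV_ln_divide[OF lt]])
  show ?thesis
    using DERIV_cdivide[OF DERIV_add[OF DERIV_diff[OF d1 DERIV_cdivide[OF d2, of 2]] DERIV_cmult[OF d3, of 4]], of 8]
    by simp
qed

lemma DERIV_Bint:
  assumes "x < sing" shows "(Bint has_real_derivative B' x) (at x)"
proof -
  define s where "s = sqrt (1 - 6 * x + x\<^sup>2)"
  have s: "s > 0" "s\<^sup>2 = 1 - 6 * x + x\<^sup>2" using discr_pos[OF assms] by (simp_all add: s_def)
  have x3: "3 - x > 0" using assms sing_bounds by simp
  have lt: "3 - x - s > 0"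
  proof -
    have "s\<^sup>2 < (3 - x)\<^sup>2" unfolding s by (simp add: power2_eq_square algebra_simps)
    then show ?thesis using power_less_imp_less_base[of s 2 "3 - x"] x3 by simp
  qed
  have "(Bint has_real_derivative (1 + 5 * x - (s + (x - 3) * ((x - 3) / s)) / 2 + 4 * ((- 1 - (x - 3) / s) / (3 - x - s))) / 8) (at x)"
    unfolding Bint_def[abs_def] s_def
    by (rule DERIV_Bint_aux[OF DERIV_sqrt_discr[OF assms] lt[unfolded s_def]])
  moreover have "(- 1 - (x - 3) / s) / (3 - x - s) = 1 / s"
  proof -
    have "- 1 - (x - 3) / s = (3 - x - s) / s" using s(1) by (simp add: field_simps)
    then show ?thesis using lt by simp
  qed
  moreover have "(x - 3) * ((x - 3) / s) = (s\<^sup>2 + 8) / s"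
    unfolding s by (simp add: power2_eq_square algebra_simps)
  moreover have "(1 + 5 * x - (s + (s\<^sup>2 + 8) / s) / 2 + 4 * (1 / s)) / 8 = B' x"
    unfolding B'_def s_def[symmetric] using s(1) by (simp add: field_simps power2_eq_square)
  ultimately show ?thesis by (simp only:)
qed

lemma Bi_sums: "(\<lambda>n. fps_nth Bi n * tau ^ n) sums (Bint tau - Bint 0)"
proof -
  have rad: "ereal sing \<le> fps_conv_radius Bi"
  proof -
    have "ereal sing \<le> conv_radius (fps_nth Bi)"
    proof (rule conv_radius_geI_ex)
      fix r assume r: "0 < r" "ereal r < ereal sing"
      then have "summable (\<lambda>n. fps_nth Bf n * r ^ n)"
        using sums_eval_fps[of r Bf] radius_ge[OF radius_Bf, of r] by (simp add: sums_iff)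
      then have "summable (\<lambda>n. r * (fps_nth Bf n * r ^ n))" by (rule summable_mult)
      moreover have "norm (fps_nth Bi (Suc n) * r ^ Suc n) \<le> r * (fps_nth Bf n * r ^ n)" for n
      proof -
        have "fps_nth Bf n / real (Suc n) \<le> fps_nth Bf n / 1" using Bf_nonneg by (intro divide_left_mono) auto
        then have "fps_nth Bf n / real (Suc n) * (r * r ^ n) \<le> fps_nth Bf n * (r * r ^ n)" using r by (intro mult_right_mono) auto
        then show ?thesis using r Bf_nonneg[of n] by (simp add: Bi_nth abs_mult mult_ac)
      qed
      ultimately have "summable (\<lambda>n. fps_nth Bi (Suc n) * r ^ Suc n)"
        by (rule summable_comparison_test'[of _ 0])
      then have "summable (\<lambda>n. fps_nth Bi n * r ^ n)" by (subst (asm) summable_Suc_iff)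
      then show "\<exists>z. norm z = r \<and> summable (\<lambda>n. fps_nth Bi n * z ^ n)" using r by (intro exI[of _ r]) auto
    qed
    then show ?thesis by (simp add: fps_conv_radius_def)
  qed
  let ?f = "\<lambda>x. eval_fps Bi x - Bint x"
  have d: "(?f has_real_derivative eval_fps (fps_deriv Bi) x - B' x) (at x)" if "0 \<le> x" "x \<le> tau" for x
    using that tau_less_sing radius_ge[OF rad, of x]
    by (intro DERIV_diff DERIV_Bint has_field_derivative_eval_fps) auto
  have "?f tau = ?f 0"
  proof (rule DERIV_isconst_end[OF tau_pos])
    show "continuous_on {0..tau} ?f" using d by (intro DERIV_atLeastAtMost_imp_continuous_on) auto
    fix x assume x: "0 < x" "x < tau"
    then show "(?f has_real_derivative 0) (at x)"
      using d[of x] eval_Bf[of x] tau_less_sing by (simp add: Bi_def fps_deriv_fps_integral)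
  qed
  then have "eval_fps Bi tau = Bint tau - Bint 0" by (simp add: eval_fps_at_0 Bi_nth)
  then show ?thesis using sums_eval_fps[of tau Bi] radius_ge[OF rad, of tau] tau_pos tau_less_sing by simp
qed

theorem Cs_sum: "(\<Sum>n. fps_nth Cs n) = tau * (1 - B' tau) + (Bint tau - Bint 0)"
proof -
  have B: "fps_nth (Bf oo Rs) sums B' tau" by (rule compose_sums[OF Bf_nonneg Rs_nonneg Rs_0 Rs_sums sums_tau(1)])
  have I: "fps_nth (Bi oo Rs) sums (Bint tau - Bint 0)" by (rule compose_sums[OF Bi_nonneg Rs_nonneg Rs_0 Rs_sums Bi_sums])
  have RB: "fps_nth (Rs * (Bf oo Rs)) sums (tau * B' tau)"
    by (rule mult_sums_nonneg[OF Rs_nonneg compose_nonneg_coeff[OF Bf_nonneg Rs_nonneg] Rs_sums B])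
  have "fps_nth Cs n = fps_nth Rs n - fps_nth (Rs * (Bf oo Rs)) n + fps_nth (Bi oo Rs) n" for n
  proof -
    have "fps_nth Cs n = fps_nth (rescale rho (Rf - Rf * (Bf oo Rf) + (Bi oo Rf))) n"
      unfolding Cs_def using Cf_dissymmetry by simp
    also have "\<dots> = fps_nth (rescale rho Rf) n - fps_nth (rescale rho (Rf * (Bf oo Rf))) n + fps_nth (rescale rho (Bi oo Rf)) n"
      by (simp add: rescale_nth algebra_simps)
    finally show ?thesis by (simp add: rescale_mult rescale_compose Rs_def)
  qed
  then have "fps_nth Cs sums (tau - tau * B' tau + (Bint tau - Bint 0))"
    using sums_add[OF sums_diff[OF Rs_sums RB] I] by presburger
  then show ?thesis by (simp add: sums_iff algebra_simps)
qed

section \<open>Numerical bounds and the main asymptotics\<close>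

text \<open>The constant \<open>240\<close> is \<open>6! / 3\<close>, where \<open>3\<close> bounds the exponential factor of the Lagrange remainder.\<close>

lemma exp_taylor_bounds:
  fixes x :: real
  assumes "-1 \<le> x" "x \<le> 0"
  shows "1 + x + x^2/2 + x^3/6 + x^4/24 + x^5/120 \<le> exp x"
    and "exp x \<le> 1 + x + x^2/2 + x^3/6 + x^4/24 + x^5/120 + x ^ 6 / 240"
proof -
  obtain t where t: "\<bar>t\<bar> \<le> \<bar>x\<bar>" "exp x = (\<Sum>m<6. x ^ m / fact m) + (exp t / fact 6) * x ^ 6"
    using Maclaurin_exp_le[of x 6] by blast
  have P: "(\<Sum>m<6. x ^ m / fact m) = 1 + x + x^2/2 + x^3/6 + x^4/24 + x^5/120"
    by (simp add: eval_nat_numeral)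
  have "exp t \<le> exp 1" using t(1) assms by simp
  then have "exp t \<le> 3" using exp_le by linarith
  then have "exp t / 720 * x ^ 6 \<le> 3 / 720 * x ^ 6" by (intro mult_right_mono divide_right_mono) auto
  moreover have "exp t / 720 * x ^ 6 \<ge> 0" by simp
  moreover have "exp x = 1 + x + x^2/2 + x^3/6 + x^4/24 + x^5/120 + exp t / 720 * x ^ 6" using t(2) unfolding P by (simp add: fact_numeral)
  ultimately show "1 + x + x^2/2 + x^3/6 + x^4/24 + x^5/120 \<le> exp x"
    "exp x \<le> 1 + x + x^2/2 + x^3/6 + x^4/24 + x^5/120 + x ^ 6 / 240" by linarith+
qed

definition stau :: real where "stau = sqrt (1 - 6 * tau + tau\<^sup>2)"

text \<open>By \<open>sqrt_discr_tau\<close> this square root is a rational function of \<open>tau\<close>.\<close>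

lemma stau_bounds: "0.06760739 < stau" "stau < 0.0676074"
proof -
  note t = tau_root(2,3)
  have e: "stau * (8 - 5 * tau) = tau * (3 - tau)" using sqrt_discr_tau t(2) by (simp add: stau_def)
  have lo: "0.17076498681 * (3 - 0.17076498682) \<le> tau * (3 - tau)" using t by (intro mult_mono) auto
  have hi: "tau * (3 - tau) \<le> 0.17076498682 * (3 - 0.17076498681)" using t by (intro mult_mono) auto
  show "0.06760739 < stau"
  proof (rule ccontr)
    assume "\<not> 0.06760739 < stau"
    then have "stau * (8 - 5 * tau) \<le> 0.06760739 * (8 - 5 * tau)" using t by (intro mult_right_mono) auto
    then show False using e lo t by simp
  qed
  show "stau < 0.0676074"
  proof (rule ccontr)
    assume "\<not> stau < 0.0676074"
    then have "0.0676074 * (8 - 5 * tau) \<le> stau * (8 - 5 * tau)" using t by (intro mult_right_mono) auto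
    then show False using e hi t by simp
  qed
qed

lemma B'_tau: "B' tau = (1 + 5 * tau - stau) / 8" by (simp add: B'_def stau_def)

lemma B'_tau_bounds: "0.2232771 < B' tau" "B' tau < 0.2232772"
  unfolding B'_tau using stau_bounds tau_root(2,3) by simp_all

lemma rho_bounds: "\<bar>rho - 0.13659\<bar> < 0.000005"
proof -
  have "exp (- B' tau) \<le> exp (- 0.2232771)" "exp (- 0.2232772) \<le> exp (- B' tau)" using B'_tau_bounds by simp_all
  moreover have "exp (- 0.2232771) \<le> (0.799895 :: real)"
    using exp_taylor_bounds(2)[of "- 0.2232771"] by (simp add: power_numeral_reduce)
  moreover have "(0.799890 :: real) \<le> exp (- 0.2232772)"
    using exp_taylor_bounds(1)[of "- 0.2232772"] by (simp add: power_numeral_reduce)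
  ultimately have e: "0.799890 \<le> exp (- B' tau)" "exp (- B' tau) \<le> 0.799895" by linarith+
  have "0.17076498681 * 0.799890 \<le> rho" unfolding rho_def Psi_def using e tau_root(2,3) by (intro mult_mono) auto
  moreover have "rho \<le> 0.17076498682 * 0.799895" unfolding rho_def Psi_def using e tau_root(2,3) by (intro mult_mono) auto
  ultimately show ?thesis by simp
qed

lemma sig2_bounds: "95.3658 < sig2" "sig2 < 95.366"
proof -
  note t = tau_root(2,3)
  have s: "stau > 0" using stau_bounds by simp
  have sig: "(sig2 - 1) * stau ^ 3 = tau\<^sup>2" unfolding sig2_def b2_def stau_def[symmetric] using s by simp
  have tt: "0.17076498681\<^sup>2 \<le> tau\<^sup>2" "tau\<^sup>2 \<le> 0.17076498682\<^sup>2" using t by (auto intro!: power_mono)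
  have ss: "0.06760739 ^ 3 \<le> stau ^ 3" "stau ^ 3 \<le> 0.0676074 ^ 3" using stau_bounds by (auto intro!: power_mono)
  show "95.3658 < sig2"
  proof (rule ccontr)
    assume "\<not> 95.3658 < sig2"
    then have "(sig2 - 1) * stau ^ 3 \<le> 94.3658 * stau ^ 3" using s by (intro mult_right_mono) auto
    also have "\<dots> \<le> 94.3658 * 0.0676074 ^ 3" using ss by (intro mult_left_mono) auto
    also have "\<dots> < 0.17076498681\<^sup>2" by (simp add: power_numeral_reduce)
    finally show False using sig tt by linarith
  qed
  show "sig2 < 95.366"
  proof (rule ccontr)
    assume c: "\<not> sig2 < 95.366"
    have "0.17076498682\<^sup>2 < 94.366 * (0.06760739 :: real) ^ 3" by (simp add: power_numeral_reduce)
    also have "\<dots> \<le> 94.366 * stau ^ 3" using ss by (intro mult_left_mono) auto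
    also have "\<dots> \<le> (sig2 - 1) * stau ^ 3" using s c by (intro mult_right_mono) auto
    finally show False using sig tt by linarith
  qed
qed

text \<open>This is the sum of \<open>Cs\<close> without the logarithms that come from \<open>Bint\<close> (\<open>exp_Cs_sum\<close>).\<close>

definition A0 :: real where
  "A0 = tau * (1 - B' tau) + (tau + 5 * tau\<^sup>2 / 2 + (3 - tau) * stau / 2 - 3 / 2) / 8"

text \<open>The logarithms add up to half the logarithm of a rational expression in \<open>tau\<close> and \<open>stau\<close>, so no logarithm has to be bounded.\<close>

lemma exp_Cs_sum: "exp (\<Sum>n. fps_nth Cs n) = exp A0 * sqrt ((3 - tau - stau) / 2)"
proof -
  have g: "3 - tau - stau > 0" using stau_bounds tau_root(2,3) by simp
  have B0: "Bint 0 = (3 / 2 + 4 * ln 2) / 8" by (simp add: Bint_def)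
  have Bt: "Bint tau = (tau + 5 * tau\<^sup>2 / 2 + (3 - tau) * stau / 2 + 4 * ln (3 - tau - stau)) / 8"
  proof -
    have "(tau - 3) * stau = - ((3 - tau) * stau)" by (simp add: algebra_simps)
    then show ?thesis unfolding Bint_def stau_def[symmetric] by simp
  qed
  have "(\<Sum>n. fps_nth Cs n) = A0 + (ln (3 - tau - stau) - ln 2) / 2"
    unfolding Cs_sum B0 Bt A0_def by (simp add: field_simps)
  also have "ln (3 - tau - stau) - ln 2 = ln ((3 - tau - stau) / 2)" using g by (simp add: ln_div)
  also have "A0 + ln ((3 - tau - stau) / 2) / 2 = A0 + ln (sqrt ((3 - tau - stau) / 2))" using g by (simp add: ln_sqrt)
  finally show ?thesis using g by (simp add: exp_add)
qed

lemma exp_A0_bounds: "0.98762 \<le> exp A0" "exp A0 \<le> 0.98763"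
proof -
  note t = tau_root(2,3) note s = stau_bounds note b = B'_tau_bounds
  have tt: "0.17076498681\<^sup>2 \<le> tau\<^sup>2" "tau\<^sup>2 \<le> 0.17076498682\<^sup>2" using t by (auto intro!: power_mono)
  have p1: "0.17076498681 * (1 - 0.2232772) \<le> tau * (1 - B' tau)" using t b by (intro mult_mono) auto
  have p2: "tau * (1 - B' tau) \<le> 0.17076498682 * (1 - 0.2232771)" using t b by (intro mult_mono) auto
  have q1: "(3 - 0.17076498682) * 0.06760739 \<le> (3 - tau) * stau" using t s by (intro mult_mono) auto
  have q2: "(3 - tau) * stau \<le> (3 - 0.17076498681) * 0.0676074" using t s by (intro mult_mono) auto
  have lo: "- 0.01245 \<le> p + (x + 5 * w / 2 + q / 2 - 3 / 2) / 8"
    if "0.17076498681 < x" "0.17076498681\<^sup>2 \<le> w" "0.17076498681 * (1 - 0.2232772) \<le> p"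
      "(3 - 0.17076498682) * 0.06760739 \<le> q" for p x w q :: real
    using that by (simp add: power2_eq_square field_simps)
  have hi: "p + (x + 5 * w / 2 + q / 2 - 3 / 2) / 8 \<le> - 0.012449"
    if "x < 0.17076498682" "w \<le> 0.17076498682\<^sup>2" "p \<le> 0.17076498682 * (1 - 0.2232771)"
      "q \<le> (3 - 0.17076498681) * 0.0676074" for p x w q :: real
    using that by (simp add: power2_eq_square field_simps)
  have "- 0.01245 \<le> A0" unfolding A0_def by (rule lo[OF t(1) tt(1) p1 q1])
  then have "exp (- 0.01245) \<le> exp A0" by simp
  moreover have "(0.98762 :: real) \<le> exp (- 0.01245)"
    using exp_taylor_bounds(1)[of "- 0.01245"] by (simp add: power_numeral_reduce)
  ultimately show "0.98762 \<le> exp A0" by linarith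
  have "A0 \<le> - 0.012449" unfolding A0_def by (rule hi[OF t(2) tt(2) p2 q2])
  then have "exp A0 \<le> exp (- 0.012449)" by simp
  moreover have "exp (- 0.012449) \<le> (0.98763 :: real)"
    using exp_taylor_bounds(2)[of "- 0.012449"] by (simp add: power_numeral_reduce)
  ultimately show "exp A0 \<le> 0.98763" by linarith
qed

definition hconst :: real where "hconst = tau / sqrt (2 * pi * sig2) * exp (\<Sum>n. fps_nth Cs n)"

lemma hconst_bounds: "\<bar>hconst - 0.008096\<bar> < 0.0000005"
proof -
  note t = tau_root(2,3) note s = stau_bounds note e = exp_A0_bounds
  define g where "g = (3 - tau - stau) / 2"
  define r where "r = sqrt (g / (2 * pi * sig2))"
  have g: "1.3808138 < g" "g < 1.3808139" unfolding g_def using t s by simp_all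
  have den1: "2 * 3.14159265 * 95.3658 \<le> 2 * pi * sig2" using pi_approx sig2_bounds by (intro mult_mono) auto
  have den2: "2 * pi * sig2 \<le> 2 * 3.1415927 * 95.366" using pi_approx sig2_bounds by (intro mult_mono) auto
  have den0: "2 * pi * sig2 > 0" using sig2_pos by simp
  have h: "hconst = tau * exp A0 * r"
    unfolding hconst_def exp_Cs_sum r_def g_def[symmetric] by (simp add: real_sqrt_divide)
  have r1: "0.0480043 \<le> r" unfolding r_def
  proof (rule real_le_rsqrt)
    have "0.0480043\<^sup>2 * (2 * pi * sig2) \<le> 0.0480043\<^sup>2 * (2 * 3.1415927 * 95.366)" using den2 by (intro mult_left_mono) auto
    also have "\<dots> \<le> g" using g by (simp add: power2_eq_square)
    finally show "0.0480043\<^sup>2 \<le> g / (2 * pi * sig2)" using den0 by (simp only: pos_le_divide_eq)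
  qed
  have r2: "r \<le> 0.0480045" unfolding r_def
  proof (rule real_le_lsqrt)
    have "g \<le> 0.0480045\<^sup>2 * (2 * 3.14159265 * 95.3658)" using g by (simp add: power2_eq_square)
    also have "\<dots> \<le> 0.0480045\<^sup>2 * (2 * pi * sig2)" using den1 by (intro mult_left_mono) auto
    finally show "g / (2 * pi * sig2) \<le> 0.0480045\<^sup>2" using den0 by (simp only: pos_divide_le_eq)
  qed auto
  have "0.17076498681 * 0.98762 * 0.0480043 \<le> hconst" unfolding h using t e r1 by (intro mult_mono) auto
  moreover have "hconst \<le> 0.17076498682 * 0.98763 * 0.0480045" unfolding h using t e r1 r2 by (intro mult_mono) auto
  ultimately show ?thesis unfolding abs_less_iff by simp
qed

lemma num_outerplanar_asymptotics:
  "(\<lambda>n. real (num_outerplanar n)) \<sim>[sequentially]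
      (\<lambda>n. hconst * real n powr (-5/2) * rho powi (- int n) * fact n)"
proof (rule asymp_equivI')
  have h0: "hconst \<noteq> 0" using hconst_bounds by auto
  have "(\<lambda>n. fps_nth Hf n * rho ^ n * real n powr (5/2) / hconst) \<longlonglongrightarrow> hconst / hconst"
    using Hf_asymptotics h0 unfolding hconst_def[symmetric] by (intro tendsto_divide tendsto_const) auto
  moreover have "eventually (\<lambda>n. fps_nth Hf n * rho ^ n * real n powr (5/2) / hconst =
      real (num_outerplanar n) / (hconst * real n powr (-5/2) * rho powi (- int n) * fact n)) sequentially"
  proof (rule eventually_sequentiallyI[of 1])
    fix n :: nat assume n: "1 \<le> n"
    have "real n powr (-5/2) = inverse (real n powr (5/2))" using powr_minus[of "real n" "5/2"] by simp
    moreover have "rho powi (- int n) = inverse (rho ^ n)" by (simp add: power_int_minus)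
    ultimately show "fps_nth Hf n * rho ^ n * real n powr (5/2) / hconst =
      real (num_outerplanar n) / (hconst * real n powr (-5/2) * rho powi (- int n) * fact n)"
      unfolding num_outerplanar_fps using h0 rho_pos n by (simp add: field_simps)
  qed
  ultimately have "(\<lambda>n. real (num_outerplanar n) / (hconst * real n powr (-5/2) * rho powi (- int n) * fact n)) \<longlonglongrightarrow> hconst / hconst"
    by (rule Lim_transform_eventually)
  then show "(\<lambda>n. real (num_outerplanar n) / (hconst * real n powr (-5/2) * rho powi (- int n) * fact n)) \<longlonglongrightarrow> 1"
    using h0 by simp
qed

theorem theorem5p1:
  shows "\<bar>rho - 0.13659\<bar> < 0.000005 \<and>
    (\<exists>h::real. \<bar>h - 0.008096\<bar> < 0.0000005 \<and>
      (\<lambda>n. real (num_outerplanar n)) \<sim>[sequentially]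
      (\<lambda>n. h * real n powr (-5/2) * rho powi (- int n) * fact n))"
  using rho_bounds hconst_bounds num_outerplanar_asymptotics by blast

end
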